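(* The Nil 3-manifolds in families (5), (6) and (7) ($1/4$-twist, $1/3$-twist and $1/6$-twist) each occur as cusp cross-sections in a single arithmetic commensurability class. For the $1/4$-twist this is the commensurability class of the Gauss-Picard modular group ${\rm PU}(2,1,\mathcal{O}_1)$, and for the $1/3$-twist and $1/6$-twist this is the commensurability class of the Eisenstein-Picard modular group ${\rm PU}(2,1,\mathcal{O}_3)$. That is, for every squarefree integer $d\geqslant1$: a Nil 3-manifold $N$ in family (5) occurs as a cusp cross-section in the commensurability class of ${\rm PU}(2,1,\mathcal{O}_d)$ if and only if $d=1$; and a Nil 3-manifold $N$ in family (6) or (7) occurs as a cusp cross-section in the commensurability class of ${\rm PU}(2,1,\mathcal{O}_d)$ if and only if $d=3$.
   Context: **Complex hyperbolic plane.** Let $\mathbb{C}^{2,1}$ be $\mathbb{C}^3$ with the Hermitian form of signature $(2,1)$ given by the matrix $H=\begin{bmatrix}0&0&1\\0&1&0\\1&0&0\end{bmatrix}$. The complex hyperbolic plane ${\rm H}^2_{\mathbb{C}}\subset\mathbb{C}{\rm P}^2$ is the set of negative lines, with distance $\cosh^2\frac12 d(\pi(X),\pi(Y))=\frac{|\langle X,Y\rangle|^2}{\langle X,X\rangle\langle Y,Y\rangle}$; its ideal boundary $\partial_\infty{\rm H}^2_{\mathbb{C}}$ is the set of null lines. ${\rm U}(2,1)\subset{\rm GL}(3,\mathbb{C})$ is the group preserving the form and ${\rm PU}(2,1)$ is its image in ${\rm PGL}(3,\mathbb{C})$, which is the group of holomorphic isometries. The full isometry group ${\rm Isom}({\rm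 H}^2_{\mathbb{C}})$ is ${\rm PU}(2,1)\rtimes\langle\sigma\rangle$ with $\sigma$ the antiholomorphic involution given by complex conjugation of coordinates. An ${\rm H}^2_{\mathbb{C}}$-manifold is a quotient ${\rm H}^2_{\mathbb{C}}/\Gamma$ with $\Gamma$ a torsion-free discrete subgroup of ${\rm Isom}({\rm H}^2_{\mathbb{C}})$. **Cusps.** If $\Gamma<{\rm Isom}({\rm H}^2_{\mathbb{C}})$ is discrete with ${\rm H}^2_{\mathbb{C}}/\Gamma$ of finite volume, a cusp point is a point $q\in\partial_\infty{\rm H}^2_{\mathbb{C}}$ fixed by a parabolic element of $\Gamma$; the corresponding cusp cross-section is the compact quotient of a horosphere based at $q$ by the stabilizer of $q$ in $\Gamma$. The manifold may have several cusps. **Picard modular groups.** For $d\geqslant1$ squarefree, $\mathcal{O}_d$ is the ring of integers of $\mathbb{Q}(i\sqrt d)$, and ${\rm PU}(2,1,\mathcal{O}_d)$ is the image in ${\rm PU}(2,1)$ of the matrices of ${\rm U}(2,1)$ (for the form $H$) with entries in $\mathcal{O}_d$. Two subgroups of ${\rm Isom}({\rm H}^2_{\mathbb{C}})$ are commensurable if some conjugate of one meets the other in a subgroup of finite index in both. It is known that every non-cocompact arithmetic lattice in ${\rm PU}(2,1)$ is commensurable to ${\rm PU}(2,1,\mathcal{O}_d)$ for exactly one squarefree $d\geqslant1$, so arithmetic commensurability classes of cusped manifolds correspond to such $d$. We say $N$ *occurs as a cusp cross-section in the commensurability class of* ${\rm PU}(2,1,\mathcal{O}_d)$ if there is a torsion-free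 subgroup $\Gamma<{\rm Isom}({\rm H}^2_{\mathbb{C}})$ commensurable to ${\rm PU}(2,1,\mathcal{O}_d)$ such that $N$ is diffeomorphic to a cusp cross-section of the ${\rm H}^2_{\mathbb{C}}$-manifold ${\rm H}^2_{\mathbb{C}}/\Gamma$. **Nil 3-manifolds.** ${\rm Nil}$ is the Heisenberg group $\mathbb{C}\times\mathbb{R}$ with product $(z_1,t_1)\cdot(z_2,t_2)=(z_1+z_2,t_1+t_2+2{\rm Im}(z_1\overline{z_2}))$, with a left-invariant Riemannian metric whose isometry group is ${\rm Nil}\rtimes({\rm U}(1)\rtimes\mathbb{Z}_2)$, where $u\in{\rm U}(1)$ acts by $(z,t)\mapsto(uz,t)$ and $\mathbb{Z}_2$ acts by $(z,t)\mapsto(\overline z,-t)$. A Nil 3-manifold is a compact manifold $N\simeq{\rm Nil}/\Delta$ with $\Delta\simeq\pi_1(N)$ a discrete torsion-free subgroup of ${\rm Isom}({\rm Nil})$. $N$ belongs to one of the following families when $\pi_1(N)$ has the given presentation (with $\mathbb{N}$ the positive integers): (5) ($1/4$-twist) $\langle a,b,c,\alpha \mid [b,a]=c^k,\ [c,a]=[c,b]=[c,\alpha]=1,\ \alpha a=b\alpha,\ \alpha b=a^{-1}\alpha,\ \alpha^4=c^p\rangle$ with $k\in2\mathbb{N}$ and either $p=1$, or $k\in4\mathbb{N}$ and $p=3$. (6) ($1/3$-twist) $\langle a,b,c,\alpha \mid [b,a]=c^k,\ [c,a]=[c,b]=[c,\alpha]=1,\ \alpha a=b\alpha c^{k_1},\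 \alpha b=a^{-1}b^{-1}\alpha,\ \alpha^3=c^{k_2}\rangle$ with $k>0$ and either $k\equiv0\pmod 3$, $k_1=0$ and $k_2\in\{1,2\}$, or $k\equiv1,2\pmod 3$, $k_1=1$ and $k_2=1$. (7) ($1/6$-twist) $\langle a,b,c,\alpha \mid [b,a]=c^k,\ [c,a]=[c,b]=[c,\alpha]=1,\ \alpha a=ab\alpha,\ \alpha b=a^{-1}\alpha,\ \alpha^6=c^{k_1}\rangle$ with $k>0$ and either $k\equiv0,4\pmod 6$ and $k_1=1$, or $k\equiv0,2\pmod 6$ and $k_1=5$. *)

theory Defs
  imports
    "HOL-Analysis.Analysis"
    "HOL-Computational_Algebra.Polynomial"
    "HOL-Computational_Algebra.Squarefree"
    "HOL-Algebra.Group_Action"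
begin

section \<open>The complex hyperbolic plane\<close>

definition H :: "complex^3^3" where
  "H = vector [vector [0, 0, 1], vector [0, 1, 0], vector [1, 0, 0]]"

definition herm :: "complex^3 \<Rightarrow> complex^3 \<Rightarrow> complex" where
  "herm X Y = (\<Sum>i\<in>UNIV. \<Sum>j\<in>UNIV. cnj (Y $ i) * H $ i $ j * X $ j)"

lemma herm_eq: "herm X Y = X$3 * cnj (Y$1) + X$2 * cnj (Y$2) + X$1 * cnj (Y$3)"
  by (simp add: herm_def H_def sum_3 vector_3 algebra_simps)

definition proportional :: "complex^3 \<Rightarrow> complex^3 \<Rightarrow> bool" where
  "proportional X Y \<longleftrightarrow> X \<noteq> 0 \<and> Y \<noteq> 0 \<and> (\<exists>c. c \<noteq> 0 \<and> Y = c *s X)"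

quotient_type cp2 = "complex^3" / partial: proportional
  morphisms rep_cp2 line
proof (rule part_equivpI)
  have "axis 1 1 \<noteq> (0 :: complex^3)"
    by (simp add: axis_eq_0_iff)
  then have "proportional (axis 1 1) (axis 1 1)"
    unfolding proportional_def by (auto intro!: exI[of _ 1] simp: vector_smult_lid)
  then show "\<exists>X. proportional X X" ..
  show "symp proportional"
  proof (rule sympI)
    fix X Y assume "proportional X Y"
    then obtain c where c: "X \<noteq> 0" "Y \<noteq> 0" "c \<noteq> 0" "Y = c *s X"
      unfolding proportional_def by auto
    then have "X = inverse c *s Y"
      by (simp add: vector_smult_assoc vector_smult_lid)
    moreover have "inverse c \<noteq> 0"
      using c(3) by simp
    ultimately show "proportional Y X"
      unfolding proportional_def using c(1,2) by blast
  qed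
  show "transp proportional"
  proof (rule transpI)
    fix X Y Z assume "proportional X Y" "proportional Y Z"
    then obtain c e where c: "X \<noteq> 0" "Z \<noteq> 0" "c \<noteq> 0" "Y = c *s X" "e \<noteq> 0" "Z = e *s Y"
      unfolding proportional_def by auto
    then have "Z = (e * c) *s X" "e * c \<noteq> 0"
      by (simp_all only: vector_smult_assoc mult_eq_0_iff) simp
    with c(1,2) show "proportional X Z"
      unfolding proportional_def by blast
  qed
qed

instantiation cp2 :: topological_space
begin

definition open_cp2 :: "cp2 set \<Rightarrow> bool" where
  "open_cp2 U \<longleftrightarrow> open {X. X \<noteq> 0 \<and> line X \<in> U}"

instance
proof
  have "{X :: complex^3. X \<noteq> 0 \<and> line X \<in> UNIV} = - {0}" by auto
  then show "open (UNIV :: cp2 set)"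
    unfolding open_cp2_def by (simp add: open_delete open_Compl)
next
  fix S T :: "cp2 set" assume "open S" "open T"
  moreover have "{X. X \<noteq> 0 \<and> line X \<in> S \<inter> T} = {X. X \<noteq> 0 \<and> line X \<in> S} \<inter> {X. X \<noteq> 0 \<and> line X \<in> T}"
    by auto
  ultimately show "open (S \<inter> T)"
    unfolding open_cp2_def by (simp add: open_Int)
next
  fix K :: "cp2 set set" assume "\<forall>S\<in>K. open S"
  moreover have "{X. X \<noteq> 0 \<and> line X \<in> \<Union>K} = (\<Union>S\<in>K. {X. X \<noteq> 0 \<and> line X \<in> S})"
    by auto
  ultimately show "open (\<Union>K)"
    unfolding open_cp2_def by auto
qed

end

definition H2C :: "cp2 set" where
  "H2C = line ` {X. Re (herm X X) < 0}"

definition boundary_H2C :: "cp2 set" where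
  "boundary_H2C = line ` {X. X \<noteq> 0 \<and> herm X X = 0}"

text \<open>Every negative line has nonzero third coordinate, so this affine chart is defined on
  all of \<^const>\<open>H2C\<close> and identifies it with the Siegel domain
  \<open>2 Re w + \<bar>z\<bar>^2 < 0\<close> in \<open>\<complex>^2\<close>.\<close>

lift_definition siegel :: "cp2 \<Rightarrow> complex \<times> complex" is "\<lambda>X. (X$1 / X$3, X$2 / X$3)"
  by (auto simp: proportional_def)

lift_definition dist_H2C :: "cp2 \<Rightarrow> cp2 \<Rightarrow> real" is
  "\<lambda>X Y. 2 * arcosh (sqrt ((cmod (herm X Y))\<^sup>2 / (Re (herm X X) * Re (herm Y Y))))"
proof -
  fix X X' Y Y' assume "proportional X X'" "proportional Y Y'"
  then obtain c e where c: "c \<noteq> 0" "X' = c *s X" and e: "e \<noteq> 0" "Y' = e *s Y"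
    unfolding proportional_def by auto
  have s: "herm (a *s U) (b *s V) = a * cnj b * herm U V" for a b U V
    by (simp add: herm_eq algebra_simps)
  have n: "Re (herm (a *s U) (a *s U)) = (cmod a)\<^sup>2 * Re (herm U U)" for a U
    unfolding s complex_norm_square[symmetric] by simp
  show "2 * arcosh (sqrt ((cmod (herm X Y))\<^sup>2 / (Re (herm X X) * Re (herm Y Y)))) =
        2 * arcosh (sqrt ((cmod (herm X' Y'))\<^sup>2 / (Re (herm X' X') * Re (herm Y' Y'))))"
    unfolding c(2) e(2) n unfolding s using c(1) e(1)
    by (simp add: norm_mult power_mult_distrib)
qed

section \<open>Its isometry group\<close>

definition U21 :: "(complex^3^3) set" where
  "U21 = {A. invertible A \<and> (\<forall>X Y. herm (A *v X) (A *v Y) = herm X Y)}"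

text \<open>The guard on \<open>A\<close> only makes the function total; it is used for invertible \<open>A\<close>.\<close>

lift_definition proj :: "complex^3^3 \<Rightarrow> cp2 \<Rightarrow> cp2" is
  "\<lambda>A X. if invertible A then A *v X else X"
proof -
  fix A :: "complex^3^3" and X Y assume "proportional X Y"
  then obtain c where c: "X \<noteq> 0" "Y \<noteq> 0" "c \<noteq> 0" "Y = c *s X"
    unfolding proportional_def by auto
  have "A *v Z \<noteq> 0" if "invertible A" "Z \<noteq> 0" for Z
    using that by (metis invertible_def matrix_vector_mul_assoc matrix_vector_mul_lid matrix_vector_mult_0_right)
  with c show "proportional (if invertible A then A *v X else X) (if invertible A then A *v Y else Y)"
    unfolding proportional_def by (auto simp: vector_scalar_commute)
qed

lift_definition conj_cp2 :: "cp2 \<Rightarrow> cp2" is "\<lambda>X. \<chi> i. cnj (X $ i)"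
proof -
  fix X Y assume "proportional X Y"
  then obtain c where c: "X \<noteq> 0" "Y \<noteq> 0" "c \<noteq> 0" "Y = c *s X"
    unfolding proportional_def by auto
  have "(\<chi> i. cnj (Z $ i)) \<noteq> 0" if "Z \<noteq> 0" for Z :: "complex^3"
    using that by (simp add: vec_eq_iff)
  with c show "proportional (\<chi> i. cnj (X $ i)) (\<chi> i. cnj (Y $ i))"
    unfolding proportional_def by (auto simp: vec_eq_iff intro!: exI[of _ "cnj c"])
qed

definition PU21 :: "(cp2 \<Rightarrow> cp2) set" where
  "PU21 = proj ` U21"

text \<open>The isometry group is \<open>PU(2,1) \<rtimes> \<langle>\<sigma>\<rangle>\<close>, acting on the whole projective plane so that ideal points can be
  moved too; an element is determined by its restriction to \<^const>\<open>H2C\<close>, which is open.\<close>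

definition Isom_H2C :: "(cp2 \<Rightarrow> cp2) monoid" where
  "Isom_H2C = \<lparr>carrier = PU21 \<union> {g \<circ> conj_cp2 | g. g \<in> PU21}, mult = (\<circ>), one = id\<rparr>"

lemma cp2_cases: obtains X where "X \<noteq> 0" "p = line X"
  by (induction p rule: cp2.abs_induct) (auto simp: proportional_def)

lemma prop_self: "X \<noteq> 0 \<Longrightarrow> proportional X X"
  unfolding proportional_def by (metis vector_smult_lid zero_neq_one)

lemma proj_line: "invertible A \<Longrightarrow> X \<noteq> 0 \<Longrightarrow> proj A (line X) = line (A *v X)"
  by (simp add: proj.abs_eq[OF prop_self])

lemma conj_line: "X \<noteq> 0 \<Longrightarrow> conj_cp2 (line X) = line (\<chi> i. cnj (X $ i))"
  by (simp add: conj_cp2.abs_eq[OF prop_self])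

lemma invertible_nonzero: "invertible (A::complex^3^3) \<Longrightarrow> X \<noteq> 0 \<Longrightarrow> A *v X \<noteq> 0"
  by (metis invertible_def matrix_vector_mul_assoc matrix_vector_mul_lid matrix_vector_mult_0_right)

lemma U21_mult: "A \<in> U21 \<Longrightarrow> B \<in> U21 \<Longrightarrow> A ** B \<in> U21"
  unfolding U21_def by (simp add: invertible_mult matrix_vector_mul_assoc[symmetric])

lemma proj_mult: "A \<in> U21 \<Longrightarrow> B \<in> U21 \<Longrightarrow> proj A \<circ> proj B = proj (A ** B)"
proof
  fix p assume A: "A \<in> U21" "B \<in> U21"
  obtain X where X: "X \<noteq> 0" "p = line X" by (rule cp2_cases)
  show "(proj A \<circ> proj B) p = proj (A ** B) p"
    using A X by (simp add: U21_def proj_line invertible_nonzero invertible_mult matrix_vector_mul_assoc)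
qed

lemma U21_one: "mat 1 \<in> U21"
  unfolding U21_def by (auto simp: invertible_def intro!: exI[of _ "mat 1"])

lemma proj_one: "proj (mat 1) = id"
proof
  fix p obtain X where X: "X \<noteq> 0" "p = line X" by (rule cp2_cases)
  show "proj (mat 1) p = id p"
    using U21_one X by (simp add: U21_def proj_line)
qed

lemma U21_inv: "A \<in> U21 \<Longrightarrow> \<exists>B\<in>U21. B ** A = mat 1"
proof -
  assume A: "A \<in> U21"
  then obtain B where B: "A ** B = mat 1" "B ** A = mat 1"
    unfolding U21_def invertible_def by auto
  have "herm (B *v X) (B *v Y) = herm X Y" for X Y
  proof -
    have "herm (A *v (B *v X)) (A *v (B *v Y)) = herm (B *v X) (B *v Y)"
      using A unfolding U21_def by blast
    then show ?thesis by (simp add: matrix_vector_mul_assoc B)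
  qed
  moreover have "invertible B" using B unfolding invertible_def by auto
  ultimately show ?thesis using B unfolding U21_def by auto
qed

lemma conj_proj:
  assumes A: "A \<in> U21"
  shows "\<exists>B\<in>U21. conj_cp2 \<circ> proj A = proj B \<circ> conj_cp2"
proof -
  define k :: "complex^3 \<Rightarrow> complex^3" where "k X = (\<chi> i. cnj (X $ i))" for X
  define K :: "complex^3^3 \<Rightarrow> complex^3^3" where "K M = (\<chi> i j. cnj (M $ i $ j))" for M
  have kk: "k (k X) = X" for X by (simp add: k_def vec_eq_iff)
  have k0: "k X \<noteq> 0" if "X \<noteq> 0" for X using that by (simp add: k_def vec_eq_iff)
  have Kk: "K M *v k X = k (M *v X)" for M X
    by (simp add: K_def k_def vec_eq_iff matrix_vector_mult_def)
  have KK: "K (M ** N) = K M ** K N" for M N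
    by (simp add: K_def vec_eq_iff matrix_matrix_mult_def)
  have K1: "K (mat 1) = mat 1" by (simp add: K_def vec_eq_iff mat_def)
  have h: "herm (k X) (k Y) = cnj (herm X Y)" for X Y by (simp add: herm_eq k_def)
  have inv: "invertible A" and pres: "herm (A *v X) (A *v Y) = herm X Y" for X Y
    using A by (auto simp: U21_def)
  obtain B where "A ** B = mat 1" "B ** A = mat 1" using inv unfolding invertible_def by auto
  then have iK: "invertible (K A)" unfolding invertible_def by (metis KK K1)
  have "herm (K A *v X) (K A *v Y) = herm X Y" for X Y
  proof -
    have "herm (K A *v k (k X)) (K A *v k (k Y)) = herm X Y"
      unfolding Kk h pres by simp
    then show ?thesis by (simp add: kk)
  qed
  with iK have "K A \<in> U21" by (simp add: U21_def)
  moreover have "conj_cp2 \<circ> proj A = proj (K A) \<circ> conj_cp2"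
  proof
    fix p obtain X where X: "X \<noteq> 0" "p = line X" by (rule cp2_cases)
    show "(conj_cp2 \<circ> proj A) p = (proj (K A) \<circ> conj_cp2) p"
      using X inv iK by (simp add: proj_line conj_line invertible_nonzero k0 Kk flip: k_def)
  qed
  ultimately show ?thesis by blast
qed

lemma conj_conj: "conj_cp2 \<circ> conj_cp2 = id"
proof
  fix p obtain X where X: "X \<noteq> 0" "p = line X" by (rule cp2_cases)
  have "(\<chi> i. cnj (X $ i)) \<noteq> 0" using X by (simp add: vec_eq_iff)
  then show "(conj_cp2 \<circ> conj_cp2) p = id p"
    using X by (simp add: conj_line)
qed

lemma PU21_mult: "f \<in> PU21 \<Longrightarrow> g \<in> PU21 \<Longrightarrow> f \<circ> g \<in> PU21"
  unfolding PU21_def by (auto simp: proj_mult U21_mult)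

lemma PU21_inv: "f \<in> PU21 \<Longrightarrow> \<exists>g\<in>PU21. g \<circ> f = id"
  unfolding PU21_def by (metis (no_types, lifting) U21_inv image_iff proj_mult proj_one)

lemma PU21_conj: "f \<in> PU21 \<Longrightarrow> \<exists>g\<in>PU21. conj_cp2 \<circ> f = g \<circ> conj_cp2"
  unfolding PU21_def using conj_proj by fastforce

lemma group_extended_by_involution:
  fixes c :: "'a \<Rightarrow> 'a"
  assumes mult: "\<And>f g. f \<in> F \<Longrightarrow> g \<in> F \<Longrightarrow> f \<circ> g \<in> F"
    and one: "id \<in> F" and inverse: "\<And>f. f \<in> F \<Longrightarrow> \<exists>g\<in>F. g \<circ> f = id"
    and invol: "c \<circ> c = id" and normal: "\<And>f. f \<in> F \<Longrightarrow> \<exists>g\<in>F. c \<circ> f = g \<circ> c"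
  shows "group \<lparr>carrier = F \<union> {g \<circ> c | g. g \<in> F}, mult = (\<circ>), one = id\<rparr>" (is "group ?G")
proof (rule groupI)
  fix x y assume "x \<in> carrier ?G" "y \<in> carrier ?G"
  then obtain f g where fg: "f \<in> F" "g \<in> F" "x = f \<or> x = f \<circ> c" "y = g \<or> y = g \<circ> c"
    by auto
  obtain g' where g': "g' \<in> F" "c \<circ> g = g' \<circ> c" using normal fg by blast
  have "(f \<circ> c) \<circ> g = (f \<circ> g') \<circ> c"
    by (metis comp_assoc g'(2))
  moreover have "(f \<circ> c) \<circ> (g \<circ> c) = f \<circ> g'"
    by (metis comp_assoc comp_id invol g'(2))
  moreover have "f \<circ> (g \<circ> c) = (f \<circ> g) \<circ> c" by (simp add: comp_assoc)
  moreover have "f \<circ> g \<in> F" "f \<circ> g' \<in> F" using fg g' mult by auto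
  ultimately show "x \<otimes>\<^bsub>?G\<^esub> y \<in> carrier ?G"
    using fg(3,4) by auto
next
  fix x assume "x \<in> carrier ?G"
  then obtain f where f: "f \<in> F" "x = f \<or> x = f \<circ> c" by auto
  obtain h where h: "h \<in> F" "h \<circ> f = id" using inverse f by blast
  obtain h' where h': "h' \<in> F" "c \<circ> h = h' \<circ> c" using normal h by blast
  have "(h' \<circ> c) \<circ> (f \<circ> c) = c \<circ> (h \<circ> f) \<circ> c"
    unfolding h'(2)[symmetric] by (simp add: comp_assoc)
  then have "(h' \<circ> c) \<circ> (f \<circ> c) = id" by (simp add: h invol)
  then show "\<exists>y\<in>carrier ?G. y \<otimes>\<^bsub>?G\<^esub> x = \<one>\<^bsub>?G\<^esub>"
    using f h h' by auto
qed (use one in \<open>auto simp: comp_assoc\<close>)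

lemma group_Isom_H2C: "group Isom_H2C"
  unfolding Isom_H2C_def
proof (rule group_extended_by_involution)
  show "id \<in> PU21" unfolding PU21_def using U21_one proj_one by force
qed (use PU21_mult PU21_inv PU21_conj conj_conj in auto)

lemma proj_isometry:
  assumes "A \<in> U21" shows "dist_H2C (proj A p) (proj A q) = dist_H2C p q"
proof -
  obtain X Y where X: "X \<noteq> 0" "p = line X" "Y \<noteq> 0" "q = line Y" by (metis cp2_cases)
  with assms show ?thesis
    by (simp add: U21_def proj_line invertible_nonzero dist_H2C.abs_eq[OF prop_self prop_self])
qed

lemma conj_isometry: "dist_H2C (conj_cp2 p) (conj_cp2 q) = dist_H2C p q"
proof -
  obtain X Y where X: "X \<noteq> 0" "p = line X" "Y \<noteq> 0" "q = line Y" by (metis cp2_cases)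
  define k :: "complex^3 \<Rightarrow> complex^3" where "k X = (\<chi> i. cnj (X $ i))" for X
  have k0: "k X \<noteq> 0" if "X \<noteq> 0" for X using that by (simp add: k_def vec_eq_iff)
  have h: "herm (k X) (k Y) = cnj (herm X Y)" for X Y by (simp add: herm_eq k_def)
  show ?thesis
    using X by (simp add: conj_line k0 h dist_H2C.abs_eq[OF prop_self prop_self] flip: k_def)
qed

lemma Isom_H2C_isometry:
  "g \<in> carrier Isom_H2C \<Longrightarrow> dist_H2C (g p) (g q) = dist_H2C p q"
  unfolding Isom_H2C_def PU21_def by (auto simp: proj_isometry conj_isometry)

definition is_parabolic :: "(cp2 \<Rightarrow> cp2) \<Rightarrow> bool" where
  "is_parabolic g \<longleftrightarrow> g \<in> carrier Isom_H2C \<and> (\<forall>p\<in>H2C. g p \<noteq> p) \<and> (\<exists>!q. q \<in> boundary_H2C \<and> g q = q)"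

text \<open>Horospheres are the level sets of the Busemann functions: for a null vector \<open>Q\<close> over \<open>q\<close>,
  the Busemann function at \<open>q\<close> is, up to an additive constant,
  \<open>[X] \<mapsto> ln (\<bar>\<langle>X,Q\<rangle>\<bar>^2 / (- \<langle>X,X\<rangle>))\<close>.\<close>

definition is_horosphere :: "cp2 \<Rightarrow> cp2 set \<Rightarrow> bool" where
  "is_horosphere q S \<longleftrightarrow> (\<exists>Q r. Q \<noteq> 0 \<and> herm Q Q = 0 \<and> line Q = q \<and> r > 0 \<and>
     S = line ` {X. Re (herm X X) < 0 \<and> (cmod (herm X Q))\<^sup>2 = r * - Re (herm X X)})"

section \<open>Lattices\<close>

definition torsion_free :: "('a, 'b) monoid_scheme \<Rightarrow> bool" where
  "torsion_free G \<longleftrightarrow> (\<forall>g\<in>carrier G. \<forall>n::nat. n > 0 \<longrightarrow> g [^]\<^bsub>G\<^esub> n = \<one>\<^bsub>G\<^esub> \<longrightarrow> g = \<one>\<^bsub>G\<^esub>)"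

definition commensurable :: "('a, 'b) monoid_scheme \<Rightarrow> 'a set \<Rightarrow> 'a set \<Rightarrow> bool" where
  "commensurable G A B \<longleftrightarrow> (\<exists>g\<in>carrier G. let A' = g <#\<^bsub>G\<^esub> A #>\<^bsub>G\<^esub> inv\<^bsub>G\<^esub> g in
     finite (rcosets\<^bsub>G\<lparr>carrier := A'\<rparr>\<^esub> (A' \<inter> B)) \<and> finite (rcosets\<^bsub>G\<lparr>carrier := B\<rparr>\<^esub> (A' \<inter> B)))"

definition ring_of_integers :: "nat \<Rightarrow> complex set" where
  "ring_of_integers d = {x. algebraic_int x \<and>
     (\<exists>a\<in>\<rat>. \<exists>b\<in>\<rat>. x = a + b * (\<i> * complex_of_real (sqrt (real d))))}"

definition PU21_O :: "nat \<Rightarrow> (cp2 \<Rightarrow> cp2) set" where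
  "PU21_O d = proj ` {A \<in> U21. \<forall>i j. A $ i $ j \<in> ring_of_integers d}"

definition cusp_point :: "(cp2 \<Rightarrow> cp2) set \<Rightarrow> cp2 \<Rightarrow> bool" where
  "cusp_point \<Gamma> q \<longleftrightarrow> q \<in> boundary_H2C \<and> (\<exists>g\<in>\<Gamma>. is_parabolic g \<and> g q = q)"

text \<open>Function types carry the topology of pointwise convergence.  On isometry groups this is the
  compact-open (Lie group) topology, so \<^const>\<open>discrete\<close> below, here and for the isometries of Nil,
  is the usual discreteness of subgroups.\<close>

definition H2C_manifold_group :: "(cp2 \<Rightarrow> cp2) set \<Rightarrow> bool" where
  "H2C_manifold_group \<Gamma> \<longleftrightarrow> subgroup \<Gamma> Isom_H2C \<and> discrete \<Gamma> \<and>
     torsion_free (Isom_H2C\<lparr>carrier := \<Gamma>\<rparr>)"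

section \<open>Nil and its compact quotients\<close>

type_synonym nil = "complex \<times> real"

definition nil_mult :: "nil \<Rightarrow> nil \<Rightarrow> nil" where
  "nil_mult p q = (fst p + fst q, snd p + snd q + 2 * Im (fst p * cnj (fst q)))"

definition nil_rot :: "complex \<Rightarrow> nil \<Rightarrow> nil" where
  "nil_rot u p = (u * fst p, snd p)"

definition nil_conj :: "nil \<Rightarrow> nil" where
  "nil_conj p = (cnj (fst p), - snd p)"

definition Isom_Nil :: "(nil \<Rightarrow> nil) monoid" where
  "Isom_Nil = \<lparr>carrier = {nil_mult n \<circ> nil_rot u | n u. cmod u = 1} \<union>
                         {nil_mult n \<circ> nil_rot u \<circ> nil_conj | n u. cmod u = 1},
               mult = (\<circ>), one = id\<rparr>"

lemma group_Isom_Nil: "group Isom_Nil"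
proof -
  define F where "F = {nil_mult n \<circ> nil_rot u | n u. cmod u = 1}"
  have mm: "nil_mult m \<circ> nil_mult n = nil_mult (nil_mult m n)" for m n
    by (rule ext) (simp add: nil_mult_def algebra_simps)
  have rr: "nil_rot u \<circ> nil_rot v = nil_rot (u * v)" for u v
    by (rule ext) (simp add: nil_rot_def)
  have rm: "nil_rot u \<circ> nil_mult n = nil_mult (nil_rot u n) \<circ> nil_rot u" if "cmod u = 1" for u n
  proof -
    have u: "u * cnj u = 1" using that by (simp add: complex_norm_square[symmetric])
    have "(u * z) * cnj (u * w) = (u * cnj u) * (z * cnj w)" for z w
      by (simp only: complex_cnj_mult ac_simps)
    then have "(u * z) * cnj (u * w) = z * cnj w" for z w unfolding u by simp
    then show ?thesis
      by (intro ext) (simp only: nil_rot_def nil_mult_def distrib_left fst_conv snd_conv o_apply)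
  qed
  have cm: "nil_conj \<circ> nil_mult n = nil_mult (nil_conj n) \<circ> nil_conj" for n
    by (rule ext) (simp add: nil_conj_def nil_mult_def algebra_simps)
  have cr: "nil_conj \<circ> nil_rot u = nil_rot (cnj u) \<circ> nil_conj" for u
    by (rule ext) (simp add: nil_conj_def nil_rot_def)
  have cc: "nil_conj \<circ> nil_conj = id"
    by (rule ext) (simp add: nil_conj_def)
  have id: "nil_mult (0, 0) = id" "nil_rot 1 = id"
    by (auto simp: nil_mult_def nil_rot_def)
  have FF: "(nil_mult m \<circ> nil_rot u) \<circ> (nil_mult n \<circ> nil_rot v)
      = nil_mult (nil_mult m (nil_rot u n)) \<circ> nil_rot (u * v)" if "cmod u = 1" for m n u v
    by (metis (no_types, lifting) comp_assoc mm rr rm that)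
  have "group \<lparr>carrier = F \<union> {g \<circ> nil_conj | g. g \<in> F}, mult = (\<circ>), one = id\<rparr>"
  proof (rule group_extended_by_involution[OF _ _ _ cc])
    fix f g assume "f \<in> F" "g \<in> F"
    then obtain m u n v where "cmod u = 1" "cmod v = 1"
      "f = nil_mult m \<circ> nil_rot u" "g = nil_mult n \<circ> nil_rot v" unfolding F_def by auto
    moreover have "cmod (u * v) = 1" using calculation by (simp add: norm_mult)
    ultimately show "f \<circ> g \<in> F" unfolding F_def using FF by blast
  next
    have "id = nil_mult (0, 0) \<circ> nil_rot 1" by (simp add: id)
    then show "id \<in> F" unfolding F_def using norm_one by blast
  next
    fix f assume "f \<in> F"
    then obtain n v where f: "cmod v = 1" "f = nil_mult n \<circ> nil_rot v" unfolding F_def by auto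
    define m where "m = (- fst (nil_rot (cnj v) n), - snd n)"
    have v: "cnj v * v = 1" using f(1) by (metis complex_norm_square mult.commute of_real_1 power_one)
    have "nil_mult m (nil_rot (cnj v) n) = (0, 0)"
    proof -
      have "nil_mult (- z, - t) (z, t) = (0, 0)" for z t
        by (simp add: nil_mult_def algebra_simps)
      then show ?thesis by (simp add: m_def nil_rot_def[of "cnj v" n])
    qed
    then have "(nil_mult m \<circ> nil_rot (cnj v)) \<circ> f = id"
      unfolding f(2) by (subst FF) (simp_all add: f(1) v id)
    moreover have "nil_mult m \<circ> nil_rot (cnj v) \<in> F"
      unfolding F_def using f(1) complex_mod_cnj[of v] by (metis (mono_tags, lifting) mem_Collect_eq)
    ultimately show "\<exists>g\<in>F. g \<circ> f = id" by blast
  next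
    fix f assume "f \<in> F"
    then obtain n v where f: "cmod v = 1" "f = nil_mult n \<circ> nil_rot v" unfolding F_def by auto
    have "nil_conj \<circ> f = (nil_mult (nil_conj n) \<circ> nil_rot (cnj v)) \<circ> nil_conj"
      unfolding f(2) by (metis comp_assoc cm cr)
    moreover have "nil_mult (nil_conj n) \<circ> nil_rot (cnj v) \<in> F"
      unfolding F_def using f(1) complex_mod_cnj[of v] by (metis (mono_tags, lifting) mem_Collect_eq)
    ultimately show "\<exists>g\<in>F. nil_conj \<circ> f = g \<circ> nil_conj" by blast
  qed
  moreover have "{g \<circ> nil_conj | g. g \<in> F} = {nil_mult n \<circ> nil_rot u \<circ> nil_conj | n u. cmod u = 1}"
    unfolding F_def by auto
  ultimately show ?thesis
    unfolding Isom_Nil_def F_def by simp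
qed

definition orbit_space :: "('a::topological_space \<Rightarrow> 'a, 'b) monoid_scheme \<Rightarrow> 'a set topology" where
  "orbit_space G = topology (\<lambda>U. U \<subseteq> orbits G UNIV (\<lambda>g. g) \<and> open {x. orbit G (\<lambda>g. g) x \<in> U})"

lemma openin_orbit_space:
  "openin (orbit_space G) U \<longleftrightarrow>
     U \<subseteq> orbits G UNIV (\<lambda>g. g) \<and> open {x. orbit G (\<lambda>g. g) x \<in> U}"
proof -
  have "istopology (\<lambda>U. U \<subseteq> orbits G UNIV (\<lambda>g. g) \<and> open {x. orbit G (\<lambda>g. g) x \<in> U})"
    unfolding istopology_def
  proof (intro conjI allI impI, goal_cases)
    case (2 S T)
    then have "open ({x. orbit G (\<lambda>g. g) x \<in> S} \<inter> {x. orbit G (\<lambda>g. g) x \<in> T})"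
      by (blast intro: open_Int)
    then show ?case by (simp add: Collect_conj_eq)
  next
    case (4 K)
    then have "open (\<Union>S\<in>K. {x. orbit G (\<lambda>g. g) x \<in> S})" by blast
    moreover have "(\<Union>S\<in>K. {x. orbit G (\<lambda>g. g) x \<in> S}) = {x. orbit G (\<lambda>g. g) x \<in> \<Union>K}"
      by blast
    ultimately show ?case by simp
  qed auto
  then show ?thesis
    unfolding orbit_space_def by (simp add: topology_inverse')
qed

text \<open>A Nil 3-manifold \<open>Nil/\<Delta>\<close> is represented by its group \<open>\<Delta>\<close>, which is its fundamental group.\<close>

definition Nil_manifold_group :: "(nil \<Rightarrow> nil) set \<Rightarrow> bool" where
  "Nil_manifold_group \<Delta> \<longleftrightarrow> subgroup \<Delta> Isom_Nil \<and> discrete \<Delta> \<and>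
     torsion_free (Isom_Nil\<lparr>carrier := \<Delta>\<rparr>) \<and> compact_space (orbit_space (Isom_Nil\<lparr>carrier := \<Delta>\<rparr>))"

section \<open>Diffeomorphisms between quotients\<close>

primrec C_k_on :: "nat \<Rightarrow> 'a::real_normed_vector set \<Rightarrow> ('a \<Rightarrow> 'b::real_normed_vector) \<Rightarrow> bool" where
  "C_k_on 0 W f \<longleftrightarrow> continuous_on W f"
| "C_k_on (Suc n) W f \<longleftrightarrow> (\<forall>x\<in>W. f differentiable (at x)) \<and>
     (\<forall>v. C_k_on n W (\<lambda>x. frechet_derivative f (at x) v))"

definition C_infinity_on :: "'a::real_normed_vector set \<Rightarrow> ('a \<Rightarrow> 'b::real_normed_vector) \<Rightarrow> bool" where
  "C_infinity_on W f \<longleftrightarrow> (\<forall>n. C_k_on n W f)"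

text \<open>A manifold \<open>M\<close> is given with an embedding \<open>e\<close> as a submanifold of a Euclidean space, and a
  group of diffeomorphisms of \<open>M\<close> acting freely and properly discontinuously.  Since \<open>M \<rightarrow> M/G\<close> is
  then a local diffeomorphism, a map \<open>M/G \<rightarrow> M'/G'\<close> is smooth iff it lifts, around each point
  of \<open>M\<close>, to a smooth map into \<open>M'\<close>; and a map from \<open>M\<close> is smooth iff it is, around each point, the
  restriction of a smooth map defined on an open set of the ambient Euclidean space.\<close>

definition smooth_quotient_map ::
  "('a \<Rightarrow> 'e::euclidean_space) \<Rightarrow> 'a set \<Rightarrow> ('a \<Rightarrow> 'a, 'm) monoid_scheme \<Rightarrow>
   ('b \<Rightarrow> 'f::euclidean_space) \<Rightarrow> 'b set \<Rightarrow> ('b \<Rightarrow> 'b, 'n) monoid_scheme \<Rightarrow>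
   ('a set \<Rightarrow> 'b set) \<Rightarrow> bool" where
  "smooth_quotient_map e M G e' M' G' f \<longleftrightarrow>
     (\<forall>x\<in>M. \<exists>W h. open W \<and> e x \<in> W \<and> C_infinity_on W h \<and>
        (\<forall>y\<in>M. e y \<in> W \<longrightarrow> (\<exists>z\<in>M'. e' z = h (e y) \<and>
           f (orbit G (\<lambda>g. g) y) = orbit G' (\<lambda>g. g) z)))"

definition diffeomorphic_quotients ::
  "('a \<Rightarrow> 'e::euclidean_space) \<Rightarrow> 'a set \<Rightarrow> ('a \<Rightarrow> 'a, 'm) monoid_scheme \<Rightarrow>
   ('b \<Rightarrow> 'f::euclidean_space) \<Rightarrow> 'b set \<Rightarrow> ('b \<Rightarrow> 'b, 'n) monoid_scheme \<Rightarrow> bool" where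
  "diffeomorphic_quotients e M G e' M' G' \<longleftrightarrow>
     (\<exists>f. bij_betw f (orbits G M (\<lambda>g. g)) (orbits G' M' (\<lambda>g. g)) \<and>
        smooth_quotient_map e M G e' M' G' f \<and>
        smooth_quotient_map e' M' G' e M G (inv_into (orbits G M (\<lambda>g. g)) f))"

section \<open>Occurrence as a cusp cross-section\<close>

definition occurs_as_cusp_cross_section :: "(nil \<Rightarrow> nil) set \<Rightarrow> nat \<Rightarrow> bool" where
  "occurs_as_cusp_cross_section \<Delta> d \<longleftrightarrow>
     (\<exists>\<Gamma>. H2C_manifold_group \<Gamma> \<and> commensurable Isom_H2C \<Gamma> (PU21_O d) \<and>
       (\<exists>q S. cusp_point \<Gamma> q \<and> is_horosphere q S \<and>
          diffeomorphic_quotients id UNIV (Isom_Nil\<lparr>carrier := \<Delta>\<rparr>) siegel S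
            (Isom_H2C\<lparr>carrier := stabilizer (Isom_H2C\<lparr>carrier := \<Gamma>\<rparr>) (\<lambda>g. g) q\<rparr>)))"

section \<open>Group presentations\<close>

text \<open>The letter \<open>(x, True)\<close> is the generator \<open>x\<close> and \<open>(x, False)\<close> its inverse; a pair of words
  in \<open>R\<close> is a defining relation.\<close>

type_synonym 'x word = "('x \<times> bool) list"

inductive word_eq :: "('x word \<times> 'x word) set \<Rightarrow> 'x word \<Rightarrow> 'x word \<Rightarrow> bool" for R where
  refl: "word_eq R w w"
| sym: "word_eq R v w \<Longrightarrow> word_eq R w v"
| trans: "word_eq R u v \<Longrightarrow> word_eq R v w \<Longrightarrow> word_eq R u w"
| cancel: "word_eq R (u @ [(x, s), (x, \<not> s)] @ v) (u @ v)"
| relation: "(l, r) \<in> R \<Longrightarrow> word_eq R (u @ l @ v) (u @ r @ v)"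

definition presented_group :: "('x word \<times> 'x word) set \<Rightarrow> 'x word set monoid" where
  "presented_group R = \<lparr>carrier = UNIV // {(v, w). word_eq R v w},
     mult = (\<lambda>P Q. {w. \<exists>u\<in>P. \<exists>v\<in>Q. word_eq R (u @ v) w}),
     one = {w. word_eq R [] w}\<rparr>"

definition word_inv :: "'x word \<Rightarrow> 'x word" where
  "word_inv w = rev (map (apsnd Not) w)"

definition word_pow :: "'x word \<Rightarrow> nat \<Rightarrow> 'x word" where
  "word_pow w n = concat (replicate n w)"

text \<open>The opposite commutator convention would give the same groups below, since \<open>c\<close> commutes
  with \<open>a\<close> and \<open>b\<close>.\<close>

definition word_comm :: "'x word \<Rightarrow> 'x word \<Rightarrow> 'x word" where
  "word_comm v w = v @ w @ word_inv v @ word_inv w"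

datatype gen = Gen_a | Gen_b | Gen_c | Gen_alpha

abbreviation "wa \<equiv> [(Gen_a, True)]"
abbreviation "wb \<equiv> [(Gen_b, True)]"
abbreviation "wc \<equiv> [(Gen_c, True)]"
abbreviation "w\<alpha> \<equiv> [(Gen_alpha, True)]"

definition common_relations :: "nat \<Rightarrow> (gen word \<times> gen word) set" where
  "common_relations k = {(word_comm wb wa, word_pow wc k), (word_comm wc wa, []),
     (word_comm wc wb, []), (word_comm wc w\<alpha>, [])}"

definition quarter_twist :: "('a, 'b) monoid_scheme \<Rightarrow> bool" where
  "quarter_twist G \<longleftrightarrow> (\<exists>k p. k > 0 \<and> (2 dvd k \<and> p = 1 \<or> 4 dvd k \<and> p = 3) \<and>
     G \<cong> presented_group (common_relations k \<union>
       {(w\<alpha> @ wa, wb @ w\<alpha>), (w\<alpha> @ wb, word_inv wa @ w\<alpha>), (word_pow w\<alpha> 4, word_pow wc p)}))"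

definition third_twist :: "('a, 'b) monoid_scheme \<Rightarrow> bool" where
  "third_twist G \<longleftrightarrow> (\<exists>k k1 k2. k > 0 \<and>
       (k mod 3 = 0 \<and> k1 = 0 \<and> k2 \<in> {1, 2} \<or> k mod 3 \<in> {1, 2} \<and> k1 = 1 \<and> k2 = 1) \<and>
     G \<cong> presented_group (common_relations k \<union>
       {(w\<alpha> @ wa, wb @ w\<alpha> @ word_pow wc k1), (w\<alpha> @ wb, word_inv wa @ word_inv wb @ w\<alpha>),
        (word_pow w\<alpha> 3, word_pow wc k2)}))"

definition sixth_twist :: "('a, 'b) monoid_scheme \<Rightarrow> bool" where
  "sixth_twist G \<longleftrightarrow> (\<exists>k k1. k > 0 \<and>
       (k mod 6 \<in> {0, 4} \<and> k1 = 1 \<or> k mod 6 \<in> {0, 2} \<and> k1 = 5) \<and>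
     G \<cong> presented_group (common_relations k \<union>
       {(w\<alpha> @ wa, wa @ wb @ w\<alpha>), (w\<alpha> @ wb, word_inv wa @ w\<alpha>), (word_pow w\<alpha> 6, word_pow wc k1)}))"

end

theory Submission
  imports Defs "HOL-Algebra.Generated_Groups"
begin

text \<open>A twisted lattice contains two translations and a screw motion whose planar part is a rotation of order
  4, 3 or 6.  Normalised to planar coordinates in the Gaussian or Eisenstein integers, a rescaling of the
  lattice acts by integral parabolic matrices.  The integral matrices congruent, modulo a suitable multiple
  of 24, to one of these parabolics form a torsion-free group commensurable to the Picard group, and the
  congruence singles out the given lattice among its stabilisers of the cusp.

  Conversely, a diffeomorphism onto a cusp cross-section lifts to universal covers, so the lattice embeds in
  the stabiliser of a cusp as a group of isometries of Nil satisfying the same relations.  Let \<open>a\<close>, \<open>b\<close>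
  be the two translations, with planar parts \<open>z\<close> and \<open>v z\<close>; the relations force \<open>v\<^sup>2 = -1\<close> or
  \<open>1 + v + v\<^sup>2 = 0\<close>.  By commensurability a power of each of them has entries in \<open>\<rat>(i \<surd>d)\<close> after a common
  conjugation, and for unipotent \<open>A\<close>, \<open>B\<close> representing \<open>a\<close>, \<open>b\<close> the matrices \<open>(A - 1)(B - 1)\<close> and
  \<open>(A - 1)\<^sup>2\<close> are proportional with ratio \<open>v\<close>, up to a rational factor and conjugation.  Hence \<open>v\<close> lies in
  \<open>\<rat>(i \<surd>d)\<close>, which determines \<open>d\<close>.\<close>

section \<open>Isometries of Nil in coordinates\<close>

text \<open>In the construction the obstacle is torsion: a matrix congruent to a parabolic may have
  finite order. If \<open>A\<close> is congruent modulo n to a parabolic of rotational part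
  \<open>u\<close>, then (A - 1)^2 (A - u) maps integral vectors to n times integral vectors. When
  \<open>A\<close> has finite projective order, an invariant norm exists in which this operator
  expands by at most 2^3 = 8. So for n > 8 some power of it kills every integral vector, and since
  bounded powers exclude Jordan blocks, (A - 1)(A - u) = 0. Modulo n this says that the shift of the
  parabolic along its axis is divisible by n, up to the factor 1 - u. As |1 - u|^2 divides 12, that
  factor costs 12; a further factor 2 clears the halves in imaginary parts, whence 24. The lattice
  can then cancel the shift by one of its own vertical translations and would contain a rotation of
  finite order. In both directions the relations must first determine the type of each generator,
  since \<open>c\<close> could a priori rotate or conjugate. This needs \<open>c\<close> to have
  infinite order, which the presentation does not show by itself; it is read off from a concrete
  model of the relations.\<close>

definition cj :: "bool \<Rightarrow> complex \<Rightarrow> complex" where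
  "cj e x = (if e then cnj x else x)"

definition sg :: "bool \<Rightarrow> real" where
  "sg e = (if e then - 1 else 1)"

text \<open>Normal form of an isometry: conjugation if \<open>e\<close>, then rotation by
  \<open>u\<close>, then left translation by (z, t). The parameters are unique as soon as u is
  nonzero.\<close>

definition nil_iso :: "complex \<Rightarrow> real \<Rightarrow> complex \<Rightarrow> bool \<Rightarrow> nil \<Rightarrow> nil" where
  "nil_iso z t u e p =
     (z + u * cj e (fst p), t + sg e * snd p + 2 * Im (z * cnj (u * cj e (fst p))))"

lemma cj_simps [simp]:
  "cj False x = x" "cj True x = cnj x" "cj e 0 = 0" "cj e 1 = 1"
  "cmod (cj e x) = cmod x" "cj e (cj e x) = x" "cj e x = 0 \<longleftrightarrow> x = 0"
  "cj e (x + y) = cj e x + cj e y" "cj e (x * y) = cj e x * cj e y" "cj e (- x) = - cj e x"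
  "cj e (of_real r) = of_real r"
  by (auto simp: cj_def)

lemma sg_simps [simp]: "sg False = 1" "sg True = - 1" "sg e * sg e = 1"
  by (auto simp: sg_def)

lemma nil_iso_alt:
  "nil_mult (z, t) \<circ> nil_rot u = nil_iso z t u False"
  "nil_mult (z, t) \<circ> nil_rot u \<circ> nil_conj = nil_iso z t u True"
  by (auto simp: nil_iso_def nil_mult_def nil_rot_def nil_conj_def fun_eq_iff)

lemma carrier_Isom_Nil: "carrier Isom_Nil = {nil_iso z t u e | z t u e. cmod u = 1}"
proof -
  have "{nil_iso z t u e | z t u e. cmod u = 1} =
        {nil_iso z t u False | z t u. cmod u = 1} \<union> {nil_iso z t u True | z t u. cmod u = 1}"
    by (auto) (metis (full_types))
  then show ?thesis
    by (simp add: Isom_Nil_def nil_iso_alt[symmetric])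
qed

lemma nil_isoI: "cmod u = 1 \<Longrightarrow> nil_iso z t u e \<in> carrier Isom_Nil"
  unfolding carrier_Isom_Nil by blast

lemma nil_isoE:
  assumes "g \<in> carrier Isom_Nil"
  obtains z t u e where "g = nil_iso z t u e" "cmod u = 1"
  using assms unfolding carrier_Isom_Nil by auto

lemma mult_Isom_Nil [simp]: "x \<otimes>\<^bsub>Isom_Nil\<^esub> y = x \<circ> y" "\<one>\<^bsub>Isom_Nil\<^esub> = id"
  by (auto simp: Isom_Nil_def)

lemma mult_Isom_H2C [simp]: "x \<otimes>\<^bsub>Isom_H2C\<^esub> y = x \<circ> y" "\<one>\<^bsub>Isom_H2C\<^esub> = id"
  by (auto simp: Isom_H2C_def)

lemma unit_cnj: "cmod u = 1 \<Longrightarrow> u * cnj u = 1" "cmod u = 1 \<Longrightarrow> cnj u * u = 1"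
  using complex_norm_square[of u] by (auto simp: mult.commute)

lemma Im_unit_mult:
  assumes "cmod u = 1"
  shows "Im ((u * x) * cnj (u * y)) = Im (x * cnj y)"
proof -
  have "(u * x) * cnj (u * y) = (u * cnj u) * (x * cnj y)" by (simp only: complex_cnj_mult ac_simps)
  then show ?thesis by (simp only: unit_cnj(1)[OF assms] mult_1_left)
qed

lemma nil_iso_comp:
  assumes "cmod u = 1"
  shows "nil_iso z t u e \<circ> nil_iso z' t' u' e' =
    nil_iso (z + u * cj e z') (t + sg e * t' + 2 * Im (z * cnj (u * cj e z')))
      (u * cj e u') (e \<noteq> e')"
proof (rule ext)
  fix p :: nil
  have *: "Im ((u * x) * cnj (u * y)) = Im (x * cnj y)" for x y
    using assms by (rule Im_unit_mult)
  define q where "q = cj e' (fst p)"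
  have q: "cj (e \<noteq> e') (fst p) = cj e q" unfolding q_def by (cases e; cases e') auto
  have s: "sg (e \<noteq> e') = sg e * sg e'" by (cases e; cases e') auto
  \<comment> \<open>Rotation preserves the form Im (x * cnj y) and conjugation changes its sign,
    which is what \<open>sg e\<close> records.\<close>
  have c: "sg e * Im (z' * cnj (u' * q)) = Im ((u * cj e z') * cnj (u * (cj e u' * cj e q)))"
    unfolding * by (cases e) (auto simp: algebra_simps)
  show "(nil_iso z t u e \<circ> nil_iso z' t' u' e') p = nil_iso (z + u * cj e z') (t + sg e * t' + 2 * Im (z * cnj (u * cj e z')))
      (u * cj e u') (e \<noteq> e') p"
    unfolding nil_iso_def q s o_apply fst_conv snd_conv q_def[symmetric]
    using c by (simp only: prod.inject cj_simps) (simp add: algebra_simps)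
qed

lemma nil_iso_id: "nil_iso 0 0 1 False = id"
  by (auto simp: nil_iso_def)

lemma nil_iso_inject:
  assumes "u \<noteq> 0"
  shows "nil_iso z t u e = nil_iso z' t' u' e' \<longleftrightarrow> z = z' \<and> t = t' \<and> u = u' \<and> e = e'"
proof
  assume *: "nil_iso z t u e = nil_iso z' t' u' e'"
  \<comment> \<open>The images of 0 and 1 determine z, t and u; the planar point i then detects the
    conjugation.\<close>
  have "nil_iso z t u e (0, 0) = nil_iso z' t' u' e' (0, 0)" "nil_iso z t u e (1, 0) = nil_iso z' t' u' e' (1, 0)"
    "nil_iso z t u e (\<i>, 0) = nil_iso z' t' u' e' (\<i>, 0)"
    unfolding * by auto
  then have "z = z'" "t = t'" "u = u'" "u * cj e \<i> = u * cj e' \<i>"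
    by (auto simp: nil_iso_def)
  moreover then have "cj e \<i> = cj e' \<i>" using assms by simp
  then have "e = e'" by (cases e; cases e') (auto simp: complex_eq_iff)
  ultimately show "z = z' \<and> t = t' \<and> u = u' \<and> e = e'" by simp
qed auto

lemma nil_iso_eq_id: "nil_iso z t u e = id \<longleftrightarrow> z = 0 \<and> t = 0 \<and> u = 1 \<and> \<not> e"
proof (cases "u = 0")
  case True
  then have "nil_iso z t u e (0,0) = nil_iso z t u e (1, 0)" by (auto simp: nil_iso_def)
  then show ?thesis using True by (metis id_apply prod.inject zero_neq_one)
qed (use nil_iso_inject[of u z t e 0 0 1 False] nil_iso_id in auto)

lemma nil_iso_funpow_vertical: "(nil_iso 0 s 1 False) ^^ n = nil_iso 0 (n * s) 1 False"
  by (induction n) (auto simp: nil_iso_id nil_iso_comp algebra_simps)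

lemma Isom_Nil_pow [simp]: "g [^]\<^bsub>Isom_Nil\<lparr>carrier := D\<rparr>\<^esub> (n::nat) = g ^^ n" "g [^]\<^bsub>Isom_Nil\<^esub> (n::nat) = g ^^ n"
  by (induction n) (simp_all add: nat_pow_def funpow_Suc_right del: funpow.simps(2))

lemma Isom_H2C_pow [simp]: "g [^]\<^bsub>Isom_H2C\<lparr>carrier := D\<rparr>\<^esub> (n::nat) = g ^^ n" "g [^]\<^bsub>Isom_H2C\<^esub> (n::nat) = g ^^ n"
  by (induction n) (simp_all add: nat_pow_def funpow_Suc_right del: funpow.simps(2))

section \<open>Lines and matrices\<close>

lemma line_eq_iff:
  assumes "X \<noteq> 0" "Y \<noteq> 0"
  shows "line X = line Y \<longleftrightarrow> (\<exists>c. c \<noteq> 0 \<and> Y = c *s X)"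
  using Quotient3_rel[OF Quotient3_cp2, of X Y] prop_self[OF assms(1)] prop_self[OF assms(2)] assms
  unfolding proportional_def by auto

lemma vec3_eq_iff: "(X::complex^3) = Y \<longleftrightarrow> X$1 = Y$1 \<and> X$2 = Y$2 \<and> X$3 = Y$3"
  by (simp add: vec_eq_iff forall_3)

lemma mat3_eq_iff: "(A::complex^3^3) = B \<longleftrightarrow> (A$1$1 = B$1$1 \<and> A$1$2 = B$1$2 \<and> A$1$3 = B$1$3) \<and>
    (A$2$1 = B$2$1 \<and> A$2$2 = B$2$2 \<and> A$2$3 = B$2$3) \<and> (A$3$1 = B$3$1 \<and> A$3$2 = B$3$2 \<and> A$3$3 = B$3$3)"
  by (simp add: vec_eq_iff forall_3)

lemma mvm3: "((A::complex^3^3) *v X) $ i = A$i$1 * X$1 + A$i$2 * X$2 + A$i$3 * X$3"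
  by (simp add: matrix_vector_mult_def sum_3)

lemma mmm3: "((A::complex^3^3) ** B) $ i $ j = A$i$1 * B$1$j + A$i$2 * B$2$j + A$i$3 * B$3$j"
  by (simp add: matrix_matrix_mult_def sum_3)

lemma mat_1_3: "(mat 1 :: complex^3^3)$1$1 = 1" "(mat 1 :: complex^3^3)$1$2 = 0" "(mat 1 :: complex^3^3)$1$3 = 0"
   "(mat 1 :: complex^3^3)$2$1 = 0" "(mat 1 :: complex^3^3)$2$2 = 1" "(mat 1 :: complex^3^3)$2$3 = 0"
   "(mat 1 :: complex^3^3)$3$1 = 0" "(mat 1 :: complex^3^3)$3$2 = 0" "(mat 1 :: complex^3^3)$3$3 = 1"
  by (auto simp: mat_def)

definition smat :: "complex \<Rightarrow> complex^3^3 \<Rightarrow> complex^3^3" where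
  "smat l A = (\<chi> i j. l * A $ i $ j)"

lemma smat_nth [simp]: "smat l A $ i $ j = l * A $ i $ j"
  by (simp add: smat_def)

lemma smat_mvm: "smat l A *v X = l *s (A *v X)"
  by (simp add: vec3_eq_iff mvm3 algebra_simps)

lemma smat_mmm: "smat l A ** B = smat l (A ** B)" "A ** smat l B = smat l (A ** B)"
  by (simp_all add: mat3_eq_iff mmm3 algebra_simps)

lemma smat_smat [simp]: "smat l (smat m A) = smat (l * m) A" "smat 1 A = A" "smat 0 A = 0"
  by (simp_all add: mat3_eq_iff algebra_simps)

lemma U21_invertible: "A \<in> U21 \<Longrightarrow> invertible A"
  by (simp add: U21_def)

lemma U21_herm: "A \<in> U21 \<Longrightarrow> herm (A *v X) (A *v Y) = herm X Y"
  by (simp add: U21_def)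

text \<open>The adjoint H A* H for the Hermitian form. Multiplication by \<open>H\<close> reverses
  the coordinates, and in the index type \<open>3\<close> the map taking i to 4 - i is this
  reversal.\<close>

definition adjH :: "complex^3^3 \<Rightarrow> complex^3^3" where
  "adjH A = (\<chi> i j. cnj (A $ (4 - j) $ (4 - i)))"

lemma adjH_nth [simp]:
  "adjH A $ 1 $ 1 = cnj (A $ 3 $ 3)" "adjH A $ 1 $ 2 = cnj (A $ 2 $ 3)" "adjH A $ 1 $ 3 = cnj (A $ 1 $ 3)"
  "adjH A $ 2 $ 1 = cnj (A $ 3 $ 2)" "adjH A $ 2 $ 2 = cnj (A $ 2 $ 2)" "adjH A $ 2 $ 3 = cnj (A $ 1 $ 2)"
  "adjH A $ 3 $ 1 = cnj (A $ 3 $ 1)" "adjH A $ 3 $ 2 = cnj (A $ 2 $ 1)" "adjH A $ 3 $ 3 = cnj (A $ 1 $ 1)"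
proof -
  have "(4 - 1 :: 3) = 3" "(4 - 2 :: 3) = 2" "(4 - 3 :: 3) = 1" by simp_all
  then show "adjH A $ 1 $ 1 = cnj (A $ 3 $ 3)" "adjH A $ 1 $ 2 = cnj (A $ 2 $ 3)" "adjH A $ 1 $ 3 = cnj (A $ 1 $ 3)"
  "adjH A $ 2 $ 1 = cnj (A $ 3 $ 2)" "adjH A $ 2 $ 2 = cnj (A $ 2 $ 2)" "adjH A $ 2 $ 3 = cnj (A $ 1 $ 2)"
  "adjH A $ 3 $ 1 = cnj (A $ 3 $ 1)" "adjH A $ 3 $ 2 = cnj (A $ 2 $ 1)" "adjH A $ 3 $ 3 = cnj (A $ 1 $ 1)"
    unfolding adjH_def by simp_all
qed

lemma herm_axis:
  fixes A :: "complex^3^3"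
  shows "herm (A *v axis j 1) (A *v axis i 1) = A$3$j * cnj (A$1$i) + A$2$j * cnj (A$2$i) + A$1$j * cnj (A$3$i)"
proof -
  have "(A *v axis j 1) $ k = A $ k $ j" for j k :: 3
    using exhaust_3[of j] by (auto simp: mvm3 axis_def)
  then show ?thesis by (simp add: herm_eq)
qed

text \<open>The entries of the product are the Hermitian products of the columns of
  \<open>A\<close>, which are those of the standard basis.\<close>

lemma adjH_mult:
  assumes "A \<in> U21" shows "adjH A ** A = mat 1"
proof -
  have h: "A$3$j * cnj (A$1$i) + A$2$j * cnj (A$2$i) + A$1$j * cnj (A$3$i) = herm (axis j 1) (axis i 1)" for i j
    using U21_herm[OF assms, of "axis j 1" "axis i 1"] unfolding herm_axis .
  have a: "herm (axis j 1) (axis i 1) = (if (i::3) = 4 - j then 1 else 0)" for i j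
  proof -
    have "(4 - 1 :: 3) = 3" "(4 - 2 :: 3) = 2" "(4 - 3 :: 3) = 1" by simp_all
    then show ?thesis using exhaust_3[of i] exhaust_3[of j]
      by (auto simp: herm_eq axis_def)
  qed
  show ?thesis
    using h[of 1 1] h[of 1 2] h[of 1 3] h[of 2 1] h[of 2 2] h[of 2 3] h[of 3 1] h[of 3 2] h[of 3 3]
    unfolding a mat3_eq_iff mmm3 mat_1_3 by (simp add: algebra_simps)
qed

lemma adjH_mult2:
  assumes "A \<in> U21" shows "A ** adjH A = mat 1"
  using adjH_mult[OF assms] matrix_left_right_inverse by blast

lemma U21I:
  assumes "adjH A ** A = mat 1" shows "A \<in> U21"
proof -
  have "A ** adjH A = mat 1" using assms matrix_left_right_inverse by blast
  then have "invertible A" using assms unfolding invertible_def by blast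
  moreover have "herm (A *v X) (A *v Y) = herm X Y" for X Y
  proof -
    have a: "herm (A *v X) Z = herm X (adjH A *v Z)" for X Z
      by (simp add: herm_eq mvm3 algebra_simps)
    show ?thesis unfolding a matrix_vector_mul_assoc assms by simp
  qed
  ultimately show ?thesis unfolding U21_def by blast
qed

lemma adjH_U21: "A \<in> U21 \<Longrightarrow> adjH A \<in> U21"
proof (rule U21I)
  assume "A \<in> U21"
  moreover have "adjH (adjH A) = A" by (simp add: mat3_eq_iff)
  ultimately show "adjH (adjH A) ** adjH A = mat 1" using adjH_mult2 by simp
qed

lemma proj_adjH:
  assumes "A \<in> U21" shows "proj A \<circ> proj (adjH A) = id" "proj (adjH A) \<circ> proj A = id"
  using assms proj_mult adjH_U21 adjH_mult adjH_mult2 proj_one by metis+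

lemma carrier_Isom_H2C: "carrier Isom_H2C = PU21 \<union> {g \<circ> conj_cp2 | g. g \<in> PU21}"
  by (simp add: Isom_H2C_def)

lemma proj_in_Isom: "A \<in> U21 \<Longrightarrow> proj A \<in> carrier Isom_H2C"
  by (auto simp: carrier_Isom_H2C PU21_def)

lemma Isom_H2CE:
  assumes "g \<in> carrier Isom_H2C"
  obtains A e where "A \<in> U21" "g = proj A \<circ> (if e then conj_cp2 else id)"
proof -
  from assms consider "g \<in> PU21" | h where "h \<in> PU21" "g = h \<circ> conj_cp2"
    unfolding carrier_Isom_H2C by blast
  then show ?thesis
  proof cases
    case 1 then show ?thesis using that[of _ False] unfolding PU21_def by auto
  next
    case 2 then show ?thesis using that[of _ True] unfolding PU21_def by auto
  qed
qed

lemma smat_U21: "A \<in> U21 \<Longrightarrow> cmod l = 1 \<Longrightarrow> smat l A \<in> U21"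
proof (rule U21I)
  assume "A \<in> U21" and l: "cmod l = 1"
  then have A: "adjH A ** A = mat 1" using adjH_mult by blast
  have "adjH (smat l A) = smat (cnj l) (adjH A)" by (simp add: mat3_eq_iff)
  then show "adjH (smat l A) ** smat l A = mat 1"
    by (simp add: smat_mmm A unit_cnj[OF l])
qed

lemma proj_smat: 
  assumes "A \<in> U21" "cmod l = 1"
  shows "proj (smat l A) = proj A"
proof
  fix p obtain X where X: "X \<noteq> 0" "p = line X" by (rule cp2_cases)
  have l: "l \<noteq> 0" using assms(2) by auto
  have "smat l A *v X \<noteq> 0" "A *v X \<noteq> 0"
    using invertible_nonzero X U21_invertible smat_U21 assms by blast+
  then have "line (smat l A *v X) = line (A *v X)"
    unfolding line_eq_iff[OF \<open>A *v X \<noteq> 0\<close> \<open>smat l A *v X \<noteq> 0\<close>] smat_mvm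
    using l by (metis \<open>A *v X \<noteq> 0\<close> \<open>smat l A *v X \<noteq> 0\<close> line_eq_iff smat_mvm)
  then show "proj (smat l A) p = proj A p"
    using X assms by (simp add: proj_line U21_invertible smat_U21)
qed

text \<open>Every nonzero vector is an eigenvector of B^-1 A. The coordinate vectors make this
  matrix diagonal and (1,1,1) makes its eigenvalues equal; the vector (0,1,0) of norm 1 shows that
  the scalar has modulus 1.\<close>

lemma proj_eqD:
  assumes A: "A \<in> U21" and B: "B \<in> U21" and eq: "proj A = proj B"
  shows "\<exists>l. cmod l = 1 \<and> A = smat l B"
proof -
  have iA: "invertible A" and iB: "invertible B" using A B U21_invertible by auto
  have ex: "\<exists>c. A *v X = c *s (B *v X)" if "X \<noteq> 0" for X
  proof -
    have "line (B *v X) = line (A *v X)"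
      using fun_cong[OF eq, of "line X"] that by (simp add: proj_line iA iB)
    then show ?thesis using line_eq_iff invertible_nonzero iA iB that by metis
  qed
  define C where "C = adjH B ** A"
  have BC: "B ** C = A" unfolding C_def matrix_mul_assoc adjH_mult2[OF B] by simp
  have ex': "\<exists>c. C *v X = c *s X" if X: "X \<noteq> 0" for X
  proof -
    obtain c where "A *v X = c *s (B *v X)" using ex[OF X] by blast
    then have "adjH B *v (A *v X) = c *s (adjH B *v (B *v X))" by (simp add: vector_scalar_commute)
    then show ?thesis unfolding C_def by (auto simp: matrix_vector_mul_assoc adjH_mult[OF B])
  qed
  have nz: "(vector [1,0,0] :: complex^3) \<noteq> 0" "(vector [0,1,0] :: complex^3) \<noteq> 0" "(vector [0,0,1] :: complex^3) \<noteq> 0"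
    "(vector [1,1,1] :: complex^3) \<noteq> 0"
    by (auto simp: vec3_eq_iff)
  obtain c1 c2 c3 c where "C *v vector [1,0,0] = c1 *s vector [1,0,0]" "C *v vector [0,1,0] = c2 *s vector [0,1,0]"
     "C *v vector [0,0,1] = c3 *s vector [0,0,1]" "C *v vector [1,1,1] = c *s vector [1,1,1]"
    using ex'[OF nz(1)] ex'[OF nz(2)] ex'[OF nz(3)] ex'[OF nz(4)] by blast
  then have "C = smat c (mat 1)"
    by (simp add: mat3_eq_iff vec3_eq_iff mvm3 mat_1_3)
  then have AB: "A = smat c B" using BC by (simp add: smat_mmm)
  have "herm (A *v X) (A *v X) = (c * cnj c) * herm (B *v X) (B *v X)" for X
    unfolding AB smat_mvm by (simp add: herm_eq algebra_simps)
  then have "herm X X = (c * cnj c) * herm X X" for X using A B by (simp add: U21_herm)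
  from this[of "vector [0,1,0]"] have "c * cnj c = 1" by (simp add: herm_eq)
  then have "(cmod c)\<^sup>2 = 1" unfolding complex_norm_square[symmetric] by (metis of_real_eq_1_iff)
  then have "cmod c = 1" by (simp add: power2_eq_1_iff) (smt (verit) norm_ge_zero)
  with AB show ?thesis by blast
qed

section \<open>The Heisenberg group at infinity\<close>

text \<open>The first coordinate of the null vector (hgt z t, z, 1): nullity fixes its real part as
  -|z|^2 / 2, while the imaginary part t / 2 is free.\<close>

definition hgt :: "complex \<Rightarrow> real \<Rightarrow> complex" where
  "hgt z t = (- (z * cnj z) + \<i> * of_real t) / 2"

definition heis :: "complex \<Rightarrow> real \<Rightarrow> complex \<Rightarrow> complex^3^3" where
  "heis z t u = vector [vector [1, - (cnj z * u), hgt z t], vector [0, u, z], vector [0, 0, 1]]"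

text \<open>The projective counterpart of \<open>nil_iso z t u e\<close>, with the same composition
  law.\<close>

definition hyp :: "complex \<Rightarrow> real \<Rightarrow> complex \<Rightarrow> bool \<Rightarrow> cp2 \<Rightarrow> cp2" where
  "hyp z t u e = proj (heis z t u) \<circ> (if e then conj_cp2 else id)"

text \<open>Subtracting 1/2 moves the null vector inside, to norm -1, and keeps its product with
  \<open>infinity\<close> equal to 1. So Nil parametrises one horosphere based at
  \<open>infinity\<close>.\<close>

definition horo :: "nil \<Rightarrow> complex^3" where
  "horo p = vector [hgt (fst p) (snd p) - 1 / 2, fst p, 1]"

definition infinity :: "complex^3" where
  "infinity = vector [1, 0, 0]"

lemma heis_nth [simp]:
  "heis z t u $ 1 $ 1 = 1" "heis z t u $ 1 $ 2 = - (cnj z * u)" "heis z t u $ 1 $ 3 = hgt z t"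
  "heis z t u $ 2 $ 1 = 0" "heis z t u $ 2 $ 2 = u" "heis z t u $ 2 $ 3 = z"
  "heis z t u $ 3 $ 1 = 0" "heis z t u $ 3 $ 2 = 0" "heis z t u $ 3 $ 3 = 1"
  by (simp_all add: heis_def)

lemma horo_nth [simp]: "horo p $ 1 = hgt (fst p) (snd p) - 1/2" "horo p $ 2 = fst p" "horo p $ 3 = 1"
  by (simp_all add: horo_def)

lemma infinity_nth [simp]: "infinity $ 1 = 1" "infinity $ 2 = 0" "infinity $ 3 = 0"
  by (simp_all add: infinity_def)

lemma horo_nonzero [simp]: "horo p \<noteq> 0" and infinity_nonzero [simp]: "infinity \<noteq> 0"
  by (auto simp: vec3_eq_iff)

lemma cnj_hgt: "cnj (hgt z t) = - (z * cnj z) - hgt z t"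
  by (simp add: hgt_def field_simps)

lemma heis_U21: assumes "cmod u = 1" shows "heis z t u \<in> U21"
proof (rule U21I)
  have u: "cnj u * u = 1" "u * cnj u = 1" using assms unit_cnj by auto
  have *: "cnj u * (u * x) = x" "u * (cnj u * x) = x" for x
    by (simp_all add: mult.assoc[symmetric] u)
  show "adjH (heis z t u) ** heis z t u = mat 1"
    by (simp add: mat3_eq_iff mmm3 mat_1_3 cnj_hgt u * algebra_simps)
qed

lemma heis_mult:
  assumes "cmod u = 1"
  shows "heis z t u ** heis z' t' u' = heis (z + u * z') (t + t' + 2 * Im (z * cnj (u * z'))) (u * u')"
proof -
  have u: "cnj u * u = 1" "u * cnj u = 1" using assms unit_cnj by auto
  have *: "cnj u * (u * x) = x" "u * (cnj u * x) = x" for x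
    by (simp_all add: mult.assoc[symmetric] u)
  \<comment> \<open>The vertical cross term becomes a difference x - cnj x, which combines with the
    cross terms of |z + u z'|^2.\<close>
  have i: "\<i> * of_real (2 * Im x) = x - cnj x" for x
    by (simp add: complex_eq_iff)
  have "hgt (z + u * z') (t + t' + 2 * Im (z * cnj (u * z'))) =
     (- ((z + u * z') * cnj (z + u * z')) + (\<i> * of_real t + \<i> * of_real t' + \<i> * of_real (2 * Im (z * cnj (u * z'))))) / 2"
    unfolding hgt_def by (simp add: algebra_simps)
  also have "\<dots> = hgt z' t' - cnj z * u * z' + hgt z t"
    unfolding i hgt_def by (simp add: field_simps * u)
  finally show ?thesis by (simp add: mat3_eq_iff mmm3 u * algebra_simps)
qed

lemma heis_1: "heis 0 0 1 = mat 1"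
  by (simp add: mat3_eq_iff mat_1_3 hgt_def)

lemma hyp_id: "hyp 0 0 1 False = id"
  by (simp add: hyp_def heis_1 proj_one)

lemma conj_heis:
  assumes "cmod u = 1"
  shows "conj_cp2 \<circ> proj (heis z t u) = proj (heis (cnj z) (- t) (cnj u)) \<circ> conj_cp2"
proof
  fix p obtain X where X: "X \<noteq> 0" "p = line X" by (rule cp2_cases)
  have h: "invertible (heis z t u)" "invertible (heis (cnj z) (- t) (cnj u))"
    using assms heis_U21 U21_invertible by auto
  have k0: "(\<chi> i. cnj (Y $ i)) \<noteq> 0" if "Y \<noteq> 0" for Y :: "complex^3"
    using that by (simp add: vec_eq_iff)
  have "(\<chi> i. cnj ((heis z t u *v X) $ i)) = heis (cnj z) (- t) (cnj u) *v (\<chi> i. cnj (X $ i))"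
    by (simp add: vec3_eq_iff mvm3 hgt_def)
  then show "(conj_cp2 \<circ> proj (heis z t u)) p = (proj (heis (cnj z) (- t) (cnj u)) \<circ> conj_cp2) p"
    using X h by (simp add: proj_line conj_line invertible_nonzero k0)
qed

lemma hyp_comp:
  assumes u: "cmod u = 1" "cmod u' = 1"
  shows "hyp z t u e \<circ> hyp z' t' u' e' =
    hyp (z + u * cj e z') (t + sg e * t' + 2 * Im (z * cnj (u * cj e z'))) (u * cj e u') (e \<noteq> e')"
proof -
  let ?c = "\<lambda>e. if e then conj_cp2 else id"
  have cc: "?c e \<circ> ?c e' = ?c (e \<noteq> e')"
    using conj_conj by auto
  have "?c e \<circ> proj (heis z' t' u') = proj (heis (cj e z') (sg e * t') (cj e u')) \<circ> ?c e"
    using conj_heis u by (cases e) auto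
  then have "hyp z t u e \<circ> hyp z' t' u' e' = proj (heis z t u) \<circ> proj (heis (cj e z') (sg e * t') (cj e u')) \<circ> (?c e \<circ> ?c e')"
    unfolding hyp_def by (metis comp_assoc)
  then show ?thesis
    unfolding cc using u by (simp add: proj_mult heis_U21 heis_mult hyp_def)
qed

lemma heis_horo: 
  assumes "cmod u = 1"
  shows "heis z t u *v horo p = horo (nil_iso z t u False p)"
proof -
  have u: "cnj u * u = 1" "u * cnj u = 1" using assms unit_cnj by auto
  have *: "cnj u * (u * x) = x" "u * (cnj u * x) = x" for x
    by (simp_all add: mult.assoc[symmetric] u)
  have i: "\<i> * of_real (2 * Im x) = x - cnj x" for x
    by (simp add: complex_eq_iff)
  obtain w s where p: "p = (w, s)" by force
  have "hgt (z + u * w) (t + s + 2 * Im (z * cnj (u * w))) =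
     (- ((z + u * w) * cnj (z + u * w)) + (\<i> * of_real t + \<i> * of_real s + \<i> * of_real (2 * Im (z * cnj (u * w))))) / 2"
    unfolding hgt_def by (simp add: algebra_simps)
  also have "\<dots> = hgt w s - cnj z * u * w + hgt z t"
    unfolding i hgt_def by (simp add: field_simps * u)
  finally show ?thesis by (simp add: vec3_eq_iff mvm3 nil_iso_def p algebra_simps)
qed

text \<open>The parametrisation \<open>horo\<close> intertwines the two actions; this is how
  statements pass between lattices in Nil and cusp stabilisers.\<close>

lemma hyp_horo:
  assumes u: "cmod u = 1"
  shows "hyp z t u e (line (horo p)) = line (horo (nil_iso z t u e p))"
proof -
  have "(if e then conj_cp2 else id) (line (horo p)) = line (horo (cj e (fst p), sg e * snd p))"
    by (auto simp: conj_line vec3_eq_iff hgt_def intro!: arg_cong[where f=line])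
  moreover have "nil_iso z t u e p = nil_iso z t u False (cj e (fst p), sg e * snd p)"
    by (simp add: nil_iso_def)
  ultimately show ?thesis
    using u by (simp add: hyp_def proj_line heis_U21 U21_invertible heis_horo del: cj_simps)
qed

lemma hyp_infinity:
  assumes u: "cmod u = 1"
  shows "hyp z t u e (line infinity) = line infinity"
proof -
  have "(if e then conj_cp2 else id) (line infinity) = line infinity"
    by (auto simp: conj_line vec3_eq_iff intro!: arg_cong[where f=line])
  moreover have "heis z t u *v infinity = infinity" by (simp add: vec3_eq_iff mvm3)
  ultimately show ?thesis
    using u by (simp add: hyp_def proj_line heis_U21 U21_invertible)
qed

lemma hgt_inject: "hgt z t = hgt z t' \<longleftrightarrow> t = t'"
  by (simp add: hgt_def)

lemma horo_inj: "line (horo p) = line (horo q) \<longleftrightarrow> p = q"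
  by (auto simp: line_eq_iff vec3_eq_iff hgt_inject prod_eq_iff)

lemma herm_horo: "herm (horo p) (horo p) = - 1"
  by (simp add: herm_eq cnj_hgt algebra_simps)

text \<open>Scaling the third coordinate to 1 makes the norm -1, and this equation determines the
  real part of the first coordinate.\<close>

lemma horo_cover:
  assumes "Re (herm X X) < 0" "(cmod (X $ 3))\<^sup>2 = - Re (herm X X)"
  obtains p where "line X = line (horo p)"
proof -
  have h: "herm X X = of_real (Re (herm X X))"
    by (simp add: herm_eq complex_eq_iff)
  have X3: "X$3 \<noteq> 0" using assms by auto
  define Y where "Y = inverse (X$3) *s X"
  have Y3: "Y$3 = 1" using X3 by (simp add: Y_def)
  have "herm Y Y = (inverse (X$3) * cnj (inverse (X$3))) * herm X X"
    unfolding Y_def by (simp add: herm_eq algebra_simps)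
  also have "inverse (X$3) * cnj (inverse (X$3)) = of_real (inverse ((cmod (X$3))\<^sup>2))"
    by (simp add: complex_norm_square del: of_real_power)
  also have "\<dots> * herm X X = - 1"
    using assms X3 by (subst h) (simp add: field_simps flip: of_real_mult)
  finally have Y: "cnj (Y$1) + Y$2 * cnj (Y$2) + Y$1 = - 1" by (simp add: herm_eq Y3)
  have "Y = horo (Y$2, 2 * Im (Y$1))"
  proof -
    have "\<i> * of_real (2 * Im (Y$1)) = Y$1 - cnj (Y$1)" by (simp add: complex_eq_iff)
    then have "hgt (Y$2) (2 * Im (Y$1)) = (- (Y$2 * cnj (Y$2)) + (Y$1 - cnj (Y$1))) / 2"
      unfolding hgt_def by simp
    also have "Y$2 * cnj (Y$2) = - 1 - Y$1 - cnj (Y$1)" using Y by (simp add: algebra_simps)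
    also have "(- (- 1 - Y$1 - cnj (Y$1)) + (Y$1 - cnj (Y$1))) / 2 = Y$1 + 1/2" by (simp add: field_simps)
    finally show ?thesis by (simp add: vec3_eq_iff Y3)
  qed
  moreover have "line X = line Y"
  proof -
    have "X \<noteq> 0" "Y \<noteq> 0" using X3 Y3 by auto
    then show ?thesis using X3 by (auto simp: line_eq_iff Y_def)
  qed
  ultimately show ?thesis using that by metis
qed

section \<open>Group presentations\<close>

lemma word_eq_context: "word_eq R u u' \<Longrightarrow> word_eq R (x @ u @ y) (x @ u' @ y)"
proof (induction rule: word_eq.induct)
  case (cancel u a s v)
  show ?case using word_eq.cancel[of R "x @ u" a s "v @ y"] by simp
next
  case (relation l r u v)
  then show ?case using word_eq.relation[of l r R "x @ u" "v @ y"] by simp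
qed (auto intro: word_eq.refl word_eq.sym word_eq.trans)

lemma word_eq_append: "word_eq R u u' \<Longrightarrow> word_eq R v v' \<Longrightarrow> word_eq R (u @ v) (u' @ v')"
  using word_eq_context[of R u u' "[]" v] word_eq_context[of R v v' u' "[]"]
  by (auto intro: word_eq.trans)

definition word_class :: "('x word \<times> 'x word) set \<Rightarrow> 'x word \<Rightarrow> 'x word set" where
  "word_class R w = {v. word_eq R w v}"

lemma word_class_eq_iff: "word_class R v = word_class R w \<longleftrightarrow> word_eq R v w"
  unfolding word_class_def by (blast intro: word_eq.refl word_eq.sym word_eq.trans)

lemma presented_group_carrier: "carrier (presented_group R) = range (word_class R)"
  by (auto simp: presented_group_def quotient_def word_class_def)

lemma presented_group_mult [simp]:
  "word_class R u \<otimes>\<^bsub>presented_group R\<^esub> word_class R v = word_class R (u @ v)"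
proof -
  have "(\<exists>u'\<in>word_class R u. \<exists>v'\<in>word_class R v. word_eq R (u' @ v') w) \<longleftrightarrow> word_eq R (u @ v) w" for w
    unfolding word_class_def mem_Collect_eq Bex_def
    by (meson word_eq.refl word_eq.sym word_eq.trans word_eq_append)
  then show ?thesis by (simp add: presented_group_def word_class_def)
qed

lemma presented_group_one: "\<one>\<^bsub>presented_group R\<^esub> = word_class R []"
  by (simp add: presented_group_def word_class_def)

lemma word_inv_left: "word_eq R (word_inv w @ w) []"
proof (induction w)
  case Nil
  then show ?case by (simp add: word_inv_def word_eq.refl)
next
  case (Cons l w)
  obtain x s where l: "l = (x, s)" by force
  have "word_eq R (word_inv w @ [(x, \<not> s), (x, \<not> \<not> s)] @ w) (word_inv w @ w)"
    by (rule word_eq.cancel)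
  then show ?case using Cons by (auto simp: word_inv_def l intro: word_eq.trans)
qed

lemma group_presented_group: "group (presented_group R)"
proof (rule groupI)
  fix x assume "x \<in> carrier (presented_group R)"
  then obtain w where w: "x = word_class R w" by (auto simp: presented_group_carrier)
  have "word_class R (word_inv w) \<otimes>\<^bsub>presented_group R\<^esub> x = \<one>\<^bsub>presented_group R\<^esub>"
    by (simp add: w presented_group_one word_class_eq_iff word_inv_left)
  then show "\<exists>y\<in>carrier (presented_group R). y \<otimes>\<^bsub>presented_group R\<^esub> x = \<one>\<^bsub>presented_group R\<^esub>"
    by (auto simp: presented_group_carrier)
qed (auto simp: presented_group_carrier presented_group_one)

definition letter_value :: "('a, 'b) monoid_scheme \<Rightarrow> ('x \<Rightarrow> 'a) \<Rightarrow> 'x \<times> bool \<Rightarrow> 'a" where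
  "letter_value G f l = (if snd l then f (fst l) else inv\<^bsub>G\<^esub> (f (fst l)))"

definition word_value :: "('a, 'b) monoid_scheme \<Rightarrow> ('x \<Rightarrow> 'a) \<Rightarrow> 'x word \<Rightarrow> 'a" where
  "word_value G f w = foldr (\<lambda>l y. letter_value G f l \<otimes>\<^bsub>G\<^esub> y) w \<one>\<^bsub>G\<^esub>"

context group
begin

lemma letter_value_closed [simp]: "range f \<subseteq> carrier G \<Longrightarrow> letter_value G f l \<in> carrier G"
  unfolding letter_value_def by (simp add: image_subset_iff)

lemma word_value_Nil [simp]: "word_value G f [] = \<one>"
  and word_value_Cons [simp]: "word_value G f (l # w) = letter_value G f l \<otimes> word_value G f w"
  by (simp_all add: word_value_def)

lemma word_value_closed [simp]: "range f \<subseteq> carrier G \<Longrightarrow> word_value G f w \<in> carrier G"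
  by (induction w) simp_all

lemma word_value_append [simp]:
  "range f \<subseteq> carrier G \<Longrightarrow> word_value G f (u @ v) = word_value G f u \<otimes> word_value G f v"
  by (induction u) (simp_all add: m_assoc)

lemma word_value_inv [simp]:
  assumes "range f \<subseteq> carrier G" shows "word_value G f (word_inv w) = inv (word_value G f w)"
proof (induction w)
  case (Cons l w)
  have f: "f x \<in> carrier G" for x using assms by auto
  have "word_inv (l # w) = word_inv w @ [(fst l, \<not> snd l)]"
    by (simp add: word_inv_def apsnd_def map_prod_def split: prod.splits)
  moreover have "letter_value G f (fst l, \<not> snd l) = inv (letter_value G f l)"
    using f by (simp add: letter_value_def)
  ultimately show ?case using assms Cons by (simp add: inv_mult_group)
qed (simp add: word_inv_def)

lemma word_value_pow [simp]:
  assumes "range f \<subseteq> carrier G" shows "word_value G f (word_pow w n) = word_value G f w [^] n"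
proof (induction n)
  case (Suc n)
  have "word_pow w (Suc n) = w @ word_pow w n" by (simp add: word_pow_def)
  then show ?case using assms Suc nat_pow_Suc2 by simp
qed (simp add: word_pow_def)

lemma word_value_cong:
  assumes f: "range f \<subseteq> carrier G" and R: "\<And>l r. (l, r) \<in> R \<Longrightarrow> word_value G f l = word_value G f r"
    and "word_eq R v w"
  shows "word_value G f v = word_value G f w"
  using assms(3)
proof (induction rule: word_eq.induct)
  case (cancel u x s v)
  have fx: "f x \<in> carrier G" for x using f by auto
  have "letter_value G f (x, s) \<otimes> (letter_value G f (x, \<not> s) \<otimes> word_value G f v) = word_value G f v"
    using f fx by (simp add: letter_value_def m_assoc[symmetric])
  then show ?case using f by simp
qed (use f R in auto)

text \<open>The generators are pulled back along the isomorphism. The third clause, that a word with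
  trivial value is a consequence of the relations, later transfers nontriviality from a model of the
  relations to \<open>G\<close>.\<close>

lemma presented_generators:
  assumes "G \<cong> presented_group R"
  obtains f where "range f \<subseteq> carrier G"
    "\<And>l r. (l, r) \<in> R \<Longrightarrow> word_value G f l = word_value G f r"
    "\<And>w. word_value G f w = \<one> \<Longrightarrow> word_eq R w []"
    "carrier G = generate G (range f)"
proof -
  obtain h where h: "h \<in> iso G (presented_group R)" using assms unfolding is_iso_def by blast
  interpret P: group "presented_group R" by (rule group_presented_group)
  interpret h: group_hom G "presented_group R" h
    using h by unfold_locales (simp add: iso_def)
  have bij: "bij_betw h (carrier G) (carrier (presented_group R))" using h by (simp add: iso_def)
  define f where "f x = inv_into (carrier G) h (word_class R [(x, True)])" for x
  have fc: "f x \<in> carrier G" and hf: "h (f x) = word_class R [(x, True)]" for x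
  proof -
    have "word_class R [(x, True)] \<in> h ` carrier G"
      using bij by (auto simp: bij_betw_def presented_group_carrier)
    then show "f x \<in> carrier G" "h (f x) = word_class R [(x, True)]"
      unfolding f_def by (rule inv_into_into, rule f_inv_into_f)
  qed
  then have f: "range f \<subseteq> carrier G" by auto
  have hl: "h (letter_value G f l) = word_class R [l]" for l
  proof (cases "snd l")
    case True
    then show ?thesis by (cases l) (simp add: letter_value_def hf)
  next
    case False
    have "inv\<^bsub>presented_group R\<^esub> (word_class R [(fst l, True)]) = word_class R [(fst l, False)]"
    proof (rule P.inv_equality)
      show "word_class R [(fst l, False)] \<otimes>\<^bsub>presented_group R\<^esub> word_class R [(fst l, True)] = \<one>\<^bsub>presented_group R\<^esub>"
        using word_inv_left[of R "[(fst l, True)]"]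
        by (simp add: presented_group_one word_class_eq_iff word_inv_def)
    qed (auto simp: presented_group_carrier)
    then show ?thesis using False fc
      by (cases l) (simp add: letter_value_def hf)
  qed
  have hw: "h (word_value G f w) = word_class R w" for w
  proof (induction w)
    case Nil
    then show ?case by (simp add: presented_group_one)
  next
    case (Cons l w)
    then show ?case using f by (simp add: hl)
  qed
  have inj: "inj_on h (carrier G)" using bij by (simp add: bij_betw_def)
  show ?thesis
  proof (rule that[OF f])
    fix l r assume "(l, r) \<in> R"
    then have "word_eq R l r" using word_eq.relation[of l r R "[]" "[]"] by simp
    then have "h (word_value G f l) = h (word_value G f r)" by (simp add: hw word_class_eq_iff)
    then show "word_value G f l = word_value G f r" using inj f by (simp add: inj_on_def)
  next
    fix w assume "word_value G f w = \<one>"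
    then have "word_class R w = word_class R []" using hw[of w] by (simp add: presented_group_one)
    then show "word_eq R w []" by (simp add: word_class_eq_iff)
  next
    have gen: "letter_value G f l \<in> generate G (range f)" for l
      by (simp add: letter_value_def generate.incl generate.inv)
    have "word_value G f w \<in> generate G (range f)" for w
      by (induction w) (simp_all add: generate.one generate.eng gen)
    moreover have "\<exists>w. x = word_value G f w" if x: "x \<in> carrier G" for x
    proof -
      obtain w where "h x = word_class R w"
        using h.hom_closed[OF x] by (auto simp: presented_group_carrier)
      then have "h x = h (word_value G f w)" by (simp add: hw)
      then have "x = word_value G f w" by (rule inj_onD[OF inj _ x word_value_closed[OF f]])
      then show ?thesis ..
    qed
    ultimately show "carrier G = generate G (range f)"
      using generate_incl[OF f] by blast
  qed
qed

lemma comm_eq_iff: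
  assumes "x \<in> carrier G" "y \<in> carrier G" "z \<in> carrier G"
  shows "x \<otimes> (y \<otimes> (inv x \<otimes> inv y)) = z \<longleftrightarrow> x \<otimes> y = z \<otimes> (y \<otimes> x)"
proof -
  have "x \<otimes> (y \<otimes> (inv x \<otimes> inv y)) = (x \<otimes> y) \<otimes> inv (y \<otimes> x)"
    using assms by (simp add: inv_mult_group m_assoc)
  then show ?thesis using assms by (metis inv_solve_right m_closed)
qed

lemma inv_mult_eq_iff:
  assumes "x \<in> carrier G" "y \<in> carrier G" "z \<in> carrier G"
  shows "y = inv x \<otimes> z \<longleftrightarrow> x \<otimes> y = z"
  using assms by (metis inv_solve_left)

text \<open>The common relations with the commutators cleared of inverses, so that in coordinates
  they become equations between products only.\<close>

definition heis_rel :: "nat \<Rightarrow> 'a \<Rightarrow> 'a \<Rightarrow> 'a \<Rightarrow> 'a \<Rightarrow> bool" where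
  "heis_rel k a b c s \<longleftrightarrow> b \<otimes> a = c [^] k \<otimes> (a \<otimes> b) \<and> c \<otimes> a = a \<otimes> c \<and> c \<otimes> b = b \<otimes> c \<and> c \<otimes> s = s \<otimes> c"

lemma common_relations_iff:
  assumes f: "range f \<subseteq> carrier G"
  shows "(\<forall>(l, r) \<in> common_relations k. word_value G f l = word_value G f r) \<longleftrightarrow>
     heis_rel k (f Gen_a) (f Gen_b) (f Gen_c) (f Gen_alpha)"
proof -
  have fc: "f x \<in> carrier G" for x using f by auto
  have l: "letter_value G f (x, True) = f x" for x by (simp add: letter_value_def)
  show ?thesis
    unfolding common_relations_def heis_rel_def word_comm_def
    by (simp add: f fc l comm_eq_iff)
qed

lemma quarter_relations_iff:
  assumes f: "range f \<subseteq> carrier G"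
  shows "(\<forall>(l, r) \<in> common_relations k \<union>
       {(w\<alpha> @ wa, wb @ w\<alpha>), (w\<alpha> @ wb, word_inv wa @ w\<alpha>), (word_pow w\<alpha> 4, word_pow wc p)}.
         word_value G f l = word_value G f r) \<longleftrightarrow>
     heis_rel k (f Gen_a) (f Gen_b) (f Gen_c) (f Gen_alpha) \<and>
     f Gen_alpha \<otimes> f Gen_a = f Gen_b \<otimes> f Gen_alpha \<and>
     f Gen_a \<otimes> (f Gen_alpha \<otimes> f Gen_b) = f Gen_alpha \<and>
     f Gen_alpha [^] (4::nat) = f Gen_c [^] p"
proof -
  have fc: "f x \<in> carrier G" for x using f by auto
  have l: "letter_value G f (x, True) = f x" for x by (simp add: letter_value_def)
  show ?thesis
    unfolding ball_Un common_relations_iff[OF f]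
    by (simp add: f fc l inv_mult_eq_iff del: append.simps)
qed

lemma third_relations_iff:
  assumes f: "range f \<subseteq> carrier G"
  shows "(\<forall>(l, r) \<in> common_relations k \<union>
       {(w\<alpha> @ wa, wb @ w\<alpha> @ word_pow wc k1), (w\<alpha> @ wb, word_inv wa @ word_inv wb @ w\<alpha>),
        (word_pow w\<alpha> 3, word_pow wc k2)}.
         word_value G f l = word_value G f r) \<longleftrightarrow>
     heis_rel k (f Gen_a) (f Gen_b) (f Gen_c) (f Gen_alpha) \<and>
     f Gen_alpha \<otimes> f Gen_a = f Gen_b \<otimes> (f Gen_alpha \<otimes> f Gen_c [^] k1) \<and>
     f Gen_b \<otimes> (f Gen_a \<otimes> (f Gen_alpha \<otimes> f Gen_b)) = f Gen_alpha \<and>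
     f Gen_alpha [^] (3::nat) = f Gen_c [^] k2"
proof -
  have fc: "f x \<in> carrier G" for x using f by auto
  have l: "letter_value G f (x, True) = f x" for x by (simp add: letter_value_def)
  show ?thesis
    unfolding ball_Un common_relations_iff[OF f]
    by (simp add: f fc l inv_mult_eq_iff del: append.simps)
qed

lemma sixth_relations_iff:
  assumes f: "range f \<subseteq> carrier G"
  shows "(\<forall>(l, r) \<in> common_relations k \<union>
       {(w\<alpha> @ wa, wa @ wb @ w\<alpha>), (w\<alpha> @ wb, word_inv wa @ w\<alpha>), (word_pow w\<alpha> 6, word_pow wc k1)}.
         word_value G f l = word_value G f r) \<longleftrightarrow>
     heis_rel k (f Gen_a) (f Gen_b) (f Gen_c) (f Gen_alpha) \<and>
     f Gen_alpha \<otimes> f Gen_a = f Gen_a \<otimes> (f Gen_b \<otimes> f Gen_alpha) \<and>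
     f Gen_a \<otimes> (f Gen_alpha \<otimes> f Gen_b) = f Gen_alpha \<and>
     f Gen_alpha [^] (6::nat) = f Gen_c [^] k1"
proof -
  have fc: "f x \<in> carrier G" for x using f by auto
  have l: "letter_value G f (x, True) = f x" for x by (simp add: letter_value_def)
  show ?thesis
    unfolding ball_Un common_relations_iff[OF f]
    by (simp add: f fc l inv_mult_eq_iff del: append.simps)
qed

end

section \<open>Normal form of the twist relations\<close>

text \<open>Commuting with the translation forces the planar linear part to fix y, hence to preserve
  the real inner product with y.\<close>

lemma commute_translation_functional:
  assumes g: "nil_iso z t u e \<circ> nil_iso y r 1 False = nil_iso y r 1 False \<circ> nil_iso z t u e"
    and u: "cmod u = 1"
  shows "Re (fst (nil_iso z t u e p) * cnj y) = Re (fst p * cnj y) + Re (z * cnj y)"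
proof -
  have u0: "u \<noteq> 0" using u by auto
  have "z + u * cj e y = y + z"
    using g u u0 by (simp add: nil_iso_comp nil_iso_inject)
  then have y: "u * cj e y = y" by simp
  have "(u * cj e (fst p)) * cnj y = (u * cj e (fst p)) * cnj (u * cj e y)" by (simp only: y)
  also have "\<dots> = (u * cnj u) * (cj e (fst p) * cnj (cj e y))" by (simp only: complex_cnj_mult ac_simps)
  also have "\<dots> = cj e (fst p) * cnj (cj e y)" by (simp only: unit_cnj(1)[OF u] mult_1_left)
  also have "Re \<dots> = Re (fst p * cnj y)" by (cases e) auto
  finally have "Re ((u * cj e (fst p)) * cnj y) = Re (fst p * cnj y)" .
  then show ?thesis by (simp add: nil_iso_def distrib_right)
qed

text \<open>If a power of \<open>c\<close> is a translation by \<open>y \<noteq> 0\<close>, everything that commutes with it moves the coordinate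
  in direction \<open>y\<close> by a constant, which contradicts \<open>[b,a] = c^k\<close>.\<close>

lemma central_power_not_horizontal:
  assumes "a \<in> carrier Isom_Nil" "b \<in> carrier Isom_Nil" "c \<in> carrier Isom_Nil" "k > 0" "y \<noteq> 0"
    and ba: "b \<circ> a = c ^^ k \<circ> (a \<circ> b)" and ca: "c \<circ> a = a \<circ> c" and cb: "c \<circ> b = b \<circ> c"
    and cm: "c ^^ m = nil_iso y r 1 False"
  shows False
proof -
  have comm: "g \<circ> nil_iso y r 1 False = nil_iso y r 1 False \<circ> g" if "c \<circ> g = g \<circ> c" for g
  proof -
    have "g \<circ> c ^^ m = c ^^ m \<circ> g"
    proof (induction m)
      case (Suc m)
      then show ?case using that by (metis comp_assoc funpow.simps(2))
    qed auto
    then show ?thesis unfolding cm .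
  qed
  define l where "l p = Re (fst p * cnj y)" for p :: nil
  have fn: "\<exists>r. \<forall>p. l (g p) = l p + r" if g: "g \<in> carrier Isom_Nil" "c \<circ> g = g \<circ> c" for g
  proof -
    obtain z t u e where g': "g = nil_iso z t u e" "cmod u = 1" using g(1) by (rule nil_isoE)
    show ?thesis using commute_translation_functional[OF comm[OF g(2), unfolded g'(1)] g'(2)]
      unfolding l_def g'(1) by blast
  qed
  obtain ra rb rc where r: "l (a p) = l p + ra" "l (b p) = l p + rb" "l (c p) = l p + rc" for p
    using fn[of a] fn[of b] fn[of c] assms by auto
  have cn: "l ((c ^^ n) p) = l p + n * rc" for n p
    by (induction n) (auto simp: r algebra_simps)
  have "l (b (a (0,0))) = l ((c ^^ k) (a (b (0,0))))" using ba by (metis comp_apply)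
  then have "rc = 0" using \<open>k > 0\<close> by (simp add: r cn)
  then have "l ((c ^^ m) (0,0)) = l (0,0)" by (simp add: cn)
  then have "Re (y * cnj y) = 0" unfolding cm by (simp add: l_def nil_iso_def)
  then show False using \<open>y \<noteq> 0\<close> by (simp add: complex_eq_iff sum_squares_eq_zero_iff)
qed

text \<open>If \<open>c\<close> conjugates, then \<open>c ^^ 2\<close> is a translation, vertical by
  the previous lemma, and its height vanishes. If \<open>c\<close> rotates, then \<open>a\<close>
  and \<open>b\<close> rotate about the same axis and commute, so \<open>c ^^ k\<close> is trivial.
  Both contradict infinite order, and the previous lemma excludes translations that are not
  vertical.\<close>

lemma infinite_order_central_vertical:
  assumes abc: "a \<in> carrier Isom_Nil" "b \<in> carrier Isom_Nil" "c \<in> carrier Isom_Nil" and "k > 0"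
    and ba: "b \<circ> a = c ^^ k \<circ> (a \<circ> b)" and ca: "c \<circ> a = a \<circ> c" and cb: "c \<circ> b = b \<circ> c"
    and inf: "\<And>j. j > 0 \<Longrightarrow> c ^^ j \<noteq> id"
  obtains h where "c = nil_iso 0 h 1 False" "h \<noteq> 0"
proof -
  note nh = central_power_not_horizontal[OF abc \<open>k > 0\<close> _ ba ca cb]
  obtain z t u e where c: "c = nil_iso z t u e" and u: "cmod u = 1" using abc(3) by (rule nil_isoE)
  have u0: "u \<noteq> 0" using u by auto
  have c2: "c ^^ 2 = c \<circ> c" by (simp add: numeral_2_eq_2)
  have "\<not> e"
  proof
    assume e: "e"
    define y where "y = z + u * cnj z"
    define r where "r = 2 * Im (z * cnj (u * cnj z))"
    have c2': "c ^^ 2 = nil_iso y r 1 False"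
      unfolding c2 unfolding c nil_iso_comp[OF u] y_def r_def using e by (simp add: unit_cnj[OF u])
    have y: "y = 0" using nh[of y 2 r] c2' by auto
    then have "u * cnj z = - z" unfolding y_def by (simp add: eq_neg_iff_add_eq_0 add.commute)
    then have "r = 0" unfolding r_def by (simp add: complex_mult_cnj)
    then show False using inf[of 2] c2' y nil_iso_id by simp
  qed
  then have c: "c = nil_iso z t u False" using c by simp
  have u1: "u = 1"
  proof (rule ccontr)
    assume u1: "u \<noteq> 1"
    \<comment> \<open>The planar fixed point of \<open>c\<close>; whatever commutes with
      \<open>c\<close> fixes it in the plane.\<close>
    define z0 where "z0 = z / (1 - u)"
    have z: "z = (1 - u) * z0" unfolding z0_def using u1 by simp
    have fixed: "zg = z0 - ug * cj eg z0"
      if g: "g = nil_iso zg tg ug eg" "cmod ug = 1" "c \<circ> g = g \<circ> c" for g zg tg ug eg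
    proof (cases eg)
      case False
      have ug0: "ug \<noteq> 0" using g by auto
      have "z + u * zg = zg + ug * z" using g False u u0 ug0 unfolding c by (simp add: nil_iso_comp nil_iso_inject)
      then have "(1 - u) * zg = (1 - u) * ((1 - ug) * z0)" unfolding z by (simp add: algebra_simps)
      then have "zg = (1 - ug) * z0" using u1 by simp
      then show ?thesis using False by (simp add: algebra_simps)
    next
      case True
      have ug0: "ug \<noteq> 0" using g by auto
      have "z + u * zg = zg + ug * cnj z" "u * ug = ug * cnj u"
        using g True u u0 ug0 unfolding c by (simp_all add: nil_iso_comp nil_iso_inject)
      then have uc: "cnj u = u" and "(1 - u) * zg = (1 - u) * (z0 - ug * cnj z0)"
        using ug0 unfolding z by (simp_all add: algebra_simps)
      then show ?thesis using u1 True by simp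
    qed
    \<comment> \<open>A conjugating element commuting with \<open>c\<close> would force u = -1 and t
      = 0, and then \<open>c\<close> would be an involution.\<close>
    have no_conj: "\<not> eg"
      if g: "g = nil_iso zg tg ug eg" "cmod ug = 1" "c \<circ> g = g \<circ> c" for g zg tg ug eg
    proof
      assume eg: eg
      have ug0: "ug \<noteq> 0" using g by auto
      have e: "u * ug = ug * cnj u" "t + tg + 2 * Im (z * cnj (u * zg)) = tg - t + 2 * Im (zg * cnj (ug * cnj z))"
      proof -
        have "nil_iso (z + u * zg) (t + tg + 2 * Im (z * cnj (u * zg))) (u * ug) eg =
          nil_iso (zg + ug * cnj z) (tg - t + 2 * Im (zg * cnj (ug * cnj z))) (ug * cnj u) (\<not> \<not> eg)"
          using g(3) eg unfolding c g(1) nil_iso_comp[OF u] nil_iso_comp[OF g(2)] by simp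
        moreover have "u * ug \<noteq> 0" using u0 ug0 by simp
        ultimately show "u * ug = ug * cnj u" "t + tg + 2 * Im (z * cnj (u * zg)) = tg - t + 2 * Im (zg * cnj (ug * cnj z))"
          using nil_iso_inject by blast+
      qed
      then have uc: "cnj u = u" using ug0 by simp
      then have "u * u = 1" using unit_cnj[OF u] by simp
      then have um: "u = - 1" using u1 by (metis power2_eq_1_iff power2_eq_square)
      have zg: "zg = z0 - ug * cnj z0" using fixed[OF g] eg by simp
      have "2 * t = 2 * Im (zg * cnj (ug * cnj z)) - 2 * Im (z * cnj (u * zg))" using e(2) by simp
      also have "\<dots> = 2 * Im (2 * (zg * (z0 * cnj ug))) + 4 * Im (z0 * cnj zg)"
        unfolding um z by (simp add: algebra_simps)
      also have "zg * (z0 * cnj ug) = z0 * z0 * cnj ug - (ug * cnj ug) * (z0 * cnj z0)"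
        unfolding zg by (simp add: algebra_simps)
      also have "Im (z0 * cnj zg) = Im (z0 * cnj z0 - z0 * z0 * cnj ug)"
        unfolding zg by (simp add: algebra_simps)
      also have "2 * Im (2 * (z0 * z0 * cnj ug - (ug * cnj ug) * (z0 * cnj z0))) + 4 * Im (z0 * cnj z0 - z0 * z0 * cnj ug) = 0"
        using g(2) by (simp add: unit_cnj complex_mult_cnj)
      finally have "t = 0" by simp
      then have "c \<circ> c = id" unfolding c using u um by (simp add: nil_iso_comp nil_iso_eq_id complex_mult_cnj)
      then show False using inf[of 2] c2 by simp
    qed
    obtain za ta ua ea where a: "a = nil_iso za ta ua ea" "cmod ua = 1" using abc(1) by (rule nil_isoE)
    obtain zb tb ub eb where b: "b = nil_iso zb tb ub eb" "cmod ub = 1" using abc(2) by (rule nil_isoE)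
    have e: "\<not> ea" "\<not> eb" using no_conj[OF a ca] no_conj[OF b cb] by auto
    have zab: "za = (1 - ua) * z0" "zb = (1 - ub) * z0" using fixed[OF a ca] fixed[OF b cb] e by (auto simp: algebra_simps)
    \<comment> \<open>Rotations about a common axis commute: their two cross terms are the same
      multiple of |z0|^2.\<close>
    have "za * cnj (ua * zb) = ((cnj ua - ua * cnj ua) * (1 - cnj ub)) * (z0 * cnj z0)"
      "zb * cnj (ub * za) = ((cnj ub - ub * cnj ub) * (1 - cnj ua)) * (z0 * cnj z0)"
      unfolding zab by (simp_all add: algebra_simps)
    then have "za * cnj (ua * zb) = zb * cnj (ub * za)"
      unfolding unit_cnj(1)[OF a(2)] unit_cnj(1)[OF b(2)] by (simp only:) (simp add: algebra_simps)
    then have ab: "a \<circ> b = b \<circ> a"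
      using a b e by (simp add: nil_iso_comp) (simp add: zab algebra_simps)
    have "c ^^ k = id"
    proof -
      have "bij a" "bij b" 
      proof -
        have "bij g" if "g \<in> carrier Isom_Nil" for g
        proof -
          interpret group Isom_Nil by (rule group_Isom_Nil)
          have "inv\<^bsub>Isom_Nil\<^esub> g \<circ> g = id" "g \<circ> inv\<^bsub>Isom_Nil\<^esub> g = id"
            using l_inv[OF that] r_inv[OF that] by simp_all
          then show ?thesis using o_bij by blast
        qed
        then show "bij a" "bij b" using abc by auto
      qed
      then have "surj (a \<circ> b)" using bij_comp bij_is_surj by blast
      moreover have "(c ^^ k) ((a \<circ> b) p) = (a \<circ> b) p" for p using ba ab by (metis comp_apply)
      ultimately show ?thesis by (metis (no_types, lifting) eq_id_iff surjD)
    qed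
    then show False using inf \<open>k > 0\<close> by blast
  qed
  then have c: "c = nil_iso z t 1 False" using c by simp
  then have "z = 0" using nh[of z 1 t] by auto
  moreover then have "t \<noteq> 0" using inf[of 1] c nil_iso_id by auto
  ultimately show ?thesis using that c by blast
qed

text \<open>A conjugation reverses heights, so it cannot commute with a nontrivial vertical
  translation.\<close>

lemma commute_vertical:
  assumes g: "g \<in> carrier Isom_Nil" and "nil_iso 0 h 1 False \<circ> g = g \<circ> nil_iso 0 h 1 False" "h \<noteq> 0"
  obtains z t u where "g = nil_iso z t u False" "cmod u = 1"
proof -
  obtain z t u e where g': "g = nil_iso z t u e" "cmod u = 1" using g by (rule nil_isoE)
  have u0: "u \<noteq> 0" using g' by auto
  have "h + t = t + sg e * h" using assms(2) g'(2) u0 unfolding g'(1) by (simp add: nil_iso_comp nil_iso_inject)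
  then have "\<not> e" using assms(3) by (cases e) auto
  then show ?thesis using that g' by auto
qed

text \<open>For v other than 1 the planar equation gives (1 - v)(zb - za) = 0. With equal planar
  parts the cross terms cancel, and the vertical equation leaves k h = 0.\<close>

lemma noncommuting_rotations:
  assumes v: "cmod v = 1" and "k > 0" "h \<noteq> 0"
    and ba: "nil_iso zb tb v False \<circ> nil_iso za ta v False =
       (nil_iso 0 h 1 False) ^^ k \<circ> (nil_iso za ta v False \<circ> nil_iso zb tb v False)"
  shows "v = 1"
proof (rule ccontr)
  assume v1: "v \<noteq> 1"
  have v0: "v \<noteq> 0" using v by auto
  have e: "zb + v * za = za + v * zb" 
    "tb + ta + 2 * Im (zb * cnj (v * za)) = k * h + (ta + tb + 2 * Im (za * cnj (v * zb)))"
    using ba v v0 by (simp_all add: nil_iso_comp nil_iso_inject nil_iso_funpow_vertical)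
  then have "(1 - v) * (zb - za) = 0" by (simp add: algebra_simps)
  then have "zb = za" using v1 by simp
  then show False using e(2) assms by simp
qed

text \<open>Since \<open>c\<close> is vertical, no generator conjugates. The twist relation gives
  \<open>a\<close> and \<open>b\<close> the same rotation, which the commutator relation forces to
  be trivial; the heights in that relation then give the area formula for k h, so \<open>a\<close>
  is not vertical.\<close>

lemma twist_coordinates:
  assumes G: "a \<in> carrier Isom_Nil" "b \<in> carrier Isom_Nil" "c \<in> carrier Isom_Nil" "s \<in> carrier Isom_Nil"
    and "k > 0"
    and ba: "b \<circ> a = c ^^ k \<circ> (a \<circ> b)" and ca: "c \<circ> a = a \<circ> c" and cb: "c \<circ> b = b \<circ> c"
    and cs: "c \<circ> s = s \<circ> c"
    and inf: "\<And>j. j > 0 \<Longrightarrow> c ^^ j \<noteq> id"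
    and rel: "s \<circ> a = b \<circ> s \<or> (\<exists>j. s \<circ> a = b \<circ> (s \<circ> c ^^ j)) \<or> (s \<circ> a = a \<circ> (b \<circ> s) \<and> a \<circ> (s \<circ> b) = s)"
  obtains h za ta zb tb z t u where "c = nil_iso 0 h 1 False" "h \<noteq> 0" "a = nil_iso za ta 1 False"
    "b = nil_iso zb tb 1 False" "s = nil_iso z t u False" "cmod u = 1" "za \<noteq> 0"
    "k * h = 4 * Im (zb * cnj za)"
proof -
  obtain h where c: "c = nil_iso 0 h 1 False" and h: "h \<noteq> 0"
    by (rule infinite_order_central_vertical[OF G(1-3) \<open>k > 0\<close> ba ca cb inf])
  obtain za ta ua where a: "a = nil_iso za ta ua False" and ua: "cmod ua = 1"
    by (rule commute_vertical[OF G(1) ca[unfolded c] h])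
  obtain zb tb ub where b: "b = nil_iso zb tb ub False" and ub: "cmod ub = 1"
    by (rule commute_vertical[OF G(2) cb[unfolded c] h])
  obtain z t u where s: "s = nil_iso z t u False" and u: "cmod u = 1"
    by (rule commute_vertical[OF G(4) cs[unfolded c] h])
  have nz: "u \<noteq> 0" "ua \<noteq> 0" "ub \<noteq> 0" using u ua ub by auto
  \<comment> \<open>In the last alternative the first relation gives \<open>ub = 1\<close> and the
    second \<open>ua * ub = 1\<close>.\<close>
  have uab: "ua = ub"
    using rel nz u ua ub unfolding a b s c
    by (auto simp add: nil_iso_comp nil_iso_inject nil_iso_funpow_vertical)
  have "ua = 1"
    using noncommuting_rotations[OF ua \<open>k > 0\<close> h ba[unfolded a b c uab[symmetric]]] .
  then have ab: "a = nil_iso za ta 1 False" "b = nil_iso zb tb 1 False" using a b uab by auto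
  have "tb + ta + 2 * Im (zb * cnj za) = k * h + (ta + tb + 2 * Im (za * cnj zb))"
    using ba unfolding ab c by (simp add: nil_iso_comp nil_iso_inject nil_iso_funpow_vertical)
  then have kh: "k * h = 4 * Im (zb * cnj za)" by (simp add: algebra_simps)
  then have "za \<noteq> 0" using h \<open>k > 0\<close> by auto
  then show ?thesis using that c h ab s u kh by blast
qed

text \<open>The relations in terms of composition alone, without an ambient group, so that any map
  multiplicative on the generated elements transports them.\<close>

definition heis_rels :: "nat \<Rightarrow> ('a \<Rightarrow> 'a) \<Rightarrow> ('a \<Rightarrow> 'a) \<Rightarrow> ('a \<Rightarrow> 'a) \<Rightarrow> ('a \<Rightarrow> 'a) \<Rightarrow> bool" where
  "heis_rels k a b c s \<longleftrightarrow> b \<circ> a = c ^^ k \<circ> (a \<circ> b) \<and> c \<circ> a = a \<circ> c \<and> c \<circ> b = b \<circ> c \<and> c \<circ> s = s \<circ> c"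

definition quarter_rels :: "nat \<Rightarrow> nat \<Rightarrow> ('a \<Rightarrow> 'a) \<Rightarrow> ('a \<Rightarrow> 'a) \<Rightarrow> ('a \<Rightarrow> 'a) \<Rightarrow> ('a \<Rightarrow> 'a) \<Rightarrow> bool" where
  "quarter_rels k p a b c s \<longleftrightarrow> heis_rels k a b c s \<and> s \<circ> a = b \<circ> s \<and> a \<circ> (s \<circ> b) = s \<and> s ^^ 4 = c ^^ p"

definition third_rels :: "nat \<Rightarrow> nat \<Rightarrow> nat \<Rightarrow> ('a \<Rightarrow> 'a) \<Rightarrow> ('a \<Rightarrow> 'a) \<Rightarrow> ('a \<Rightarrow> 'a) \<Rightarrow> ('a \<Rightarrow> 'a) \<Rightarrow> bool" where
  "third_rels k k1 k2 a b c s \<longleftrightarrow> heis_rels k a b c s \<and> s \<circ> a = b \<circ> (s \<circ> c ^^ k1) \<and>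
     b \<circ> (a \<circ> (s \<circ> b)) = s \<and> s ^^ 3 = c ^^ k2"

definition sixth_rels :: "nat \<Rightarrow> nat \<Rightarrow> ('a \<Rightarrow> 'a) \<Rightarrow> ('a \<Rightarrow> 'a) \<Rightarrow> ('a \<Rightarrow> 'a) \<Rightarrow> ('a \<Rightarrow> 'a) \<Rightarrow> bool" where
  "sixth_rels k k1 a b c s \<longleftrightarrow> heis_rels k a b c s \<and> s \<circ> a = a \<circ> (b \<circ> s) \<and> a \<circ> (s \<circ> b) = s \<and> s ^^ 6 = c ^^ k1"

lemma third_root:
  obtains w where "w * w = - 1 - w" "Re w = - 1 / 2" "Im w = sqrt 3 / 2" "cmod w = 1"
  by (rule that[of "Complex (- 1 / 2) (sqrt 3 / 2)"])
    (auto simp: complex_eq_iff cmod_def field_simps power2_eq_square)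

lemma vertical_infinite_order: "h \<noteq> 0 \<Longrightarrow> j > 0 \<Longrightarrow> nil_iso 0 h 1 False ^^ j \<noteq> id"
  by (simp add: nil_iso_funpow_vertical nil_iso_eq_id)

text \<open>Concrete lattices satisfying the relations; they show that \<open>c\<close> has infinite order in the
  presented groups.\<close>

lemma quarter_model:
  assumes "k > 0"
  shows "\<exists>a b c s. {a, b, c, s} \<subseteq> carrier Isom_Nil \<and> quarter_rels k p a b c s \<and> (\<forall>j>0. c ^^ j \<noteq> id)"
proof -
  \<comment> \<open>With planar parts 1 and i the commutator is the vertical translation by 4, which
    has to be \<open>c ^^ k\<close>. The height of \<open>?s\<close> is a quarter of that of
    \<open>c ^^ p\<close>.\<close>
  define h :: real where "h = 4 / k"
  let ?a = "nil_iso 1 0 1 False" and ?b = "nil_iso \<i> 0 1 False" and ?c = "nil_iso 0 h 1 False"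
    and ?s = "nil_iso 0 (p * h / 4) \<i> False"
  have kh: "k * h = 4" "h \<noteq> 0" using assms by (auto simp: h_def)
  have "{?a, ?b, ?c, ?s} \<subseteq> carrier Isom_Nil"
    by (auto intro!: nil_isoI)
  moreover have "heis_rels k ?a ?b ?c ?s"
    using kh by (simp add: heis_rels_def nil_iso_comp nil_iso_funpow_vertical nil_iso_inject)
  moreover have "?s \<circ> ?a = ?b \<circ> ?s"
    by (simp add: nil_iso_comp nil_iso_inject)
  moreover have "?a \<circ> (?s \<circ> ?b) = ?s"
    by (simp add: nil_iso_comp nil_iso_inject)
  moreover have "?s ^^ 4 = ?c ^^ p"
  proof -
    have "?s ^^ 4 = ?s \<circ> (?s \<circ> (?s \<circ> ?s))" by (simp add: eval_nat_numeral)
    then show ?thesis by (simp add: nil_iso_comp nil_iso_funpow_vertical nil_iso_inject)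
  qed
  moreover have "\<forall>j>0. ?c ^^ j \<noteq> id" using kh by (simp add: vertical_infinite_order)
  ultimately show ?thesis unfolding quarter_rels_def by blast
qed

lemma third_model:
  assumes "k > 0"
  shows "\<exists>a b c s. {a, b, c, s} \<subseteq> carrier Isom_Nil \<and> third_rels k k1 k2 a b c s \<and> (\<forall>j>0. c ^^ j \<noteq> id)"
proof -
  obtain w where w: "w * w = - 1 - w" "Re w = - 1 / 2" "Im w = sqrt 3 / 2" "cmod w = 1" by (rule third_root)
  \<comment> \<open>The commutator now has height 4 Im w = 2 sqrt 3.\<close>
  define h where "h = 2 * sqrt 3 / k"
  \<comment> \<open>The solution of the vertical part of the relation b a s b = s, once the height
    of \<open>?b\<close> is fixed by s a = b s c^k1.\<close>
  define ta where "ta = (2 * k1 * h - sqrt 3) / 3"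
  let ?a = "nil_iso 1 ta 1 False" and ?b = "nil_iso w (ta - k1 * h) 1 False" and ?c = "nil_iso 0 h 1 False"
    and ?s = "nil_iso 0 (k2 * h / 3) w False"
  have w0: "w \<noteq> 0" using w(4) by auto
  have kh: "k * h = 2 * sqrt 3" "h \<noteq> 0" using assms by (auto simp: h_def)
  have w3: "w * (w * w) = 1" unfolding w(1) by (simp add: w(1) algebra_simps)
  have "{?a, ?b, ?c, ?s} \<subseteq> carrier Isom_Nil"
    using w by (auto intro!: nil_isoI)
  moreover have "heis_rels k ?a ?b ?c ?s"
    using kh w w0 by (simp add: heis_rels_def nil_iso_comp nil_iso_funpow_vertical nil_iso_inject)
  moreover have "?s \<circ> ?a = ?b \<circ> (?s \<circ> ?c ^^ k1)"
    using w w0 by (simp add: nil_iso_comp nil_iso_funpow_vertical nil_iso_inject)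
  moreover have "?b \<circ> (?a \<circ> (?s \<circ> ?b)) = ?s"
  proof -
    have "Im ((w + 1) * cnj (w * w)) = 0" unfolding w(1) by (simp add: w)
    moreover have "3 * ta = 2 * k1 * h - sqrt 3" unfolding ta_def by simp
    moreover have "?b \<circ> (?a \<circ> (?s \<circ> ?b)) = (?b \<circ> ?a) \<circ> (?s \<circ> ?b)" by (simp add: comp_assoc)
    ultimately show ?thesis
      using w0 by (simp add: nil_iso_comp w(4) nil_iso_inject del: complex_cnj_mult) (simp add: w)
  qed
  moreover have "?s ^^ 3 = ?c ^^ k2"
  proof -
    have "?s ^^ 3 = ?s \<circ> (?s \<circ> ?s)" by (simp add: eval_nat_numeral)
    then show ?thesis by (simp add: nil_iso_comp w(4) w3 nil_iso_funpow_vertical nil_iso_inject)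
  qed
  moreover have "\<forall>j>0. ?c ^^ j \<noteq> id" using kh by (simp add: vertical_infinite_order)
  ultimately show ?thesis unfolding third_rels_def by blast
qed

lemma sixth_model:
  assumes "k > 0"
  shows "\<exists>a b c s. {a, b, c, s} \<subseteq> carrier Isom_Nil \<and> sixth_rels k k1 a b c s \<and> (\<forall>j>0. c ^^ j \<noteq> id)"
proof -
  obtain w where w: "w * w = - 1 - w" "Re w = - 1 / 2" "Im w = sqrt 3 / 2" "cmod w = 1" by (rule third_root)
  define h where "h = 2 * sqrt 3 / k"
  \<comment> \<open>A primitive sixth root of unity. The heights -sqrt 3 and sqrt 3 below solve the
    vertical parts of the two relations that involve \<open>?s\<close>.\<close>
  define u where "u = 1 + w"
  let ?a = "nil_iso 1 (- sqrt 3) 1 False" and ?b = "nil_iso w (sqrt 3) 1 False" and ?c = "nil_iso 0 h 1 False"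
    and ?s = "nil_iso 0 (k1 * h / 6) u False"
  have w0: "w \<noteq> 0" using w(4) by auto
  have kh: "k * h = 2 * sqrt 3" "h \<noteq> 0" using assms by (auto simp: h_def)
  have w3: "w * (w * w) = 1" unfolding w(1) by (simp add: w(1) algebra_simps)
  have uu: "u * u = w" and uw: "u * w = - 1" by (simp_all add: u_def w(1) algebra_simps)
  have "cmod u * cmod w = 1" unfolding norm_mult[symmetric] uw by simp
  then have u: "cmod u = 1" "u \<noteq> 0" using w(4) by auto
  have "{?a, ?b, ?c, ?s} \<subseteq> carrier Isom_Nil"
    using w u by (auto intro!: nil_isoI)
  moreover have "heis_rels k ?a ?b ?c ?s"
    using kh w u by (simp add: heis_rels_def nil_iso_comp nil_iso_funpow_vertical nil_iso_inject)
  moreover have "?s \<circ> ?a = ?a \<circ> (?b \<circ> ?s)"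
    using u w by (simp add: nil_iso_comp nil_iso_inject) (simp add: u_def)
  moreover have "?a \<circ> (?s \<circ> ?b) = ?s"
    using u by (simp add: nil_iso_comp nil_iso_inject uw)
  moreover have "?s ^^ 6 = ?c ^^ k1"
  proof -
    have s2: "?s \<circ> ?s = nil_iso 0 (k1 * h / 3) w False"
      unfolding nil_iso_comp[OF u(1)] by (simp add: uu mult.commute)
    have "?s ^^ 6 = (?s \<circ> ?s) \<circ> ((?s \<circ> ?s) \<circ> (?s \<circ> ?s))" by (simp add: eval_nat_numeral comp_assoc)
    also have "\<dots> = ?c ^^ k1" unfolding s2 
      by (simp add: nil_iso_comp w(4) nil_iso_inject mult.assoc w3 nil_iso_funpow_vertical)
    finally show ?thesis .
  qed
  moreover have "\<forall>j>0. ?c ^^ j \<noteq> id" using kh by (simp add: vertical_infinite_order)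
  ultimately show ?thesis unfolding sixth_rels_def by blast
qed

text \<open>If the power were trivial in \<open>G\<close>, its word would be a consequence of the
  relations and hence trivial in every model of them.\<close>

lemma word_order_from_model:
  assumes "group G" "range f \<subseteq> carrier G" and fR: "\<And>w. word_value G f w = \<one>\<^bsub>G\<^esub> \<Longrightarrow> word_eq R w []"
    and "group M" "range m \<subseteq> carrier M" and mR: "\<forall>(l, r)\<in>R. word_value M m l = word_value M m r"
    and ne: "m x [^]\<^bsub>M\<^esub> (j::nat) \<noteq> \<one>\<^bsub>M\<^esub>"
  shows "f x [^]\<^bsub>G\<^esub> j \<noteq> \<one>\<^bsub>G\<^esub>"
proof
  interpret G: group G by fact
  interpret M: group M by fact
  let ?w = "word_pow [(x, True)] j"
  assume "f x [^]\<^bsub>G\<^esub> j = \<one>\<^bsub>G\<^esub>"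
  moreover have fx: "f x \<in> carrier G" "m x \<in> carrier M" using assms by auto
  ultimately have "word_value G f ?w = \<one>\<^bsub>G\<^esub>"
    using assms(2) by (simp add: letter_value_def)
  then have "word_eq R ?w []" by (rule fR)
  then have "word_value M m ?w = word_value M m []"
    by (rule M.word_value_cong[OF assms(5), rotated]) (use mR in auto)
  then show False using ne assms(5) fx by (simp add: letter_value_def)
qed

text \<open>\<open>P\<close> is the translation of the relations \<open>R\<close> into equations. It
  is required for all groups of maps because it is used twice: for the lattice, and for the model
  inside the whole isometry group.\<close>

lemma twist_generators:
  assumes D: "subgroup \<Delta> Isom_Nil" and iso: "Isom_Nil\<lparr>carrier := \<Delta>\<rparr> \<cong> presented_group R"
    and P: "\<And>(G :: (nil \<Rightarrow> nil) monoid) f. group G \<Longrightarrow> range f \<subseteq> carrier G \<Longrightarrow> mult G = (\<circ>) \<Longrightarrow> \<one>\<^bsub>G\<^esub> = id \<Longrightarrow> 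
       (\<forall>(l, r)\<in>R. word_value G f l = word_value G f r) \<longleftrightarrow> P (f Gen_a) (f Gen_b) (f Gen_c) (f Gen_alpha)"
    and model: "\<exists>a b c s. {a, b, c, s} \<subseteq> carrier Isom_Nil \<and> P a b c s \<and> (\<forall>j>0. c ^^ j \<noteq> id)"
  obtains a b c s where "P a b c s" "{a, b, c, s} \<subseteq> \<Delta>" "\<And>j. j > 0 \<Longrightarrow> c ^^ j \<noteq> id"
    "\<Delta> = generate (Isom_Nil\<lparr>carrier := \<Delta>\<rparr>) {a, b, c, s}"
proof -
  interpret I: group Isom_Nil by (rule group_Isom_Nil)
  let ?G = "Isom_Nil\<lparr>carrier := \<Delta>\<rparr>"
  interpret G: group ?G by (rule I.subgroup_imp_group[OF D])
  obtain f where f: "range f \<subseteq> carrier ?G" "\<And>l r. (l, r) \<in> R \<Longrightarrow> word_value ?G f l = word_value ?G f r"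
    "\<And>w. word_value ?G f w = \<one>\<^bsub>?G\<^esub> \<Longrightarrow> word_eq R w []" "carrier ?G = generate ?G (range f)"
    by (rule G.presented_generators[OF iso], rule that)
  have "x \<in> {Gen_a, Gen_b, Gen_c, Gen_alpha}" for x by (cases x) simp_all
  then have "(UNIV :: gen set) = {Gen_a, Gen_b, Gen_c, Gen_alpha}" by (rule UNIV_eq_I)
  then have r: "range f = {f Gen_a, f Gen_b, f Gen_c, f Gen_alpha}" by (metis image_empty image_insert)
  obtain a b c s where m: "{a, b, c, s} \<subseteq> carrier Isom_Nil" "P a b c s" "\<forall>j>0. c ^^ j \<noteq> id"
    using model by (elim exE conjE) (rule that)
  define m where "m x = (case x of Gen_a \<Rightarrow> a | Gen_b \<Rightarrow> b | Gen_c \<Rightarrow> c | Gen_alpha \<Rightarrow> s)" for x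
  have mc: "range m \<subseteq> carrier Isom_Nil" using m(1) by (auto simp: m_def split: gen.splits)
  have mR: "\<forall>(l, r)\<in>R. word_value Isom_Nil m l = word_value Isom_Nil m r"
    using P[OF group_Isom_Nil mc] m(2) by (simp add: m_def Isom_Nil_def)
  show ?thesis
  proof (rule that)
    show "P (f Gen_a) (f Gen_b) (f Gen_c) (f Gen_alpha)"
    using P[OF G.is_group f(1)] f(2) by (auto simp: Isom_Nil_def)
    show "f Gen_c ^^ j \<noteq> id" if "j > 0" for j
    proof -
    have "m Gen_c [^]\<^bsub>Isom_Nil\<^esub> j \<noteq> \<one>\<^bsub>Isom_Nil\<^esub>" using m(3) that by (simp add: m_def)
    from word_order_from_model[OF G.is_group f(1,3) group_Isom_Nil mc mR this]
      show ?thesis by simp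
    qed
    show "{f Gen_a, f Gen_b, f Gen_c, f Gen_alpha} \<subseteq> \<Delta>" using f(1) unfolding r by simp
    show "\<Delta> = generate ?G {f Gen_a, f Gen_b, f Gen_c, f Gen_alpha}" using f(4) unfolding r by simp
  qed
qed

lemma pow_of_comp:
  assumes "mult G = (\<circ>)" "\<one>\<^bsub>G\<^esub> = id"
  shows "x [^]\<^bsub>G\<^esub> (n::nat) = x ^^ n"
  using assms by (induction n) (simp_all add: nat_pow_def funpow_Suc_right del: funpow.simps(2))

lemma quarter_twist_generators:
  assumes "subgroup \<Delta> Isom_Nil" "quarter_twist (Isom_Nil\<lparr>carrier := \<Delta>\<rparr>)"
  obtains k p a b c s where "k > 0" "quarter_rels k p a b c s" "{a, b, c, s} \<subseteq> \<Delta>" "\<And>j. j > 0 \<Longrightarrow> c ^^ j \<noteq> id"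
    "\<Delta> = generate (Isom_Nil\<lparr>carrier := \<Delta>\<rparr>) {a, b, c, s}"
proof -
  obtain k p where k: "k > 0" and iso: "Isom_Nil\<lparr>carrier := \<Delta>\<rparr> \<cong> presented_group (common_relations k \<union>
       {(w\<alpha> @ wa, wb @ w\<alpha>), (w\<alpha> @ wb, word_inv wa @ w\<alpha>), (word_pow w\<alpha> 4, word_pow wc p)})"
    using assms(2) unfolding quarter_twist_def by (elim exE conjE) (rule that)
  show ?thesis
  proof (rule twist_generators[where P="quarter_rels k p", OF assms(1) iso _ quarter_model[OF k, of p]], goal_cases)
    case (1 G f)
    then show ?case
      by (simp only: group.quarter_relations_iff group.heis_rel_def pow_of_comp quarter_rels_def heis_rels_def)
  next
    case (2 a b c s)
    show ?case by (rule that[OF k 2])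
  qed
qed

lemma third_twist_generators:
  assumes "subgroup \<Delta> Isom_Nil" "third_twist (Isom_Nil\<lparr>carrier := \<Delta>\<rparr>)"
  obtains k k1 k2 a b c s where "k > 0" "third_rels k k1 k2 a b c s" "{a, b, c, s} \<subseteq> \<Delta>" "\<And>j. j > 0 \<Longrightarrow> c ^^ j \<noteq> id"
    "\<Delta> = generate (Isom_Nil\<lparr>carrier := \<Delta>\<rparr>) {a, b, c, s}"
proof -
  obtain k k1 k2 where k: "k > 0" and iso: "Isom_Nil\<lparr>carrier := \<Delta>\<rparr> \<cong> presented_group (common_relations k \<union>
       {(w\<alpha> @ wa, wb @ w\<alpha> @ word_pow wc k1), (w\<alpha> @ wb, word_inv wa @ word_inv wb @ w\<alpha>),
        (word_pow w\<alpha> 3, word_pow wc k2)})"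
    using assms(2) unfolding third_twist_def by (elim exE conjE) (rule that)
  show ?thesis
  proof (rule twist_generators[where P="third_rels k k1 k2", OF assms(1) iso _ third_model[OF k, of k1 k2]], goal_cases)
    case (1 G f)
    then show ?case
      by (simp only: group.third_relations_iff group.heis_rel_def pow_of_comp third_rels_def heis_rels_def)
  next
    case (2 a b c s)
    show ?case by (rule that[OF k 2])
  qed
qed

lemma sixth_twist_generators:
  assumes "subgroup \<Delta> Isom_Nil" "sixth_twist (Isom_Nil\<lparr>carrier := \<Delta>\<rparr>)"
  obtains k k1 a b c s where "k > 0" "sixth_rels k k1 a b c s" "{a, b, c, s} \<subseteq> \<Delta>" "\<And>j. j > 0 \<Longrightarrow> c ^^ j \<noteq> id"
    "\<Delta> = generate (Isom_Nil\<lparr>carrier := \<Delta>\<rparr>) {a, b, c, s}"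
proof -
  obtain k k1 where k: "k > 0" and iso: "Isom_Nil\<lparr>carrier := \<Delta>\<rparr> \<cong> presented_group (common_relations k \<union>
       {(w\<alpha> @ wa, wa @ wb @ w\<alpha>), (w\<alpha> @ wb, word_inv wa @ w\<alpha>), (word_pow w\<alpha> 6, word_pow wc k1)})"
    using assms(2) unfolding sixth_twist_def by (elim exE conjE) (rule that)
  show ?thesis
  proof (rule twist_generators[where P="sixth_rels k k1", OF assms(1) iso _ sixth_model[OF k, of k1]], goal_cases)
    case (1 G f)
    then show ?case
      by (simp only: group.sixth_relations_iff group.heis_rel_def pow_of_comp sixth_rels_def heis_rels_def)
  next
    case (2 a b c s)
    show ?case by (rule that[OF k 2])
  qed
qed

section \<open>The Gaussian and Eisenstein integers\<close>

text \<open>If b is the denominator of r, then b^j divides D for every j. For b at least 2 the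
  exponent j = D gives 2^D <= D, which is absurd.\<close>

lemma rational_bounded_denominator_int:
  fixes r :: real
  assumes "r \<in> \<rat>" "D > (0::nat)" "\<And>j. of_nat D * r ^ j \<in> \<int>"
  shows "r \<in> \<int>"
proof -
  obtain x where x: "r = of_rat x" using assms(1) by (rule Rats_cases)
  obtain a b where ab: "quotient_of x = (a, b)" by force
  have b: "b > 0" "coprime a b" using quotient_of_denom_pos[OF ab] quotient_of_coprime[OF ab] by auto
  have r: "r = of_int a / of_int b"
    unfolding x using quotient_of_div[OF ab] by (simp add: of_rat_divide)
  have dvd: "b ^ j dvd int D" for j
  proof -
    obtain n where "of_nat D * r ^ j = of_int n" using assms(3) Ints_cases by blast
    then have "real D * of_int a ^ j = of_int n * of_int b ^ j"
      using b unfolding r by (simp add: power_divide field_simps)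
    then have "of_int (int D * a ^ j) = (of_int (n * b ^ j) :: real)" by simp
    then have "int D * a ^ j = n * b ^ j" by (simp only: of_int_eq_iff)
    then have "b ^ j dvd int D * a ^ j" by simp
    then show ?thesis using b by (simp add: coprime_dvd_mult_left_iff coprime_commute)
  qed
  have "b = 1"
  proof (rule ccontr)
    assume "b \<noteq> 1"
    then have "2 ^ D \<le> b ^ D" using b by (intro power_mono) auto
    also have "b ^ D \<le> int D" using dvd assms(2) by (intro zdvd_imp_le) auto
    finally have "int (2 ^ D) \<le> int D" by simp
    then show False using less_exp[of D] by (simp only: zle_int)
  qed
  then show ?thesis using r by simp
qed

text \<open>A monic equation keeps all powers of x in q^-n (Z + Z w) for fixed q and n. So the
  powers of the rational number |x|^2 have bounded denominators, and it is an integer. The same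
  holds for x + 1, and the trace is |x + 1|^2 - |x|^2 - 1.\<close>

lemma quadratic_integer_norm_trace:
  fixes x :: complex and d :: nat
  assumes alg: "algebraic_int x" and a: "a \<in> \<rat>" and b: "b \<in> \<rat>" and x: "x = of_real a + of_real b * (\<i> * of_real (sqrt (real d)))"
  shows "(cmod x)\<^sup>2 \<in> \<int>" "2 * Re x \<in> \<int>"
proof -
  define w where "w = \<i> * complex_of_real (sqrt (real d))"
  have ww: "w * w = - of_nat d" by (simp add: w_def complex_eq_iff)
  define L where "L = {of_int m + of_int l * w | m l. True}"
  have LI: "of_int m + of_int l * w \<in> L" for m l by (auto simp: L_def)
  have L0: "0 \<in> L" using LI[of 0 0] by simp
  have Ladd: "y + z \<in> L" if yz: "y \<in> L" "z \<in> L" for y z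
  proof -
    obtain m l m' l' where "y = of_int m + of_int l * w" "z = of_int m' + of_int l' * w" using yz unfolding L_def by auto
    then have "y + z = of_int (m + m') + of_int (l + l') * w" by (simp add: algebra_simps)
    then show ?thesis using LI by metis
  qed
  have Lmult: "y * z \<in> L" if yz: "y \<in> L" "z \<in> L" for y z
  proof -
    obtain m l m' l' where y: "y = of_int m + of_int l * w" and z: "z = of_int m' + of_int l' * w" using yz unfolding L_def by auto
    have "y * z = of_int (m * m') + of_int (l * l') * (w * w) + of_int (m * l' + l * m') * w"
      unfolding y z by (simp add: algebra_simps)
    also have "\<dots> = of_int (m * m' - l * l' * int d) + of_int (m * l' + l * m') * w"
      unfolding ww by simp
    finally show ?thesis using LI by metis
  qed
  have LZ: "of_int m \<in> L" for m using LI[of m 0] by simp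
  have Lnat: "of_nat m \<in> L" for m using LZ[of "int m"] by simp
  have Lpow: "y ^ n \<in> L" if "y \<in> L" for y n
    by (induction n) (use LZ[of 1] that Lmult in auto)
  have Lsum: "sum f A \<in> L" if "\<And>i. i \<in> A \<Longrightarrow> f i \<in> L" for f and A :: "nat set"
    using that by (induction A rule: infinite_finite_induct) (auto intro: L0 Ladd)
  obtain q :: nat where q: "q > 0" "of_nat q * x \<in> L"
  proof -
    obtain a1 a2 where a': "a = of_int a1 / of_nat a2" "a2 > 0" using a by (metis Rats_cases' of_nat_0_less_iff of_int_of_nat_eq pos_int_cases)
    obtain b1 b2 where b': "b = of_int b1 / of_nat b2" "b2 > 0" using b by (metis Rats_cases' of_nat_0_less_iff of_int_of_nat_eq pos_int_cases)
    have "of_nat (a2 * b2) * x = of_int (a1 * int b2) + of_int (b1 * int a2) * w"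
      unfolding x w_def[symmetric] a'(1) b'(1) using a'(2) b'(2) by (simp add: field_simps)
    then show ?thesis using that[of "a2 * b2"] a' b' LI by (metis nat_0_less_mult_iff)
  qed
  obtain p where p: "lead_coeff p = 1" "\<forall>i. coeff p i \<in> \<int>" "poly p x = 0"
    using alg by (auto simp: algebraic_int.simps)
  define n where "n = degree p"
  have "poly p x = (\<Sum>i\<le>n. coeff p i * x ^ i)" by (simp add: poly_altdef n_def)
  also have "\<dots> = (\<Sum>i<n. coeff p i * x ^ i) + x ^ n"
    using p(1) by (simp add: lessThan_Suc_atMost[symmetric] n_def)
  finally have xn: "x ^ n = - (\<Sum>i<n. coeff p i * x ^ i)" using p(3) by (simp add: eq_neg_iff_add_eq_0 add.commute)
  \<comment> \<open>Below the degree n the factor q^n clears the denominator of x^j; from n on the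
    monic equation lowers the exponent.\<close>
  have key: "of_nat q ^ n * x ^ j \<in> L" for j
  proof (induction j rule: less_induct)
    case (less j)
    show ?case
    proof (cases "j < n")
      case True
      then have "of_nat q ^ n * x ^ j = of_nat q ^ (n - j) * (of_nat q * x) ^ j"
        by (simp add: power_mult_distrib mult.assoc[symmetric] power_add[symmetric])
      then show ?thesis using q by (simp add: Lmult Lpow Lnat)
    next
      case False
      have "of_nat q ^ n * x ^ j = of_nat q ^ n * (x ^ n * x ^ (j - n))" using False by (simp add: power_add[symmetric])
      also have "\<dots> = of_int (- 1) * (\<Sum>i<n. coeff p i * (of_nat q ^ n * x ^ (i + (j - n))))"
        unfolding xn by (simp add: sum_distrib_left sum_distrib_right power_add mult_ac sum_negf)
      also have "\<dots> \<in> L"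
      proof (rule Lmult[OF LZ Lsum], rule Lmult)
        fix i assume "i \<in> {..<n}"
        then show "of_nat q ^ n * x ^ (i + (j - n)) \<in> L" using less False by auto
        show "coeff p i \<in> L" using p(2) LZ by (metis Ints_cases)
      qed
      finally show ?thesis .
    qed
  qed
  have key1: "of_nat q ^ n * (x + 1) ^ j \<in> L" for j
  proof -
    have "of_nat q ^ n * (x + 1) ^ j = (\<Sum>i\<le>j. of_nat (j choose i) * (of_nat q ^ n * x ^ i))"
      by (simp add: binomial_ring sum_distrib_left mult_ac)
    then show ?thesis using key by (simp add: Lsum Lmult Lnat)
  qed
  have Lnorm: "(cmod y)\<^sup>2 \<in> \<int>" if y: "y \<in> L" for y
  proof -
    obtain m l where y: "y = of_int m + of_int l * w" using y unfolding L_def by auto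
    have "(cmod y)\<^sup>2 = (of_int m)\<^sup>2 + (of_int l)\<^sup>2 * real d" unfolding y by (simp add: cmod_power2 w_def power_mult_distrib)
    then show ?thesis by simp
  qed
  have int: "(cmod y)\<^sup>2 \<in> \<int>" if y: "\<And>j. of_nat q ^ n * y ^ j \<in> L" and r: "(cmod y)\<^sup>2 \<in> \<rat>" for y
  proof (rule rational_bounded_denominator_int[OF r])
    show "q ^ (2 * n) > 0" using q by simp
    show "of_nat (q ^ (2 * n)) * (cmod y)\<^sup>2 ^ j \<in> \<int>" for j
    proof -
      have "of_nat (q ^ (2 * n)) * (cmod y)\<^sup>2 ^ j = (cmod (of_nat q ^ n * y ^ j))\<^sup>2"
        by (simp add: norm_mult norm_power power_mult_distrib power_mult[symmetric] mult.commute)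
      then show ?thesis using Lnorm[OF y] by simp
    qed
  qed
  have Rex: "Re x = a" "Im x = b * sqrt (real d)" unfolding x by simp_all
  have "(cmod x)\<^sup>2 = a\<^sup>2 + b\<^sup>2 * real d" "(cmod (x + 1))\<^sup>2 = (a + 1)\<^sup>2 + b\<^sup>2 * real d"
    by (simp_all add: cmod_power2 Rex power_mult_distrib)
  then have rat: "(cmod x)\<^sup>2 \<in> \<rat>" "(cmod (x + 1))\<^sup>2 \<in> \<rat>"
    using a b by simp_all
  show 1: "(cmod x)\<^sup>2 \<in> \<int>" by (rule int[OF key rat(1)])
  have 2: "(cmod (x + 1))\<^sup>2 \<in> \<int>" by (rule int[OF key1 rat(2)])
  have "2 * Re x = (cmod (x + 1))\<^sup>2 - (cmod x)\<^sup>2 - 1" unfolding cmod_power2 by (simp add: power2_eq_square algebra_simps)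
  then show "2 * Re x \<in> \<int>" using 1 2 by simp
qed

lemma rational_sqrt_int:
  fixes r :: real
  assumes "r \<in> \<rat>" "r\<^sup>2 \<in> \<int>" shows "r \<in> \<int>"
proof -
  obtain n where n: "r\<^sup>2 = of_int n" using assms(2) Ints_cases by blast
  have "algebraic_int r"
  proof (rule algebraic_int_root)
    show "algebraic_int (r\<^sup>2)" using n by auto
    show "poly (monom 1 2) r = r\<^sup>2" by (simp add: poly_monom)
    show "\<forall>i. coeff (monom 1 2 :: real poly) i \<in> \<int>" by simp
    show "lead_coeff (monom 1 2 :: real poly) = 1" by (simp add: degree_monom_eq)
    show "degree (monom 1 2 :: real poly) > 0" by (simp add: degree_monom_eq)
  qed
  then show ?thesis using assms(1) rational_algebraic_int_is_int by blast
qed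

locale quadratic_order =
  fixes d :: nat and v :: complex
  assumes dv: "d = 1 \<and> v * v = - 1 \<or> d = 3 \<and> v * v = - 1 - v"
begin

definition \<O> :: "complex set" where "\<O> = {of_int m + of_int l * v | m l. True}"

lemma v_cases:
  obtains "d = 1" "Re v = 0" "(Im v)\<^sup>2 = 1" "cnj v = - v" | "d = 3" "Re v = - 1 / 2" "(Im v)\<^sup>2 = 3 / 4" "cnj v = - 1 - v"
proof -
  from dv consider "d = 1" "v * v = - 1" | "d = 3" "v * v = - 1 - v" by blast
  then show ?thesis
  proof cases
    case 1
    then have e: "Re v * Re v - Im v * Im v = - 1" "Re v * Im v + Im v * Re v = 0" by (simp_all add: complex_eq_iff)
    then have "Re v = 0" using sum_squares_eq_zero_iff[of "Re v" 1] by (cases "Im v = 0") (auto simp: algebra_simps)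
    then show ?thesis using that(1) 1 e by (simp add: complex_eq_iff power2_eq_square)
  next
    case 2
    then have e: "Re v * Re v - Im v * Im v = - 1 - Re v" "Im v * (2 * Re v + 1) = 0" by (simp_all add: complex_eq_iff algebra_simps)
    have "Re v = - 1 / 2"
    proof (cases "Im v = 0")
      case True
      then have "(Re v + 1 / 2)\<^sup>2 + 3 / 4 = 0" using e by (simp add: power2_eq_square algebra_simps)
      then show ?thesis by (smt (verit) zero_le_power2 divide_pos_pos)
    qed (use e in simp)
    moreover then have "(Im v)\<^sup>2 = 3 / 4" using e by (simp add: power2_eq_square)
    ultimately show ?thesis using that(2) 2 by (simp add: complex_eq_iff)
  qed
qed

lemma OI: "of_int m + of_int l * v \<in> \<O>"
  by (auto simp: \<O>_def)

lemma OE: assumes "x \<in> \<O>" obtains m l where "x = of_int m + of_int l * v"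
  using assms by (auto simp: \<O>_def)

lemma O_int [simp]: "of_int m \<in> \<O>" and O_v [simp]: "v \<in> \<O>"
  using OI[of m 0] OI[of 0 1] by auto

lemma O_nat [simp]: "of_nat m \<in> \<O>" and O_0 [simp]: "0 \<in> \<O>" and O_1 [simp]: "1 \<in> \<O>"
  using O_int[of "int m"] O_int[of 0] O_int[of 1] by auto

lemma O_numeral [simp]: "numeral m \<in> \<O>"
  using O_int[of "numeral m"] by simp

lemma O_add [simp]: "x \<in> \<O> \<Longrightarrow> y \<in> \<O> \<Longrightarrow> x + y \<in> \<O>"
proof (elim OE)
  fix m l m' l' assume "x = of_int m + of_int l * v" "y = of_int m' + of_int l' * v"
  then have "x + y = of_int (m + m') + of_int (l + l') * v" by (simp add: algebra_simps)
  then show ?thesis using OI by metis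
qed

lemma O_minus [simp]: "x \<in> \<O> \<Longrightarrow> - x \<in> \<O>"
proof (elim OE)
  fix m l assume "x = of_int m + of_int l * v"
  then have "- x = of_int (- m) + of_int (- l) * v" by simp
  then show ?thesis using OI by metis
qed

lemma O_diff [simp]: "x \<in> \<O> \<Longrightarrow> y \<in> \<O> \<Longrightarrow> x - y \<in> \<O>"
  using O_add[of x "- y"] by simp

lemma vv_O: "v * v \<in> \<O>"
  using dv by auto

lemma O_mult [simp]: "x \<in> \<O> \<Longrightarrow> y \<in> \<O> \<Longrightarrow> x * y \<in> \<O>"
proof (elim OE)
  fix m l m' l' assume xy: "x = of_int m + of_int l * v" "y = of_int m' + of_int l' * v"
  obtain p q where pq: "v * v = of_int p + of_int q * v" using vv_O by (rule OE)
  have "x * y = of_int (m * m') + of_int (l * l') * (v * v) + of_int (m * l' + l * m') * v"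
    unfolding xy by (simp add: algebra_simps)
  also have "\<dots> = of_int (m * m' + l * l' * p) + of_int (m * l' + l * m' + l * l' * q) * v"
    unfolding pq by (simp add: algebra_simps)
  finally show ?thesis using OI by metis
qed

lemma O_cnj [simp]: "x \<in> \<O> \<Longrightarrow> cnj x \<in> \<O>"
proof -
  have "cnj v \<in> \<O>" by (rule v_cases) simp_all
  then show "x \<in> \<O> \<Longrightarrow> cnj x \<in> \<O>" by (elim OE[of x]) simp
qed

lemma O_norm: "x \<in> \<O> \<Longrightarrow> (cmod x)\<^sup>2 \<in> \<int>"
proof (elim OE)
  fix m l assume x: "x = of_int m + of_int l * v"
  have "(cmod x)\<^sup>2 = (of_int m + of_int l * Re v)\<^sup>2 + (of_int l)\<^sup>2 * (Im v)\<^sup>2"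
    unfolding x by (simp add: cmod_power2 power_mult_distrib)
  also have "\<dots> = of_int m * of_int m + 2 * Re v * (of_int m * of_int l) + of_int l * of_int l * ((Re v)\<^sup>2 + (Im v)\<^sup>2)"
    by (simp add: power2_eq_square algebra_simps)
  also have "(Re v)\<^sup>2 + (Im v)\<^sup>2 = 1" by (rule v_cases) (simp_all add: power_divide)
  also have "of_int m * of_int m + 2 * Re v * (of_int m * of_int l) + of_int l * of_int l * 1 \<in> \<int>"
    by (rule v_cases) simp_all
  finally show ?thesis .
qed

lemma O_trace: "x \<in> \<O> \<Longrightarrow> 2 * Re x \<in> \<int>"
proof (elim OE)
  fix m l assume x: "x = of_int m + of_int l * v"
  have "2 * Re x = 2 * of_int m + of_int l * (2 * Re v)" by (simp add: x)
  moreover have "2 * Re v \<in> \<int>" by (rule v_cases) simp_all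
  ultimately show ?thesis by simp
qed

lemma O_discrete: "x \<in> \<O> \<Longrightarrow> x \<noteq> 0 \<Longrightarrow> cmod x \<ge> 1"
proof -
  assume x: "x \<in> \<O>" "x \<noteq> 0"
  obtain n where n: "(cmod x)\<^sup>2 = of_int n" using O_norm[OF x(1)] Ints_cases by blast
  have "(cmod x)\<^sup>2 > 0" using x(2) by simp
  then have "of_int n \<ge> (1::real)" using n by simp
  then have "(cmod x)\<^sup>2 \<ge> 1\<^sup>2" using n by simp
  then show ?thesis by (rule power2_le_imp_le) simp
qed

lemma Im_v: "2 * Im v = 2 * sqrt d \<or> 2 * Im v = - (2 * sqrt d) \<or> 2 * Im v = sqrt d \<or> 2 * Im v = - sqrt d"
proof (rule v_cases)
  assume "d = 1" "(Im v)\<^sup>2 = 1"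
  then show ?thesis by (auto simp: power2_eq_1_iff)
next
  assume "d = 3" "(Im v)\<^sup>2 = 3 / 4"
  then have "(2 * Im v)\<^sup>2 = (sqrt d)\<^sup>2" by (simp add: power_mult_distrib)
  then show ?thesis unfolding power2_eq_iff by auto
qed

lemma O_Im: "x \<in> \<O> \<Longrightarrow> \<exists>n::int. 2 * Im x = sqrt d * n"
proof (elim OE)
  fix m l assume x: "x = of_int m + of_int l * v"
  have e: "2 * Im x = of_int l * (2 * Im v)" unfolding x by simp
  from Im_v show ?thesis unfolding e
    by (elim disjE) (auto intro: exI[of _ "2 * l"] exI[of _ "- 2 * l"] exI[of _ l] exI[of _ "- l"])
qed

lemma O_sqrt_d: "\<i> * of_real (sqrt d) \<in> \<O>"
proof (rule v_cases)
  assume h: "d = 1" "Re v = 0" "(Im v)\<^sup>2 = 1"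
  then have "\<i> * of_real (sqrt d) = v \<or> \<i> * of_real (sqrt d) = - v"
    by (auto simp: complex_eq_iff power2_eq_1_iff)
  then show ?thesis by (metis O_v O_minus)
next
  assume h: "d = 3" "Re v = - 1 / 2" "(Im v)\<^sup>2 = 3 / 4"
  then have "(2 * Im v)\<^sup>2 = (sqrt d)\<^sup>2" by (simp add: power_mult_distrib)
  then have "2 * Im v = sqrt d \<or> 2 * Im v = - sqrt d" unfolding power2_eq_iff by auto
  then have "\<i> * of_real (sqrt d) = 1 + 2 * v \<or> \<i> * of_real (sqrt d) = - (1 + 2 * v)"
    using h(2) by (auto simp: complex_eq_iff)
  then show ?thesis using O_add[OF O_1 O_mult[OF O_numeral[of "Num.Bit0 Num.One"] O_v]] by (metis O_minus)
qed

text \<open>The trace 2 Re u is an integer between -2 and 1, so |1 - u|^2 = 2 - 2 Re u is 4, 3, 2 or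
  1 and divides 12; then 12 / (1 - u) is an integral multiple of 1 - cnj u.\<close>

lemma O_one_minus_unit:
  assumes "u \<in> \<O>" "cmod u = 1" "u \<noteq> 1"
  shows "12 / (1 - u) \<in> \<O>"
proof -
  obtain n where n: "2 * Re u = of_int n" using O_trace[OF assms(1)] Ints_cases by blast
  have q: "(cmod (1 - u))\<^sup>2 = 2 - 2 * Re u"
  proof -
    have "(Re u)\<^sup>2 + (Im u)\<^sup>2 = 1" using assms(2) by (metis cmod_power2 power_one)
    moreover have "(cmod (1 - u))\<^sup>2 = (1 - Re u)\<^sup>2 + (Im u)\<^sup>2" by (simp add: cmod_power2)
    ultimately show ?thesis by (simp add: power2_eq_square algebra_simps)
  qed
  have "\<bar>Re u\<bar> \<le> 1" using abs_Re_le_cmod[of u] assms(2) by simp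
  then have "\<bar>real_of_int n\<bar> \<le> 2" using n by linarith
  moreover have "(cmod (1 - u))\<^sup>2 > 0" using assms(3) by simp
  then have "real_of_int n < 2" using n q by linarith
  ultimately have "- 2 \<le> n" "n < 2" by linarith+
  then have "n = - 2 \<or> n = - 1 \<or> n = 0 \<or> n = 1" by auto
  then have "\<exists>m::nat. 12 / (cmod (1 - u))\<^sup>2 = of_nat m"
    unfolding q n by (elim disjE) (auto intro: exI[of _ 3] exI[of _ 4] exI[of _ 6] exI[of _ 12])
  then obtain m :: nat where m: "12 / (cmod (1 - u))\<^sup>2 = of_nat m" by blast
  have ne: "cnj (1 - u) \<noteq> 0" using assms(3) by (simp del: complex_cnj_diff)
  have "12 / (1 - u) = 12 * cnj (1 - u) / ((1 - u) * cnj (1 - u))"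
    by (rule nonzero_mult_divide_mult_cancel_right[OF ne, symmetric])
  also have "\<dots> = of_real (12 / (cmod (1 - u))\<^sup>2) * cnj (1 - u)"
    unfolding complex_norm_square[symmetric] by simp
  finally show ?thesis using assms(1) unfolding m by simp
qed

lemma O_finite_residues:
  assumes "n > (0::nat)"
  obtains F where "finite F" "F \<subseteq> \<O>" "\<And>x. x \<in> \<O> \<Longrightarrow> \<exists>y\<in>F. \<exists>w\<in>\<O>. x = y + of_nat n * w"
proof -
  define F where "F = (\<lambda>(m, l). of_int m + of_int l * v) ` ({0..<int n} \<times> {0..<int n})"
  show ?thesis
  proof
    show "finite F" by (simp add: F_def)
    show "F \<subseteq> \<O>" using OI by (auto simp: F_def)
    fix x assume "x \<in> \<O>"
    then obtain m l where x: "x = of_int m + of_int l * v" by (rule OE)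
    have e: "of_int m = of_int (m mod n) + of_nat n * (of_int (m div n) :: complex)" for m :: int
      by (metis add.commute mult_div_mod_eq of_int_add of_int_mult of_int_of_nat_eq)
    have "x = (of_int (m mod n) + of_int (l mod n) * v) + of_nat n * (of_int (m div n) + of_int (l div n) * v)"
      unfolding x by (subst e[of m], subst e[of l]) (simp add: algebra_simps)
    moreover have "of_int (m mod n) + of_int (l mod n) * v \<in> F"
      using assms by (auto simp: F_def)
    ultimately show "\<exists>y\<in>F. \<exists>w\<in>\<O>. x = y + of_nat n * w" using OI by blast
  qed
qed

text \<open>Integral norm and trace leave x = (s + l i sqrt d) / 2 with s^2 + d l^2 divisible by 4.
  For d = 1 this makes s and l even; for d = 3 it makes them of equal parity, which is membership in
  the Eisenstein integers.\<close>

lemma ring_of_integers_eq: "ring_of_integers d = \<O>"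
proof
  show "\<O> \<subseteq> ring_of_integers d"
  proof
    fix x assume x: "x \<in> \<O>"
    obtain n where n: "2 * Im x = sqrt d * of_int n" using O_Im[OF x] by blast
    obtain t where t: "2 * Re x = of_int t" using O_trace[OF x] Ints_cases by blast
    obtain q where q: "(cmod x)\<^sup>2 = of_int q" using O_norm[OF x] Ints_cases by blast
    have "x * x - of_int t * x + of_int q = 0"
    proof -
      have "of_int t = complex_of_real (2 * Re x)" "of_int q = complex_of_real ((Re x)\<^sup>2 + (Im x)\<^sup>2)"
        unfolding t q cmod_power2[symmetric] by simp_all
      then show ?thesis
        by (simp add: complex_eq_iff cmod_power2 power2_eq_square algebra_simps)
    qed
    then have "poly [:of_int q, - of_int t, 1:] x = 0" by (simp add: algebra_simps)
    moreover have "\<forall>i. coeff [:of_int q, - of_int t, 1::complex:] i \<in> \<int>"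
      by (auto simp: coeff_pCons split: nat.splits)
    moreover have "lead_coeff [:of_int q, - of_int t, 1::complex:] = 1" by simp
    ultimately have alg: "algebraic_int x" unfolding algebraic_int.simps by blast
    have "Re x = of_int t / 2" "Im x = of_int n / 2 * sqrt d" using n t by (simp_all add: field_simps)
    then have "x = complex_of_real (of_int t / 2) + complex_of_real (of_int n / 2) * (\<i> * of_real (sqrt d))"
      by (simp add: complex_eq_iff)
    moreover have "complex_of_real (of_int t / 2) \<in> \<rat>" "complex_of_real (of_int n / 2) \<in> \<rat>"
      by simp_all
    ultimately show "x \<in> ring_of_integers d" using alg unfolding ring_of_integers_def by blast
  qed
  show "ring_of_integers d \<subseteq> \<O>"
  proof
    fix x assume "x \<in> ring_of_integers d"
    then obtain a' b' where alg: "algebraic_int x" and ab': "a' \<in> \<rat>" "b' \<in> \<rat>" "x = a' + b' * (\<i> * of_real (sqrt d))"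
      by (auto simp: ring_of_integers_def)
    have real: "\<exists>r\<in>\<rat>. y = complex_of_real r" if "y \<in> \<rat>" for y
    proof -
      obtain i j where y: "y = of_int i / of_int j" using \<open>y \<in> \<rat>\<close> by (rule Rats_cases') 
      then have "y = complex_of_real (of_int i / of_int j)" by simp
      moreover have "(of_int i / of_int j :: real) \<in> \<rat>" by simp
      ultimately show ?thesis by blast
    qed
    obtain a b where ab: "a' = of_real a" "b' = of_real b" "a \<in> \<rat>" "b \<in> \<rat>"
      using real[OF ab'(1)] real[OF ab'(2)] by (elim bexE) (rule that)
    have x: "x = of_real a + of_real b * (\<i> * of_real (sqrt d))" using ab'(3) ab by simp
    note nt = quadratic_integer_norm_trace[OF alg ab(3,4) x]
    have Re: "Re x = a" "Im x = b * sqrt d" unfolding x by simp_all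
    obtain s where s: "2 * a = of_int s" using nt(2) Re Ints_cases by metis
    obtain q where "(cmod x)\<^sup>2 = of_int q" using nt(1) Ints_cases by blast
    then have q: "a\<^sup>2 + b\<^sup>2 * d = of_int q" by (simp add: cmod_power2 Re power_mult_distrib)
    then have q4: "(2 * b)\<^sup>2 * d = of_int (4 * q - s\<^sup>2)" using s[symmetric] by (simp add: power_mult_distrib)
    have r: "2 * b \<in> \<rat>" "3 * (2 * b) \<in> \<rat>" using ab(4) by simp_all
    have "2 * b \<in> \<int>"
    proof (rule v_cases)
      assume "d = 1"
      then have "(2 * b)\<^sup>2 = of_int (4 * q - s\<^sup>2)" using q4 by simp
      then have "(2 * b)\<^sup>2 \<in> \<int>" by (simp only: Ints_of_int)
      then show ?thesis by (rule rational_sqrt_int[OF r(1)])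
    next
      assume d: "d = 3"
      \<comment> \<open>For d = 3 only 3 (2 b)^2 is known to be integral. Thus 6 b is an integer,
        and its square is divisible by 3, so 2 b is an integer as well.\<close>
      have "(3 * (2 * b))\<^sup>2 = 3 * ((2 * b)\<^sup>2 * d)" using d by (simp add: power_mult_distrib)
      also have "\<dots> = of_int (3 * (4 * q - s\<^sup>2))" unfolding q4 by simp
      finally have e: "(3 * (2 * b))\<^sup>2 = of_int (3 * (4 * q - s\<^sup>2))" .
      then have "(3 * (2 * b))\<^sup>2 \<in> \<int>" by (simp only: Ints_of_int)
      then have "3 * (2 * b) \<in> \<int>" by (rule rational_sqrt_int[OF r(2)])
      then obtain j where j: "3 * (2 * b) = of_int j" using Ints_cases by blast
      have "real_of_int (j\<^sup>2) = of_int (3 * (4 * q - s\<^sup>2))" using e unfolding j by simp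
      then have "j\<^sup>2 = 3 * (4 * q - s\<^sup>2)" by (simp only: of_int_eq_iff)
      then have "3 dvd j ^ 2" by simp
      then have "3 dvd j" using prime_dvd_power[of "3::int" j 2] by simp
      then obtain i where "j = 3 * i" by blast
      then have "2 * b = of_int i" using j by simp
      then show ?thesis by simp
    qed
    then obtain l where l: "2 * b = of_int l" using Ints_cases by blast
    have "real_of_int (s\<^sup>2 + l\<^sup>2 * int d) = of_int (4 * q)" using q4 unfolding l by simp
    then have e: "s\<^sup>2 + l\<^sup>2 * int d = 4 * q" by (simp only: of_int_eq_iff)
    have vw: "\<i> * of_real (sqrt d) = 1 + 2 * v \<or> \<i> * of_real (sqrt d) = - (1 + 2 * v)" if "d = 3"
    proof (rule v_cases)
      assume h: "d = 3" "Re v = - 1 / 2" "(Im v)\<^sup>2 = 3 / 4"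
      then have "(2 * Im v)\<^sup>2 = (sqrt d)\<^sup>2" by (simp add: power_mult_distrib)
      then have "2 * Im v = sqrt d \<or> 2 * Im v = - sqrt d" unfolding power2_eq_iff by auto
      then show ?thesis using h(2) by (auto simp: complex_eq_iff)
    qed (use that in simp)
    have a2: "of_real a = of_int s / (2::complex)" and b2: "of_real b = of_int l / (2::complex)"
      using s l by (auto simp: complex_eq_iff)
    show "x \<in> \<O>"
    proof (rule v_cases)
      assume d: "d = 1"
      have "even s \<and> even l"
      proof -
        have sq: "\<exists>j. s\<^sup>2 = 4 * j + (if even s then 0 else 1)" for s :: int
        proof (cases "even s")
          case True
          then obtain i where "s = 2 * i" by (rule evenE)
          then have "s\<^sup>2 = 4 * (i * i)" by (simp add: power2_eq_square)
          then show ?thesis using True by auto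
        next
          case False
          then obtain i where "s = 2 * i + 1" by (rule oddE)
          then have "s\<^sup>2 = 4 * (i * i + i) + 1" by (simp add: power2_eq_square algebra_simps)
          then show ?thesis using False by (intro exI[of _ "i * i + i"]) simp
        qed
        obtain i j where "s\<^sup>2 = 4 * i + (if even s then 0 else 1)" "l\<^sup>2 = 4 * j + (if even l then 0 else 1)"
          using sq by metis
        moreover have "s\<^sup>2 + l\<^sup>2 = 4 * q" using e d by simp
        ultimately show ?thesis by (auto split: if_splits) presburger+
      qed
      then obtain s' l' where "s = 2 * s'" "l = 2 * l'" by (auto elim!: evenE)
      then have "x = of_int s' + of_int l' * (\<i> * of_real (sqrt d))" unfolding x a2 b2 by simp
      moreover have "\<i> * of_real (sqrt d) \<in> \<O>" by (rule O_sqrt_d)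
      ultimately show ?thesis by simp
    next
      assume d: "d = 3"
      have "even (s - l)"
      proof -
        have "even (s\<^sup>2 + l\<^sup>2 * 3)" using e d by simp
        then show ?thesis by simp
      qed
      then have "even (s + l)" by simp
      with \<open>even (s - l)\<close> obtain i j where "s - l = 2 * i" "s + l = 2 * j" unfolding dvd_def by metis
      then have sl: "s = i + j" "l = j - i" by auto
      have "2 * x = of_int s + of_int l * (\<i> * of_real (sqrt d))" unfolding x a2 b2 by simp
      then have "2 * x = of_int s + of_int l * (1 + 2 * v) \<or> 2 * x = of_int s + of_int l * (- (1 + 2 * v))"
        using vw[OF d] by (elim disjE) (simp_all only: simp_thms)
      then have "2 * x = 2 * (of_int j + of_int l * v) \<or> 2 * x = 2 * (of_int i - of_int l * v)"
        by (simp add: algebra_simps sl)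
      then have "x = of_int j + of_int l * v \<or> x = of_int i - of_int l * v" by (metis mult_cancel_left zero_neq_numeral)
      then show ?thesis by (elim disjE) simp_all
    qed
  qed
qed

end

section \<open>Discreteness of integral unitary matrices\<close>

lemma line_in_cone:
  assumes sc: "\<And>X c. c \<noteq> 0 \<Longrightarrow> X \<in> C \<Longrightarrow> c *s X \<in> C" and "0 \<notin> C" "X \<noteq> 0"
  shows "line X \<in> line ` C \<longleftrightarrow> X \<in> C"
proof
  assume "line X \<in> line ` C"
  then obtain Y where Y: "Y \<in> C" "line Y = line X" by auto
  have "Y \<noteq> 0" using assms(2) Y(1) by auto
  then obtain c where "c \<noteq> 0" "X = c *s Y" using Y(2) line_eq_iff[OF _ assms(3)] by auto
  then show "X \<in> C" using sc Y(1) by simp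
qed (rule imageI)

lemma open_line_cone:
  assumes sc: "\<And>X c. c \<noteq> 0 \<Longrightarrow> X \<in> C \<Longrightarrow> c *s X \<in> C" and "0 \<notin> C" "open C"
  shows "open (line ` C)"
proof -
  have "X \<noteq> 0 \<and> line X \<in> line ` C \<longleftrightarrow> X \<in> C" for X
    using line_in_cone[OF sc assms(2), of X] assms(2) by (cases "X = 0") simp_all
  then show ?thesis using assms(3) by (simp add: open_cp2_def)
qed

text \<open>Vectors on which the two functionals are small against the i-th coordinate. The
  condition is invariant under scaling, so it describes an open set of lines.\<close>

definition dom_cone :: "3 \<Rightarrow> (complex^3 \<Rightarrow> complex) \<Rightarrow> (complex^3 \<Rightarrow> complex) \<Rightarrow> (complex^3) set" where
  "dom_cone i f g = {X. 10 * cmod (f X) < cmod (X $ i) \<and> 10 * cmod (g X) < cmod (X $ i)}"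

definition homogeneous :: "(complex^3 \<Rightarrow> complex) \<Rightarrow> bool" where
  "homogeneous f \<longleftrightarrow> continuous_on UNIV f \<and> (\<forall>c X. f (c *s X) = c * f X)"

lemma homogeneous_intros [simp]:
  "homogeneous (\<lambda>X. X $ i)" "homogeneous (\<lambda>X. X $ i - X $ j)"
  unfolding homogeneous_def by (auto intro!: continuous_intros simp: right_diff_distrib)

lemma dom_cone_scale:
  assumes "homogeneous f" "homogeneous g" "c \<noteq> 0" "X \<in> dom_cone i f g"
  shows "c *s X \<in> dom_cone i f g"
proof -
  have "10 * cmod (c * x) < cmod (c * y)" if "10 * cmod x < cmod y" for x y
    using mult_strict_left_mono[OF that, of "cmod c"] assms(3) by (simp add: norm_mult mult_ac)
  then show ?thesis using assms by (simp add: dom_cone_def homogeneous_def)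
qed

lemma zero_dom_cone: "0 \<notin> dom_cone i f g"
  by (simp add: dom_cone_def not_less)

lemma dom_cone_line:
  assumes "homogeneous f" "homogeneous g" "X \<noteq> 0"
  shows "line X \<in> line ` dom_cone i f g \<longleftrightarrow> X \<in> dom_cone i f g"
  by (rule line_in_cone[OF dom_cone_scale[OF assms(1,2)] zero_dom_cone assms(3)])

lemma open_dom_cone:
  assumes "homogeneous f" "homogeneous g"
  shows "open (line ` dom_cone i f g)"
proof (rule open_line_cone[OF dom_cone_scale[OF assms] zero_dom_cone])
  have "continuous_on UNIV f" "continuous_on UNIV g" using assms by (simp_all add: homogeneous_def)
  then show "open (dom_cone i f g)"
    unfolding dom_cone_def by (intro open_Collect_conj open_Collect_less continuous_intros)
qed

text \<open>A neighbourhood of the identity for pointwise convergence, given by four points in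
  general position. The coordinate points control the off-diagonal entries, and [1,1,1] compares the
  diagonal ones.\<close>

definition near_id :: "(cp2 \<Rightarrow> cp2) set" where
  "near_id = {f. f (line (vector [1,0,0])) \<in> line ` dom_cone 1 (\<lambda>X. X$2) (\<lambda>X. X$3) \<and>
     f (line (vector [0,1,0])) \<in> line ` dom_cone 2 (\<lambda>X. X$1) (\<lambda>X. X$3) \<and>
     f (line (vector [0,0,1])) \<in> line ` dom_cone 3 (\<lambda>X. X$1) (\<lambda>X. X$2) \<and>
     f (line (vector [1,1,1])) \<in> line ` dom_cone 1 (\<lambda>X. X$1 - X$2) (\<lambda>X. X$1 - X$3)}"

lemma open_near_id: "open near_id"
proof -
  have o: "open {f :: cp2 \<Rightarrow> cp2. f p \<in> U}" if "open U" for p U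
  proof -
    have "open ((\<lambda>f :: cp2 \<Rightarrow> cp2. f p) -` U)"
      by (rule open_vimage[OF that continuous_on_product_coordinates])
    then show ?thesis by (simp add: vimage_def)
  qed
  show ?thesis unfolding near_id_def
    by (intro open_Collect_conj o open_dom_cone homogeneous_intros)
qed

lemma id_near_id: "id \<in> near_id"
  unfolding near_id_def mem_Collect_eq id_apply
  by (intro conjI imageI) (simp_all add: dom_cone_def)

lemma continuous_right_translation:
  "continuous_on UNIV (\<lambda>f :: 'a \<Rightarrow> 'b::topological_space. f \<circ> g)"
  by (rule continuous_on_coordinatewise_then_product) (simp add: o_def)

text \<open>Right translation by the inverse of an element is continuous and moves that element to
  the identity.\<close>

lemma discrete_if_id_isolated:
  assumes G: "subgroup G Isom_H2C" and N: "open N" "\<And>f. f \<in> G \<Longrightarrow> f \<in> N \<Longrightarrow> f = id" "id \<in> N"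
  shows "discrete G"
proof (rule discreteI)
  fix f assume f: "f \<in> G"
  interpret I: group Isom_H2C by (rule group_Isom_H2C)
  interpret G: subgroup G Isom_H2C by fact
  define g where "g = inv\<^bsub>Isom_H2C\<^esub> f"
  have g: "g \<in> G" "f \<circ> g = id" "g \<circ> f = id"
    using f I.r_inv[of f] I.l_inv[of f] by (auto simp: g_def)
  show "f isolated_in G"
  proof (rule isolated_inI[OF f])
    show "open ((\<lambda>h. h \<circ> g) -` N)" by (rule open_vimage[OF N(1) continuous_right_translation])
    have eq: "h = f" if h: "h \<in> G" "h \<circ> g \<in> N" for h
    proof -
      have "h \<circ> g \<in> G" using G.m_closed[OF h(1) g(1)] by simp
      then have "h \<circ> g = id" using N(2) h(2) by blast
      then have "h \<circ> (g \<circ> f) = f" unfolding comp_assoc[symmetric] by simp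
      then show ?thesis by (simp add: g)
    qed
    have "f \<in> (\<lambda>h. h \<circ> g) -` N" using N(3) by (simp only: vimage_eq g(2))
    then show "(\<lambda>h. h \<circ> g) -` N \<inter> G = {f}" using f eq by blast
  qed
qed

context quadratic_order
begin

definition int_mat :: "complex^3^3 \<Rightarrow> bool" where
  "int_mat A \<longleftrightarrow> (\<forall>i j. A $ i $ j \<in> \<O>)"

lemma int_mat_nth [simp]: "int_mat A \<Longrightarrow> A $ i $ j \<in> \<O>"
  by (simp add: int_mat_def)

lemma int_mat_mult [simp]: "int_mat A \<Longrightarrow> int_mat B \<Longrightarrow> int_mat (A ** B)"
  unfolding int_mat_def mmm3 by simp

lemma int_mat_adjH [simp]: "int_mat A \<Longrightarrow> int_mat (adjH A)"
  unfolding int_mat_def adjH_def by simp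

lemma int_mat_1 [simp]: "int_mat (mat 1)"
  by (simp add: int_mat_def mat_def)

lemma PU21_O_eq: "PU21_O d = proj ` {A \<in> U21. int_mat A}"
  by (simp add: PU21_O_def ring_of_integers_eq int_mat_def)

text \<open>Each off-diagonal entry is below a tenth of the diagonal entry in its column. Unitarity
  then bounds the diagonal entries, of modulus at least 1, by 1.03, so the off-diagonal integers
  have modulus below 1 and vanish; the fourth point does the same for the differences of diagonal
  entries.\<close>

lemma integral_near_id:
  assumes A: "A \<in> U21" "int_mat A" and N: "proj A \<in> near_id"
  shows "proj A = id"
proof -
  have i: "invertible A" using A U21_invertible by blast
  have cols: "A *v vector [1,0,0] = vector [A$1$1, A$2$1, A$3$1]" "A *v vector [0,1,0] = vector [A$1$2, A$2$2, A$3$2]"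
    "A *v vector [0,0,1] = vector [A$1$3, A$2$3, A$3$3]" 
    by (simp_all add: vec3_eq_iff mvm3)
  have nz: "(vector [1,0,0] :: complex^3) \<noteq> 0" "(vector [0,1,0] :: complex^3) \<noteq> 0" "(vector [0,0,1] :: complex^3) \<noteq> 0"
    "(vector [1,1,1] :: complex^3) \<noteq> 0"
    by (auto simp: vec3_eq_iff)
  have "A *v vector [1,0,0] \<in> dom_cone 1 (\<lambda>X. X$2) (\<lambda>X. X$3)"
    "A *v vector [0,1,0] \<in> dom_cone 2 (\<lambda>X. X$1) (\<lambda>X. X$3)"
    "A *v vector [0,0,1] \<in> dom_cone 3 (\<lambda>X. X$1) (\<lambda>X. X$2)"
    "A *v vector [1,1,1] \<in> dom_cone 1 (\<lambda>X. X$1 - X$2) (\<lambda>X. X$1 - X$3)"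
    using N unfolding near_id_def mem_Collect_eq proj_line[OF i nz(1)] proj_line[OF i nz(2)] proj_line[OF i nz(3)] proj_line[OF i nz(4)]
      dom_cone_line[OF homogeneous_intros(1) homogeneous_intros(1) invertible_nonzero[OF i nz(1)]]
      dom_cone_line[OF homogeneous_intros(1) homogeneous_intros(1) invertible_nonzero[OF i nz(2)]]
      dom_cone_line[OF homogeneous_intros(1) homogeneous_intros(1) invertible_nonzero[OF i nz(3)]]
      dom_cone_line[OF homogeneous_intros(2) homogeneous_intros(2) invertible_nonzero[OF i nz(4)]]
    by (simp_all only: simp_thms)
  then have n: "10 * cmod (A$2$1) < cmod (A$1$1)" "10 * cmod (A$3$1) < cmod (A$1$1)"
     "10 * cmod (A$1$2) < cmod (A$2$2)" "10 * cmod (A$3$2) < cmod (A$2$2)"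
     "10 * cmod (A$1$3) < cmod (A$3$3)" "10 * cmod (A$2$3) < cmod (A$3$3)"
     "10 * cmod ((A *v vector [1,1,1])$1 - (A *v vector [1,1,1])$2) < cmod ((A *v vector [1,1,1])$1)"
     "10 * cmod ((A *v vector [1,1,1])$1 - (A *v vector [1,1,1])$3) < cmod ((A *v vector [1,1,1])$1)"
    unfolding dom_cone_def mem_Collect_eq cols vector_3 by (simp_all only: simp_thms)
  have nz0: "y \<noteq> 0" if "10 * cmod x < cmod y" for x y :: complex
    by (intro notI) (use that norm_ge_zero[of x] in simp)
  have d0: "A$1$1 \<noteq> 0" "A$2$2 \<noteq> 0" "A$3$3 \<noteq> 0" by (rule nz0[OF n(1)], rule nz0[OF n(3)], rule nz0[OF n(5)])
  have d1: "cmod (A$1$1) \<ge> 1" "cmod (A$2$2) \<ge> 1" "cmod (A$3$3) \<ge> 1"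
    using O_discrete[OF int_mat_nth[OF A(2)] d0(1)] O_discrete[OF int_mat_nth[OF A(2)] d0(2)]
      O_discrete[OF int_mat_nth[OF A(2)] d0(3)] by simp_all
  have "(adjH A ** A) $ 3 $ 3 = 1" "(adjH A ** A) $ 2 $ 2 = 1" using adjH_mult[OF A(1)] by (simp_all add: mat_1_3)
  then have e: "cnj (A$3$1) * A$1$3 + cnj (A$2$1) * A$2$3 + cnj (A$1$1) * A$3$3 = 1"
     "cnj (A$3$2) * A$1$2 + cnj (A$2$2) * A$2$2 + cnj (A$1$2) * A$3$2 = 1"
    by (simp_all add: mmm3)
  \<comment> \<open>The hypotheses give P <= 1 + P/50, hence P <= 50/49.\<close>
  have bound: "P \<le> 103/100" if "z1 + z2 + z3 = 1" "cmod z1 \<le> 1/100 * P" "cmod z2 \<le> 1/100 * P" "cmod z3 = P" for z1 z2 z3 :: complex and P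
  proof -
    have z3: "z3 = 1 - z1 - z2" using that(1) by (simp add: algebra_simps)
    have "cmod z3 \<le> 1 + cmod z1 + cmod z2"
      unfolding z3 using norm_triangle_ineq4[of "1 - z1" z2] norm_triangle_ineq4[of 1 z1] by simp
    then have "P \<le> 1 + cmod z1 + cmod z2" using that(4) by simp
    then show ?thesis using that(2,3) by simp
  qed
  have sm: "x * y \<le> 1/100 * (a * b)" if "10 * x < a" "10 * y < b" "0 \<le> x" "0 \<le> y" for x y a b :: real
  proof -
    have "x * y \<le> (1/10 * a) * (1/10 * b)" using that by (intro mult_mono) auto
    then show ?thesis by simp
  qed
  have b13: "cmod (A$1$1) * cmod (A$3$3) \<le> 103/100"
    using sm[OF n(2,5)] sm[OF n(1,6)] by (intro bound[OF e(1)]) (simp_all only: norm_mult complex_mod_cnj norm_ge_zero)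
  have "cmod (A$2$2) * cmod (A$2$2) \<le> 103/100"
    using sm[OF n(4,3)] sm[OF n(3,4)] e(2)
    by (intro bound[of "cnj (A$3$2) * A$1$2" "cnj (A$1$2) * A$3$2" "cnj (A$2$2) * A$2$2"])
      (simp_all only: norm_mult complex_mod_cnj norm_ge_zero add_ac)
  then have b2: "cmod (A$2$2) \<le> 103/100" using mult_left_mono[OF d1(2), of "cmod (A$2$2)"] by simp
  have b1: "cmod (A$1$1) \<le> 103/100" "cmod (A$3$3) \<le> 103/100"
    using b13 mult_left_mono[OF d1(3), of "cmod (A$1$1)"] mult_right_mono[OF d1(1), of "cmod (A$3$3)"] by simp_all
  have z: "x = 0" if "x \<in> \<O>" "cmod x < 1" for x using O_discrete[OF that(1)] that(2) by (meson not_less)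
  have zz: "x = 0" if "10 * cmod x < P" "P \<le> 103/100" "x \<in> \<O>" for x P
    by (rule z[OF that(3)]) (use that in linarith)
  note iA = int_mat_nth[OF A(2)]
  have off: "A$2$1 = 0" "A$3$1 = 0" "A$1$2 = 0" "A$3$2 = 0" "A$1$3 = 0" "A$2$3 = 0"
    by (rule zz[OF n(1) b1(1) iA], rule zz[OF n(2) b1(1) iA], rule zz[OF n(3) b2 iA], rule zz[OF n(4) b2 iA],
        rule zz[OF n(5) b1(2) iA], rule zz[OF n(6) b1(2) iA])
  have "A *v vector [1,1,1] = vector [A$1$1, A$2$2, A$3$3]" by (simp add: vec3_eq_iff mvm3 off)
  then have n1: "(A *v vector [1,1,1])$1 = A$1$1" "(A *v vector [1,1,1])$2 = A$2$2" "(A *v vector [1,1,1])$3 = A$3$3"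
    by simp_all
  note n' = n(7,8)[unfolded n1]
  have "A$1$1 - A$2$2 = 0" "A$1$1 - A$3$3 = 0"
    by (rule zz[OF n'(1) b1(1) O_diff[OF iA iA]], rule zz[OF n'(2) b1(1) O_diff[OF iA iA]])
  then have dg: "A$2$2 = A$1$1" "A$3$3 = A$1$1" by (simp_all only: right_minus_eq)
  have As: "A = smat (A$1$1) (mat 1)" by (simp add: mat3_eq_iff off mat_1_3 dg)
  have "cnj (A$2$2) * A$2$2 = 1" using e(2) by (simp add: off)
  then have "cmod (cnj (A$2$2) * A$2$2) = cmod 1" by (rule arg_cong)
  then have "(cmod (A$2$2))\<^sup>2 = 1" by (simp only: norm_mult complex_mod_cnj power2_eq_square norm_one)
  then have "cmod (A$1$1) = 1" using norm_ge_zero[of "A$2$2"] by (simp only: power2_eq_1_iff dg) linarith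
  then have p1: "proj (smat (A$1$1) (mat 1)) = proj (mat 1)" by (rule proj_smat[OF U21_one])
  have "proj A = proj (smat (A$1$1) (mat 1))" by (rule arg_cong[OF As])
  also note p1
  also note proj_one
  finally show ?thesis .
qed

end

section \<open>Power-bounded integral matrices\<close>

text \<open>If Y = (A - w) Z is killed by A - w, then A^k Z = w^k Z + k w^(k-1) Y, which grows
  linearly unless Y = 0.\<close>

lemma unit_eigenvalue_semisimple:
  fixes A :: "complex^3^3"
  assumes bd: "\<And>k. norm (((*v) A ^^ k) Z) \<le> C" and w: "cmod w = 1"
    and sq: "A *v (A *v Z - w *s Z) = w *s (A *v Z - w *s Z)"
  shows "A *v Z = w *s Z"
proof -
  define Y where "Y = A *v Z - w *s Z"
  have AZ: "A *v Z = w *s Z + Y" by (simp add: Y_def)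
  have AY: "A *v Y = w *s Y" using sq by (simp add: Y_def)
  \<comment> \<open>Multiplied by w, so that the exponent k - 1 does not occur at k = 0.\<close>
  have p: "w *s ((*v) A ^^ k) Z = w ^ Suc k *s Z + (of_nat k * w ^ k) *s Y" for k
  proof (induction k)
    case (Suc k)
    have "w *s ((*v) A ^^ Suc k) Z = A *v (w *s ((*v) A ^^ k) Z)" by (simp add: vector_scalar_commute)
    also have "\<dots> = w ^ Suc k *s (w *s Z + Y) + (of_nat k * w ^ k) *s (w *s Y)"
      unfolding Suc by (simp only: matrix_vector_right_distrib vector_scalar_commute AZ AY)
    also have "\<dots> = w ^ Suc (Suc k) *s Z + (of_nat (Suc k) * w ^ Suc k) *s Y"
      by (simp add: vec3_eq_iff algebra_simps)
    finally show ?case .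
  qed (simp add: vec3_eq_iff)
  have ns: "norm (c *s X) = cmod c * norm X" for c and X :: "complex^3"
    by (simp add: norm_vec_def norm_mult L2_set_right_distrib)
  have le: "real k * norm Y \<le> C + norm Z" for k
  proof -
    have "(of_nat k * w ^ k) *s Y = w *s ((*v) A ^^ k) Z - w ^ Suc k *s Z" using p[of k] by simp
    then have "norm ((of_nat k * w ^ k) *s Y) \<le> norm (w *s ((*v) A ^^ k) Z) + norm (w ^ Suc k *s Z)"
      by (metis norm_triangle_ineq4)
    then have "real k * norm Y \<le> norm (((*v) A ^^ k) Z) + norm Z" 
      unfolding ns by (simp add: norm_mult norm_power w)
    then show ?thesis using bd[of k] by linarith
  qed
  have "norm Y = 0"
  proof (rule ccontr)
    assume "norm Y \<noteq> 0"
    then have "0 < norm Y" by simp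
    from reals_Archimedean3[OF this] obtain k :: nat where "C + norm Z < real k * norm Y" by blast
    then show False using le[of k] by linarith
  qed
  then show ?thesis using AZ by simp
qed

lemma matpow_diff_smult:
  fixes A :: "complex^3^3"
  shows "((*v) A ^^ k) (X - c *s Y) = ((*v) A ^^ k) X - c *s ((*v) A ^^ k) Y"
  by (induction k) (simp_all add: matrix_vector_mult_diff_distrib vector_scalar_commute)

lemma norm_smult3: "norm (c *s X) = cmod c * norm (X :: complex^3)"
  by (simp add: norm_vec_def norm_mult L2_set_right_distrib)

context quadratic_order
begin

definition int_vec :: "complex^3 \<Rightarrow> bool" where
  "int_vec X \<longleftrightarrow> (\<forall>i. X $ i \<in> \<O>)"

text \<open>The sum of the norms of \<open>A^k X\<close> over a period is an \<open>A\<close>-invariant norm.\<close>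

lemma torsion_semisimple:
  fixes A :: "complex^3^3" and m n :: nat
  defines "Q \<equiv> \<lambda>w X. A *v X - w *s X"
  assumes m: "m > 0" and per: "\<And>X. ((*v) A ^^ m) X = l *s X" "cmod l = 1"
    and u: "cmod u = 1" and n: "n > 8"
    and cong: "\<And>X. int_vec X \<Longrightarrow> \<exists>Y. int_vec Y \<and> Q 1 (Q 1 (Q u X)) = of_nat n *s Y"
    and X: "int_vec X"
  shows "Q 1 (Q u X) = 0"
proof -
  define nrm where "nrm X = (\<Sum>k<m. norm (((*v) A ^^ k) X))" for X
  have nrm0: "nrm X \<ge> 0" for X unfolding nrm_def by (rule sum_nonneg) simp
  have nA: "nrm (A *v X) = nrm X" for X
  proof -
    have "nrm (A *v X) = (\<Sum>k<m. norm (((*v) A ^^ Suc k) X))" by (simp add: nrm_def funpow_Suc_right del: funpow.simps)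
    also have "\<dots> = (\<Sum>k<Suc m. norm (((*v) A ^^ k) X)) - norm X"
      by (subst sum.lessThan_Suc_shift) simp
    \<comment> \<open>The term entering at the end of the sum is A^m X = l X, of the same norm as
      the term X that leaves it.\<close>
    also have "\<dots> = nrm X" by (simp add: nrm_def per norm_smult3)
    finally show ?thesis .
  qed
  have nd: "nrm (X - c *s Y) \<le> nrm X + cmod c * nrm Y" for X c Y
  proof -
    have "nrm (X - c *s Y) \<le> (\<Sum>k<m. norm (((*v) A ^^ k) X) + cmod c * norm (((*v) A ^^ k) Y))"
      unfolding nrm_def
    proof (rule sum_mono)
      fix k
      show "norm (((*v) A ^^ k) (X - c *s Y)) \<le> norm (((*v) A ^^ k) X) + cmod c * norm (((*v) A ^^ k) Y)"
        unfolding matpow_diff_smult norm_smult3[symmetric] by (rule norm_triangle_ineq4)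
    qed
    then show ?thesis by (simp add: nrm_def sum.distrib sum_distrib_left)
  qed
  have nQ: "nrm (Q w X) \<le> 2 * nrm X" if "cmod w = 1" for w X
    using nd[of "A *v X" w X] that by (simp add: Q_def nA)
  have le_nrm: "norm X \<le> nrm X" for X
  proof -
    have "norm (((*v) A ^^ 0) X) \<le> nrm X" unfolding nrm_def by (rule member_le_sum) (use m in auto)
    then show ?thesis by simp
  qed
  have pow: "nrm (((*v) A ^^ k) X) = nrm X" for k X by (induction k) (simp_all add: nA)
  have bd: "norm (((*v) A ^^ k) X) \<le> nrm X" for k X using le_nrm[of "((*v) A ^^ k) X"] pow[of k X] by simp
  have ss: "Q w Z = 0" if "cmod w = 1" "Q w (Q w Z) = 0" for w Z
    using unit_eigenvalue_semisimple[OF bd that(1), of Z] that(2) by (simp add: Q_def)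
  have comm: "Q w (Q w' Z) = Q w' (Q w Z)" for w w' Z
    by (simp add: Q_def matrix_vector_mult_diff_distrib vector_scalar_commute vec3_eq_iff algebra_simps)
  have hom: "Q w (c *s Z) = c *s Q w Z" for w c Z
    by (simp add: Q_def vector_scalar_commute vec3_eq_iff algebra_simps)
  have Q0: "Q w 0 = 0" for w by (simp add: Q_def)
  \<comment> \<open>Three factors, each expanding the invariant norm at most by 2, against
    divisibility by n > 8 on integral vectors: N^j X is n^j times an integral vector of norm at most
    (8/n)^j nrm X, which is zero for large j.\<close>
  define N where "N Z = Q 1 (Q 1 (Q u Z))" for Z
  have Nj: "\<exists>Y. int_vec Y \<and> (N ^^ j) X = (of_nat n) ^ j *s Y" for j
  proof (induction j)
    case 0
    then show ?case using X by (intro exI[of _ X]) simp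
  next
    case (Suc j)
    then obtain Y where Y: "int_vec Y" "(N ^^ j) X = (of_nat n) ^ j *s Y" by blast
    obtain Y' where Y': "int_vec Y'" "N Y = of_nat n *s Y'" using cong[OF Y(1)] unfolding N_def by blast
    have "(N ^^ Suc j) X = (of_nat n) ^ j *s N Y" by (simp add: Y(2)) (simp add: N_def hom)
    then have "(N ^^ Suc j) X = (of_nat n) ^ Suc j *s Y'" by (simp add: Y' vector_smult_assoc mult.commute)
    then show ?case using Y'(1) by blast
  qed
  have nN: "nrm ((N ^^ j) X) \<le> 8 ^ j * nrm X" for j
  proof (induction j)
    case (Suc j)
    have "nrm (N Z) \<le> 8 * nrm Z" for Z
      using nQ[of 1 "Q 1 (Q u Z)"] nQ[of 1 "Q u Z"] nQ[OF u, of Z] by (simp add: N_def)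
    from this[of "(N ^^ j) X"] show ?case using Suc by simp
  qed simp
  have "\<exists>j. (N ^^ j) X = 0"
  proof -
    have "0 < 1 / (nrm X + 1)" "8 / real n < 1" using nrm0[of X] n by simp_all
    from real_arch_pow_inv[OF this] obtain j where "(8 / real n) ^ j < 1 / (nrm X + 1)" by blast
    then have "(8 / real n) ^ j * (nrm X + 1) < 1" using nrm0[of X] by (simp add: pos_less_divide_eq)
    moreover have "(8 / real n) ^ j * nrm X \<le> (8 / real n) ^ j * (nrm X + 1)"
      by (rule mult_left_mono) simp_all
    ultimately have j: "(8 / real n) ^ j * nrm X < 1" by linarith
    obtain Y where Y: "int_vec Y" "(N ^^ j) X = (of_nat n) ^ j *s Y" using Nj by blast
    have "real n ^ j * norm Y = norm ((N ^^ j) X)" unfolding Y(2) norm_smult3 by (simp add: norm_power)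
    also have "\<dots> \<le> 8 ^ j * nrm X" using le_nrm[of "(N ^^ j) X"] nN[of j] by simp
    finally have "norm Y \<le> (8 / real n) ^ j * nrm X" using n by (simp add: power_divide field_simps)
    then have nY: "norm Y < 1" using j by linarith
    have "Y $ i = 0" for i
    proof (rule ccontr)
      assume "Y $ i \<noteq> 0"
      then have "1 \<le> cmod (Y $ i)" using O_discrete Y(1) by (simp add: int_vec_def)
      moreover have "cmod (Y $ i) \<le> norm Y" by (rule Finite_Cartesian_Product.norm_nth_le)
      ultimately show False using nY by linarith
    qed
    then have "Y = 0" by (simp add: vec_eq_iff)
    then show ?thesis using Y(2) by (intro exI[of _ j]) simp
  qed
  then obtain j where j: "(N ^^ j) X = 0" by blast
  \<comment> \<open>Each application of \<open>N\<close> adds repeated factors A - 1 and A - u;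
    semisimplicity strips them down to one of each.\<close>
  have "Q 1 (Q u Z) = 0" if "(N ^^ j) Z = 0" for Z j
    using that
  proof (induction j arbitrary: Z)
    case 0
    then show ?case by (simp add: Q0)
  next
    case (Suc j)
    have "(N ^^ j) (N Z) = 0" using Suc.prems by (simp add: funpow_Suc_right del: funpow.simps)
    then have "Q 1 (Q u (N Z)) = 0" by (rule Suc.IH)
    then have "Q 1 (Q 1 (Q 1 (Q u (Q u Z)))) = 0" unfolding N_def by (simp only: comm[of u 1])
    then have "Q 1 (Q u (Q u Z)) = 0" by (rule ss[OF norm_one ss[OF norm_one]])
    then have "Q u (Q u (Q 1 Z)) = 0" by (simp only: comm[of u 1])
    then have "Q u (Q 1 Z) = 0" by (rule ss[OF u])
    then show ?case by (simp only: comm[of u 1])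
  qed
  then show ?thesis using j by blast
qed

section \<open>Congruences in the ring of integers, and torsion elements congruent to
  parabolics\<close>

definition cg :: "nat \<Rightarrow> complex \<Rightarrow> complex \<Rightarrow> bool" where
  "cg n x y \<longleftrightarrow> x \<in> \<O> \<and> y \<in> \<O> \<and> (\<exists>w\<in>\<O>. x = y + of_nat n * w)"

lemma cgI: "x \<in> \<O> \<Longrightarrow> y \<in> \<O> \<Longrightarrow> w \<in> \<O> \<Longrightarrow> x = y + of_nat n * w \<Longrightarrow> cg n x y"
  by (auto simp: cg_def)

lemma cgE: assumes "cg n x y" obtains w where "x \<in> \<O>" "y \<in> \<O>" "w \<in> \<O>" "x = y + of_nat n * w"
  using assms by (auto simp: cg_def)

lemma cg_refl: "x \<in> \<O> \<Longrightarrow> cg n x x"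
  by (rule cgI[of _ _ 0]) simp_all

lemma cg_sym: "cg n x y \<Longrightarrow> cg n y x"
  by (erule cgE, rule_tac w = "- w" in cgI) simp_all

lemma cg_trans: "cg n x y \<Longrightarrow> cg n y z \<Longrightarrow> cg n x z"
  by (elim cgE, rule_tac w = "w + wa" in cgI) (simp_all add: algebra_simps)

lemma cg_add: "cg n x y \<Longrightarrow> cg n x' y' \<Longrightarrow> cg n (x + x') (y + y')"
  by (elim cgE, rule_tac w = "w + wa" in cgI) (simp_all add: algebra_simps)

lemma cg_diff: "cg n x y \<Longrightarrow> cg n x' y' \<Longrightarrow> cg n (x - x') (y - y')"
  by (elim cgE, rule_tac w = "w - wa" in cgI) (simp_all add: algebra_simps)

lemma cg_mult:
  assumes "cg n x y" "cg n x' y'" shows "cg n (x * x') (y * y')"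
proof -
  obtain w where w: "x \<in> \<O>" "y \<in> \<O>" "w \<in> \<O>" "x = y + of_nat n * w" using assms(1) by (rule cgE)
  obtain w' where w': "x' \<in> \<O>" "y' \<in> \<O>" "w' \<in> \<O>" "x' = y' + of_nat n * w'" using assms(2) by (rule cgE)
  have "x * x' = y * y' + of_nat n * (y * w' + w * x')" unfolding w(4) w'(4) by (simp add: algebra_simps)
  then show ?thesis by (intro cgI[of _ _ "y * w' + w * x'"]) (simp_all add: w(1-3) w'(1-3))
qed

lemma cg_cnj: "cg n x y \<Longrightarrow> cg n (cnj x) (cnj y)"
  by (erule cgE, rule_tac w = "cnj w" in cgI) simp_all

lemma cg_close:
  assumes "cg n x y" "cmod (x - y) < real n" shows "x = y"
proof -
  obtain w where w: "w \<in> \<O>" "x = y + of_nat n * w" using assms(1) by (rule cgE)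
  have "real n * cmod w < real n" using assms(2) by (simp add: w norm_mult)
  then have "cmod w < 1" by (cases "n = 0") simp_all
  then have "w = 0" using O_discrete[OF w(1)] by linarith
  then show ?thesis by (simp add: w)
qed

definition mcg :: "nat \<Rightarrow> complex^3^3 \<Rightarrow> complex^3^3 \<Rightarrow> bool" where
  "mcg n A B \<longleftrightarrow> (\<forall>i j. cg n (A $ i $ j) (B $ i $ j))"

lemma mcgD: "mcg n A B \<Longrightarrow> cg n (A $ i $ j) (B $ i $ j)"
  by (simp add: mcg_def)

lemma mcg_refl: "int_mat A \<Longrightarrow> mcg n A A"
  by (simp add: mcg_def cg_refl)

lemma mcg_sym: "mcg n A B \<Longrightarrow> mcg n B A"
  by (simp add: mcg_def cg_sym)

lemma mcg_int: "mcg n A B \<Longrightarrow> int_mat A" "mcg n A B \<Longrightarrow> int_mat B"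
  by (simp_all add: mcg_def int_mat_def cg_def)

lemma mcg_mult: "mcg n A B \<Longrightarrow> mcg n A' B' \<Longrightarrow> mcg n (A ** A') (B ** B')"
  unfolding mcg_def mmm3 by (simp add: cg_add cg_mult)

lemma mcg_adjH: "mcg n A B \<Longrightarrow> mcg n (adjH A) (adjH B)"
  unfolding mcg_def adjH_def by (simp add: cg_cnj)

definition vcg :: "nat \<Rightarrow> complex^3 \<Rightarrow> complex^3 \<Rightarrow> bool" where
  "vcg n X Y \<longleftrightarrow> (\<forall>i. cg n (X $ i) (Y $ i))"

lemma vcg_mult: "mcg n A B \<Longrightarrow> vcg n X Y \<Longrightarrow> vcg n (A *v X) (B *v Y)"
  unfolding mcg_def vcg_def mvm3 by (simp add: cg_add cg_mult)

lemma vcg_Q: "mcg n A B \<Longrightarrow> vcg n X Y \<Longrightarrow> w \<in> \<O> \<Longrightarrow> vcg n (A *v X - w *s X) (B *v Y - w *s Y)"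
  using vcg_mult[of n A B X Y] unfolding vcg_def by (simp add: cg_diff cg_mult cg_refl)

lemma vcg_0:
  assumes "vcg n X 0" shows "\<exists>Y. int_vec Y \<and> X = of_nat n *s Y"
proof -
  have "\<exists>w\<in>\<O>. X $ i = of_nat n * w" for i using assms by (auto simp: vcg_def cg_def)
  then obtain f where f: "f i \<in> \<O>" "X $ i = of_nat n * f i" for i by metis
  then show ?thesis by (intro exI[of _ "\<chi> i. f i"]) (simp add: int_vec_def vec_eq_iff)
qed

lemma heis_Q:
  "heis z t u *v X - u *s X = vector [(1 - u) * X$1 - cnj z * u * X$2 + hgt z t * X$3, z * X$3, (1 - u) * X$3]"
  by (simp add: vec3_eq_iff mvm3 algebra_simps)

text \<open>For B = \<open>heis z t u\<close> the product (B - 1)(B - u) has a single possibly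
  nonzero entry, in the upper right corner. For u other than 1 that entry measures the shift along
  the axis; one more factor B - 1 kills it.\<close>

lemma heis_QQ:
  "heis z t u *v (heis z t u *v X - u *s X) - 1 *s (heis z t u *v X - u *s X) =
     vector [((1 - u) * hgt z t - u * (z * cnj z)) * X$3, 0, 0]"
  unfolding heis_Q by (simp add: vec3_eq_iff mvm3 algebra_simps)

text \<open>A torsion element congruent to a parabolic element of rotational part \<open>u\<close> satisfies
  \<open>(A - 1) (A - u) = 0\<close>; reading this modulo \<open>n\<close> bounds the vertical part of the parabolic.\<close>

lemma torsion_congruent_heis:
  fixes m n :: nat
  assumes cong: "mcg n A (heis z t u)" and u: "cmod u = 1" and n: "n > 8"
    and m: "m > 0" and per: "\<And>X. ((*v) A ^^ m) X = l *s X" "cmod l = 1"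
  shows "u = 1 \<Longrightarrow> A = mat 1" "cg n ((1 - u) * hgt z t - u * (z * cnj z)) 0"
proof -
  define Q where "Q w X = A *v X - w *s X" for w X
  define B where "B = heis z t u"
  have B: "mcg n A B" using cong by (simp add: B_def)
  have uO: "u \<in> \<O>" using int_mat_nth[OF mcg_int(2)[OF cong], of 2 2] by simp
  have vr: "vcg n X X" if "int_vec X" for X using that by (simp add: vcg_def int_vec_def cg_refl)
  have Q2: "vcg n (Q 1 (Q u X)) (vector [((1 - u) * hgt z t - u * (z * cnj z)) * X$3, 0, 0])" if "int_vec X" for X
    unfolding Q_def heis_QQ[symmetric] B_def[symmetric]
    by (intro vcg_Q[OF B] vr that uO O_1)
  have c: "\<exists>Y. int_vec Y \<and> Q 1 (Q 1 (Q u X)) = of_nat n *s Y" if X: "int_vec X" for X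
  proof (rule vcg_0)
    have "vcg n (A *v Q 1 (Q u X) - 1 *s Q 1 (Q u X))
       (B *v (vector [((1 - u) * hgt z t - u * (z * cnj z)) * X$3, 0, 0]) - 1 *s vector [((1 - u) * hgt z t - u * (z * cnj z)) * X$3, 0, 0])"
      by (rule vcg_Q[OF B Q2[OF X] O_1])
    also have "(B *v (vector [((1 - u) * hgt z t - u * (z * cnj z)) * X$3, 0, 0]) - 1 *s vector [((1 - u) * hgt z t - u * (z * cnj z)) * X$3, 0, 0]) = 0"
      by (simp add: B_def vec3_eq_iff mvm3)
    finally show "vcg n (Q 1 (Q 1 (Q u X))) 0" by (simp only: Q_def)
  qed
  have z: "Q 1 (Q u X) = 0" if "int_vec X" for X
    using torsion_semisimple[OF m per(1) per(2) u n _ that] c unfolding Q_def by blast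
  have iv: "int_vec (vector [1,0,0])" "int_vec (vector [0,1,0])" "int_vec (vector [0,0,1])"
    by (simp_all add: int_vec_def forall_3)
  show "cg n ((1 - u) * hgt z t - u * (z * cnj z)) 0"
    using Q2[OF iv(3)] unfolding z[OF iv(3)] by (simp add: vcg_def forall_3 cg_sym)
  \<comment> \<open>Now (A - 1)^2 vanishes on integral vectors, and the powers of A are bounded
    because they are periodic up to unit scalars; so A - 1 vanishes too.\<close>
  show "A = mat 1" if "u = 1"
  proof -
    have bd: "\<exists>C. \<forall>k. norm (((*v) A ^^ k) Z) \<le> C" for Z
    proof -
      have k: "norm (((*v) A ^^ (q * m + r)) Z) = norm (((*v) A ^^ r) Z)" for q r
      proof (induction q)
        case (Suc q)
        have "((*v) A ^^ (Suc q * m + r)) Z = ((*v) A ^^ m) (((*v) A ^^ (q * m + r)) Z)"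
          by (simp add: funpow_add add.assoc)
        then show ?case using Suc by (simp add: per norm_smult3)
      qed simp
      have "norm (((*v) A ^^ k) Z) \<le> (\<Sum>r<m. norm (((*v) A ^^ r) Z))" for k
      proof -
        have "norm (((*v) A ^^ k) Z) = norm (((*v) A ^^ (k mod m)) Z)" using k[of "k div m" "k mod m"] by simp
        also have "\<dots> \<le> (\<Sum>r<m. norm (((*v) A ^^ r) Z))"
          by (rule member_le_sum[where f = "\<lambda>r. norm (((*v) A ^^ r) Z)"]) (use m in simp_all)
        finally show ?thesis .
      qed
      then show ?thesis by blast
    qed
    have fx: "A *v X = X" if X: "int_vec X" for X
    proof -
      obtain C where C: "norm (((*v) A ^^ k) X) \<le> C" for k using bd by blast
      have "A *v (A *v X - 1 *s X) = 1 *s (A *v X - 1 *s X)" using z[OF X] \<open>u = 1\<close> by (simp add: Q_def)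
      then have "A *v X = 1 *s X" by (rule unit_eigenvalue_semisimple[OF C, rotated]) simp
      then show ?thesis by simp
    qed
    show ?thesis using fx[OF iv(1)] fx[OF iv(2)] fx[OF iv(3)]
      by (simp add: mat3_eq_iff vec3_eq_iff mvm3 mat_1_3)
  qed
qed

end

section \<open>Elements fixing the point at infinity\<close>

lemma proj_funpow:
  assumes "A \<in> U21"
  obtains M where "M \<in> U21" "proj M = proj A ^^ k" "\<And>X. M *v X = ((*v) A ^^ k) X"
proof -
  have "\<exists>M\<in>U21. proj M = proj A ^^ k \<and> (\<forall>X. M *v X = ((*v) A ^^ k) X)"
  proof (induction k)
    case 0
    show ?case by (rule bexI[OF _ U21_one]) (simp add: proj_one)
  next
    case (Suc k)
    then obtain M where M: "M \<in> U21" "proj M = proj A ^^ k" "\<forall>X. M *v X = ((*v) A ^^ k) X" by blast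
    show ?case
      by (rule bexI[OF _ U21_mult[OF assms M(1)]])
        (simp add: proj_mult[OF assms M(1), symmetric] M(2,3) matrix_vector_mul_assoc[symmetric])
  qed
  then show ?thesis using that by blast
qed

lemma U21_fixing_infinity:
  assumes A: "A \<in> U21" and f: "proj A (line infinity) = line infinity"
  obtains l m u where "A$1$1 = l" "A$2$1 = 0" "A$3$1 = 0" "A$3$2 = 0" "A$3$3 = m" "l * cnj m = 1"
    "A$2$2 = u" "cmod u = 1"
proof -
  have i: "invertible A" using A by (rule U21_invertible)
  have "line infinity = line (A *v infinity)" using f by (simp add: proj_line[OF i infinity_nonzero])
  then obtain c where c: "A *v infinity = c *s infinity"
    using line_eq_iff[OF infinity_nonzero invertible_nonzero[OF i infinity_nonzero]] by auto
  have col: "A$1$1 = c" "A$2$1 = 0" "A$3$1 = 0" using c by (simp_all add: vec3_eq_iff mvm3)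
  note E = adjH_mult[OF A, unfolded mat3_eq_iff mmm3 mat_1_3 adjH_nth]
  have e: "cnj (A$3$3) * c = 1" "cnj c * A$3$2 = 0" "cnj c * A$3$3 = 1"
    using E by (simp_all add: col)
  then have 32: "A$3$2 = 0" by auto
  have "cnj (A$2$2) * A$2$2 = 1" using E by (simp add: 32)
  then have "cmod (cnj (A$2$2) * A$2$2) = cmod 1" by (rule arg_cong)
  then have "(cmod (A$2$2))\<^sup>2 = 1" by (simp only: norm_mult complex_mod_cnj power2_eq_square norm_one)
  then have u1: "cmod (A$2$2) = 1" using norm_ge_zero[of "A$2$2"] by (simp only: power2_eq_1_iff) linarith
  have "c * cnj (A$3$3) = 1" using e(1) by (simp add: mult.commute)
  then show ?thesis by (rule that[OF col 32 HOL.refl _ HOL.refl u1])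
qed

text \<open>Unitarity expresses the (1,2) entry through the second row, and the real part of the
  corner entry through |z|^2.\<close>

lemma unipotent_to_heis:
  assumes A: "A \<in> U21" and c: "A$1$1 = 1" "A$2$1 = 0" "A$3$1 = 0" "A$3$2 = 0" "A$3$3 = 1"
  shows "A = heis (A$2$3) (2 * Im (A$1$3)) (A$2$2)"
proof -
  note E = adjH_mult[OF A, unfolded mat3_eq_iff mmm3 mat_1_3 adjH_nth]
  have e: "cnj (A$2$3) * A$2$2 + A$1$2 = 0" "cnj (A$1$3) + cnj (A$2$3) * A$2$3 + A$1$3 = 0"
    using E by (simp_all add: c add_ac)
  have "\<i> * of_real (2 * Im (A$1$3)) = A$1$3 - cnj (A$1$3)" by (simp add: complex_eq_iff)
  then have "hgt (A$2$3) (2 * Im (A$1$3)) = (- (A$2$3 * cnj (A$2$3)) + (A$1$3 - cnj (A$1$3))) / 2"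
    unfolding hgt_def by simp
  also have "A$2$3 * cnj (A$2$3) = - A$1$3 - cnj (A$1$3)" using e(2) by (simp add: algebra_simps eq_neg_iff_add_eq_0)
  finally have "hgt (A$2$3) (2 * Im (A$1$3)) = A$1$3" by simp
  moreover have "A$1$2 = - (cnj (A$2$3) * A$2$2)" using e(1) by (simp add: eq_neg_iff_add_eq_0 add.commute)
  ultimately show ?thesis by (simp add: mat3_eq_iff c)
qed

text \<open>An eigenvector with nonzero third coordinate would have eigenvalue 1, which the nonzero
  corner entry excludes. So all fixed points lie on the line X$3 = 0, tangent to the boundary at
  infinity; it contains one null line and no negative line.\<close>

lemma vertical_parabolic:
  assumes "h \<noteq> 0"
  shows "is_parabolic (proj (heis 0 h 1))" "proj (heis 0 h 1) (line infinity) = line infinity"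
    "line infinity \<in> boundary_H2C"
proof -
  have U: "heis 0 h 1 \<in> U21" by (rule heis_U21) simp
  then have i: "invertible (heis 0 h 1)" by (rule U21_invertible)
  have hn: "hgt 0 h \<noteq> 0" using assms by (simp add: hgt_def)
  have fx: "X$3 = 0" if X: "X \<noteq> 0" and eq: "proj (heis 0 h 1) (line X) = line X" for X
  proof -
    have "line X = line (heis 0 h 1 *v X)" using eq by (simp add: proj_line[OF i X])
    then obtain c where c: "heis 0 h 1 *v X = c *s X"
      using line_eq_iff[OF X invertible_nonzero[OF i X]] by auto
    then have c3: "X$1 + hgt 0 h * X$3 = c * X$1" "X$3 = c * X$3" by (simp_all add: vec3_eq_iff mvm3)
    show ?thesis
    proof (rule ccontr)
      assume "X$3 \<noteq> 0"
      moreover then have "c = 1" using c3(2) by simp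
      ultimately show False using c3(1) hn by simp
    qed
  qed
  show inf: "proj (heis 0 h 1) (line infinity) = line infinity"
    using hyp_infinity[of 1 0 h False] by (simp add: hyp_def)
  have "herm infinity infinity = 0" by (simp add: herm_eq)
  then show bd: "line infinity \<in> boundary_H2C" unfolding boundary_H2C_def by (intro imageI) simp
  have uniq: "q = line infinity" if q: "q \<in> boundary_H2C" "proj (heis 0 h 1) q = q" for q
  proof -
    obtain X where X: "X \<noteq> 0" "herm X X = 0" "q = line X" using q(1) by (auto simp: boundary_H2C_def)
    have X3: "X$3 = 0" using fx[OF X(1)] q(2) X(3) by simp
    then have "X$2 = 0" using X(2) by (simp add: herm_eq)
    then have X1: "X = X$1 *s infinity" using X3 by (simp add: vec3_eq_iff)
    then have "X$1 \<noteq> 0" using X(1) by (metis vector_smult_lzero)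
    then have "line infinity = line X" using X1 line_eq_iff[OF infinity_nonzero X(1)] by auto
    then show ?thesis using X(3) by simp
  qed
  have neg: "proj (heis 0 h 1) p \<noteq> p" if p: "p \<in> H2C" for p
  proof
    assume eq: "proj (heis 0 h 1) p = p"
    obtain X where X: "Re (herm X X) < 0" "p = line X" using p by (auto simp: H2C_def)
    have X0: "X \<noteq> 0" using X(1) by (auto simp: herm_eq)
    have "X$3 = 0" using fx[OF X0] eq X(2) by simp
    then have "Re (herm X X) = (cmod (X$2))\<^sup>2" unfolding cmod_power2 by (simp add: herm_eq power2_eq_square)
    then show False using X(1) by simp
  qed
  show "is_parabolic (proj (heis 0 h 1))"
    unfolding is_parabolic_def
  proof (intro conjI ballI ex1I[of _ "line infinity"])
    show "proj (heis 0 h 1) \<in> carrier Isom_H2C" by (rule proj_in_Isom[OF U])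
  qed (use bd inf neg uniq in blast)+
qed

context quadratic_order
begin

text \<open>The integral trace between -2 and 2 determines the quadratic equation of u, and the root
  has order 1, 2, 3, 4 or 6.\<close>

lemma O_unit_pow12:
  assumes "u \<in> \<O>" "cmod u = 1" shows "u ^ 12 = 1"
proof -
  obtain n where n: "2 * Re u = of_int n" using O_trace[OF assms(1)] Ints_cases by blast
  have "\<bar>Re u\<bar> \<le> 1" using abs_Re_le_cmod[of u] assms(2) by simp
  then have "\<bar>real_of_int n\<bar> \<le> 2" using n by linarith
  then have "- 2 \<le> n" "n \<le> 2" by linarith+
  then have nn: "n = - 2 \<or> n = - 1 \<or> n = 0 \<or> n = 1 \<or> n = 2" by auto
  have "u * u = of_real (2 * Re u) * u - u * cnj u" by (simp add: complex_eq_iff algebra_simps)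
  then have uu: "u * u = of_int n * u - 1" unfolding n unit_cnj(1)[OF assms(2)] by simp
  have p12: "u ^ 12 = ((u * u) * u) * ((u * u) * u) * (((u * u) * u) * ((u * u) * u))"
    by (simp add: eval_nat_numeral mult.assoc)
  from nn show ?thesis
  proof (elim disjE)
    assume "n = - 2"
    then have e: "u * u = - 2 * u - 1" using uu by simp
    have "(u + 1) * (u + 1) = u * u + 2 * u + 1" by (simp add: algebra_simps)
    then have "(u + 1) * (u + 1) = 0" unfolding e by simp
    then have "u = - 1" by (simp add: eq_neg_iff_add_eq_0)
    then show ?thesis by simp
  next
    assume "n = 2"
    then have "(u - 1) * (u - 1) = 0" using uu by (simp add: algebra_simps)
    then show ?thesis by simp
  next
    assume "n = - 1"
    then have e: "u * u = - u - 1" using uu by simp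
    have "(u * u) * u = (- u - 1) * u" by (simp only: e)
    also have "\<dots> = - (u * u) - u" by (simp add: algebra_simps)
    also have "\<dots> = 1" by (simp add: e)
    finally have "(u * u) * u = 1" .
    then show ?thesis unfolding p12 by simp
  next
    assume "n = 0"
    then have e: "u * u = - 1" using uu by simp
    show ?thesis unfolding p12 e by (simp add: e)
  next
    assume "n = 1"
    then have e: "u * u = u - 1" using uu by simp
    have "(u * u) * u = (u - 1) * u" by (simp only: e)
    also have "\<dots> = u * u - u" by (simp add: algebra_simps)
    also have "\<dots> = - 1" by (simp add: e)
    finally have "(u * u) * u = - 1" .
    then show ?thesis unfolding p12 by simp
  qed
qed

end

text \<open>\<open>z0\<close> is the planar fixed point, and the given height is the one at which
  the screw motion does not translate along its axis.\<close>

lemma rotation_about_axis: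
  fixes z u :: complex
  assumes "u \<noteq> 1" "cmod u = 1"
  defines "z0 \<equiv> z / (1 - u)"
  shows "nil_iso z (2 * (cmod z0)\<^sup>2 * Im u) u False =
     nil_iso z0 0 1 False \<circ> nil_iso 0 0 u False \<circ> nil_iso (- z0) 0 1 False"
proof -
  have "(1 - u) * z0 = z" using assms(1) by (simp add: z0_def)
  then have z: "z = z0 - u * z0" by (simp add: algebra_simps)
  have "2 * Im (z0 * cnj (- (u * z0))) = 2 * ((Re z0)\<^sup>2 + (Im z0)\<^sup>2) * Im u"
    by (simp add: power2_eq_square algebra_simps)
  then have "2 * Im (z0 * cnj (u * (- z0))) = 2 * (cmod z0)\<^sup>2 * Im u"
    unfolding cmod_power2 mult_minus_right .
  then show ?thesis
    using assms(2) by (simp add: nil_iso_comp z del: complex_cnj_mult complex_cnj_minus)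
qed

lemma funpow_conj:
  assumes "T' \<circ> T = id" "T \<circ> T' = id"
  shows "(T \<circ> g \<circ> T') ^^ k = T \<circ> g ^^ k \<circ> T'"
proof (induction k)
  case (Suc k)
  have "(T \<circ> g \<circ> T') ^^ Suc k = T \<circ> g \<circ> T' \<circ> (T \<circ> g ^^ k \<circ> T')" by (simp only: funpow.simps Suc)
  also have "\<dots> = T \<circ> g \<circ> (T' \<circ> T) \<circ> g ^^ k \<circ> T'" by (simp only: comp_assoc)
  also have "\<dots> = T \<circ> g ^^ Suc k \<circ> T'" by (simp only: assms(1) funpow.simps comp_assoc id_comp)
  finally show ?case .
qed (simp add: assms)

lemma rotation_about_axis_pow:
  assumes "u \<noteq> 1" "cmod u = 1" "u ^ k = 1"
  shows "nil_iso z (2 * (cmod (z / (1 - u)))\<^sup>2 * Im u) u False ^^ k = id"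
proof -
  let ?z = "z / (1 - u)"
  have TT: "nil_iso (- w) 0 1 False \<circ> nil_iso w 0 1 False = id" "nil_iso w 0 1 False \<circ> nil_iso (- w) 0 1 False = id" for w
    by (simp_all add: nil_iso_comp nil_iso_eq_id)
  have "nil_iso 0 0 u False ^^ j = nil_iso 0 0 (u ^ j) False" for j
    using assms(2) by (induction j) (simp_all add: nil_iso_id nil_iso_comp)
  then show ?thesis
    unfolding rotation_about_axis[OF assms(1,2)] funpow_conj[OF TT] by (simp add: assms(3) nil_iso_id TT)
qed

section \<open>The congruence group of an integral cusp lattice\<close>

text \<open>The lattice after rescaling. Heights that are multiples of 2 sqrt d make i t / 2
  integral. The three translations listed at the end allow any sufficiently divisible translation to
  be recognised as an element of \<open>D\<close>.\<close>

locale cusp_lattice = quadratic_order +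
  fixes D :: "(nil \<Rightarrow> nil) set" and r :: nat and ta tb tc :: int
  assumes D: "subgroup D Isom_Nil"
    and form: "\<And>g. g \<in> D \<Longrightarrow> \<exists>z t u. cmod u = 1 \<and> g = nil_iso z t u False \<and> int_mat (heis z t u)"
    and tf: "\<And>g n. g \<in> D \<Longrightarrow> n > 0 \<Longrightarrow> g ^^ n = id \<Longrightarrow> g = id"
    and r: "r > 0" and tc: "tc \<noteq> 0"
    and Da: "nil_iso (of_nat r) (2 * sqrt d * ta) 1 False \<in> D"
    and Db: "nil_iso (of_nat r * v) (2 * sqrt d * tb) 1 False \<in> D"
    and Dc: "nil_iso 0 (2 * sqrt d * tc) 1 False \<in> D"
begin

definition DD :: "complex \<Rightarrow> real \<Rightarrow> complex \<Rightarrow> bool" where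
  "DD z t u \<longleftrightarrow> cmod u = 1 \<and> nil_iso z t u False \<in> D"

lemma DD_unit: "DD z t u \<Longrightarrow> cmod u = 1"
  by (simp add: DD_def)

lemma DD_int: "DD z t u \<Longrightarrow> int_mat (heis z t u)"
proof -
  assume DD: "DD z t u"
  then have u: "u \<noteq> 0" by (auto simp: DD_def)
  obtain z' t' u' where "nil_iso z t u False = nil_iso z' t' u' False" "int_mat (heis z' t' u')"
    using form[of "nil_iso z t u False"] DD by (auto simp: DD_def)
  then show ?thesis using nil_iso_inject[OF u] by auto
qed

lemma DD_mult:
  assumes "DD z t u" "DD z' t' u'"
  shows "DD (z + u * z') (t + t' + 2 * Im (z * cnj (u * z'))) (u * u')"
proof -
  have "nil_iso z t u False \<circ> nil_iso z' t' u' False \<in> D"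
    using subgroup.m_closed[OF D] assms by (simp add: DD_def)
  then show ?thesis using assms by (simp add: DD_def nil_iso_comp norm_mult)
qed

lemma DD_one: "DD 0 0 1"
  using subgroup.one_closed[OF D] by (simp add: DD_def nil_iso_id)

lemma DD_inv:
  assumes "DD z t u"
  obtains z' t' u' where "DD z' t' u'" "z' + u' * z = 0" "t' + t + 2 * Im (z' * cnj (u' * z)) = 0" "u' * u = 1"
proof -
  interpret I: group Isom_Nil by (rule group_Isom_Nil)
  let ?g = "nil_iso z t u False"
  have g: "?g \<in> D" "?g \<in> carrier Isom_Nil" using assms subgroup.mem_carrier[OF D] by (auto simp: DD_def)
  have "inv\<^bsub>Isom_Nil\<^esub> ?g \<in> D" by (rule subgroup.m_inv_closed[OF D g(1)])
  then obtain z' t' u' where n: "cmod u' = 1" "inv\<^bsub>Isom_Nil\<^esub> ?g = nil_iso z' t' u' False" using form by blast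
  have DD': "DD z' t' u'" using n \<open>inv\<^bsub>Isom_Nil\<^esub> ?g \<in> D\<close> by (simp add: DD_def)
  have "nil_iso z' t' u' False \<circ> ?g = id" using I.l_inv[OF g(2)] n by simp
  then have "nil_iso (z' + u' * z) (t' + t + 2 * Im (z' * cnj (u' * z))) (u' * u) False = id"
    by (simp only: nil_iso_comp[OF n(1)] cj_simps sg_simps mult_1_left simp_thms)
  then show ?thesis using that[OF DD'] unfolding nil_iso_eq_id by blast
qed

lemma DD_adjH:
  assumes "DD z t u"
  obtains z' t' u' where "DD z' t' u'" "adjH (heis z t u) = heis z' t' u'"
proof -
  obtain z' t' u' where n: "DD z' t' u'" "z' + u' * z = 0" "t' + t + 2 * Im (z' * cnj (u' * z)) = 0" "u' * u = 1"
    using DD_inv[OF assms] by blast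
  have "heis z' t' u' ** heis z t u = mat 1"
    unfolding heis_mult[OF DD_unit[OF n(1)]] n(2,3,4) by (rule heis_1)
  then have "heis z' t' u' ** (heis z t u ** adjH (heis z t u)) = adjH (heis z t u)"
    by (simp add: matrix_mul_assoc)
  then show ?thesis using that n(1) adjH_mult2[OF heis_U21[OF DD_unit[OF assms]]] by simp
qed

lemma DD_translation_power:
  assumes "DD z t 1" shows "DD (of_int k * z) (of_int k * t) 1"
proof -
  have nat: "DD (of_nat n * z) (of_nat n * t) 1" if "DD z t 1" for n z t
  proof (induction n)
    case (Suc n)
    have "Im (z * cnj (of_nat n * z)) = 0" by simp
    then show ?case using DD_mult[OF that Suc] by (simp add: algebra_simps del: complex_cnj_mult)
  qed (simp add: DD_one)
  obtain z' t' u' where n: "DD z' t' u'" "z' + u' * z = 0" "t' + t + 2 * Im (z' * cnj (u' * z)) = 0" "u' * 1 = 1"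
    using DD_inv[OF assms] by blast
  have u': "u' = 1" using n(4) by simp
  have z': "z' = - z" using n(2) u' by (simp add: eq_neg_iff_add_eq_0)
  have "t' + t + 2 * Im (- z * cnj z) = 0" using n(3) unfolding u' z' by simp
  then have "t' = - t" by simp
  then have neg: "DD (- z) (- t) 1" using n(1) u' z' by simp
  show ?thesis
  proof (cases "k \<ge> 0")
    case True
    then obtain n where "k = int n" by (metis nonneg_int_cases)
    then show ?thesis using nat[OF assms, of n] by simp
  next
    case False
    then obtain n where "k = - int n" by (metis int_cases2 of_nat_0_le_iff)
    then show ?thesis using nat[OF neg, of n] by simp
  qed
qed

text \<open>The factor 12 pays for division by 1 - u and 2 for halves of imaginary parts;
  \<open>r\<close> and \<open>tc\<close> let the translations in \<open>D\<close> produce every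
  integral translation congruent to 1. The value exceeds 8, as the torsion argument
  requires.\<close>

definition lev :: nat where "lev = 24 * r * nat \<bar>tc\<bar>"

lemma lev: "lev > 8" "lev > 0"
proof -
  have "r * nat \<bar>tc\<bar> \<ge> 1" using r tc by simp
  then show "lev > 8" "lev > 0" unfolding lev_def by linarith+
qed

text \<open>The integral unitary matrices whose reduction modulo \<open>lev\<close> lies in the
  image of the lattice. It is a group because the lattice is one, and it contains all integral
  unitary matrices congruent to 1.\<close>

definition Gt :: "(complex^3^3) set" where
  "Gt = {A \<in> U21. \<exists>z t u. DD z t u \<and> mcg lev A (heis z t u)}"

definition \<Gamma> :: "(cp2 \<Rightarrow> cp2) set" where
  "\<Gamma> = proj ` Gt"

lemma GtI: "A \<in> U21 \<Longrightarrow> DD z t u \<Longrightarrow> mcg lev A (heis z t u) \<Longrightarrow> A \<in> Gt"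
  by (auto simp: Gt_def)

lemma GtE:
  assumes "A \<in> Gt" obtains z t u where "A \<in> U21" "int_mat A" "DD z t u" "cmod u = 1" "mcg lev A (heis z t u)"
  using assms mcg_int(1) DD_unit by (auto simp: Gt_def)

lemma DD_Gt: "DD z t u \<Longrightarrow> heis z t u \<in> Gt"
  by (rule GtI[OF heis_U21[OF DD_unit] _ mcg_refl[OF DD_int]])

lemma Gt_mult:
  assumes "A \<in> Gt" "B \<in> Gt" shows "A ** B \<in> Gt"
proof -
  obtain z t u where A: "A \<in> U21" "DD z t u" "cmod u = 1" "mcg lev A (heis z t u)" using assms(1) by (rule GtE)
  obtain z' t' u' where B: "B \<in> U21" "DD z' t' u'" "mcg lev B (heis z' t' u')" using assms(2) by (rule GtE)
  show ?thesis
    using mcg_mult[OF A(4) B(3)] unfolding heis_mult[OF A(3)]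
    by (rule GtI[OF U21_mult[OF A(1) B(1)] DD_mult[OF A(2) B(2)]])
qed

lemma Gt_adjH:
  assumes "A \<in> Gt" shows "adjH A \<in> Gt"
proof -
  obtain z t u where A: "A \<in> U21" "DD z t u" "mcg lev A (heis z t u)" using assms(1) by (rule GtE)
  obtain z' t' u' where B: "DD z' t' u'" "adjH (heis z t u) = heis z' t' u'" using DD_adjH[OF A(2)] by blast
  show ?thesis using mcg_adjH[OF A(3)] unfolding B(2) by (rule GtI[OF adjH_U21[OF A(1)] B(1)])
qed

lemma inv_proj:
  assumes "A \<in> U21" shows "inv\<^bsub>Isom_H2C\<^esub> (proj A) = proj (adjH A)"
proof -
  interpret I: group Isom_H2C by (rule group_Isom_H2C)
  show ?thesis by (rule I.inv_equality) (simp_all add: proj_adjH assms proj_in_Isom adjH_U21)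
qed

lemma Gamma_subgroup: "subgroup \<Gamma> Isom_H2C"
proof -
  interpret I: group Isom_H2C by (rule group_Isom_H2C)
  show ?thesis
  proof (rule I.subgroupI)
    show "\<Gamma> \<subseteq> carrier Isom_H2C" unfolding \<Gamma>_def by (auto elim!: GtE intro: proj_in_Isom)
    show "\<Gamma> \<noteq> {}" unfolding \<Gamma>_def using DD_Gt[OF DD_one] by blast
    fix a assume "a \<in> \<Gamma>"
    then obtain A where A: "A \<in> Gt" "a = proj A" by (auto simp: \<Gamma>_def)
    have AU: "A \<in> U21" using A(1) by (rule GtE)
    show "inv\<^bsub>Isom_H2C\<^esub> a \<in> \<Gamma>" unfolding A(2) inv_proj[OF AU] \<Gamma>_def by (rule imageI[OF Gt_adjH[OF A(1)]])
    fix b assume "b \<in> \<Gamma>"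
    then obtain B where B: "B \<in> Gt" "b = proj B" by (auto simp: \<Gamma>_def)
    have BU: "B \<in> U21" using B(1) by (rule GtE)
    show "a \<otimes>\<^bsub>Isom_H2C\<^esub> b \<in> \<Gamma>"
      unfolding A(2) B(2) mult_Isom_H2C proj_mult[OF AU BU] \<Gamma>_def by (rule imageI[OF Gt_mult[OF A(1) B(1)]])
  qed
qed

lemma Gamma_integral: "\<Gamma> \<subseteq> PU21_O d"
  unfolding \<Gamma>_def PU21_O_eq by (auto elim!: GtE)

lemma Gamma_discrete: "discrete \<Gamma>"
proof (rule discrete_if_id_isolated[OF Gamma_subgroup open_near_id _ id_near_id])
  fix f assume f: "f \<in> \<Gamma>" "f \<in> near_id"
  then obtain A where A: "A \<in> Gt" "f = proj A" by (auto simp: \<Gamma>_def)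
  have "A \<in> U21" "int_mat A" using A(1) by (auto elim: GtE)
  then show "f = id" using integral_near_id f(2) A(2) by simp
qed

text \<open>For u = 1 the congruence already forces the matrix to be 1. Otherwise its torsion is
  transferred to the lattice \<open>D\<close>, where it is excluded.\<close>

lemma Gamma_torsion_free: "torsion_free (Isom_H2C\<lparr>carrier := \<Gamma>\<rparr>)"
  unfolding torsion_free_def
proof (intro ballI allI impI)
  fix g and m :: nat
  assume "g \<in> carrier (Isom_H2C\<lparr>carrier := \<Gamma>\<rparr>)" and m: "m > 0"
    and gm: "g [^]\<^bsub>Isom_H2C\<lparr>carrier := \<Gamma>\<rparr>\<^esub> m = \<one>\<^bsub>Isom_H2C\<lparr>carrier := \<Gamma>\<rparr>\<^esub>"
  then obtain A where A: "A \<in> Gt" "g = proj A" by (auto simp: \<Gamma>_def)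
  have gm': "proj A ^^ m = id" using gm by (simp add: A(2))
  obtain z t u where Z: "A \<in> U21" "int_mat A" "DD z t u" "cmod u = 1" "mcg lev A (heis z t u)" using A(1) by (rule GtE)
  obtain M where M: "M \<in> U21" "proj M = proj A ^^ m" "\<And>X. M *v X = ((*v) A ^^ m) X" using proj_funpow[OF Z(1)] by blast
  \<comment> \<open>A trivial projective power makes the matrix power a unit scalar, not the
    identity; hence the factor \<open>l\<close> in the period.\<close>
  have "proj M = proj (mat 1)" unfolding M(2) gm' proj_one ..
  then obtain l where l: "cmod l = 1" "M = smat l (mat 1)" using proj_eqD[OF M(1) U21_one] by blast
  have per: "((*v) A ^^ m) X = l *s X" for X
    unfolding M(3)[symmetric] l(2) smat_mvm by simp
  note T = torsion_congruent_heis[OF Z(5,4) lev(1) m per l(1)]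
  have "g = id"
  proof (cases "u = 1")
    case True
    then show ?thesis using T(1) by (simp add: A(2) proj_one)
  next
    case u1: False
    have uO: "u \<in> \<O>" using int_mat_nth[OF DD_int[OF Z(3)], of 2 2] by simp
    define z0 where "z0 = z / (1 - u)"
    \<comment> \<open>The shift along the axis: the height minus the height at which the element
      would be a pure rotation about \<open>z0\<close>.\<close>
    define \<tau> where "\<tau> = t - 2 * (cmod z0)\<^sup>2 * Im u"
    have z: "z = (1 - u) * z0" using u1 by (simp add: z0_def)
    have k: "(1 - u) * hgt z t - u * (z * cnj z) = (1 - u) * (\<i> * of_real \<tau>) / 2"
    proof -
      have zz: "z0 * cnj z0 = of_real ((cmod z0)\<^sup>2)" by (simp add: complex_norm_square del: of_real_power)
      have iu: "u - cnj u = 2 * \<i> * of_real (Im u)" by (simp add: complex_eq_iff)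
      have uc: "u * cnj u = 1" by (rule unit_cnj(1)[OF Z(4)])
      have "(1 - cnj u) * (1 + u) = u - cnj u" by (simp add: algebra_simps uc)
      then have e: "(1 - cnj u) * (1 + u) = 2 * \<i> * of_real (Im u)" unfolding iu .
      have "(1 - u) * hgt z t - u * (z * cnj z) = (1 - u) * (\<i> * of_real t) / 2 - (z * cnj z) * (1 + u) / 2"
        unfolding hgt_def by (simp add: field_simps)
      also have "(z * cnj z) * (1 + u) = (1 - u) * ((1 - cnj u) * (1 + u)) * (z0 * cnj z0)"
        unfolding z by (simp add: mult_ac)
      also have "\<dots> = (1 - u) * (2 * \<i> * of_real (Im u)) * of_real ((cmod z0)\<^sup>2)"
        unfolding e zz ..
      also have "(1 - u) * (\<i> * of_real t) / 2 - (1 - u) * (2 * \<i> * of_real (Im u)) * of_real ((cmod z0)\<^sup>2) / 2 =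
          (1 - u) * (\<i> * of_real \<tau>) / 2" unfolding \<tau>_def by (simp add: field_simps)
      finally show ?thesis .
    qed
    obtain w where w: "w \<in> \<O>" "(1 - u) * (\<i> * of_real \<tau>) / 2 = of_nat lev * w"
      using T(2) unfolding k by (elim cgE) simp
    \<comment> \<open>Integrality of y uses up the factor 12 of the level.\<close>
    define y where "y = 12 / (1 - u) * w"
    have yO: "y \<in> \<O>" unfolding y_def by (rule O_mult[OF O_one_minus_unit[OF uO Z(4) u1] w(1)])
    have "\<i> * of_real \<tau> = 2 * (of_nat lev * w) / (1 - u)" unfolding w(2)[symmetric] using u1 by simp
    also have "\<dots> = of_nat (4 * r * nat \<bar>tc\<bar>) * y" unfolding y_def lev_def by (simp add: field_simps)
    finally have "Im (\<i> * of_real \<tau>) = Im (of_nat (4 * r * nat \<bar>tc\<bar>) * y)" by simp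
    then have t1: "\<tau> = real (2 * r * nat \<bar>tc\<bar>) * (2 * Im y)" by simp
    obtain j where j: "2 * Im y = sqrt d * of_int j" using O_Im[OF yO] by blast
    define i where "i = int r * sgn tc * j"
    have "real (nat \<bar>tc\<bar>) = of_int (sgn tc) * of_int tc" by (simp add: sgn_if)
    then have t2: "\<tau> = of_int i * (2 * sqrt d * tc)" unfolding t1 j i_def by simp
    \<comment> \<open>The shift is a multiple of the height of the vertical generator. Undoing it
      inside \<open>D\<close> leaves a rotation whose twelfth power is trivial.\<close>
    have "DD 0 (of_int (- i) * (2 * sqrt d * tc)) 1"
      using DD_translation_power[of 0 "2 * sqrt d * tc" "- i"] Dc by (simp add: DD_def)
    then have "DD 0 (- \<tau>) 1" unfolding t2 by simp
    from DD_mult[OF this Z(3)] have "DD z (t - \<tau>) u" by simp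
    then have inD: "nil_iso z (2 * (cmod z0)\<^sup>2 * Im u) u False \<in> D" by (simp add: DD_def \<tau>_def)
    have "nil_iso z (2 * (cmod z0)\<^sup>2 * Im u) u False ^^ 12 = id"
      unfolding z0_def by (rule rotation_about_axis_pow[OF u1 Z(4) O_unit_pow12[OF uO Z(4)]])
    then have "nil_iso z (2 * (cmod z0)\<^sup>2 * Im u) u False = id" by (rule tf[OF inD, rotated]) simp
    then show ?thesis using u1 by (simp add: nil_iso_eq_id)
  qed
  then show "g = \<one>\<^bsub>Isom_H2C\<lparr>carrier := \<Gamma>\<rparr>\<^esub>" by simp
qed

end

section \<open>The stabiliser of the cusp, and finite index in the Picard group\<close>

context cusp_lattice
begin

lemma cg_le2: "cg lev x y \<Longrightarrow> cmod x \<le> 1 \<Longrightarrow> cmod y \<le> 1 \<Longrightarrow> x = y"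
proof (rule cg_close)
  assume "cmod x \<le> 1" "cmod y \<le> 1"
  moreover have "8 < real lev" using lev(1) by simp
  ultimately show "cmod (x - y) < real lev" using norm_triangle_ineq4[of x y] by linarith
qed

text \<open>Powers of the two horizontal generators produce the planar part z; the height left over
  is a multiple of that of the vertical generator.\<close>

lemma congruence_translation_in_D:
  assumes "z \<in> \<O>" "hgt z t \<in> \<O>" "cg lev z 0" "cg lev (hgt z t) 0"
  shows "DD z t 1"
proof -
  define T where "T = nat \<bar>tc\<bar>"
  define e where "e = sgn tc"
  have T: "real T = of_int e * of_int tc" "e * e = 1" using tc by (simp_all add: T_def e_def sgn_if)
  have lev: "of_nat lev = (24 * of_nat r * of_nat T :: complex)" "real lev = 24 * real r * real T" by (simp_all add: lev_def T_def)
  obtain w where w: "w \<in> \<O>" "z = of_nat lev * w" using assms(3) by (elim cgE) simp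
  obtain i j where ij: "w = of_int i + of_int j * v" using w(1) by (rule OE)
  obtain w' where w': "w' \<in> \<O>" "hgt z t = of_nat lev * w'" using assms(4) by (elim cgE) simp
  obtain k where k: "2 * Im w' = sqrt d * of_int k" using O_Im[OF w'(1)] by blast
  obtain f where f: "2 * Im v = sqrt d * of_int f" using O_Im[OF O_v] by blast
  have "Im (hgt z t) = t / 2" by (simp add: hgt_def)
  then have "t = real lev * (2 * Im w')" unfolding w'(2) by simp
  then have t: "t = 24 * real r * real T * (sqrt d * of_int k)" unfolding k lev .
  \<comment> \<open>Since \<open>lev\<close> is r times 24 T, the planar part lev * w equals x r + y
    r v.\<close>
  define x where "x = 24 * int T * i"
  define y where "y = 24 * int T * j"
  have X: "DD (of_int x * of_nat r) (of_int x * (2 * sqrt d * ta)) 1"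
    using DD_translation_power[of "of_nat r"] Da by (simp add: DD_def)
  have Y: "DD (of_int y * (of_nat r * v)) (of_int y * (2 * sqrt d * tb)) 1"
    using DD_translation_power[of "of_nat r * v"] Db by (simp add: DD_def)
  define t0 where "t0 = of_int x * (2 * sqrt d * ta) + of_int y * (2 * sqrt d * tb) +
       2 * Im ((of_int x * of_nat r) * cnj (1 * (of_int y * (of_nat r * v))))"
  have XY: "DD (of_int x * of_nat r + 1 * (of_int y * (of_nat r * v))) t0 (1 * 1)"
    unfolding t0_def by (rule DD_mult[OF X Y])
  have "of_int x * of_nat r + 1 * (of_int y * (of_nat r * v)) = z"
    unfolding w(2) ij lev x_def y_def by (simp add: algebra_simps)
  then have XY': "DD z t0 1" using XY by simp
  have "Im ((of_int x * of_nat r) * cnj (1 * (of_int y * (of_nat r * v)))) = - (of_int x * real r * of_int y * real r * Im v)"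
    by simp
  then have e2: "2 * Im ((of_int x * of_nat r) * cnj (1 * (of_int y * (of_nat r * v)))) = - (of_int x * real r * of_int y * real r * (2 * Im v))"
    by simp
  then have t0: "t0 = sqrt d * (2 * of_int x * ta + 2 * of_int y * tb - of_int x * real r * of_int y * real r * of_int f)"
    unfolding t0_def e2 f by (simp add: algebra_simps)
  \<comment> \<open>The exponent of the vertical generator; the sign \<open>e\<close> turns T = |tc|
    back into tc.\<close>
  define q where "q = e * (12 * int r * k - 24 * i * ta - 24 * j * tb + 12 * i * int r * y * int r * f)"
  have xT: "real_of_int x = 24 * real T * of_int i" "real_of_int y = 24 * real T * of_int j" by (simp_all add: x_def y_def)
  have "t - t0 = sqrt d * (real T * (2 * (12 * real r * of_int k - 24 * of_int i * ta - 24 * of_int j * tb + 12 * of_int i * real r * of_int y * real r * of_int f)))"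
    unfolding t t0 by (simp add: xT(1)) (simp add: xT(2) algebra_simps)
  also have "\<dots> = of_int q * (2 * sqrt d * tc)"
    unfolding q_def T(1) by (simp add: algebra_simps)
  finally have tt: "of_int q * (2 * sqrt d * tc) = t - t0" ..
  have "DD (of_int q * 0) (of_int q * (2 * sqrt d * tc)) 1"
    using DD_translation_power[of 0 "2 * sqrt d * tc"] Dc by (simp add: DD_def)
  then have "DD 0 (t - t0) 1" unfolding tt by simp
  from DD_mult[OF this XY'] show ?thesis by simp
qed

text \<open>The corner entries are integers with l * cnj m = 1, so both have modulus 1; being
  congruent to 1 modulo a level above 2, they equal 1. The quotient of \<open>A\<close> by the
  lattice element it is congruent to is then a translation congruent to 1, which lies in
  \<open>D\<close>.\<close>

lemma Gamma_fixing_infinity: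
  assumes "A \<in> Gt" "proj A (line infinity) = line infinity"
  obtains z t u where "DD z t u" "A = heis z t u"
proof -
  obtain z t u where Z: "A \<in> U21" "int_mat A" "DD z t u" "cmod u = 1" "mcg lev A (heis z t u)" using assms(1) by (rule GtE)
  obtain l m u' where e: "A$1$1 = l" "A$2$1 = 0" "A$3$1 = 0" "A$3$2 = 0" "A$3$3 = m" "l * cnj m = 1" "A$2$2 = u'" "cmod u' = 1"
    using U21_fixing_infinity[OF Z(1) assms(2)] by blast
  have lm: "cmod l * cmod m = 1" using arg_cong[OF e(6), of cmod] by (simp add: norm_mult)
  have l0: "l \<noteq> 0" "m \<noteq> 0" using e(6) by auto
  have lO: "l \<in> \<O>" "m \<in> \<O>" using int_mat_nth[OF Z(2)] e(1,5) by metis+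
  have "cmod l \<ge> 1" "cmod m \<ge> 1" using O_discrete lO l0 by simp_all
  then have "cmod l \<le> 1" "cmod m \<le> 1" using lm mult_left_mono[of 1 "cmod m" "cmod l"] mult_right_mono[of 1 "cmod l" "cmod m"] by linarith+
  moreover have "cg lev l 1" "cg lev m 1" "cg lev u' u"
    using mcgD[OF Z(5), of 1 1] mcgD[OF Z(5), of 3 3] mcgD[OF Z(5), of 2 2] e by simp_all
  ultimately have lmu: "l = 1" "m = 1" "u' = u" using cg_le2 Z(4) e(8) by simp_all
  have A: "A = heis (A$2$3) (2 * Im (A$1$3)) u"
    using unipotent_to_heis[OF Z(1)] e lmu by simp
  define z1 where "z1 = A$2$3"
  define t1 where "t1 = 2 * Im (A$1$3)"
  have A1: "A = heis z1 t1 u" using A by (simp only: z1_def t1_def)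
  obtain z' t' u'' where B: "DD z' t' u''" "adjH (heis z t u) = heis z' t' u''" using DD_adjH[OF Z(3)] by blast
  have "A ** adjH (heis z t u) = heis (z1 + u * z') (t1 + t' + 2 * Im (z1 * cnj (u * z'))) (u * u'')"
    unfolding A1 B(2) by (rule heis_mult[OF Z(4)])
  moreover have "mcg lev (A ** adjH (heis z t u)) (heis z t u ** adjH (heis z t u))"
    by (rule mcg_mult[OF Z(5) mcg_refl]) (simp add: DD_int[OF Z(3)])
  moreover have "heis z t u ** adjH (heis z t u) = mat 1" by (rule adjH_mult2[OF heis_U21[OF Z(4)]])
  ultimately obtain z2 t2 u2 where C: "A ** adjH (heis z t u) = heis z2 t2 u2" "mcg lev (heis z2 t2 u2) (mat 1)" "u2 = u * u''"
    by metis
  have "adjH (heis z t u) $ 2 $ 2 = cnj u" by simp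
  then have "u'' = cnj u" unfolding B(2) by simp
  then have u2: "u2 = 1" using C(3) unit_cnj(1)[OF Z(4)] by simp
  have "cg lev z2 0" "cg lev (hgt z2 t2) 0"
    using mcgD[OF C(2), of 2 3] mcgD[OF C(2), of 1 3] by (simp_all add: mat_1_3)
  then have "DD z2 t2 1" using congruence_translation_in_D by (auto simp: cg_def)
  from DD_mult[OF this Z(3)] have DDm: "DD (z2 + 1 * z) (t2 + t + 2 * Im (z2 * cnj (1 * z))) (1 * u)" .
  have "A = (A ** adjH (heis z t u)) ** heis z t u"
    unfolding matrix_mul_assoc[symmetric] adjH_mult[OF heis_U21[OF Z(4)]] by simp
  also have "\<dots> = heis (z2 + 1 * z) (t2 + t + 2 * Im (z2 * cnj (1 * z))) (1 * u)"
    unfolding C(1) u2 by (rule heis_mult) simp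
  finally show ?thesis by (rule that[OF DDm])
qed

lemma stabilizer_Gamma:
  "stabilizer (Isom_H2C\<lparr>carrier := \<Gamma>\<rparr>) (\<lambda>g. g) (line infinity) = {proj (heis z t u) | z t u. DD z t u}"
proof (intro equalityI subsetI)
  fix g assume "g \<in> stabilizer (Isom_H2C\<lparr>carrier := \<Gamma>\<rparr>) (\<lambda>g. g) (line infinity)"
  then obtain A where "A \<in> Gt" "g = proj A" "proj A (line infinity) = line infinity"
    by (auto simp: stabilizer_def \<Gamma>_def)
  then show "g \<in> {proj (heis z t u) | z t u. DD z t u}" using Gamma_fixing_infinity by blast
next
  fix g assume "g \<in> {proj (heis z t u) | z t u. DD z t u}"
  then obtain z t u where g: "g = proj (heis z t u)" "DD z t u" by blast
  then have "g (line infinity) = line infinity"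
    using hyp_infinity[OF DD_unit[OF g(2)], of z t False] by (simp add: hyp_def)
  moreover have "g \<in> \<Gamma>" unfolding \<Gamma>_def g(1) by (rule imageI[OF DD_Gt[OF g(2)]])
  ultimately show "g \<in> stabilizer (Isom_H2C\<lparr>carrier := \<Gamma>\<rparr>) (\<lambda>g. g) (line infinity)"
    by (simp add: stabilizer_def)
qed

lemma Gamma_cusp: "cusp_point \<Gamma> (line infinity)"
proof -
  have "2 * sqrt d * tc \<noteq> 0" using tc dv by auto
  note p = vertical_parabolic[OF this]
  have "DD 0 (2 * sqrt d * tc) 1" using Dc by (simp add: DD_def)
  then have "proj (heis 0 (2 * sqrt d * tc) 1) \<in> \<Gamma>" unfolding \<Gamma>_def by (intro imageI DD_Gt)
  then show ?thesis unfolding cusp_point_def using p by blast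
qed

lemma coset_cong:
  assumes "A \<in> U21" "int_mat A" "B \<in> U21" "int_mat B" "mcg lev A B"
  shows "\<Gamma> #>\<^bsub>Isom_H2C\<^esub> proj A \<subseteq> \<Gamma> #>\<^bsub>Isom_H2C\<^esub> proj B"
proof
  fix x assume "x \<in> \<Gamma> #>\<^bsub>Isom_H2C\<^esub> proj A"
  then obtain g where g: "g \<in> \<Gamma>" "x = g \<circ> proj A" by (auto simp: r_coset_def)
  have "mcg lev (A ** adjH B) (B ** adjH B)" by (rule mcg_mult[OF assms(5) mcg_refl]) (simp add: assms)
  then have "mcg lev (A ** adjH B) (heis 0 0 1)" by (simp only: adjH_mult2[OF assms(3)] heis_1)
  then have "A ** adjH B \<in> Gt" by (intro GtI[OF U21_mult[OF assms(1) adjH_U21[OF assms(3)]] DD_one])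
  then have "proj (A ** adjH B) \<in> \<Gamma>" unfolding \<Gamma>_def by (rule imageI)
  then have h: "g \<circ> proj (A ** adjH B) \<in> \<Gamma>" using subgroup.m_closed[OF Gamma_subgroup g(1)] by simp
  have "A = (A ** adjH B) ** B" by (simp add: matrix_mul_assoc[symmetric] adjH_mult[OF assms(3)])
  then have "proj A = proj (A ** adjH B) \<circ> proj B"
    using proj_mult[OF U21_mult[OF assms(1) adjH_U21[OF assms(3)]] assms(3)] by simp
  then have "x = (g \<circ> proj (A ** adjH B)) \<circ> proj B" using g(2) by (simp add: comp_assoc)
  then show "x \<in> \<Gamma> #>\<^bsub>Isom_H2C\<^esub> proj B" using h unfolding r_coset_def by auto
qed

text \<open>The coset of an integral matrix depends only on the residues of its nine entries modulo
  \<open>lev\<close>.\<close>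

lemma finite_cosets: "finite ((\<lambda>b. \<Gamma> #>\<^bsub>Isom_H2C\<^esub> b) ` PU21_O d)"
proof -
  obtain F where F: "finite F" "F \<subseteq> \<O>" "\<And>x. x \<in> \<O> \<Longrightarrow> \<exists>y\<in>F. \<exists>w\<in>\<O>. x = y + of_nat lev * w"
    using O_finite_residues[OF lev(2)] by blast
  define res where "res x = (SOME y. y \<in> F \<and> cg lev x y)" for x
  have res: "res x \<in> F \<and> cg lev x (res x)" if "x \<in> \<O>" for x
    unfolding res_def by (rule someI_ex) (use F(2) F(3)[OF that] that in \<open>auto intro: cgI\<close>)
  define code where "code A = (\<lambda>(i, j). res (A $ i $ j))" for A :: "complex^3^3"
  define E where "E = PiE (UNIV :: (3 \<times> 3) set) (\<lambda>_. F)"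
  have fE: "finite E" unfolding E_def by (rule finite_PiE) (simp_all add: F)
  define pick where "pick c = (SOME A. A \<in> U21 \<and> int_mat A \<and> code A = c)" for c
  have "(\<lambda>b. \<Gamma> #>\<^bsub>Isom_H2C\<^esub> b) ` PU21_O d \<subseteq> (\<lambda>c. \<Gamma> #>\<^bsub>Isom_H2C\<^esub> proj (pick c)) ` E"
  proof
    fix C assume "C \<in> (\<lambda>b. \<Gamma> #>\<^bsub>Isom_H2C\<^esub> b) ` PU21_O d"
    then obtain A where A: "A \<in> U21" "int_mat A" "C = \<Gamma> #>\<^bsub>Isom_H2C\<^esub> proj A" by (auto simp: PU21_O_eq)
    have cE: "code A \<in> E" unfolding E_def code_def using res[OF int_mat_nth[OF A(2)]] by (simp add: PiE_def Pi_iff split: prod.split)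
    define B where "B = pick (code A)"
    have B: "B \<in> U21 \<and> int_mat B \<and> code B = code A"
      unfolding B_def pick_def by (rule someI_ex) (use A in blast)
    have "mcg lev A B" unfolding mcg_def
    proof (intro allI)
      fix i j
      have e: "res (B $ i $ j) = res (A $ i $ j)" 
      proof -
        have "code B (i, j) = code A (i, j)" using B by simp
        then show ?thesis by (simp add: code_def)
      qed
      have "cg lev (A $ i $ j) (res (A $ i $ j))" "cg lev (B $ i $ j) (res (A $ i $ j))"
        using res[OF int_mat_nth[OF A(2)], of i j] res[of "B $ i $ j"] B e by simp_all
      then show "cg lev (A $ i $ j) (B $ i $ j)" by (rule cg_trans[OF _ cg_sym])
    qed
    then have "C = \<Gamma> #>\<^bsub>Isom_H2C\<^esub> proj B"
      unfolding A(3) using coset_cong[of A B] coset_cong[of B A] A(1,2) B mcg_sym by blast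
    then show "C \<in> (\<lambda>c. \<Gamma> #>\<^bsub>Isom_H2C\<^esub> proj (pick c)) ` E" using cE unfolding B_def by blast
  qed
  then show ?thesis by (rule finite_subset) (rule finite_imageI[OF fE])
qed

lemma Gamma_commensurable: "commensurable Isom_H2C \<Gamma> (PU21_O d)"
proof -
  interpret I: group Isom_H2C by (rule group_Isom_H2C)
  have one: "id \<in> carrier Isom_H2C" using I.one_closed by simp
  have conj: "id <#\<^bsub>Isom_H2C\<^esub> \<Gamma> #>\<^bsub>Isom_H2C\<^esub> inv\<^bsub>Isom_H2C\<^esub> id = \<Gamma>"
  proof -
    have "inv\<^bsub>Isom_H2C\<^esub> id = id" using I.inv_one by simp
    then show ?thesis by (simp add: l_coset_def r_coset_def)
  qed
  have int: "\<Gamma> \<inter> PU21_O d = \<Gamma>" using Gamma_integral by blast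
  have rc: "rcosets\<^bsub>Isom_H2C\<lparr>carrier := X\<rparr>\<^esub> \<Gamma> = (\<lambda>b. \<Gamma> #>\<^bsub>Isom_H2C\<^esub> b) ` X" for X
    by (auto simp: RCOSETS_def r_coset_def)
  have "finite ((\<lambda>b. \<Gamma> #>\<^bsub>Isom_H2C\<^esub> b) ` \<Gamma>)"
    using finite_subset[OF image_mono[OF Gamma_integral] finite_cosets] .
  then show ?thesis
    unfolding commensurable_def Let_def using finite_cosets
    by (intro bexI[OF _ one]) (simp only: conj int rc simp_thms)
qed

lemma Gamma_manifold: "H2C_manifold_group \<Gamma>"
  unfolding H2C_manifold_group_def using Gamma_subgroup Gamma_discrete Gamma_torsion_free by blast

end

section \<open>Smoothness of quadratic maps\<close>

lemma C_k_on_affine: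
  "bounded_linear L \<Longrightarrow> C_k_on n UNIV (\<lambda>x. c + L x)"
proof (induction n arbitrary: c L)
  case 0
  then show ?case by (auto intro!: continuous_intros bounded_linear.continuous_on[OF 0])
next
  case (Suc n)
  have d: "((\<lambda>x. c + L x) has_derivative L) (at x)" for x
    using Suc.prems by (auto intro!: derivative_eq_intros bounded_linear.has_derivative[OF Suc.prems])
  have "C_k_on n UNIV (\<lambda>x. frechet_derivative (\<lambda>x. c + L x) (at x) v)" for v
  proof -
    have "frechet_derivative (\<lambda>x. c + L x) (at x) v = L v + 0" for x
      by (simp only: frechet_derivative_at[OF d, symmetric] add_0_right)
    then show ?thesis using Suc.IH[of "\<lambda>_. 0" "L v"] by simp
  qed
  moreover have "(\<lambda>x. c + L x) differentiable (at x)" for x using d unfolding differentiable_def by blast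
  ultimately show ?case by simp
qed

text \<open>The coordinate changes used below are of this form. Their derivatives are affine, so
  smoothness of every order follows after one differentiation.\<close>

definition quadratic_map :: "('a::real_normed_vector \<Rightarrow> 'b::real_normed_vector) \<Rightarrow> bool" where
  "quadratic_map f \<longleftrightarrow> (\<exists>c L B. bounded_linear L \<and> bounded_bilinear B \<and> f = (\<lambda>x. c + L x + B x x))"

lemma quadratic_mapI:
  assumes "bounded_linear L" "bounded_bilinear B" "\<And>x. f x = c + L x + B x x"
  shows "quadratic_map f"
  unfolding quadratic_map_def using assms by (intro exI[of _ c] exI[of _ L] exI[of _ B]) auto

lemma C_infinity_quadratic_map:
  assumes "quadratic_map f" shows "C_infinity_on UNIV f"
proof -
  obtain c L B where L: "bounded_linear L" and B: "bounded_bilinear B" and f: "f = (\<lambda>x. c + L x + B x x)"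
    using assms unfolding quadratic_map_def by blast
  have d: "(f has_derivative (\<lambda>v. L v + (B x v + B v x))) (at x)" for x
  proof -
    have d1: "((\<lambda>x. B x x) has_derivative (\<lambda>v. B x v + B v x)) (at x)"
      by (rule bounded_bilinear.FDERIV[OF B has_derivative_ident has_derivative_ident])
    have d2: "((\<lambda>x. c + L x) has_derivative (\<lambda>v. 0 + L v)) (at x)"
      by (rule has_derivative_add[OF has_derivative_const bounded_linear_imp_has_derivative[OF L]])
    have "((\<lambda>x. (c + L x) + B x x) has_derivative (\<lambda>v. (0 + L v) + (B x v + B v x))) (at x)"
      by (rule has_derivative_add[OF d2 d1])
    then show ?thesis unfolding f by simp
  qed
  have "C_k_on n UNIV f" for n
  proof (cases n)
    case 0
    have "continuous_on UNIV f"
      by (simp add: continuous_at_imp_continuous_on has_derivative_continuous[OF d])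
    then show ?thesis using 0 by simp
  next
    case (Suc m)
    have "C_k_on m UNIV (\<lambda>x. frechet_derivative f (at x) v)" for v
    proof -
      have "bounded_linear (\<lambda>x. B x v + B v x)"
        by (intro bounded_linear_add bounded_bilinear.bounded_linear_left[OF B] bounded_bilinear.bounded_linear_right[OF B])
      from C_k_on_affine[OF this, of m "L v"]
      show ?thesis by (simp only: frechet_derivative_at[OF d, symmetric])
    qed
    moreover have "f differentiable (at x)" for x using d unfolding differentiable_def by blast
    ultimately show ?thesis by (simp add: Suc)
  qed
  then show ?thesis by (simp add: C_infinity_on_def)
qed

lemma quadratic_map_affine:
  assumes "bounded_linear L" "\<And>x. f x = c + L x"
  shows "quadratic_map f"
proof (rule quadratic_mapI[OF assms(1)])
  show "bounded_bilinear (\<lambda>x y. 0 :: 'b)" by standard (auto intro!: exI[of _ 0])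
qed (simp add: assms(2))

lemma quadratic_map_comp_affine:
  assumes "quadratic_map f" and A: "bounded_linear A" and g: "\<And>x. g x = a + A x"
  shows "quadratic_map (\<lambda>x. f (g x))"
proof -
  obtain c L B where L: "bounded_linear L" and B: "bounded_bilinear B" and f: "f = (\<lambda>x. c + L x + B x x)"
    using assms(1) unfolding quadratic_map_def by blast
  show ?thesis
  proof (rule quadratic_mapI)
    show "bounded_linear (\<lambda>x. L (A x) + (B a (A x) + B (A x) a))"
      by (intro bounded_linear_add bounded_linear_compose[OF L A]
         bounded_linear_compose[OF bounded_bilinear.bounded_linear_left[OF B] A]
         bounded_linear_compose[OF bounded_bilinear.bounded_linear_right[OF B] A])
    show "bounded_bilinear (\<lambda>x y. B (A x) (A y))" by (rule bounded_bilinear.comp[OF B A A])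
    show "f (g x) = (c + L a + B a a) + (L (A x) + (B a (A x) + B (A x) a)) + B (A x) (A x)" for x
      unfolding f g by (simp add: linear_add[OF bounded_linear.linear[OF L]]
        bounded_bilinear.add_left[OF B] bounded_bilinear.add_right[OF B] algebra_simps)
  qed
qed

section \<open>Similarities of Nil\<close>

text \<open>Left translation taking m to the axis over the origin, followed by the Heisenberg
  dilation by l, which multiplies heights by |l|^2.\<close>

definition simil :: "complex \<Rightarrow> complex \<Rightarrow> nil \<Rightarrow> nil" where
  "simil m l p = (l * (fst p - m), (cmod l)\<^sup>2 * (snd p - 2 * Im (m * cnj (fst p))))"

definition simil_inv :: "complex \<Rightarrow> complex \<Rightarrow> nil \<Rightarrow> nil" where
  "simil_inv m l q = (fst q / l + m, snd q / (cmod l)\<^sup>2 + 2 * Im (m * cnj (fst q / l + m)))"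

lemma simil_inverse:
  assumes "l \<noteq> 0" shows "simil_inv m l (simil m l p) = p" "simil m l (simil_inv m l p) = p"
  using assms by (simp_all add: simil_def simil_inv_def prod_eq_iff)

lemma bij_simil: "l \<noteq> 0 \<Longrightarrow> bij (simil m l)"
  by (rule o_bij[of "simil_inv m l"]) (auto simp: simil_inverse)

lemma simil_affine:
  "simil m l p = (- (l * m), 0) + (l * fst p, (cmod l)\<^sup>2 * (snd p - 2 * Im (m * cnj (fst p))))"
  by (simp add: simil_def algebra_simps)

lemma simil_linear_part: "bounded_linear (\<lambda>p :: nil. (l * fst p, (cmod l)\<^sup>2 * (snd p - 2 * Im (m * cnj (fst p)))))"
  unfolding linear_conv_bounded_linear[symmetric]
  by (rule linearI) (simp_all add: prod_eq_iff algebra_simps)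

lemma simil_inv_affine:
  "simil_inv m l q = (m, 0) + (fst q / l, snd q / (cmod l)\<^sup>2 + 2 * Im (m * cnj (fst q / l)))"
  by (simp add: simil_inv_def prod_eq_iff complex_mult_cnj algebra_simps)

lemma simil_inv_linear_part: "bounded_linear (\<lambda>q :: nil. (fst q / l, snd q / (cmod l)\<^sup>2 + 2 * Im (m * cnj (fst q / l))))"
proof -
  have "bounded_linear (\<lambda>q :: nil. fst q / l)"
    by (rule bounded_linear_compose[OF bounded_linear_divide bounded_linear_fst])
  moreover have "bounded_linear (\<lambda>q :: nil. snd q / (cmod l)\<^sup>2)"
    by (rule bounded_linear_compose[OF bounded_linear_divide bounded_linear_snd])
  moreover have "bounded_linear (\<lambda>q :: nil. 2 * Im (m * cnj (fst q / l)))"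
    by (intro bounded_linear_const_mult bounded_linear_compose[OF bounded_linear_Im]
        bounded_linear_compose[OF bounded_linear_cnj] calculation(1))
  ultimately show ?thesis by (intro bounded_linear_Pair bounded_linear_add)
qed

section \<open>The standard horosphere\<close>

definition horosphere0 :: "cp2 set" where
  "horosphere0 = line ` {X. Re (herm X X) < 0 \<and> (cmod (herm X infinity))\<^sup>2 = 1 * - Re (herm X X)}"

lemma is_horosphere0: "is_horosphere (line infinity) horosphere0"
  unfolding is_horosphere_def horosphere0_def
  by (intro exI[of _ infinity] exI[of _ "1::real"]) (simp add: herm_eq)

lemma horosphere0_eq: "horosphere0 = range (\<lambda>p. line (horo p))"
proof (intro equalityI subsetI)
  fix x assume "x \<in> horosphere0"
  then obtain X where "x = line X" "Re (herm X X) < 0" "(cmod (X $ 3))\<^sup>2 = - Re (herm X X)"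
    by (auto simp: horosphere0_def herm_eq)
  then show "x \<in> range (\<lambda>p. line (horo p))" using horo_cover by blast
next
  fix x assume "x \<in> range (\<lambda>p. line (horo p))"
  then obtain p where x: "x = line (horo p)" by blast
  show "x \<in> horosphere0" unfolding horosphere0_def x
  proof (rule imageI, rule CollectI)
    have "herm (horo p) infinity = 1" by (simp add: herm_eq)
    then show "Re (herm (horo p) (horo p)) < 0 \<and> (cmod (herm (horo p) infinity))\<^sup>2 = 1 * - Re (herm (horo p) (horo p))"
      unfolding herm_horo by simp
  qed
qed

lemma siegel_line: "X \<noteq> 0 \<Longrightarrow> siegel (line X) = (X $ 1 / X $ 3, X $ 2 / X $ 3)"
  by (simp add: siegel.abs_eq[OF prop_self])

lemma siegel_horo: "siegel (line (horo p)) = (hgt (fst p) (snd p) - 1 / 2, fst p)"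
  by (simp add: siegel_line)

lemma quadratic_map_siegel_horo: "quadratic_map (\<lambda>p. siegel (line (horo p)))"
proof (rule quadratic_mapI)
  show "bounded_linear (\<lambda>p :: nil. (\<i> * of_real (snd p) / 2, fst p))"
    unfolding linear_conv_bounded_linear[symmetric]
    by (rule linearI) (simp_all add: prod_eq_iff algebra_simps scaleR_conv_of_real)
  show "bounded_bilinear (\<lambda>(p :: nil) (q :: nil). (- (fst p * cnj (fst q)) / 2, 0 :: complex))"
  proof -
    have "bilinear (\<lambda>(p :: nil) (q :: nil). (- (fst p * cnj (fst q)) / 2, 0 :: complex))"
      unfolding bilinear_def
      by (intro conjI allI linearI) (simp_all add: prod_eq_iff algebra_simps add_divide_distrib diff_divide_distrib)
    then show ?thesis by (simp only: bilinear_conv_bounded_bilinear)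
  qed
  show "siegel (line (horo p)) = (- 1 / 2, 0) + (\<i> * of_real (snd p) / 2, fst p) + (- (fst p * cnj (fst p)) / 2, 0)" for p
    unfolding siegel_horo hgt_def by (simp add: prod_eq_iff field_simps)
qed

context cusp_lattice
begin

text \<open>The similarity conjugates the given group to \<open>D\<close>, and \<open>horo\<close>
  carries \<open>D\<close> to the stabiliser of the cusp. The composite is one global map of Nil
  onto the horosphere matching the orbits, so no local choices are needed for smoothness.\<close>

theorem occurs:
  assumes l: "l \<noteq> 0"
    and to: "\<And>g. g \<in> \<Delta> \<Longrightarrow> \<exists>h\<in>D. simil m l \<circ> g = h \<circ> simil m l"
    and from_: "\<And>h. h \<in> D \<Longrightarrow> \<exists>g\<in>\<Delta>. simil m l \<circ> g = h \<circ> simil m l"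
  shows "occurs_as_cusp_cross_section \<Delta> d"
proof -
  let ?s = "simil m l"
  let ?G = "Isom_Nil\<lparr>carrier := \<Delta>\<rparr>"
  let ?St = "stabilizer (Isom_H2C\<lparr>carrier := \<Gamma>\<rparr>) (\<lambda>g. g) (line infinity)"
  let ?H = "Isom_H2C\<lparr>carrier := ?St\<rparr>"
  define \<Psi> where "\<Psi> p = line (horo (?s p))" for p
  have inj: "inj \<Psi>"
    unfolding \<Psi>_def by (rule injI) (use bij_is_inj[OF bij_simil[OF l]] in \<open>simp add: horo_inj inj_eq\<close>)
  have act: "proj (heis z t u) (\<Psi> p) = line (horo (nil_iso z t u False (?s p)))" if "DD z t u" for z t u p
    using hyp_horo[OF DD_unit[OF that], of z t False] by (simp add: hyp_def \<Psi>_def)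
  have orb: "orbit ?H (\<lambda>g. g) (\<Psi> p) = \<Psi> ` orbit ?G (\<lambda>g. g) p" for p
  proof (intro equalityI subsetI)
    fix y assume "y \<in> orbit ?H (\<lambda>g. g) (\<Psi> p)"
    then obtain z t u where y: "DD z t u" "y = proj (heis z t u) (\<Psi> p)"
      unfolding stabilizer_Gamma by (auto simp: orbit_def)
    have "nil_iso z t u False \<in> D" using y(1) by (simp add: DD_def)
    then obtain g where g: "g \<in> \<Delta>" "?s \<circ> g = nil_iso z t u False \<circ> ?s" using from_ by blast
    have "y = \<Psi> (g p)" unfolding y(2) act[OF y(1)] using fun_cong[OF g(2), of p] by (simp add: \<Psi>_def)
    then show "y \<in> \<Psi> ` orbit ?G (\<lambda>g. g) p" using g(1) by (auto simp: orbit_def)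
  next
    fix y assume "y \<in> \<Psi> ` orbit ?G (\<lambda>g. g) p"
    then obtain g where g: "g \<in> \<Delta>" "y = \<Psi> (g p)" by (auto simp: orbit_def)
    obtain h where h: "h \<in> D" "?s \<circ> g = h \<circ> ?s" using to[OF g(1)] by blast
    obtain z t u where h': "cmod u = 1" "h = nil_iso z t u False" using form[OF h(1)] by blast
    have DD: "DD z t u" using h h' by (simp add: DD_def)
    have "y = proj (heis z t u) (\<Psi> p)"
      unfolding act[OF DD] g(2) using fun_cong[OF h(2), of p] by (simp add: \<Psi>_def h'(2))
    then show "y \<in> orbit ?H (\<lambda>g. g) (\<Psi> p)"
      unfolding stabilizer_Gamma using DD by (auto simp: orbit_def)
  qed
  define f where "f U = \<Psi> ` U" for U
  have S: "horosphere0 = range \<Psi>"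
  proof -
    have "range \<Psi> = (\<lambda>p. line (horo p)) ` range ?s" by (auto simp: \<Psi>_def)
    then show ?thesis using bij_is_surj[OF bij_simil[OF l, of m]] by (simp add: horosphere0_eq)
  qed
  have orbs: "orbits ?G UNIV (\<lambda>g. g) = range (orbit ?G (\<lambda>g. g))"
    "orbits ?H horosphere0 (\<lambda>g. g) = range (\<lambda>p. orbit ?H (\<lambda>g. g) (\<Psi> p))"
    unfolding orbits_def S by auto
  have injf: "inj_on f (orbits ?G UNIV (\<lambda>g. g))"
    unfolding f_def by (rule inj_onI) (simp only: inj_image_eq_iff[OF inj])
  have bij: "bij_betw f (orbits ?G UNIV (\<lambda>g. g)) (orbits ?H horosphere0 (\<lambda>g. g))"
    unfolding bij_betw_def using injf by (simp only: orbs orb f_def image_image simp_thms)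
  have f1: "f (orbit ?G (\<lambda>g. g) p) = orbit ?H (\<lambda>g. g) (\<Psi> p)" for p
    by (simp only: f_def orb)
  have f2: "inv_into (orbits ?G UNIV (\<lambda>g. g)) f (orbit ?H (\<lambda>g. g) (\<Psi> p)) = orbit ?G (\<lambda>g. g) p" for p
    unfolding f1[symmetric] by (rule inv_into_f_f[OF injf]) (simp add: orbs)
  have diff: "diffeomorphic_quotients id UNIV ?G siegel horosphere0 ?H"
    unfolding diffeomorphic_quotients_def
  proof (intro exI conjI)
    show "bij_betw f (orbits ?G UNIV (\<lambda>g. g)) (orbits ?H horosphere0 (\<lambda>g. g))" by (rule bij)
    show "smooth_quotient_map id UNIV ?G siegel horosphere0 ?H f"
      unfolding smooth_quotient_map_def
    proof (intro ballI exI conjI impI)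
      show "open (UNIV :: nil set)" by simp
      show "C_infinity_on UNIV (\<lambda>p. siegel (line (horo (?s p))))"
        by (rule C_infinity_quadratic_map[OF quadratic_map_comp_affine[OF quadratic_map_siegel_horo simil_linear_part simil_affine]])
      fix y :: nil
      show "\<exists>z\<in>horosphere0. siegel z = siegel (line (horo (?s (id y)))) \<and> f (orbit ?G (\<lambda>g. g) y) = orbit ?H (\<lambda>g. g) z"
      proof (rule bexI[of _ "\<Psi> y"], rule conjI)
        show "siegel (\<Psi> y) = siegel (line (horo (?s (id y))))" by (simp only: \<Psi>_def id_apply)
        show "f (orbit ?G (\<lambda>g. g) y) = orbit ?H (\<lambda>g. g) (\<Psi> y)" by (rule f1)
        show "\<Psi> y \<in> horosphere0" unfolding S by (rule rangeI)
      qed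
    qed simp
    show "smooth_quotient_map siegel horosphere0 ?H id UNIV ?G (inv_into (orbits ?G UNIV (\<lambda>g. g)) f)"
      unfolding smooth_quotient_map_def
    proof (intro ballI exI conjI impI)
      show "open (UNIV :: (complex \<times> complex) set)" by simp
      have "bounded_linear (\<lambda>q :: complex \<times> complex. (snd q, 2 * Im (fst q)))"
        unfolding linear_conv_bounded_linear[symmetric] by (rule linearI) (simp_all add: prod_eq_iff)
      note bl = bounded_linear_compose[OF simil_inv_linear_part this]
      \<comment> \<open>On the horosphere the second Siegel coordinate is the planar part, and twice
        the imaginary part of the first is the height.\<close>
      show "C_infinity_on UNIV (\<lambda>q :: complex \<times> complex. simil_inv m l (snd q, 2 * Im (fst q)))"
        by (rule C_infinity_quadratic_map[OF quadratic_map_affine[OF bl simil_inv_affine]])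
      fix y assume "y \<in> horosphere0"
      then obtain p where y: "y = \<Psi> p" unfolding S by blast
      have "simil_inv m l (snd (siegel y), 2 * Im (fst (siegel y))) = p"
        unfolding y \<Psi>_def siegel_horo by (simp add: hgt_def simil_inverse[OF l])
      then show "\<exists>z\<in>UNIV. id z = simil_inv m l (snd (siegel y), 2 * Im (fst (siegel y))) \<and>
          inv_into (orbits ?G UNIV (\<lambda>g. g)) f (orbit ?H (\<lambda>g. g) y) = orbit ?G (\<lambda>g. g) z"
        by (intro bexI[of _ p]) (simp_all add: y f2)
    qed simp
  qed
  have "\<exists>q S. cusp_point \<Gamma> q \<and> is_horosphere q S \<and> diffeomorphic_quotients id UNIV ?G siegel S
      (Isom_H2C\<lparr>carrier := stabilizer (Isom_H2C\<lparr>carrier := \<Gamma>\<rparr>) (\<lambda>g. g) q\<rparr>)"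
    by (rule exI, rule exI, rule conjI[OF Gamma_cusp conjI[OF is_horosphere0 diff]])
  then show ?thesis
    unfolding occurs_as_cusp_cross_section_def
    by (intro exI[of _ \<Gamma>] conjI[OF Gamma_manifold conjI[OF Gamma_commensurable]])
qed

end

section \<open>Twisted lattices up to similarity\<close>

text \<open>Multiplicativity is only assumed on \<open>S\<close>: the transfer lemmas serve both
  conjugation by a similarity, with \<open>S\<close> everything, and the homomorphism induced by a
  diffeomorphism, defined on the lattice alone.\<close>

lemma hom_funpow:
  assumes id: "id \<in> S" "K id = id" and comp: "\<forall>f\<in>S. \<forall>g\<in>S. f \<circ> g \<in> S \<and> K (f \<circ> g) = K f \<circ> K g"
    and f: "f \<in> S"
  shows "f ^^ n \<in> S \<and> K (f ^^ n) = K f ^^ n"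
proof (induction n)
  case 0
  show ?case unfolding funpow.simps by (simp only: id simp_thms)
next
  case (Suc n)
  then show ?case using comp f unfolding funpow.simps by (simp only: simp_thms)
qed

lemma hom_heis_rels:
  assumes id: "id \<in> S" "K id = id" and comp: "\<forall>f\<in>S. \<forall>g\<in>S. f \<circ> g \<in> S \<and> K (f \<circ> g) = K f \<circ> K g"
    and S: "a \<in> S" "b \<in> S" "c \<in> S" "s \<in> S"
    and rel: "heis_rels k a b c s"
  shows "heis_rels k (K a) (K b) (K c) (K s)"
proof -
  have K: "K (f \<circ> g) = K f \<circ> K g" "f \<circ> g \<in> S" if "f \<in> S" "g \<in> S" for f g using comp that by simp_all
  have pw: "K (f ^^ n) = K f ^^ n" "f ^^ n \<in> S" if "f \<in> S" for f n using hom_funpow[OF id comp that] by simp_all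
  have "K (b \<circ> a) = K (c ^^ k \<circ> (a \<circ> b))" "K (c \<circ> a) = K (a \<circ> c)" "K (c \<circ> b) = K (b \<circ> c)" "K (c \<circ> s) = K (s \<circ> c)"
    using rel by (simp_all only: heis_rels_def)
  then show ?thesis unfolding heis_rels_def by (simp only: K pw S simp_thms)
qed

lemma hom_quarter_rels:
  assumes id: "id \<in> S" "K id = id" and comp: "\<forall>f\<in>S. \<forall>g\<in>S. f \<circ> g \<in> S \<and> K (f \<circ> g) = K f \<circ> K g"
    and S: "a \<in> S" "b \<in> S" "c \<in> S" "s \<in> S"
    and rel: "quarter_rels k p a b c s"
  shows "quarter_rels k p (K a) (K b) (K c) (K s)"
proof -
  have h: "heis_rels k (K a) (K b) (K c) (K s)"
    by (rule hom_heis_rels[OF id comp S]) (use rel in \<open>simp_all only: quarter_rels_def\<close>)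
  have K: "K (f \<circ> g) = K f \<circ> K g" "f \<circ> g \<in> S" if "f \<in> S" "g \<in> S" for f g using comp that by simp_all
  have pw: "K (f ^^ n) = K f ^^ n" "f ^^ n \<in> S" if "f \<in> S" for f n using hom_funpow[OF id comp that] by simp_all
  have "K (s \<circ> a) = K (b \<circ> s)" "K (a \<circ> (s \<circ> b)) = K s" "K (s ^^ 4) = K (c ^^ p)"
    using rel by (simp_all only: quarter_rels_def)
  then show ?thesis unfolding quarter_rels_def using h by (simp only: K pw S simp_thms)
qed

lemma hom_third_rels:
  assumes id: "id \<in> S" "K id = id" and comp: "\<forall>f\<in>S. \<forall>g\<in>S. f \<circ> g \<in> S \<and> K (f \<circ> g) = K f \<circ> K g"
    and S: "a \<in> S" "b \<in> S" "c \<in> S" "s \<in> S"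
    and rel: "third_rels k k1 k2 a b c s"
  shows "third_rels k k1 k2 (K a) (K b) (K c) (K s)"
proof -
  have h: "heis_rels k (K a) (K b) (K c) (K s)"
    by (rule hom_heis_rels[OF id comp S]) (use rel in \<open>simp_all only: third_rels_def\<close>)
  have K: "K (f \<circ> g) = K f \<circ> K g" "f \<circ> g \<in> S" if "f \<in> S" "g \<in> S" for f g using comp that by simp_all
  have pw: "K (f ^^ n) = K f ^^ n" "f ^^ n \<in> S" if "f \<in> S" for f n using hom_funpow[OF id comp that] by simp_all
  have "K (s \<circ> a) = K (b \<circ> (s \<circ> c ^^ k1))" "K (b \<circ> (a \<circ> (s \<circ> b))) = K s" "K (s ^^ 3) = K (c ^^ k2)"
    using rel by (simp_all only: third_rels_def)
  then show ?thesis unfolding third_rels_def using h by (simp only: K pw S simp_thms)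
qed

lemma hom_sixth_rels:
  assumes id: "id \<in> S" "K id = id" and comp: "\<forall>f\<in>S. \<forall>g\<in>S. f \<circ> g \<in> S \<and> K (f \<circ> g) = K f \<circ> K g"
    and S: "a \<in> S" "b \<in> S" "c \<in> S" "s \<in> S"
    and rel: "sixth_rels k k1 a b c s"
  shows "sixth_rels k k1 (K a) (K b) (K c) (K s)"
proof -
  have h: "heis_rels k (K a) (K b) (K c) (K s)"
    by (rule hom_heis_rels[OF id comp S]) (use rel in \<open>simp_all only: sixth_rels_def\<close>)
  have K: "K (f \<circ> g) = K f \<circ> K g" "f \<circ> g \<in> S" if "f \<in> S" "g \<in> S" for f g using comp that by simp_all
  have pw: "K (f ^^ n) = K f ^^ n" "f ^^ n \<in> S" if "f \<in> S" for f n using hom_funpow[OF id comp that] by simp_all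
  have "K (s \<circ> a) = K (a \<circ> (b \<circ> s))" "K (a \<circ> (s \<circ> b)) = K s" "K (s ^^ 6) = K (c ^^ k1)"
    using rel by (simp_all only: sixth_rels_def)
  then show ?thesis unfolding sixth_rels_def using h by (simp only: K pw S simp_thms)
qed

lemma nil_iso_rotation_pow:
  "cmod u = 1 \<Longrightarrow> nil_iso 0 t u False ^^ n = nil_iso 0 (real n * t) (u ^ n) False"
  by (induction n) (simp_all add: nil_iso_id nil_iso_comp algebra_simps)

text \<open>Heights x for which i x lies in the field Q(i sqrt d); a rescaling turns finitely many
  of them into multiples of 2 sqrt d.\<close>

definition rat_multiple :: "nat \<Rightarrow> real \<Rightarrow> bool" where
  "rat_multiple d x \<longleftrightarrow> (\<exists>q\<in>\<rat>. x = sqrt d * q)"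

lemma rat_multiple_intros:
  "rat_multiple d x \<Longrightarrow> rat_multiple d y \<Longrightarrow> rat_multiple d (x + y)"
  "rat_multiple d x \<Longrightarrow> q \<in> \<rat> \<Longrightarrow> rat_multiple d (q * x)"
  "rat_multiple d 0"
proof -
  assume "rat_multiple d x" "rat_multiple d y"
  then obtain p q where "p \<in> \<rat>" "q \<in> \<rat>" "x = sqrt d * p" "y = sqrt d * q" by (auto simp: rat_multiple_def)
  then show "rat_multiple d (x + y)" unfolding rat_multiple_def by (intro bexI[of _ "p + q"]) (simp_all add: algebra_simps)
next
  assume "rat_multiple d x" "q \<in> \<rat>"
  then obtain p where "p \<in> \<rat>" "x = sqrt d * p" by (auto simp: rat_multiple_def)
  then show "rat_multiple d (q * x)" unfolding rat_multiple_def using \<open>q \<in> \<rat>\<close> by (intro bexI[of _ "q * p"]) simp_all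
qed (auto simp: rat_multiple_def intro: bexI[of _ 0])

lemma (in quadratic_order) rat_multiple_Im: "rat_multiple d (Im v)"
proof -
  obtain n where "2 * Im v = sqrt d * of_int n" using O_Im[OF O_v] by blast
  then have "Im v = sqrt d * (of_int n / 2)" by simp
  then show ?thesis unfolding rat_multiple_def by (intro bexI[of _ "of_int n / 2"]) simp_all
qed

text \<open>The normalised coordinates of the generators: \<open>a\<close> has planar part 1.\<close>

definition solved :: "nat \<Rightarrow> complex \<Rightarrow> complex \<Rightarrow> real \<Rightarrow> real \<Rightarrow> real \<Rightarrow> real \<Rightarrow> bool" where
  "solved d u w \<alpha> \<beta> \<eta> \<tau> \<longleftrightarrow> quadratic_order d w \<and> (u = w \<or> u = 1 + w) \<and>
     rat_multiple d \<alpha> \<and> rat_multiple d \<beta> \<and> rat_multiple d \<eta> \<and> rat_multiple d \<tau>"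

lemma solve_commutator:
  assumes "heis_rels k (nil_iso 1 \<alpha> 1 False) (nil_iso w \<beta> 1 False) (nil_iso 0 \<eta> 1 False) s" "k > 0"
    and "quadratic_order d w"
  shows "rat_multiple d \<eta>"
proof -
  have "nil_iso w \<beta> 1 False \<circ> nil_iso 1 \<alpha> 1 False = nil_iso 0 \<eta> 1 False ^^ k \<circ> (nil_iso 1 \<alpha> 1 False \<circ> nil_iso w \<beta> 1 False)"
    using assms(1) by (simp only: heis_rels_def)
  then have "k * \<eta> = 4 * Im w" by (simp add: nil_iso_funpow_vertical nil_iso_comp nil_iso_inject)
  then have "\<eta> = (4 / k) * Im w" using assms(2) by (simp add: field_simps)
  then show ?thesis using quadratic_order.rat_multiple_Im[OF assms(3)] by (simp only:) (intro rat_multiple_intros; simp)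
qed

text \<open>Here and for the other twists, the planar parts of the relations determine w and u, and
  the vertical parts form a linear system with rational coefficients that expresses all heights
  through Im w and the height of \<open>c\<close>.\<close>

lemma quarter_solve:
  assumes rel: "quarter_rels k p (nil_iso 1 \<alpha> 1 False) (nil_iso w \<beta> 1 False) (nil_iso 0 \<eta> 1 False) (nil_iso 0 \<tau> u False)"
    and k: "k > 0" and u: "cmod u = 1"
  shows "solved 1 u w \<alpha> \<beta> \<eta> \<tau>"
proof -
  let ?a = "nil_iso 1 \<alpha> 1 False" and ?b = "nil_iso w \<beta> 1 False" and ?c = "nil_iso 0 \<eta> 1 False" and ?s = "nil_iso 0 \<tau> u False"
  have u0: "u \<noteq> 0" using u by auto
  have h: "heis_rels k ?a ?b ?c ?s" and "?s \<circ> ?a = ?b \<circ> ?s" and "?a \<circ> (?s \<circ> ?b) = ?s" and "?s ^^ 4 = ?c ^^ p"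
    using rel by (simp_all only: quarter_rels_def)
  then have uw: "u = w" and ab: "\<alpha> = \<beta>" and e: "1 + u * w = 0" "\<alpha> + (\<tau> + \<beta>) + 2 * Im (cnj (u * w)) = \<tau>"
    and t: "4 * \<tau> = p * \<eta>"
    using u u0 by (simp_all add: nil_iso_comp nil_iso_inject nil_iso_rotation_pow nil_iso_funpow_vertical del: complex_cnj_mult)
  have "u * w = - 1" using e(1) by (simp add: eq_neg_iff_add_eq_0 add.commute)
  then have Q: "quadratic_order 1 w" using uw by unfold_locales simp
  have "\<alpha> = 0" using e(2) ab unfolding \<open>u * w = - 1\<close> by simp
  moreover have eta: "rat_multiple 1 \<eta>" by (rule solve_commutator[OF h k Q])
  moreover have "\<tau> = (p / 4) * \<eta>" using t by simp
  then have "rat_multiple 1 \<tau>" using eta by (simp only:) (intro rat_multiple_intros; simp)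
  ultimately show ?thesis unfolding solved_def using Q uw ab rat_multiple_intros(3)[of 1] by simp
qed

lemma third_solve:
  assumes rel: "third_rels k k1 k2 (nil_iso 1 \<alpha> 1 False) (nil_iso w \<beta> 1 False) (nil_iso 0 \<eta> 1 False) (nil_iso 0 \<tau> u False)"
    and k: "k > 0" and u: "cmod u = 1"
  shows "solved 3 u w \<alpha> \<beta> \<eta> \<tau>"
proof -
  let ?a = "nil_iso 1 \<alpha> 1 False" and ?b = "nil_iso w \<beta> 1 False" and ?c = "nil_iso 0 \<eta> 1 False" and ?s = "nil_iso 0 \<tau> u False"
  have u0: "u \<noteq> 0" using u by auto
  have h: "heis_rels k ?a ?b ?c ?s" and r: "?s \<circ> ?a = ?b \<circ> (?s \<circ> ?c ^^ k1)" "?b \<circ> (?a \<circ> (?s \<circ> ?b)) = ?s" "?s ^^ 3 = ?c ^^ k2"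
    using rel by (simp_all only: third_rels_def)
  have uw: "u = w" and ab: "\<tau> + \<alpha> = \<beta> + (\<tau> + k1 * \<eta>)"
    using r(1) u u0 by (simp_all add: nil_iso_comp nil_iso_inject nil_iso_funpow_vertical)
  have t: "3 * \<tau> = k2 * \<eta>"
    using r(3) u u0 by (simp_all add: nil_iso_inject nil_iso_rotation_pow nil_iso_funpow_vertical)
  have "(?b \<circ> ?a) \<circ> (?s \<circ> ?b) = ?s" using r(2) by (simp only: comp_assoc)
  then have e: "w + 1 + u * w = 0" "\<beta> + \<alpha> + 2 * Im w + (\<tau> + \<beta>) + 2 * Im ((w + 1) * cnj (u * w)) = \<tau>"
    using u u0 by (simp_all add: nil_iso_comp nil_iso_inject del: complex_cnj_mult)
  have uww: "u * w = - (w + 1)" using e(1) by (simp only: add_eq_0_iff)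
  then have Q: "quadratic_order 3 w" using uw by unfold_locales simp
  have "Im ((w + 1) * cnj (u * w)) = 0" unfolding uww by (simp add: algebra_simps)
  then have "3 * \<alpha> = 2 * k1 * \<eta> - 2 * Im w" using e(2) ab by (simp add: algebra_simps del: complex_cnj_mult times_complex.sel)
  then have al: "\<alpha> = (2 * k1 / 3) * \<eta> + (- 2 / 3) * Im w" by simp
  have be: "\<beta> = \<alpha> + (- real k1) * \<eta>" using ab by simp
  have ta: "\<tau> = (k2 / 3) * \<eta>" using t by simp
  have eta: "rat_multiple 3 \<eta>" by (rule solve_commutator[OF h k Q])
  note Imw = quadratic_order.rat_multiple_Im[OF Q]
  have "rat_multiple 3 \<alpha>" unfolding al by (intro rat_multiple_intros eta Imw) simp_all
  moreover from this have "rat_multiple 3 \<beta>" unfolding be by (intro rat_multiple_intros eta) simp_all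
  moreover have "rat_multiple 3 \<tau>" unfolding ta by (intro rat_multiple_intros eta) simp_all
  ultimately show ?thesis unfolding solved_def using Q uw eta by simp
qed

lemma sixth_solve:
  assumes rel: "sixth_rels k k1 (nil_iso 1 \<alpha> 1 False) (nil_iso w \<beta> 1 False) (nil_iso 0 \<eta> 1 False) (nil_iso 0 \<tau> u False)"
    and k: "k > 0" and u: "cmod u = 1"
  shows "solved 3 u w \<alpha> \<beta> \<eta> \<tau>"
proof -
  let ?a = "nil_iso 1 \<alpha> 1 False" and ?b = "nil_iso w \<beta> 1 False" and ?c = "nil_iso 0 \<eta> 1 False" and ?s = "nil_iso 0 \<tau> u False"
  have u0: "u \<noteq> 0" using u by auto
  have h: "heis_rels k ?a ?b ?c ?s" and r: "?s \<circ> ?a = ?a \<circ> (?b \<circ> ?s)" "?a \<circ> (?s \<circ> ?b) = ?s" "?s ^^ 6 = ?c ^^ k1"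
    using rel by (simp_all only: sixth_rels_def)
  have uw: "u = 1 + w" and ab: "\<tau> + \<alpha> = \<alpha> + (\<beta> + \<tau>) + 2 * Im (cnj w)"
    using r(1) u u0 by (simp_all add: nil_iso_comp nil_iso_inject)
  have t: "6 * \<tau> = k1 * \<eta>"
    using r(3) u u0 by (simp_all add: nil_iso_inject nil_iso_rotation_pow nil_iso_funpow_vertical)
  have e: "1 + u * w = 0" "\<alpha> + (\<tau> + \<beta>) + 2 * Im (cnj (u * w)) = \<tau>"
    using r(2) u u0 by (simp_all add: nil_iso_comp nil_iso_inject del: complex_cnj_mult)
  have uww: "u * w = - 1" using e(1) by (simp add: eq_neg_iff_add_eq_0 add.commute)
  have "w * w = - 1 - w" using uww unfolding uw by (simp add: algebra_simps eq_neg_iff_add_eq_0)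
  then have Q: "quadratic_order 3 w" by unfold_locales simp
  have be: "\<beta> = 2 * Im w" using ab by simp
  have al: "\<alpha> = (- 2) * Im w" using e(2) unfolding uww be by simp
  have ta: "\<tau> = (k1 / 6) * \<eta>" using t by simp
  have eta: "rat_multiple 3 \<eta>" by (rule solve_commutator[OF h k Q])
  note Imw = quadratic_order.rat_multiple_Im[OF Q]
  have "rat_multiple 3 \<alpha>" unfolding al by (intro rat_multiple_intros Imw) simp_all
  moreover have "rat_multiple 3 \<beta>" unfolding be by (intro rat_multiple_intros Imw) simp_all
  moreover have "rat_multiple 3 \<tau>" unfolding ta by (intro rat_multiple_intros eta) simp_all
  ultimately show ?thesis unfolding solved_def using Q uw eta by simp
qed

text \<open>The height acquired by an isometry when it is conjugated by the translation taking m to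
  the origin.\<close>

definition vert :: "complex \<Rightarrow> complex \<Rightarrow> real \<Rightarrow> complex \<Rightarrow> real" where
  "vert m z t u = t - 2 * Im (m * cnj z) + 2 * Im ((z - m) * cnj (u * m))"

text \<open>The similarity is a dilation after a translation. The dilation multiplies the cross
  terms by |l|^2, the same factor as the heights.\<close>

lemma simil_nil_iso:
  assumes u: "cmod u = 1"
  shows "simil m l \<circ> nil_iso z t u False = nil_iso (l * (z - m + u * m)) ((cmod l)\<^sup>2 * vert m z t u) u False \<circ> simil m l"
proof -
  define dil where "dil p = (l * fst p, (cmod l)\<^sup>2 * snd p)" for p :: nil
  have s: "simil m l = dil \<circ> nil_iso (- m) 0 1 False"
    by (rule ext) (simp add: simil_def dil_def nil_iso_def)
  have ll: "Im ((l * x) * cnj (l * y)) = (cmod l)\<^sup>2 * Im (x * cnj y)" for x y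
  proof -
    have "(l * x) * cnj (l * y) = (l * cnj l) * (x * cnj y)" by (simp only: complex_cnj_mult ac_simps)
    also have "\<dots> = complex_of_real ((cmod l)\<^sup>2) * (x * cnj y)" by (simp only: complex_norm_square)
    finally have eq: "(l * x) * cnj (l * y) = complex_of_real ((cmod l)\<^sup>2) * (x * cnj y)" .
    show ?thesis unfolding eq times_complex.sel Re_complex_of_real Im_complex_of_real by simp
  qed
  have d: "dil \<circ> nil_iso z t u False = nil_iso (l * z) ((cmod l)\<^sup>2 * t) u False \<circ> dil" for z t u
  proof (rule ext)
    fix p :: nil
    have eq1: "u * (l * fst p) = l * (u * fst p)" by simp
    have "Im ((l * z) * cnj (u * (l * fst p))) = (cmod l)\<^sup>2 * Im (z * cnj (u * fst p))" by (simp only: eq1 ll)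
    then show "(dil \<circ> nil_iso z t u False) p = (nil_iso (l * z) ((cmod l)\<^sup>2 * t) u False \<circ> dil) p"
      unfolding dil_def nil_iso_def o_apply fst_conv snd_conv cj_simps sg_simps by (simp only:) (simp add: algebra_simps)
  qed
  have c: "nil_iso (- m) 0 1 False \<circ> nil_iso z t u False = nil_iso (z - m + u * m) (vert m z t u) u False \<circ> nil_iso (- m) 0 1 False"
  proof -
    have e: "(z - m + u * m) * cnj (u * - m) = - ((z - m) * cnj (u * m)) - (u * m) * cnj (u * m)" by (simp add: algebra_simps)
    have "Im ((u * m) * cnj (u * m)) = 0" by (simp only: complex_norm_square[symmetric]) simp
    then have "Im ((z - m + u * m) * cnj (u * - m)) = - Im ((z - m) * cnj (u * m))" unfolding e by simp
    then show ?thesis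
      unfolding nil_iso_comp[OF u] nil_iso_comp[OF norm_one] vert_def by (simp add: algebra_simps del: complex_cnj_mult complex_cnj_minus)
  qed
  have "simil m l \<circ> nil_iso z t u False = dil \<circ> (nil_iso (- m) 0 1 False \<circ> nil_iso z t u False)" by (simp only: s comp_assoc)
  also have "\<dots> = (dil \<circ> nil_iso (z - m + u * m) (vert m z t u) u False) \<circ> nil_iso (- m) 0 1 False" by (simp only: c comp_assoc)
  also have "\<dots> = nil_iso (l * (z - m + u * m)) ((cmod l)\<^sup>2 * vert m z t u) u False \<circ> simil m l" by (simp only: d s comp_assoc)
  finally show ?thesis .
qed

definition sconj :: "complex \<Rightarrow> complex \<Rightarrow> (nil \<Rightarrow> nil) \<Rightarrow> nil \<Rightarrow> nil" where
  "sconj m l g = simil m l \<circ> g \<circ> simil_inv m l"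

lemma sconj_props:
  assumes "l \<noteq> 0"
  shows "sconj m l id = id" "sconj m l (f \<circ> g) = sconj m l f \<circ> sconj m l g"
    "simil m l \<circ> g = sconj m l g \<circ> simil m l" "sconj m l g = id \<Longrightarrow> g = id"
    "simil m l \<circ> g = h \<circ> simil m l \<Longrightarrow> sconj m l g = h"
proof -
  have e: "simil_inv m l \<circ> simil m l = id" "simil m l \<circ> simil_inv m l = id"
    using simil_inverse[OF assms] by (auto simp: fun_eq_iff)
  show "sconj m l id = id" by (simp add: sconj_def e)
  show "sconj m l (f \<circ> g) = sconj m l f \<circ> sconj m l g"
  proof -
    have "sconj m l f \<circ> sconj m l g = simil m l \<circ> f \<circ> (simil_inv m l \<circ> simil m l) \<circ> g \<circ> simil_inv m l"
      by (simp only: sconj_def comp_assoc)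
    then show ?thesis by (simp only: e sconj_def comp_assoc id_comp)
  qed
  show s: "simil m l \<circ> g = sconj m l g \<circ> simil m l" for g by (simp only: sconj_def comp_assoc e comp_id)
  show "g = id" if "sconj m l g = id"
  proof -
    have "simil m l \<circ> g = simil m l" using s[of g] that by simp
    then have "(simil_inv m l \<circ> simil m l) \<circ> g = simil_inv m l \<circ> simil m l" by (simp only: comp_assoc)
    then show ?thesis by (simp add: e)
  qed
  show "sconj m l g = h" if "simil m l \<circ> g = h \<circ> simil m l"
    unfolding sconj_def that by (simp only: comp_assoc e comp_id)
qed

lemma sconj_nil_iso:
  assumes "l \<noteq> 0" "cmod u = 1"
  shows "sconj m l (nil_iso z t u False) = nil_iso (l * (z - m + u * m)) ((cmod l)\<^sup>2 * vert m z t u) u False"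
  by (rule sconj_props(5)[OF assms(1) simil_nil_iso[OF assms(2)]])

lemma common_multiple:
  assumes "finite A" "A \<subseteq> (\<rat> :: real set)"
  shows "\<exists>N::nat. N > 0 \<and> (\<forall>q\<in>A. real N * q \<in> \<int>)"
  using assms
proof (induction rule: finite_induct)
  case empty
  show ?case by (intro exI[of _ 1]) simp
next
  case (insert x A)
  then obtain N :: nat where N: "N > 0" "\<forall>q\<in>A. real N * q \<in> \<int>" by auto
  obtain i j :: int where ij: "x = of_int i / of_int j" "j > 0" using insert.prems by (auto elim: Rats_cases')
  have "real (nat j) * x = of_int i" using ij by simp
  then have x: "real (nat j * N) * x = of_int (int N * i)" by (simp add: mult_ac)
  have "real (nat j * N) * q \<in> \<int>" if q: "q \<in> A" for q
  proof -
    have "real (nat j) * (real N * q) \<in> \<int>" by (rule Ints_mult[OF Ints_of_nat N(2)[rule_format, OF q]])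
    then show ?thesis by (simp add: mult_ac)
  qed
  moreover have "real (nat j * N) * x \<in> \<int>" unfolding x by (rule Ints_of_int)
  moreover have "nat j * N > 0" using ij N by simp
  ultimately show ?case by (intro exI[of _ "nat j * N"]) simp
qed

lemma nil_iso_inverse:
  assumes "cmod u = 1"
  shows "nil_iso (- (cnj u * z)) (- t) (cnj u) False \<circ> nil_iso z t u False = id"
    "adjH (heis z t u) = heis (- (cnj u * z)) (- t) (cnj u)"
proof -
  have "Im ((cnj u * z) * cnj (cnj u * z)) = 0" by (simp only: complex_norm_square[symmetric]) simp
  then have i: "Im (- (cnj u * z) * cnj (cnj u * z)) = 0" by simp
  have c: "cmod (cnj u) = 1" using assms by simp
  show "nil_iso (- (cnj u * z)) (- t) (cnj u) False \<circ> nil_iso z t u False = id"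
    unfolding nil_iso_comp[OF c] cj_simps nil_iso_eq_id using i unit_cnj(2)[OF assms] by simp
  have "heis (- (cnj u * z)) (- t) (cnj u) ** heis z t u = mat 1"
    unfolding heis_mult[OF c] using i unit_cnj(2)[OF assms] heis_1 by simp
  then have "heis (- (cnj u * z)) (- t) (cnj u) ** (heis z t u ** adjH (heis z t u)) = adjH (heis z t u)"
    by (simp add: matrix_mul_assoc)
  then show "adjH (heis z t u) = heis (- (cnj u * z)) (- t) (cnj u)"
    using adjH_mult2[OF heis_U21[OF assms]] by simp
qed

lemma sconj_scale:
  assumes "l \<noteq> 0" "\<rho> > 0" "cmod u = 1"
    and "sconj m l (nil_iso z t u False) = nil_iso z1 t1 u False"
  shows "sconj m (of_real \<rho> * l) (nil_iso z t u False) = nil_iso (of_real \<rho> * z1) (\<rho>\<^sup>2 * t1) u False"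
proof -
  have l: "of_real \<rho> * l \<noteq> 0" and u0: "u \<noteq> 0" using assms by auto
  have "l * (z - m + u * m) = z1" "(cmod l)\<^sup>2 * vert m z t u = t1"
    using assms(4) unfolding sconj_nil_iso[OF assms(1,3)] using nil_iso_inject[OF u0] by simp_all
  moreover have "(cmod (of_real \<rho> * l))\<^sup>2 = \<rho>\<^sup>2 * (cmod l)\<^sup>2" by (simp add: norm_mult power_mult_distrib)
  ultimately show ?thesis unfolding sconj_nil_iso[OF l assms(3)] by (simp add: mult.assoc)
qed

text \<open>If \<open>s\<close> were a translation, the planar parts would give zb = za or zb = 0;
  in both cases the area Im (zb * cnj za) vanishes, hence also k h.\<close>

lemma screw_rotation_ne_1:
  assumes c: "real k * h = 4 * Im (zb * cnj za)" "k > 0" "h \<noteq> 0" and u: "cmod u = 1"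
    and rel: "nil_iso z t u False \<circ> nil_iso za ta 1 False = nil_iso zb tb 1 False \<circ> nil_iso z t u False \<or>
       (\<exists>j. nil_iso z t u False \<circ> nil_iso za ta 1 False = nil_iso zb tb 1 False \<circ> (nil_iso z t u False \<circ> nil_iso 0 h 1 False ^^ j)) \<or>
       nil_iso z t u False \<circ> nil_iso za ta 1 False = nil_iso za ta 1 False \<circ> (nil_iso zb tb 1 False \<circ> nil_iso z t u False)"
  shows "u \<noteq> 1"
proof
  assume u1: "u = 1"
  have "zb = za \<or> zb = 0"
    using rel unfolding u1 by (elim disjE exE) (simp_all add: nil_iso_comp nil_iso_inject nil_iso_funpow_vertical)
  then have "real k * h = 0" unfolding c(1) by (elim disjE) (simp_all add: complex_mult_cnj)
  then show False using c(2,3) by simp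
qed

text \<open>Clearing denominators by a further dilation makes the generators integral parabolics,
  and integrality passes to products and inverses, hence to the whole lattice.\<close>

theorem twist_occurs:
  assumes D: "subgroup \<Delta> Isom_Nil" and tf: "\<And>g n. g \<in> \<Delta> \<Longrightarrow> n > 0 \<Longrightarrow> g ^^ n = id \<Longrightarrow> g = id"
    and gen: "\<Delta> = generate (Isom_Nil\<lparr>carrier := \<Delta>\<rparr>) {a, b, c, s}" and sub: "{a, b, c, s} \<subseteq> \<Delta>"
    and a: "a = nil_iso za ta 1 False" and b: "b = nil_iso zb tb 1 False"
    and c: "c = nil_iso 0 h 1 False" "h \<noteq> 0" and s: "s = nil_iso z t u False" "cmod u = 1"
    and za: "za \<noteq> 0"
    and norm: "sconj m (1 / za) a = nil_iso 1 \<alpha> 1 False" "sconj m (1 / za) b = nil_iso w \<beta> 1 False"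
      "sconj m (1 / za) c = nil_iso 0 \<eta> 1 False" "sconj m (1 / za) s = nil_iso 0 \<tau> u False"
    and solved: "solved d u w \<alpha> \<beta> \<eta> \<tau>"
  shows "occurs_as_cusp_cross_section \<Delta> d"
proof -
  interpret I: group Isom_Nil by (rule group_Isom_Nil)
  interpret Q: quadratic_order d w using solved by (simp add: solved_def)
  have l: "1 / za \<noteq> 0" using za by simp
  obtain qa qb qc qs where q: "qa \<in> \<rat>" "qb \<in> \<rat>" "qc \<in> \<rat>" "qs \<in> \<rat>" and
    eq: "\<alpha> = sqrt d * qa" "\<beta> = sqrt d * qb" "\<eta> = sqrt d * qc" "\<tau> = sqrt d * qs"
    using solved unfolding solved_def rat_multiple_def by blast
  obtain N :: nat where N: "N > 0" "\<forall>q\<in>{qa, qb, qc, qs}. real N * q \<in> \<int>"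
    using common_multiple[of "{qa, qb, qc, qs}"] q by auto
  obtain ia where ia: "real N * qa = of_int ia" using N(2) Ints_cases by (metis insertI1)
  obtain ib where ib: "real N * qb = of_int ib" using N(2) Ints_cases by (metis insertI1 insertI2)
  obtain ic where ic: "real N * qc = of_int ic" using N(2) Ints_cases by (metis insertI1 insertI2)
  obtain ix where is': "real N * qs = of_int ix" using N(2) Ints_cases by (metis insertI1 insertI2)
  \<comment> \<open>The factor N clears the denominators of the heights in units of sqrt d. The
    factor 2 makes the planar norms even and the new heights multiples of 2 sqrt d, as integrality
    of \<open>hgt\<close> requires.\<close>
  define \<rho> where "\<rho> = real (2 * N)"
  have \<rho>: "\<rho> > 0" using N by (simp add: \<rho>_def)
  define L where "L = of_real \<rho> * (1 / za)"
  have L: "L \<noteq> 0" using \<rho> za by (simp add: L_def)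
  define K where "K = sconj m L"
  note K = sconj_props[OF L, of m, folded K_def]
  have sq: "\<rho>\<^sup>2 * (sqrt d * x) = 2 * sqrt d * of_int (2 * int N * i)" if "real N * x = of_int i" for x i
  proof -
    have "\<rho>\<^sup>2 * (sqrt d * x) = 4 * real N * sqrt d * (real N * x)" by (simp add: \<rho>_def power2_eq_square)
    then show ?thesis unfolding that by simp
  qed
  have Ka: "K a = nil_iso (of_nat (2 * N)) (2 * sqrt d * of_int (2 * int N * ia)) 1 False"
    using sconj_scale[OF l \<rho> _ norm(1)[unfolded a]] by (simp only: K_def L_def a eq sq[OF ia] norm_one) (simp add: \<rho>_def)
  have Kb: "K b = nil_iso (of_nat (2 * N) * w) (2 * sqrt d * of_int (2 * int N * ib)) 1 False"
    using sconj_scale[OF l \<rho> _ norm(2)[unfolded b]] by (simp only: K_def L_def b eq sq[OF ib] norm_one) (simp add: \<rho>_def)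
  have Kc: "K c = nil_iso 0 (2 * sqrt d * of_int (2 * int N * ic)) 1 False"
    using sconj_scale[OF l \<rho> _ norm(3)[unfolded c(1)]] by (simp only: K_def L_def c(1) eq sq[OF ic] norm_one) simp
  have Ks: "K s = nil_iso 0 (2 * sqrt d * of_int (2 * int N * ix)) u False"
    using sconj_scale[OF l \<rho> s(2) norm(4)[unfolded s(1)]] by (simp only: K_def L_def s(1) eq sq[OF is']) simp
  have uO: "u \<in> Q.\<O>" using solved unfolding solved_def by (elim conjE disjE) simp_all
  have wu: "cmod w = 1"
  proof -
    have "(cmod w)\<^sup>2 = 1" unfolding cmod_power2 by (rule Q.v_cases) (simp_all add: power_divide)
    then show ?thesis using norm_ge_zero[of w] by (simp only: power2_eq_1_iff) linarith
  qed
  have ht: "hgt x (2 * sqrt d * of_int i) \<in> Q.\<O>" if "x * cnj x = of_int (2 * j)" for x i j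
  proof -
    have "hgt x (2 * sqrt d * of_int i) = of_int (- j) + (\<i> * of_real (sqrt d)) * of_int i"
      unfolding hgt_def that by (simp add: field_simps)
    then show ?thesis using Q.O_sqrt_d by simp
  qed
  have ww: "w * cnj w = 1" by (rule unit_cnj(1)[OF wu])
  have hb: "(of_nat (2 * N) * w) * cnj (of_nat (2 * N) * w) = of_int (2 * (2 * int N * int N))"
  proof -
    have "(of_nat (2 * N) * w) * cnj (of_nat (2 * N) * w) = of_nat (2 * N) * of_nat (2 * N) * (w * cnj w)" by simp
    then show ?thesis unfolding ww by simp
  qed
  have ints: "Q.int_mat (heis (of_nat (2 * N)) (2 * sqrt d * of_int i) 1)"
    "Q.int_mat (heis (of_nat (2 * N) * w) (2 * sqrt d * of_int i) 1)"
    "Q.int_mat (heis 0 (2 * sqrt d * of_int i) 1)"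
    "Q.int_mat (heis 0 (2 * sqrt d * of_int i) u)" for i
    using ht[of "of_nat (2 * N)" "2 * int N * int N" i] ht[OF hb, of i] ht[of 0 0 i] uO
    unfolding Q.int_mat_def forall_3 heis_nth by simp_all
  \<comment> \<open>The property that is propagated from the generators: after conjugation the
    element is an integral parabolic without conjugation.\<close>
  define P where "P g \<longleftrightarrow> (\<exists>z t u. cmod u = 1 \<and> K g = nil_iso z t u False \<and> Q.int_mat (heis z t u))" for g
  have PI: "P g" if "cmod u = 1" "K g = nil_iso z t u False" "Q.int_mat (heis z t u)" for g z t u
    using that unfolding P_def by blast
  have Pgen: "P a" "P b" "P c" "P s"
    using PI[OF norm_one Ka ints(1)] PI[OF norm_one Kb ints(2)] PI[OF norm_one Kc ints(3)] PI[OF s(2) Ks ints(4)] .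
  have Pinv: "P g'" if g: "P g" "g \<circ> g' = id" for g g'
  proof -
    obtain z t u where z: "cmod u = 1" "K g = nil_iso z t u False" "Q.int_mat (heis z t u)" using g(1) unfolding P_def by blast
    let ?n = "nil_iso (- (cnj u * z)) (- t) (cnj u) False"
    have "K g \<circ> K g' = id" using g(2) K(1,2) by metis
    then have "?n \<circ> (K g \<circ> K g') = ?n" by simp
    then have "K g' = ?n" unfolding comp_assoc[symmetric] z(2) nil_iso_inverse(1)[OF z(1)] by simp
    moreover have "Q.int_mat (heis (- (cnj u * z)) (- t) (cnj u))"
      unfolding nil_iso_inverse(2)[OF z(1), symmetric] by (rule Q.int_mat_adjH[OF z(3)])
    moreover have "cmod (cnj u) = 1" using z(1) by simp
    ultimately show ?thesis by (intro PI)
  qed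
  have Pmult: "P (g \<circ> g')" if g: "P g" "P g'" for g g'
  proof -
    obtain z t u where z: "cmod u = 1" "K g = nil_iso z t u False" "Q.int_mat (heis z t u)" using g(1) unfolding P_def by blast
    obtain z' t' u' where z': "cmod u' = 1" "K g' = nil_iso z' t' u' False" "Q.int_mat (heis z' t' u')" using g(2) unfolding P_def by blast
    have "cmod (u * u') = 1" by (simp add: norm_mult z z')
    moreover have "K (g \<circ> g') = nil_iso (z + u * z') (t + t' + 2 * Im (z * cnj (u * z'))) (u * u') False"
      unfolding K(2) z(2) z'(2) nil_iso_comp[OF z(1)] by simp
    moreover have "Q.int_mat (heis (z + u * z') (t + t' + 2 * Im (z * cnj (u * z'))) (u * u'))"
      unfolding heis_mult[OF z(1), symmetric] by (rule Q.int_mat_mult[OF z(3) z'(3)])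
    ultimately show ?thesis by (rule PI)
  qed
  have Pall: "P g" if "g \<in> \<Delta>" for g
  proof -
    have "g \<in> generate (Isom_Nil\<lparr>carrier := \<Delta>\<rparr>) {a, b, c, s}" using that gen by simp
    then show ?thesis
    proof (induction rule: generate.induct)
      case one
      have "K id = nil_iso 0 0 1 False" unfolding K(1) nil_iso_id ..
      moreover have "Q.int_mat (heis 0 0 1)" unfolding heis_1 by (rule Q.int_mat_1)
      ultimately have "P id" by (intro PI[OF norm_one])
      moreover have "\<one>\<^bsub>Isom_Nil\<lparr>carrier := \<Delta>\<rparr>\<^esub> = id" by (simp add: Isom_Nil_def)
      ultimately show ?case by (simp only:)
    next
      case (incl x)
      then show ?case using Pgen by auto
    next
      case (inv x)
      then have x: "x \<in> \<Delta>" "P x" using sub Pgen by auto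
      have "inv\<^bsub>Isom_Nil\<lparr>carrier := \<Delta>\<rparr>\<^esub> x = inv\<^bsub>Isom_Nil\<^esub> x" by (rule I.m_inv_consistent[OF D x(1)])
      moreover have "x \<circ> inv\<^bsub>Isom_Nil\<^esub> x = id" using I.r_inv[of x] subgroup.mem_carrier[OF D x(1)] by simp
      ultimately show ?case using Pinv[OF x(2)] by simp
    next
      case (eng g g')
      have "g \<otimes>\<^bsub>Isom_Nil\<lparr>carrier := \<Delta>\<rparr>\<^esub> g' = g \<circ> g'" by (simp add: Isom_Nil_def)
      then show ?case using Pmult[OF eng.IH] by (simp only:)
    qed
  qed
  define DD where "DD = K ` \<Delta>"
  have Dsub: "subgroup DD Isom_Nil"
  proof (rule I.subgroupI)
    show "DD \<subseteq> carrier Isom_Nil"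
    proof
      fix x assume "x \<in> DD"
      then obtain g where "g \<in> \<Delta>" "x = K g" by (auto simp: DD_def)
      then show "x \<in> carrier Isom_Nil" using Pall[of g] nil_isoI unfolding P_def by auto
    qed
    show "DD \<noteq> {}" using subgroup.one_closed[OF D] by (auto simp: DD_def)
    fix x assume x: "x \<in> DD"
    then obtain g where g: "g \<in> \<Delta>" "x = K g" by (auto simp: DD_def)
    have "inv\<^bsub>Isom_Nil\<^esub> g \<circ> g = id" using I.l_inv[of g] subgroup.mem_carrier[OF D g(1)] by simp
    then have "K (inv\<^bsub>Isom_Nil\<^esub> g) \<circ> x = id" unfolding g(2) K(2)[symmetric] by (simp only: K(1))
    moreover have i: "K (inv\<^bsub>Isom_Nil\<^esub> g) \<in> DD" unfolding DD_def by (rule imageI[OF subgroup.m_inv_closed[OF D g(1)]])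
    ultimately have "inv\<^bsub>Isom_Nil\<^esub> x = K (inv\<^bsub>Isom_Nil\<^esub> g)"
      using \<open>DD \<subseteq> carrier Isom_Nil\<close> x by (intro I.inv_equality) auto
    then show "inv\<^bsub>Isom_Nil\<^esub> x \<in> DD" using i by simp
    fix y assume "y \<in> DD"
    then obtain g' where g': "g' \<in> \<Delta>" "y = K g'" by (auto simp: DD_def)
    have "g \<circ> g' \<in> \<Delta>" using subgroup.m_closed[OF D g(1) g'(1)] by simp
    then have "K (g \<circ> g') \<in> DD" unfolding DD_def by (rule imageI)
    then show "x \<otimes>\<^bsub>Isom_Nil\<^esub> y \<in> DD" by (simp add: K(2) g(2) g'(2))
  qed
  interpret C: cusp_lattice d w DD "2 * N" "2 * int N * ia" "2 * int N * ib" "2 * int N * ic"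
  proof (intro cusp_lattice.intro cusp_lattice_axioms.intro)
    show "quadratic_order d w" by (rule Q.quadratic_order_axioms)
    show "subgroup DD Isom_Nil" by (rule Dsub)
    show "\<exists>z t u. cmod u = 1 \<and> g = nil_iso z t u False \<and> Q.int_mat (heis z t u)" if g: "g \<in> DD" for g
    proof -
      obtain x where "x \<in> \<Delta>" "g = K x" using g by (auto simp: DD_def)
      then show ?thesis using Pall[of x] by (simp add: P_def)
    qed
    show "g = id" if g: "g \<in> DD" "n > 0" "g ^^ n = id" for g n
    proof -
      obtain x where x: "x \<in> \<Delta>" "g = K x" using g(1) by (auto simp: DD_def)
      have "K (x ^^ n) = K x ^^ n"
        using hom_funpow[of UNIV K x n] K(1,2) by simp
      then have "x ^^ n = id" using K(4) g(3) x(2) by simp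
      then have "x = id" by (rule tf[OF x(1) g(2)])
      then show ?thesis using x(2) K(1) by simp
    qed
    show "2 * N > 0" using N by simp
    show "2 * int N * ic \<noteq> 0"
    proof
      assume z0: "2 * int N * ic = 0"
      have "K c = id" unfolding Kc z0 of_int_0 mult_zero_right by (rule nil_iso_id)
      then have "c = id" by (rule K(4))
      then show False using c by (simp add: nil_iso_eq_id)
    qed
    show "nil_iso (of_nat (2 * N)) (2 * sqrt d * of_int (2 * int N * ia)) 1 False \<in> DD"
      unfolding Ka[symmetric] DD_def using sub by simp
    show "nil_iso (of_nat (2 * N) * w) (2 * sqrt d * of_int (2 * int N * ib)) 1 False \<in> DD"
      unfolding Kb[symmetric] DD_def using sub by simp
    show "nil_iso 0 (2 * sqrt d * of_int (2 * int N * ic)) 1 False \<in> DD"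
      unfolding Kc[symmetric] DD_def using sub by simp
  qed
  show ?thesis
  proof (rule C.occurs[OF L])
    show "\<exists>h\<in>DD. simil m L \<circ> g = h \<circ> simil m L" if "g \<in> \<Delta>" for g
      using K(3)[of g] that by (intro bexI[of _ "K g"]) (simp_all add: DD_def)
    show "\<exists>g\<in>\<Delta>. simil m L \<circ> g = h \<circ> simil m L" if h: "h \<in> DD" for h
    proof -
      obtain g where "g \<in> \<Delta>" "h = K g" using h by (auto simp: DD_def)
      then show ?thesis using K(3)[of g] by (intro bexI[of _ g]) simp_all
    qed
  qed
qed

text \<open>The similarity centred on the axis of \<open>s\<close> and normalising \<open>a\<close>.\<close>

lemma normalised_generators:
  assumes "u \<noteq> 1" "cmod u = 1" "za \<noteq> 0"
  obtains m w \<alpha> \<beta> \<eta> \<tau> where "sconj m (1 / za) (nil_iso za ta 1 False) = nil_iso 1 \<alpha> 1 False"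
    "sconj m (1 / za) (nil_iso zb tb 1 False) = nil_iso w \<beta> 1 False"
    "sconj m (1 / za) (nil_iso 0 h 1 False) = nil_iso 0 \<eta> 1 False"
    "sconj m (1 / za) (nil_iso z t u False) = nil_iso 0 \<tau> u False"
proof -
  have l: "1 / za \<noteq> 0" using assms(3) by simp
  define m where "m = z / (1 - u)"
  have "(1 - u) * m = z" using assms(1) by (simp add: m_def)
  then have "z - m + u * m = 0" by (simp add: algebra_simps)
  then have "sconj m (1 / za) (nil_iso z t u False) = nil_iso 0 ((cmod (1 / za))\<^sup>2 * vert m z t u) u False"
    unfolding sconj_nil_iso[OF l assms(2)] by simp
  moreover have "sconj m (1 / za) (nil_iso x r 1 False) = nil_iso (1 / za * x) ((cmod (1 / za))\<^sup>2 * vert m x r 1) 1 False" for x r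
    unfolding sconj_nil_iso[OF l norm_one] by simp
  moreover from this[of za ta] have "sconj m (1 / za) (nil_iso za ta 1 False) = nil_iso 1 ((cmod (1 / za))\<^sup>2 * vert m za ta 1) 1 False"
    using assms(3) by simp
  moreover have "1 / za * 0 = 0" by simp
  ultimately show ?thesis using that by metis
qed

lemma torsion_free_Isom_Nil:
  assumes "torsion_free (Isom_Nil\<lparr>carrier := \<Delta>\<rparr>)" "g \<in> \<Delta>" "n > 0" "g ^^ n = id"
  shows "g = id"
  using assms unfolding torsion_free_def by simp

lemma quarter_twist_occurs:
  assumes D: "subgroup \<Delta> Isom_Nil" "torsion_free (Isom_Nil\<lparr>carrier := \<Delta>\<rparr>)" and q: "quarter_twist (Isom_Nil\<lparr>carrier := \<Delta>\<rparr>)"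
  shows "occurs_as_cusp_cross_section \<Delta> 1"
proof -
  obtain k p a b c s where k: "k > 0" and rel: "quarter_rels k p a b c s" and sub: "{a, b, c, s} \<subseteq> \<Delta>"
    and inf: "\<And>j. j > 0 \<Longrightarrow> c ^^ j \<noteq> id" and gen: "\<Delta> = generate (Isom_Nil\<lparr>carrier := \<Delta>\<rparr>) {a, b, c, s}"
    by (rule quarter_twist_generators[OF D(1) q], rule that)
  have car: "a \<in> carrier Isom_Nil" "b \<in> carrier Isom_Nil" "c \<in> carrier Isom_Nil" "s \<in> carrier Isom_Nil"
    using sub subgroup.subset[OF D(1)] by auto
  have r: "b \<circ> a = c ^^ k \<circ> (a \<circ> b)" "c \<circ> a = a \<circ> c" "c \<circ> b = b \<circ> c" "c \<circ> s = s \<circ> c" "s \<circ> a = b \<circ> s"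
    using rel by (simp_all only: quarter_rels_def heis_rels_def)
  obtain h za ta zb tb z t u where co: "c = nil_iso 0 h 1 False" "h \<noteq> 0" "a = nil_iso za ta 1 False"
    "b = nil_iso zb tb 1 False" "s = nil_iso z t u False" "cmod u = 1" "za \<noteq> 0" "real k * h = 4 * Im (zb * cnj za)"
    by (rule twist_coordinates[OF car k r(1-4) _ disjI1[OF r(5)]], rule inf, assumption, rule that)
  have u1: "u \<noteq> 1"
    by (rule screw_rotation_ne_1[OF co(8) k co(2,6)]) (rule disjI1, rule r(5)[unfolded co(3,4,5)])
  obtain m w \<alpha> \<beta> \<eta> \<tau> where n0: "sconj m (1 / za) (nil_iso za ta 1 False) = nil_iso 1 \<alpha> 1 False"
    "sconj m (1 / za) (nil_iso zb tb 1 False) = nil_iso w \<beta> 1 False"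
    "sconj m (1 / za) (nil_iso 0 h 1 False) = nil_iso 0 \<eta> 1 False"
    "sconj m (1 / za) (nil_iso z t u False) = nil_iso 0 \<tau> u False"
    by (rule normalised_generators[OF u1 co(6,7)], rule that)
  note n = n0[folded co(1,3,4,5)]
  have l: "1 / za \<noteq> 0" using co(7) by simp
  have "quarter_rels k p (sconj m (1 / za) a) (sconj m (1 / za) b) (sconj m (1 / za) c) (sconj m (1 / za) s)"
    by (rule hom_quarter_rels[where S = UNIV, OF _ _ _ _ _ _ _ rel]) (simp_all only: sconj_props(1,2)[OF l] UNIV_I ball_UNIV simp_thms)
  then have "solved 1 u w \<alpha> \<beta> \<eta> \<tau>" unfolding n by (rule quarter_solve[OF _ k co(6)])
  then show ?thesis
    by (intro twist_occurs[OF D(1) torsion_free_Isom_Nil[OF D(2)] gen sub co(3,4,1,2,5,6,7) n])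
qed

lemma third_twist_occurs:
  assumes D: "subgroup \<Delta> Isom_Nil" "torsion_free (Isom_Nil\<lparr>carrier := \<Delta>\<rparr>)" and q: "third_twist (Isom_Nil\<lparr>carrier := \<Delta>\<rparr>)"
  shows "occurs_as_cusp_cross_section \<Delta> 3"
proof -
  obtain k k1 k2 a b c s where k: "k > 0" and rel: "third_rels k k1 k2 a b c s" and sub: "{a, b, c, s} \<subseteq> \<Delta>"
    and inf: "\<And>j. j > 0 \<Longrightarrow> c ^^ j \<noteq> id" and gen: "\<Delta> = generate (Isom_Nil\<lparr>carrier := \<Delta>\<rparr>) {a, b, c, s}"
    by (rule third_twist_generators[OF D(1) q], rule that)
  have car: "a \<in> carrier Isom_Nil" "b \<in> carrier Isom_Nil" "c \<in> carrier Isom_Nil" "s \<in> carrier Isom_Nil"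
    using sub subgroup.subset[OF D(1)] by auto
  have r: "b \<circ> a = c ^^ k \<circ> (a \<circ> b)" "c \<circ> a = a \<circ> c" "c \<circ> b = b \<circ> c" "c \<circ> s = s \<circ> c" "s \<circ> a = b \<circ> (s \<circ> c ^^ k1)"
    using rel by (simp_all only: third_rels_def heis_rels_def)
  have r5: "\<exists>j. s \<circ> a = b \<circ> (s \<circ> c ^^ j)" by (rule exI[of _ k1], rule r(5))
  obtain h za ta zb tb z t u where co: "c = nil_iso 0 h 1 False" "h \<noteq> 0" "a = nil_iso za ta 1 False"
    "b = nil_iso zb tb 1 False" "s = nil_iso z t u False" "cmod u = 1" "za \<noteq> 0" "real k * h = 4 * Im (zb * cnj za)"
    by (rule twist_coordinates[OF car k r(1-4) _ disjI2[OF disjI1[OF r5]]], rule inf, assumption, rule that)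
  have u1: "u \<noteq> 1"
    by (rule screw_rotation_ne_1[OF co(8) k co(2,6)]) (rule disjI2, rule disjI1, rule r5[unfolded co(1,3,4,5)])
  obtain m w \<alpha> \<beta> \<eta> \<tau> where n0: "sconj m (1 / za) (nil_iso za ta 1 False) = nil_iso 1 \<alpha> 1 False"
    "sconj m (1 / za) (nil_iso zb tb 1 False) = nil_iso w \<beta> 1 False"
    "sconj m (1 / za) (nil_iso 0 h 1 False) = nil_iso 0 \<eta> 1 False"
    "sconj m (1 / za) (nil_iso z t u False) = nil_iso 0 \<tau> u False"
    by (rule normalised_generators[OF u1 co(6,7)], rule that)
  note n = n0[folded co(1,3,4,5)]
  have l: "1 / za \<noteq> 0" using co(7) by simp
  have "third_rels k k1 k2 (sconj m (1 / za) a) (sconj m (1 / za) b) (sconj m (1 / za) c) (sconj m (1 / za) s)"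
    by (rule hom_third_rels[where S = UNIV, OF _ _ _ _ _ _ _ rel]) (simp_all only: sconj_props(1,2)[OF l] UNIV_I ball_UNIV simp_thms)
  then have "solved 3 u w \<alpha> \<beta> \<eta> \<tau>" unfolding n by (rule third_solve[OF _ k co(6)])
  then show ?thesis
    by (intro twist_occurs[OF D(1) torsion_free_Isom_Nil[OF D(2)] gen sub co(3,4,1,2,5,6,7) n])
qed

lemma sixth_twist_occurs:
  assumes D: "subgroup \<Delta> Isom_Nil" "torsion_free (Isom_Nil\<lparr>carrier := \<Delta>\<rparr>)" and q: "sixth_twist (Isom_Nil\<lparr>carrier := \<Delta>\<rparr>)"
  shows "occurs_as_cusp_cross_section \<Delta> 3"
proof -
  obtain k k1 a b c s where k: "k > 0" and rel: "sixth_rels k k1 a b c s" and sub: "{a, b, c, s} \<subseteq> \<Delta>"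
    and inf: "\<And>j. j > 0 \<Longrightarrow> c ^^ j \<noteq> id" and gen: "\<Delta> = generate (Isom_Nil\<lparr>carrier := \<Delta>\<rparr>) {a, b, c, s}"
    by (rule sixth_twist_generators[OF D(1) q], rule that)
  have car: "a \<in> carrier Isom_Nil" "b \<in> carrier Isom_Nil" "c \<in> carrier Isom_Nil" "s \<in> carrier Isom_Nil"
    using sub subgroup.subset[OF D(1)] by auto
  have r: "b \<circ> a = c ^^ k \<circ> (a \<circ> b)" "c \<circ> a = a \<circ> c" "c \<circ> b = b \<circ> c" "c \<circ> s = s \<circ> c" "s \<circ> a = a \<circ> (b \<circ> s)" "a \<circ> (s \<circ> b) = s"
    using rel by (simp_all only: sixth_rels_def heis_rels_def)
  obtain h za ta zb tb z t u where co: "c = nil_iso 0 h 1 False" "h \<noteq> 0" "a = nil_iso za ta 1 False"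
    "b = nil_iso zb tb 1 False" "s = nil_iso z t u False" "cmod u = 1" "za \<noteq> 0" "real k * h = 4 * Im (zb * cnj za)"
    by (rule twist_coordinates[OF car k r(1-4) _ disjI2[OF disjI2[OF conjI[OF r(5,6)]]]], rule inf, assumption, rule that)
  have u1: "u \<noteq> 1"
    by (rule screw_rotation_ne_1[OF co(8) k co(2,6)]) (rule disjI2, rule disjI2, rule r(5)[unfolded co(3,4,5)])
  obtain m w \<alpha> \<beta> \<eta> \<tau> where n0: "sconj m (1 / za) (nil_iso za ta 1 False) = nil_iso 1 \<alpha> 1 False"
    "sconj m (1 / za) (nil_iso zb tb 1 False) = nil_iso w \<beta> 1 False"
    "sconj m (1 / za) (nil_iso 0 h 1 False) = nil_iso 0 \<eta> 1 False"
    "sconj m (1 / za) (nil_iso z t u False) = nil_iso 0 \<tau> u False"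
    by (rule normalised_generators[OF u1 co(6,7)], rule that)
  note n = n0[folded co(1,3,4,5)]
  have l: "1 / za \<noteq> 0" using co(7) by simp
  have "sixth_rels k k1 (sconj m (1 / za) a) (sconj m (1 / za) b) (sconj m (1 / za) c) (sconj m (1 / za) s)"
    by (rule hom_sixth_rels[where S = UNIV, OF _ _ _ _ _ _ _ rel]) (simp_all only: sconj_props(1,2)[OF l] UNIV_I ball_UNIV simp_thms)
  then have "solved 3 u w \<alpha> \<beta> \<eta> \<tau>" unfolding n by (rule sixth_solve[OF _ k co(6)])
  then show ?thesis
    by (intro twist_occurs[OF D(1) torsion_free_Isom_Nil[OF D(2)] gen sub co(3,4,1,2,5,6,7) n])
qed

section \<open>Free and properly discontinuous actions on Nil\<close>

lemma continuous_nil_iso: "continuous_on S (nil_iso z t u e)"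
proof -
  have "continuous_on S (\<lambda>p. (z + u * cj e (fst p), t + sg e * snd p + 2 * Im (z * cnj (u * cj e (fst p)))))"
    by (cases e) (auto intro!: continuous_intros)
  then show ?thesis by (simp add: nil_iso_def[abs_def])
qed

locale nil_action =
  fixes G :: "(nil \<Rightarrow> nil) set"
  assumes G: "subgroup G Isom_Nil"
    and fin: "\<And>K. bounded K \<Longrightarrow> finite {g \<in> G. \<exists>x\<in>K. g x \<in> K}"
    and free: "\<And>g x. g \<in> G \<Longrightarrow> g x = x \<Longrightarrow> g = id"
begin

lemma continuous_action: "g \<in> G \<Longrightarrow> continuous_on S g"
  using subgroup.mem_carrier[OF G] by (metis nil_isoE continuous_nil_iso)

lemma one_mem: "id \<in> G"
  using subgroup.one_closed[OF G] by simp

lemma mult_mem: "g \<in> G \<Longrightarrow> h \<in> G \<Longrightarrow> g \<circ> h \<in> G"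
  using subgroup.m_closed[OF G] by simp

lemma inverse_mem:
  assumes "g \<in> G" obtains h where "h \<in> G" "h \<circ> g = id" "g \<circ> h = id"
proof -
  interpret I: group Isom_Nil by (rule group_Isom_Nil)
  have g: "g \<in> carrier Isom_Nil" using subgroup.mem_carrier[OF G assms] .
  show ?thesis
    using that[OF subgroup.m_inv_closed[OF G assms]] I.l_inv[OF g] I.r_inv[OF g] by simp
qed

lemma eq_if_agree:
  assumes "g \<in> G" "h \<in> G" "g x = h x" shows "g = h"
proof -
  obtain h' where h': "h' \<in> G" "h' \<circ> h = id" "h \<circ> h' = id" using inverse_mem[OF assms(2)] by blast
  have "(h' \<circ> g) x = x" using assms(3) fun_cong[OF h'(2), of x] by simp
  then have "h' \<circ> g = id" using free mult_mem[OF h'(1) assms(1)] by blast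
  then have "h \<circ> (h' \<circ> g) = h" by simp
  then show ?thesis unfolding comp_assoc[symmetric] h'(3) by simp
qed

text \<open>Only finitely many elements bring the unit ball about y back to itself, and each
  nontrivial one moves y; a smaller ball avoids them all.\<close>

lemma separated:
  obtains e where "e > 0" "\<And>g x. g \<in> G \<Longrightarrow> x \<in> ball y e \<Longrightarrow> g x \<in> ball y e \<Longrightarrow> g = id"
proof -
  define F where "F = {g \<in> G. \<exists>x\<in>ball y 1. g x \<in> ball y 1} - {id}"
  have finF: "finite F" unfolding F_def using fin[OF bounded_ball] by simp
  have ev: "\<forall>\<^sub>F e in at_right 0. \<forall>x\<in>ball y e. g x \<notin> ball y e" if g: "g \<in> F" for g
  proof -
    have gG: "g \<in> G" "g \<noteq> id" using g by (auto simp: F_def)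
    define \<delta> where "\<delta> = dist (g y) y"
    have "g y \<noteq> y" using free[OF gG(1), of y] gG(2) by blast
    then have \<delta>: "\<delta> > 0" by (simp add: \<delta>_def)
    have "isCont g y" using continuous_action[OF gG(1), of UNIV] by (cases y) (simp add: continuous_on_eq_continuous_at)
    then obtain e1 where e1: "e1 > 0" "\<And>x. dist x y < e1 \<Longrightarrow> dist (g x) (g y) < \<delta> / 2"
      using \<delta> unfolding continuous_at_eps_delta by (metis half_gt_zero)
    show ?thesis unfolding eventually_at_right_field
    proof (intro exI[of _ "min e1 (\<delta> / 2)"] conjI allI impI ballI)
      show "0 < min e1 (\<delta> / 2)" using e1 \<delta> by simp
      fix e x assume e: "0 < e" "e < min e1 (\<delta> / 2)" and x: "x \<in> ball y e"
      have "dist (g x) (g y) < \<delta> / 2" using e x by (intro e1(2)) (simp add: dist_commute)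
      then have "\<delta> / 2 < dist (g x) y" using dist_triangle[of "g y" y "g x"] by (simp add: \<delta>_def dist_commute)
      then show "g x \<notin> ball y e" using e by (simp add: dist_commute)
    qed
  qed
  have "\<forall>\<^sub>F e in at_right 0. \<forall>g\<in>F. \<forall>x\<in>ball y e. g x \<notin> ball y e"
    by (rule eventually_ball_finite[OF finF]) (use ev in blast)
  moreover have "\<forall>\<^sub>F e in at_right (0::real). 0 < e \<and> e < 1"
    unfolding eventually_at_right_field by (intro exI[of _ 1]) simp
  ultimately have "\<forall>\<^sub>F e in at_right (0::real). (\<forall>g\<in>F. \<forall>x\<in>ball y e. g x \<notin> ball y e) \<and> 0 < e \<and> e < 1"
    by eventually_elim simp
  then obtain e where e: "\<forall>g\<in>F. \<forall>x\<in>ball y e. g x \<notin> ball y e" "0 < e" "e < 1"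
    using eventually_happens[of _ "at_right (0::real)"] trivial_limit_at_right_real by blast
  show ?thesis
  proof (rule that[OF e(2)])
    fix g x assume g: "g \<in> G" "x \<in> ball y e" "g x \<in> ball y e"
    have sub: "ball y e \<subseteq> ball y 1" using e by (intro subset_ball) simp
    show "g = id"
    proof (rule ccontr)
      assume "g \<noteq> id"
      then have "g \<in> F" unfolding F_def using g sub by blast
      then show False using e(1) g by blast
    qed
  qed
qed

text \<open>The pullback of the covering \<open>Nil \<rightarrow> Nil/G\<close> along a map given by local lifts; it has a section
  because \<open>Nil\<close> is simply connected.\<close>

lemma global_lift:
  fixes R :: "nil \<Rightarrow> nil \<Rightarrow> bool"
  assumes loc: "\<And>x. \<exists>W \<eta>. open W \<and> x \<in> W \<and> continuous_on W \<eta> \<and> (\<forall>x'\<in>W. \<forall>y. R x' y \<longleftrightarrow> (\<exists>g\<in>G. y = g (\<eta> x')))"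
  obtains \<phi> where "continuous_on UNIV \<phi>" "\<And>x. R x (\<phi> x)"
proof -
  define E where "E = {p. R (fst p) (snd p)}"
  have cov: "covering_space E fst (UNIV :: nil set)"
    unfolding covering_space_def
  proof (intro conjI ballI)
    show "continuous_on E fst" by (intro continuous_intros)
    have "x \<in> fst ` E" for x
    proof -
      obtain y where "R x y" using loc[of x] one_mem by blast
      then have "(x, y) \<in> E" by (simp add: E_def)
      then show ?thesis by (rule rev_image_eqI) simp
    qed
    then show "fst ` E = UNIV" by blast
    fix x :: nil
    obtain W \<eta> where W: "open W" "x \<in> W" "continuous_on W \<eta>" "\<And>x' y. x' \<in> W \<Longrightarrow> R x' y \<longleftrightarrow> (\<exists>g\<in>G. y = g (\<eta> x'))"
      using loc[of x] by blast
    obtain e where e: "e > 0" "\<And>g x'. g \<in> G \<Longrightarrow> x' \<in> ball (\<eta> x) e \<Longrightarrow> g x' \<in> ball (\<eta> x) e \<Longrightarrow> g = id"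
      by (rule separated[of "\<eta> x"], rule that)
    define T where "T = W \<inter> \<eta> -` ball (\<eta> x) e"
    have T: "open T" "x \<in> T" "T \<subseteq> W"
      using continuous_open_preimage[OF W(3,1) open_ball] W(2) e(1) by (auto simp: T_def)
    \<comment> \<open>The sheet of \<open>g\<close> is the graph of \<open>g\<close> after the local
      lift. Two sheets that meet coincide by freeness, and the small ball makes each sheet open in
      \<open>E\<close>.\<close>
    define S :: "(nil \<Rightarrow> nil) \<Rightarrow> (nil \<times> nil) set" where "S g = (\<lambda>x'. (x', g (\<eta> x'))) ` T" for g
    have cT: "continuous_on T \<eta>" by (rule continuous_on_subset[OF W(3) T(3)])
    have un: "\<Union> (S ` G) = E \<inter> fst -` T"
    proof (intro equalityI subsetI)
      fix p assume "p \<in> \<Union> (S ` G)"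
      then obtain g x' where "g \<in> G" "x' \<in> T" "p = (x', g (\<eta> x'))" by (auto simp: S_def)
      moreover have "R x' (g (\<eta> x'))" if "g \<in> G" "x' \<in> T" for g x' using W(4)[of x' "g (\<eta> x')"] T(3) that by blast
      ultimately show "p \<in> E \<inter> fst -` T" by (simp add: E_def)
    next
      fix p assume p: "p \<in> E \<inter> fst -` T"
      then obtain g where "g \<in> G" "snd p = g (\<eta> (fst p))" using W(4)[of "fst p" "snd p"] T(3) unfolding E_def by blast
      then have "p \<in> S g" "g \<in> G" using p by (auto simp: S_def image_iff prod_eq_iff)
      then show "p \<in> \<Union> (S ` G)" by blast
    qed
    have op: "openin (top_of_set E) (S g)" if g: "g \<in> G" for g
    proof -
      obtain h where h: "h \<in> G" "h \<circ> g = id" "g \<circ> h = id" using inverse_mem[OF g] by blast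
      have "S g = E \<inter> (fst -` T \<inter> (\<lambda>p. h (snd p)) -` ball (\<eta> x) e)"
      proof (intro equalityI subsetI)
        fix p assume p: "p \<in> S g"
        then have "p \<in> E \<inter> fst -` T" using un g by blast
        moreover obtain x' where "x' \<in> T" "p = (x', g (\<eta> x'))" using p by (auto simp: S_def)
        moreover then have "h (snd p) \<in> ball (\<eta> x) e" using fun_cong[OF h(2), of "\<eta> x'"] by (simp add: T_def)
        ultimately show "p \<in> E \<inter> (fst -` T \<inter> (\<lambda>p. h (snd p)) -` ball (\<eta> x) e)" by blast
      next
        fix p assume p: "p \<in> E \<inter> (fst -` T \<inter> (\<lambda>p. h (snd p)) -` ball (\<eta> x) e)"
        then obtain g' where g': "g' \<in> G" "snd p = g' (\<eta> (fst p))" using W(4)[of "fst p" "snd p"] T(3) unfolding E_def by blast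
        have "(h \<circ> g') (\<eta> (fst p)) \<in> ball (\<eta> x) e" "\<eta> (fst p) \<in> ball (\<eta> x) e" using p g'(2) by (auto simp: T_def)
        then have "h \<circ> g' = id" using e(2)[OF mult_mem[OF h(1) g'(1)]] by blast
        then have "g \<circ> (h \<circ> g') = g" by simp
        then have "g' = g" unfolding comp_assoc[symmetric] h(3) by simp
        then show "p \<in> S g" using g'(2) p by (auto simp: S_def image_iff prod_eq_iff)
      qed
      moreover have "open (fst -` T \<inter> (\<lambda>p :: nil \<times> nil. h (snd p)) -` ball (\<eta> x) e)"
      proof (rule open_Int)
        show "open (fst -` T :: (nil \<times> nil) set)" by (rule open_vimage_fst[OF T(1)])
        have "continuous_on UNIV (\<lambda>p :: nil \<times> nil. h (snd p))"
          by (rule continuous_on_compose2[OF continuous_action[OF h(1), of UNIV] continuous_on_snd[OF continuous_on_id]]) simp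
        then show "open ((\<lambda>p :: nil \<times> nil. h (snd p)) -` ball (\<eta> x) e)" by (rule open_vimage[OF open_ball])
      qed
      ultimately show ?thesis by (simp only: openin_open) blast
    qed
    have disj: "S g = S h" if gh: "g \<in> G" "h \<in> G" "\<not> disjnt (S g) (S h)" for g h
    proof -
      obtain p where p: "p \<in> S g" "p \<in> S h" using gh(3) unfolding disjnt_def by blast
      obtain x' where x': "p = (x', g (\<eta> x'))" using p(1) unfolding S_def by blast
      obtain y' where "p = (y', h (\<eta> y'))" using p(2) unfolding S_def by blast
      then have "g (\<eta> x') = h (\<eta> x')" unfolding x' prod.inject by (elim conjE) (simp only:)
      then have "g = h" by (rule eq_if_agree[OF gh(1,2)])
      then show ?thesis by simp
    qed
    have hom: "homeomorphism (S g) T fst (\<lambda>x'. (x', g (\<eta> x')))" if g: "g \<in> G" for g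
    proof -
      have "continuous_on T (\<lambda>x'. (x', g (\<eta> x')))"
        by (intro continuous_on_Pair continuous_on_id continuous_on_compose2[OF continuous_action[OF g, of UNIV] cT]) simp
      then show ?thesis unfolding homeomorphism_def S_def
        by (auto simp: image_image intro!: continuous_intros)
    qed
    show "\<exists>T. x \<in> T \<and> openin (top_of_set UNIV) T \<and>
         (\<exists>v. \<Union>v = E \<inter> fst -` T \<and> (\<forall>u\<in>v. openin (top_of_set E) u) \<and> pairwise disjnt v \<and>
            (\<forall>u\<in>v. \<exists>q. homeomorphism u T fst q))"
    proof (rule exI[of _ T], intro conjI exI[of _ "S ` G"])
      show "x \<in> T" by (rule T(2))
      show "openin (top_of_set UNIV) T" using T(1) by simp
      show "\<Union> (S ` G) = E \<inter> fst -` T" by (rule un)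
      show "\<forall>u\<in>S ` G. openin (top_of_set E) u" using op by blast
      show "pairwise disjnt (S ` G)" unfolding pairwise_def using disj by blast
      show "\<forall>u\<in>S ` G. \<exists>q. homeomorphism u T fst q" using hom by blast
    qed
  qed
  have sc: "simply_connected (UNIV :: nil set)" by (rule convex_imp_simply_connected) simp
  have lp: "locally path_connected (UNIV :: nil set)" by (rule open_imp_locally_path_connected) simp
  \<comment> \<open>Lifting the identity map of the simply connected base gives the section.\<close>
  obtain g where g: "continuous_on UNIV g" "g \<in> UNIV \<rightarrow> E" "\<And>y. y \<in> (UNIV :: nil set) \<Longrightarrow> fst (g y) = id y"
    by (rule covering_space_lift[OF cov sc lp continuous_on_id', of]) (simp_all add: id_def)
  show ?thesis
  proof (rule that)
    show "continuous_on UNIV (\<lambda>x. snd (g x))" by (intro continuous_intros g)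
    fix x
    have "g x \<in> E" using g(2) by auto
    then show "R x (snd (g x))" using g(3)[of x] by (simp add: E_def)
  qed
qed

text \<open>The sets on which k' agrees with \<open>g\<close> after k are open by the separation
  property, pairwise disjoint by freeness, and cover the connected space Nil.\<close>

lemma constant_translate:
  assumes k: "continuous_on UNIV k" "continuous_on UNIV k'" and ex: "\<And>x :: nil. \<exists>g\<in>G. k' x = g (k x)"
  obtains g where "g \<in> G" "\<And>x. k' x = g (k x)"
proof -
  define U where "U g = {x. k' x = g (k x)}" for g
  have op: "open (U g)" if g: "g \<in> G" for g
    unfolding open_contains_ball
  proof
    fix x assume "x \<in> U g"
    then have x: "k' x = g (k x)" by (simp add: U_def)
    obtain e where e: "e > 0" "\<And>h y. h \<in> G \<Longrightarrow> y \<in> ball (k' x) e \<Longrightarrow> h y \<in> ball (k' x) e \<Longrightarrow> h = id"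
      by (rule separated[of "k' x"], rule that)
    obtain g' where g': "g' \<in> G" "g' \<circ> g = id" "g \<circ> g' = id" using inverse_mem[OF g] by blast
    have cg: "continuous_on UNIV (\<lambda>x. g (k x))"
      by (rule continuous_on_compose2[OF continuous_action[OF g, of UNIV] k(1)]) simp
    have "open (k' -` ball (k' x) e \<inter> (\<lambda>x. g (k x)) -` ball (k' x) e)"
      by (intro open_Int open_vimage[OF open_ball k(2)] open_vimage[OF open_ball cg])
    moreover have "x \<in> k' -` ball (k' x) e \<inter> (\<lambda>x. g (k x)) -` ball (k' x) e" using e(1) x by simp
    ultimately obtain r where r: "r > 0" "ball x r \<subseteq> k' -` ball (k' x) e \<inter> (\<lambda>x. g (k x)) -` ball (k' x) e"
      using open_contains_ball by metis
    have "ball x r \<subseteq> U g"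
    proof
      fix y assume "y \<in> ball x r"
      then have y: "k' y \<in> ball (k' x) e" "g (k y) \<in> ball (k' x) e" using r(2) by auto
      obtain h where h: "h \<in> G" "k' y = h (k y)" using ex by blast
      have hk: "(h \<circ> g') (g (k y)) = k' y" using fun_cong[OF g'(2), of "k y"] h(2) by simp
      then have "h \<circ> g' = id" using e(2)[OF mult_mem[OF h(1) g'(1)] y(2)] y(1) by simp
      then show "y \<in> U g" using hk by (simp add: U_def)
    qed
    then show "\<exists>e>0. ball x e \<subseteq> U g" using r(1) by blast
  qed
  obtain g where g: "g \<in> G" "k' 0 = g (k 0)" using ex by blast
  have "- U g = (\<Union>h\<in>G - {g}. U h)"
  proof (intro equalityI subsetI)
    fix x assume x: "x \<in> - U g"
    obtain h where h: "h \<in> G" "k' x = h (k x)" using ex by blast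
    then have "h \<noteq> g" "x \<in> U h" using x by (auto simp: U_def)
    then show "x \<in> (\<Union>h\<in>G - {g}. U h)" using h(1) by blast
  next
    fix x assume "x \<in> (\<Union>h\<in>G - {g}. U h)"
    then obtain h where h: "h \<in> G" "h \<noteq> g" "k' x = h (k x)" by (auto simp: U_def)
    then show "x \<in> - U g" using eq_if_agree[OF h(1) g(1), of "k x"] by (auto simp: U_def)
  qed
  then have "open (- U g)" using op by auto
  then have "closed (U g)" by (simp add: closed_def)
  then have "U g = {} \<or> U g = UNIV" using op[OF g(1)] clopen by blast
  moreover have "0 \<in> U g" using g(2) by (simp add: U_def)
  ultimately have "U g = UNIV" by blast
  then show ?thesis using that[OF g(1)] unfolding U_def by blast
qed

end

text \<open>\<open>R\<close> relates points over corresponding points of the two quotients. A lift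
  \<open>\<phi>\<close> intertwines \<open>g\<close> with a unique element, which is
  \<open>\<theta> g\<close>. For injectivity a lift \<open>\<psi>\<close> in the other direction is
  used: \<open>\<psi>\<close> after \<open>\<phi>\<close> is an element of \<open>D\<close>, so a
  \<open>g\<close> with trivial image fixes a point.\<close>

lemma deck_group_hom:
  assumes A: "nil_action D" and B: "nil_action G"
    and locD: "\<And>y. \<exists>W \<eta>. open W \<and> y \<in> W \<and> continuous_on W \<eta> \<and> (\<forall>y'\<in>W. \<forall>x. R x y' \<longleftrightarrow> (\<exists>g\<in>D. x = g (\<eta> y')))"
    and locG: "\<And>x. \<exists>W \<eta>. open W \<and> x \<in> W \<and> continuous_on W \<eta> \<and> (\<forall>x'\<in>W. \<forall>y. R x' y \<longleftrightarrow> (\<exists>g\<in>G. y = g (\<eta> x')))"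
  obtains \<theta> where "\<And>g. g \<in> D \<Longrightarrow> \<theta> g \<in> G" "\<And>g h. g \<in> D \<Longrightarrow> h \<in> D \<Longrightarrow> \<theta> (g \<circ> h) = \<theta> g \<circ> \<theta> h"
    "\<And>g. g \<in> D \<Longrightarrow> \<theta> g = id \<Longrightarrow> g = id"
proof -
  interpret A: nil_action D by (rule A)
  interpret B: nil_action G by (rule B)
  obtain \<phi> where \<phi>: "continuous_on UNIV \<phi>" "\<And>x. R x (\<phi> x)" by (rule B.global_lift[OF locG], rule that)
  obtain \<psi> where \<psi>: "continuous_on UNIV \<psi>" "\<And>y. R (\<psi> y) y" by (rule A.global_lift[OF locD], rule that)
  have relG: "\<exists>g\<in>G. y' = g y" if "R x y" "R x y'" for x y y'
  proof -
    obtain \<eta> where "\<And>y. R x y \<longleftrightarrow> (\<exists>g\<in>G. y = g (\<eta> x))" using locG[of x] by blast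
    then obtain g g' where g: "g \<in> G" "g' \<in> G" "y = g (\<eta> x)" "y' = g' (\<eta> x)" using \<open>R x y\<close> \<open>R x y'\<close> by blast
    obtain h where h: "h \<in> G" "h \<circ> g = id" "g \<circ> h = id" using B.inverse_mem[OF g(1)] by blast
    have "(g' \<circ> h) y = y'" using g(3,4) fun_cong[OF h(2), of "\<eta> x"] by simp
    then show ?thesis using B.mult_mem[OF g(2) h(1)] by (intro bexI[of _ "g' \<circ> h"]) simp_all
  qed
  have relD: "\<exists>g\<in>D. x' = g x" if "R x y" "R x' y" for x x' y
  proof -
    obtain \<eta> where "\<And>x. R x y \<longleftrightarrow> (\<exists>g\<in>D. x = g (\<eta> y))" using locD[of y] by blast
    then obtain g g' where g: "g \<in> D" "g' \<in> D" "x = g (\<eta> y)" "x' = g' (\<eta> y)" using \<open>R x y\<close> \<open>R x' y\<close> by blast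
    obtain h where h: "h \<in> D" "h \<circ> g = id" "g \<circ> h = id" using A.inverse_mem[OF g(1)] by blast
    have "(g' \<circ> h) x = x'" using g(3,4) fun_cong[OF h(2), of "\<eta> y"] by simp
    then show ?thesis using A.mult_mem[OF g(2) h(1)] by (intro bexI[of _ "g' \<circ> h"]) simp_all
  qed
  have invD: "R x y" if "R (g x) y" "g \<in> D" for g x y
  proof -
    obtain \<eta> where \<eta>: "\<And>x. R x y \<longleftrightarrow> (\<exists>g\<in>D. x = g (\<eta> y))" using locD[of y] by blast
    then obtain g' where g': "g' \<in> D" "g x = g' (\<eta> y)" using \<open>R (g x) y\<close> by blast
    obtain h where h: "h \<in> D" "h \<circ> g = id" "g \<circ> h = id" using A.inverse_mem[OF \<open>g \<in> D\<close>] by blast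
    have "x = (h \<circ> g') (\<eta> y)" using fun_cong[OF h(2), of x] g'(2) by simp
    then show ?thesis using \<eta> A.mult_mem[OF h(1) g'(1)] by blast
  qed
  have cpsi: "continuous_on UNIV (\<lambda>x. \<psi> (\<phi> x))"
    by (rule continuous_on_compose2[OF \<psi>(1) \<phi>(1)]) simp
  obtain \<delta> where \<delta>: "\<delta> \<in> D" "\<And>x. \<psi> (\<phi> x) = \<delta> x"
    by (rule A.constant_translate[OF continuous_on_id cpsi]) (use relD[OF \<phi>(2) \<psi>(2)] in blast)+
  have ex: "\<exists>g'\<in>G. \<forall>x. \<phi> (g x) = g' (\<phi> x)" if g: "g \<in> D" for g
  proof -
    have c: "continuous_on UNIV (\<lambda>x. \<phi> (g x))"
      by (rule continuous_on_compose2[OF \<phi>(1) A.continuous_action[OF g, of UNIV]]) simp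
    show ?thesis
    proof (rule B.constant_translate[OF \<phi>(1) c])
      show "\<exists>g'\<in>G. \<phi> (g x) = g' (\<phi> x)" for x
        by (rule relG[OF \<phi>(2)[of x] invD[OF \<phi>(2)[of "g x"] g]])
      show "\<exists>g'\<in>G. \<forall>x. \<phi> (g x) = g' (\<phi> x)" if "g' \<in> G" "\<And>x. \<phi> (g x) = g' (\<phi> x)" for g'
        using that by blast
    qed
  qed
  define \<theta> where "\<theta> g = (SOME g'. g' \<in> G \<and> (\<forall>x. \<phi> (g x) = g' (\<phi> x)))" for g
  have \<theta>: "\<theta> g \<in> G \<and> (\<forall>x. \<phi> (g x) = \<theta> g (\<phi> x))" if "g \<in> D" for g
  proof -
    have "\<exists>g'. g' \<in> G \<and> (\<forall>x. \<phi> (g x) = g' (\<phi> x))" using ex[OF that] by blast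
    from someI_ex[OF this] show ?thesis unfolding \<theta>_def .
  qed
  show ?thesis
  proof (rule that)
    show "\<theta> g \<in> G" if "g \<in> D" for g using \<theta>[OF that] by blast
    show "\<theta> (g \<circ> h) = \<theta> g \<circ> \<theta> h" if g: "g \<in> D" "h \<in> D" for g h
    proof (rule B.eq_if_agree)
      show "\<theta> (g \<circ> h) \<in> G" using \<theta>[OF A.mult_mem[OF g]] by blast
      show "\<theta> g \<circ> \<theta> h \<in> G" using B.mult_mem \<theta>[OF g(1)] \<theta>[OF g(2)] by blast
      have "\<theta> (g \<circ> h) (\<phi> 0) = \<phi> ((g \<circ> h) 0)"
        by (rule spec[OF conjunct2[OF \<theta>[OF A.mult_mem[OF g]]], THEN HOL.sym])
      also have "\<dots> = \<phi> (g (h 0))" by (simp only: comp_apply)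
      also have "\<dots> = \<theta> g (\<phi> (h 0))" by (rule spec[OF conjunct2[OF \<theta>[OF g(1)]]])
      also have "\<phi> (h 0) = \<theta> h (\<phi> 0)" by (rule spec[OF conjunct2[OF \<theta>[OF g(2)]]])
      also have "\<theta> g (\<theta> h (\<phi> 0)) = (\<theta> g \<circ> \<theta> h) (\<phi> 0)" by (simp only: comp_apply)
      finally show "\<theta> (g \<circ> h) (\<phi> 0) = (\<theta> g \<circ> \<theta> h) (\<phi> 0)" .
    qed
    show "g = id" if g: "g \<in> D" "\<theta> g = id" for g
    proof -
      have "\<phi> (g 0) = \<theta> g (\<phi> 0)" by (rule spec[OF conjunct2[OF \<theta>[OF g(1)]]])
      then have "\<phi> (g 0) = \<phi> 0" unfolding g(2) id_apply .
      then have "\<delta> (g 0) = \<delta> 0" unfolding \<delta>(2)[symmetric] by simp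
      then have "(\<delta> \<circ> g) 0 = \<delta> 0" by simp
      then have "\<delta> \<circ> g = \<delta>" by (rule A.eq_if_agree[OF A.mult_mem[OF \<delta>(1) g(1)] \<delta>(1)])
      moreover obtain h where h: "h \<circ> \<delta> = id" using A.inverse_mem[OF \<delta>(1)] by blast
      ultimately have "h \<circ> (\<delta> \<circ> g) = id" by (simp only: h)
      then show ?thesis unfolding comp_assoc[symmetric] h by simp
    qed
  qed
qed

section \<open>From discreteness to proper discontinuity and freeness\<close>

text \<open>The hypotheses on \<open>E\<close> hold for \<open>nil_iso\<close> itself and for its conjugates acting on the boundary
  at a parabolic fixed point.\<close>

locale discrete_rep =
  fixes E :: "complex \<Rightarrow> real \<Rightarrow> complex \<Rightarrow> bool \<Rightarrow> 'b \<Rightarrow> 'b::topological_space"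
    and \<G> :: "('b \<Rightarrow> 'b) set"
  assumes comp: "\<And>z t u e z' t' u' e'. cmod u = 1 \<Longrightarrow> cmod u' = 1 \<Longrightarrow> E z t u e \<circ> E z' t' u' e' =
      E (z + u * cj e z') (t + sg e * t' + 2 * Im (z * cnj (u * cj e z'))) (u * cj e u') (e \<noteq> e')"
    and one: "E 0 0 1 False = id"
    and cont: "\<And>x. continuous_on {p. cmod (snd (snd p)) = 1} (\<lambda>p. E (fst p) (fst (snd p)) (snd (snd p)) False x)"
    and faithful: "\<And>z t u e. cmod u = 1 \<Longrightarrow> E z t u e = id \<Longrightarrow> nil_iso z t u e = id"
    and id_mem: "id \<in> \<G>" and mult: "\<And>f g. f \<in> \<G> \<Longrightarrow> g \<in> \<G> \<Longrightarrow> f \<circ> g \<in> \<G>"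
    and division: "\<And>f g h. f \<in> \<G> \<Longrightarrow> g \<in> \<G> \<Longrightarrow> f = h \<circ> g \<Longrightarrow> h \<in> \<G>"
    and disc: "discrete \<G>"
    and tf: "\<And>f n. f \<in> \<G> \<Longrightarrow> n > 0 \<Longrightarrow> f ^^ n = id \<Longrightarrow> f = id"
begin

definition cpl :: "(complex \<times> real \<times> complex) set" where
  "cpl = {p. cmod (snd (snd p)) = 1}"

text \<open>Parameters of p' p^-1 for two isometries with the same \<open>e\<close>; the
  conjugations cancel in this quotient.\<close>

definition quot :: "(complex \<times> real \<times> complex) \<Rightarrow> (complex \<times> real \<times> complex) \<Rightarrow> complex \<times> real \<times> complex" where
  "quot p' p = (let w = snd (snd p') * cnj (snd (snd p)); y = fst p' - w * fst p in
     (y, fst (snd p') - fst (snd p) - 2 * Im (y * cnj (w * fst p)), w))"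

definition F :: "complex \<times> real \<times> complex \<Rightarrow> bool \<Rightarrow> 'b \<Rightarrow> 'b" where
  "F p e = E (fst p) (fst (snd p)) (snd (snd p)) e"

lemma quot_cpl: "p \<in> cpl \<Longrightarrow> p' \<in> cpl \<Longrightarrow> quot p' p \<in> cpl"
  by (simp add: cpl_def quot_def Let_def norm_mult)

lemma F_quot:
  assumes "p \<in> cpl" "p' \<in> cpl" shows "F p' e = F (quot p' p) False \<circ> F p e"
proof -
  define w where "w = snd (snd p') * cnj (snd (snd p))"
  have u: "cmod w = 1" "cmod (snd (snd p)) = 1" using assms by (simp_all add: cpl_def w_def norm_mult)
  have w: "w * snd (snd p) = snd (snd p')"
    using unit_cnj(2)[OF u(2)] by (simp add: w_def mult.assoc)
  show ?thesis
    unfolding F_def quot_def Let_def w_def[symmetric] fst_conv snd_conv by (subst comp[OF u]) (simp add: w)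
qed

lemma quot_id:
  assumes "p \<in> cpl" "quot p' p = (0, 0, 1)" shows "p' = p"
proof -
  define w where "w = snd (snd p') * cnj (snd (snd p))"
  have w: "w = 1" "fst p' = w * fst p" "fst (snd p') = fst (snd p)" 
    using assms(2) unfolding quot_def Let_def w_def[symmetric] by auto
  have "snd (snd p') = w * snd (snd p)"
    using unit_cnj(2)[of "snd (snd p)"] assms(1) by (simp add: w_def cpl_def mult.assoc)
  then show ?thesis using w by (simp add: prod_eq_iff)
qed

text \<open>Infinitely many parameters in a compact set would accumulate. Two distinct ones close to
  the limit have a quotient close to the identity that still lies in the group, against
  discreteness.\<close>

lemma finite_params:
  "finite {p \<in> cpl. cmod (fst p) \<le> R \<and> \<bar>fst (snd p)\<bar> \<le> R \<and> F p e \<in> \<G>}" (is "finite ?P")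
proof (rule ccontr)
  assume inf: "infinite ?P"
  obtain N where N: "open N" "N \<inter> \<G> = {id}"
    using disc id_mem unfolding discrete_def isolated_in_def by blast
  let ?C = "cball 0 R \<times> {-R..R} \<times> sphere 0 1 :: (complex \<times> real \<times> complex) set"
  have C: "compact ?C" by (intro compact_Times compact_cball compact_Icc compact_sphere)
  have sub: "?P \<subseteq> ?C" by (auto simp: cpl_def)
  obtain q where q: "q \<in> ?C" "q islimpt ?P"
    using C[unfolded compact_eq_Bolzano_Weierstrass] inf sub by blast
  have qc: "q \<in> cpl" using q(1) by (auto simp: cpl_def)
  have cF: "continuous_on cpl (\<lambda>p. F p False)"
    by (rule continuous_on_coordinatewise_then_product) (use cont in \<open>simp add: F_def cpl_def\<close>)
  have cq: "continuous_on (cpl \<times> cpl) (\<lambda>r. quot (fst r) (snd r))"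
    unfolding quot_def Let_def by (intro continuous_intros)
  have c: "continuous_on (cpl \<times> cpl) (\<lambda>r. F (quot (fst r) (snd r)) False)"
    by (rule continuous_on_compose2[OF cF cq]) (auto intro: quot_cpl)
  obtain A where A: "open A" "A \<inter> cpl \<times> cpl = (\<lambda>r. F (quot (fst r) (snd r)) False) -` N \<inter> cpl \<times> cpl"
    using c N(1) unfolding continuous_on_open_invariant by blast
  have "snd (snd q) * cnj (snd (snd q)) = 1" using qc by (simp add: cpl_def unit_cnj)
  then have "quot q q = (0, 0, 1)" by (simp add: quot_def Let_def)
  then have "F (quot q q) False = id" by (simp add: F_def one)
  moreover have "id \<in> N" using N(2) by blast
  ultimately have "(q, q) \<in> (\<lambda>r. F (quot (fst r) (snd r)) False) -` N \<inter> cpl \<times> cpl"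
    using qc by (simp only: Int_iff vimage_eq mem_Times_iff fst_conv snd_conv simp_thms)
  then have "(q, q) \<in> A" unfolding A(2)[symmetric] by blast
  obtain B B' where B0: "open B" "open B'" "(q, q) \<in> B \<times> B'" "B \<times> B' \<subseteq> A"
    by (rule open_prod_elim[OF A(1) \<open>(q, q) \<in> A\<close>], rule that)
  then have B: "q \<in> B" "q \<in> B'" "open (B \<inter> B')" by blast+
  have "infinite (B \<inter> B' \<inter> ?P)"
    using q(2)[unfolded islimpt_eq_acc_point, THEN spec, of "B \<inter> B'"] B by (simp only: Int_iff simp_thms)
  then obtain p where p: "p \<in> B \<inter> B' \<inter> ?P" using infinite_imp_nonempty by blast
  have "infinite (B \<inter> B' \<inter> ?P - {p})" using \<open>infinite (B \<inter> B' \<inter> ?P)\<close> by (rule infinite_remove)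
  then obtain p' where "p' \<in> B \<inter> B' \<inter> ?P - {p}" using infinite_imp_nonempty by blast
  then have p': "p' \<in> B \<inter> B' \<inter> ?P" "p' \<noteq> p" by blast+
  have pc: "p \<in> cpl" "p' \<in> cpl" using p p'(1) by blast+
  have "(p', p) \<in> A" using B0(4) p p'(1) by blast
  then have "(p', p) \<in> A \<inter> cpl \<times> cpl" using pc by blast
  then have "F (quot p' p) False \<in> N" unfolding A(2) by simp
  moreover have "F (quot p' p) False \<in> \<G>"
    by (rule division[OF _ _ F_quot[OF pc]]) (use p p'(1) in blast)+
  ultimately have "F (quot p' p) False = id" using N(2) by blast
  then have "nil_iso (fst (quot p' p)) (fst (snd (quot p' p))) (snd (snd (quot p' p))) False = id"
    using quot_cpl[OF pc] by (intro faithful) (simp_all add: F_def cpl_def)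
  then have "quot p' p = (0, 0, 1)" unfolding nil_iso_eq_id by (simp add: prod_eq_iff)
  then show False using quot_id[OF pc(1)] p'(2) by blast
qed

definition G :: "(nil \<Rightarrow> nil) set" where
  "G = {nil_iso z t u e | z t u e. cmod u = 1 \<and> E z t u e \<in> \<G>}"

lemma GI: "cmod u = 1 \<Longrightarrow> E z t u e \<in> \<G> \<Longrightarrow> nil_iso z t u e \<in> G"
  unfolding G_def by blast

lemma GE:
  assumes "g \<in> G" obtains z t u e where "g = nil_iso z t u e" "cmod u = 1" "E z t u e \<in> \<G>"
  using assms unfolding G_def by blast

lemma G_powers:
  assumes "cmod u = 1"
  shows "\<exists>z' t' u' e'. cmod u' = 1 \<and> nil_iso z t u e ^^ n = nil_iso z' t' u' e' \<and> E z t u e ^^ n = E z' t' u' e'"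
proof (induction n)
  case 0
  show ?case by (intro exI[of _ 0] exI[of _ 1] exI[of _ False]) (simp add: nil_iso_id one id_def)
next
  case (Suc n)
  then obtain z' t' u' e' where IH: "cmod u' = 1" "nil_iso z t u e ^^ n = nil_iso z' t' u' e'" "E z t u e ^^ n = E z' t' u' e'"
    by (elim exE conjE)
  have "cmod (u * cj e u') = 1" using assms IH(1) by (simp add: norm_mult)
  then show ?case
    unfolding funpow.simps IH comp[OF assms IH(1)] nil_iso_comp[OF assms] by blast
qed

lemma subgroup_G: "subgroup G Isom_Nil"
proof
  interpret I: group Isom_Nil by (rule group_Isom_Nil)
  show "G \<subseteq> carrier Isom_Nil" unfolding G_def carrier_Isom_Nil by blast
  have "nil_iso 0 0 1 False \<in> G" by (rule GI) (simp_all add: one id_mem)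
  then show "\<one>\<^bsub>Isom_Nil\<^esub> \<in> G" unfolding nil_iso_id by simp
  fix x assume x: "x \<in> G"
  then obtain z t u e where g: "x = nil_iso z t u e" "cmod u = 1" "E z t u e \<in> \<G>" by (rule GE)
  {
    fix y assume y: "y \<in> G"
    then obtain z' t' u' e' where g': "y = nil_iso z' t' u' e'" "cmod u' = 1" "E z' t' u' e' \<in> \<G>" by (rule GE)
    have "nil_iso z t u e \<circ> nil_iso z' t' u' e' \<in> G"
      unfolding nil_iso_comp[OF g(2)] 
      by (rule GI, simp add: norm_mult g g') (use mult[OF g(3) g'(3)] in \<open>simp only: comp[OF g(2) g'(2)]\<close>)
    then show "x \<otimes>\<^bsub>Isom_Nil\<^esub> y \<in> G" by (simp only: g g' mult_Isom_Nil)
  }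
  have xc: "x \<in> carrier Isom_Nil" using x unfolding G_def carrier_Isom_Nil by blast
  obtain z' t' u' e' where g': "inv\<^bsub>Isom_Nil\<^esub> x = nil_iso z' t' u' e'" "cmod u' = 1"
    by (rule nil_isoE[OF I.inv_closed[OF xc]], rule that)
  have "nil_iso z' t' u' e' \<circ> x = id" using I.l_inv[OF xc] unfolding g'(1) mult_Isom_Nil .
  then have "nil_iso z' t' u' e' \<circ> nil_iso z t u e = id" unfolding g(1) .
  then have "E z' t' u' e' \<circ> E z t u e = id"
    unfolding nil_iso_comp[OF g'(2)] nil_iso_eq_id comp[OF g'(2) g(2)] by (elim conjE) (simp only: one simp_thms)
  then have "E z' t' u' e' \<in> \<G>" by (intro division[OF id_mem g(3)]) simp
  then show "inv\<^bsub>Isom_Nil\<^esub> x \<in> G" unfolding g'(1) by (rule GI[OF g'(2)])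
qed

lemma finite_bounded:
  assumes "bounded K" shows "finite {g \<in> G. \<exists>x\<in>K. g x \<in> K}"
proof -
  obtain B where B: "B > 0" "\<And>x. x \<in> K \<Longrightarrow> norm x \<le> B" using assms unfolding bounded_pos by blast
  have K: "cmod (fst x) \<le> B" "\<bar>snd x\<bar> \<le> B" if "x \<in> K" for x
    using B(2)[OF that] norm_fst_le[of "fst x" "snd x"] norm_snd_le[of "snd x" "fst x"] by auto
  \<comment> \<open>From |z + w| <= B and |w| <= B follows |z| <= 2 B, and then |t| <= B + B + 2 (2
    B B).\<close>
  define R where "R = 2 * B + 4 * B * B"
  define P where "P e = {p \<in> cpl. cmod (fst p) \<le> R \<and> \<bar>fst (snd p)\<bar> \<le> R \<and> F p e \<in> \<G>}" for e
  have "{g \<in> G. \<exists>x\<in>K. g x \<in> K} \<subseteq> (\<Union>e. (\<lambda>p. nil_iso (fst p) (fst (snd p)) (snd (snd p)) e) ` P e)"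
  proof
    fix g assume "g \<in> {g \<in> G. \<exists>x\<in>K. g x \<in> K}"
    then obtain x where g: "g \<in> G" and x: "x \<in> K" "g x \<in> K" by blast
    obtain z t u e where p: "g = nil_iso z t u e" "cmod u = 1" "E z t u e \<in> \<G>" by (rule GE[OF g])
    define w where "w = u * cj e (fst x)"
    have w: "cmod w \<le> B" using K(1)[OF x(1)] by (simp add: w_def norm_mult p(2))
    have gx: "cmod (z + w) \<le> B" "\<bar>t + sg e * snd x + 2 * Im (z * cnj w)\<bar> \<le> B"
      using K[OF x(2)] unfolding p(1) nil_iso_def w_def by auto
    have z: "cmod z \<le> 2 * B" using norm_triangle_ineq4[of "z + w" w] gx(1) w by simp
    have "\<bar>Im (z * cnj w)\<bar> \<le> cmod z * cmod w" using abs_Im_le_cmod[of "z * cnj w"] by (simp add: norm_mult)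
    also have "\<dots> \<le> 2 * B * B" by (intro mult_mono z w) (use B in auto)
    finally have im: "\<bar>Im (z * cnj w)\<bar> \<le> 2 * B * B" .
    have s: "\<bar>sg e * snd x\<bar> \<le> B" using K(2)[OF x(1)] by (simp add: sg_def abs_mult)
    have t: "\<bar>t\<bar> \<le> R" using gx(2) im s unfolding R_def by linarith
    have "0 \<le> B * B" by simp
    then have "cmod z \<le> R" using z unfolding R_def by linarith
    then have "(z, t, u) \<in> P e" using t p by (simp add: P_def cpl_def F_def)
    then have "g \<in> (\<lambda>p. nil_iso (fst p) (fst (snd p)) (snd (snd p)) e) ` P e"
      by (rule rev_image_eqI) (simp add: p(1))
    then show "g \<in> (\<Union>e. (\<lambda>p. nil_iso (fst p) (fst (snd p)) (snd (snd p)) e) ` P e)" by blast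
  qed
  moreover have "finite (\<Union>e. (\<lambda>p. nil_iso (fst p) (fst (snd p)) (snd (snd p)) e) ` P e)"
    by (intro finite_UN_I finite_imageI) (simp_all add: P_def finite_params)
  ultimately show ?thesis by (rule finite_subset)
qed

text \<open>The powers of an element fixing a point all fix it, so there are finitely many of them;
  the element has finite order and is trivial.\<close>

lemma nil_action_G: "nil_action G"
proof (rule nil_action.intro)
  fix g x assume g: "g \<in> G" "g x = x"
  obtain z t u e where p: "g = nil_iso z t u e" "cmod u = 1" "E z t u e \<in> \<G>" by (rule GE[OF g(1)])
  have pow: "g ^^ n \<in> {h \<in> G. \<exists>y\<in>{x}. h y \<in> {x}}" for n
  proof -
    have "g ^^ n \<in> G"
      using subgroup.one_closed[OF subgroup_G] subgroup.m_closed[OF subgroup_G g(1)]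
      by (induction n) (simp_all only: funpow.simps mult_Isom_Nil)
    moreover have "(g ^^ n) x = x" by (induction n) (simp_all add: g(2))
    ultimately show ?thesis by blast
  qed
  have "finite {h \<in> G. \<exists>y\<in>{x}. h y \<in> {x}}" by (rule finite_bounded) simp
  then have "finite (range (\<lambda>n. g ^^ n))" by (rule rev_finite_subset) (use pow in blast)
  then have "\<not> inj (\<lambda>n. g ^^ n)" using finite_imageD[of "\<lambda>n. g ^^ n" UNIV] infinite_UNIV_nat by blast
  then obtain i j where ij: "i < j" "g ^^ i = g ^^ j" using linorder_injI[of "\<lambda>n. g ^^ n"] by blast
  interpret I: group Isom_Nil by (rule group_Isom_Nil)
  define n where "n = j - i"
  have n: "n > 0" "j = i + n" using ij(1) by (simp_all add: n_def)
  have gc: "g \<in> carrier Isom_Nil" unfolding p(1) by (rule nil_isoI[OF p(2)])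
  have "g [^]\<^bsub>Isom_Nil\<^esub> i \<otimes>\<^bsub>Isom_Nil\<^esub> g [^]\<^bsub>Isom_Nil\<^esub> n = g [^]\<^bsub>Isom_Nil\<^esub> i"
    using ij(2) n(2) I.nat_pow_mult[OF gc, of i n] by simp
  then have "g [^]\<^bsub>Isom_Nil\<^esub> n = \<one>\<^bsub>Isom_Nil\<^esub>" using I.l_cancel_one[OF I.nat_pow_closed[OF gc] I.nat_pow_closed[OF gc]] by blast
  then have "g ^^ n = id" by simp
  moreover obtain z' t' u' e' where q: "g ^^ n = nil_iso z' t' u' e'" "E z t u e ^^ n = E z' t' u' e'"
    using G_powers[OF p(2), of n z t e] unfolding p(1) by (elim exE conjE)
  ultimately have "nil_iso z' t' u' e' = id" by (simp only:)
  then have "E z t u e ^^ n = id" unfolding q(2) nil_iso_eq_id by (elim conjE) (simp only: one simp_thms)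
  then have "E z t u e = id" by (rule tf[OF p(3) n(1)])
  then show "g = id" unfolding p(1) by (rule faithful[OF p(2)])
qed (rule subgroup_G finite_bounded)+

end

lemma nil_action_Nil_manifold:
  assumes "Nil_manifold_group \<Delta>" shows "nil_action \<Delta>"
proof -
  interpret I: group Isom_Nil by (rule group_Isom_Nil)
  have D: "subgroup \<Delta> Isom_Nil" "discrete \<Delta>" "torsion_free (Isom_Nil\<lparr>carrier := \<Delta>\<rparr>)"
    using assms by (auto simp: Nil_manifold_group_def)
  interpret D: subgroup \<Delta> Isom_Nil by (rule D(1))
  interpret r: discrete_rep nil_iso \<Delta>
  proof
    show "continuous_on {p. cmod (snd (snd p)) = 1} (\<lambda>p. nil_iso (fst p) (fst (snd p)) (snd (snd p)) False x)" for x
      unfolding nil_iso_def by (auto intro!: continuous_intros)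
    show "id \<in> \<Delta>" using D.one_closed by simp
    show "f \<circ> g \<in> \<Delta>" if "f \<in> \<Delta>" "g \<in> \<Delta>" for f g using D.m_closed[OF that] by simp
    show "h \<in> \<Delta>" if "f \<in> \<Delta>" "g \<in> \<Delta>" "f = h \<circ> g" for f g h
    proof -
      have "g \<circ> inv\<^bsub>Isom_Nil\<^esub> g = id" using I.r_inv[of g] D.mem_carrier[OF that(2)] by simp
      then have "f \<circ> inv\<^bsub>Isom_Nil\<^esub> g = h" unfolding that(3) comp_assoc by simp
      then show ?thesis using D.m_closed[OF that(1) D.m_inv_closed[OF that(2)]] by simp
    qed
    show "f = id" if "f \<in> \<Delta>" "n > 0" "f ^^ n = id" for f n
      using D(3) that unfolding torsion_free_def by simp
  qed (simp_all add: nil_iso_comp nil_iso_id D(2))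
  have "r.G = \<Delta>"
    unfolding r.G_def using D.subset unfolding carrier_Isom_Nil by blast
  then show ?thesis using r.nil_action_G by simp
qed

lemma continuous_on_line: "continuous_on {X. X \<noteq> 0} line"
  unfolding continuous_on_open_invariant
proof (intro allI impI)
  fix U :: "cp2 set" assume "open U"
  then have "open {X. X \<noteq> 0 \<and> line X \<in> U}" unfolding open_cp2_def .
  then show "\<exists>A. open A \<and> A \<inter> {X. X \<noteq> 0} = line -` U \<inter> {X. X \<noteq> 0}"
    by (intro exI[of _ "{X. X \<noteq> 0 \<and> line X \<in> U}"] conjI) auto
qed

text \<open>Faithfulness is seen on the horosphere, where \<open>hyp\<close> acts as
  \<open>nil_iso\<close>; continuity holds because the matrix entries are polynomial in the
  parameters and their conjugates.\<close>

lemma discrete_rep_conj: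
  assumes W: "W \<in> U21" and M: "H2C_manifold_group \<Gamma>"
  shows "discrete_rep (\<lambda>z t u e. proj W \<circ> hyp z t u e \<circ> proj (adjH W)) \<Gamma>"
proof -
  interpret I: group Isom_H2C by (rule group_Isom_H2C)
  have D: "subgroup \<Gamma> Isom_H2C" "discrete \<Gamma>" "torsion_free (Isom_H2C\<lparr>carrier := \<Gamma>\<rparr>)"
    using M by (auto simp: H2C_manifold_group_def)
  interpret D: subgroup \<Gamma> Isom_H2C by (rule D(1))
  note WW = proj_adjH[OF W]
  show ?thesis
  proof
    show "(proj W \<circ> hyp z t u e \<circ> proj (adjH W)) \<circ> (proj W \<circ> hyp z' t' u' e' \<circ> proj (adjH W)) =
        proj W \<circ> hyp (z + u * cj e z') (t + sg e * t' + 2 * Im (z * cnj (u * cj e z'))) (u * cj e u') (e \<noteq> e') \<circ> proj (adjH W)"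
      if u: "cmod u = 1" "cmod u' = 1" for z t u e z' t' u' e'
    proof -
      have "(proj W \<circ> hyp z t u e \<circ> proj (adjH W)) \<circ> (proj W \<circ> hyp z' t' u' e' \<circ> proj (adjH W)) =
         proj W \<circ> (hyp z t u e \<circ> (proj (adjH W) \<circ> proj W) \<circ> hyp z' t' u' e') \<circ> proj (adjH W)"
        by (simp only: comp_assoc)
      then show ?thesis unfolding WW comp_id hyp_comp[OF u] .
    qed
    show "proj W \<circ> hyp 0 0 1 False \<circ> proj (adjH W) = id" unfolding hyp_id comp_id by (rule WW)
    show "continuous_on {p. cmod (snd (snd p)) = 1}
        (\<lambda>p. (proj W \<circ> hyp (fst p) (fst (snd p)) (snd (snd p)) False \<circ> proj (adjH W)) x)" for x
    proof -
      obtain X where X: "X \<noteq> 0" "x = line X" by (rule cp2_cases)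
      define Y where "Y = adjH W *v X"
      have Y: "Y \<noteq> 0" unfolding Y_def by (rule invertible_nonzero[OF U21_invertible[OF adjH_U21[OF W]] X(1)])
      let ?f = "\<lambda>p. W *v (heis (fst p) (fst (snd p)) (snd (snd p)) *v Y)"
      have ne: "heis z t u *v Y \<noteq> 0" "W *v (heis z t u *v Y) \<noteq> 0" if "cmod u = 1" for z t u
        using invertible_nonzero[OF U21_invertible[OF heis_U21[OF that]] Y] 
          invertible_nonzero[OF U21_invertible[OF W]] by blast+
      have eq: "(proj W \<circ> hyp z t u False \<circ> proj (adjH W)) x = line (W *v (heis z t u *v Y))" if "cmod u = 1" for z t u
        using ne[OF that] X(1) Y
        by (simp add: X(2) hyp_def proj_line U21_invertible adjH_U21 W heis_U21 that Y_def[symmetric])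
      have "continuous_on UNIV (\<lambda>p. ?f p $ i)" for i
        by (simp add: mvm3 hgt_def[abs_def]) (intro continuous_intros | simp)+
      then have "continuous_on UNIV (\<lambda>p. \<chi> i. ?f p $ i)" by (rule continuous_on_vec_lambda)
      then have "continuous_on UNIV ?f" unfolding vec_lambda_eta .
      then have "continuous_on {p. cmod (snd (snd p)) = 1} ?f" by (rule continuous_on_subset) simp
      then have "continuous_on {p. cmod (snd (snd p)) = 1} (\<lambda>p. line (?f p))"
        by (rule continuous_on_compose2[OF continuous_on_line]) (use ne in auto)
      then show ?thesis by (rule continuous_on_eq) (use eq in simp)
    qed
    show "nil_iso z t u e = id" if u: "cmod u = 1" and "proj W \<circ> hyp z t u e \<circ> proj (adjH W) = id" for z t u e
    proof
      fix p
      have "(proj (adjH W) \<circ> proj W) \<circ> hyp z t u e \<circ> (proj (adjH W) \<circ> proj W) = proj (adjH W) \<circ> (proj W \<circ> hyp z t u e \<circ> proj (adjH W)) \<circ> proj W"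
        by (simp only: comp_assoc)
      then have "hyp z t u e = id" unfolding that(2) comp_id WW id_comp .
      then have "line (horo (nil_iso z t u e p)) = line (horo p)" unfolding hyp_horo[OF u, symmetric] by simp
      then show "nil_iso z t u e p = id p" unfolding horo_inj by simp
    qed
    show "id \<in> \<Gamma>" using D.one_closed by simp
    show "f \<circ> g \<in> \<Gamma>" if "f \<in> \<Gamma>" "g \<in> \<Gamma>" for f g using D.m_closed[OF that] by simp
    show "h \<in> \<Gamma>" if "f \<in> \<Gamma>" "g \<in> \<Gamma>" "f = h \<circ> g" for f g h
    proof -
      have "g \<circ> inv\<^bsub>Isom_H2C\<^esub> g = id" using I.r_inv[of g] D.mem_carrier[OF that(2)] by simp
      then have "f \<circ> inv\<^bsub>Isom_H2C\<^esub> g = h" unfolding that(3) comp_assoc by simp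
      then show ?thesis using D.m_closed[OF that(1) D.m_inv_closed[OF that(2)]] by simp
    qed
    show "f = id" if "f \<in> \<Gamma>" "n > 0" "f ^^ n = id" for f n
      using D(3) that unfolding torsion_free_def by simp
  qed (rule D(2))
qed

section \<open>Commensurability and the coefficient field\<close>

text \<open>By finite index two powers of k x k^-1 lie in the same coset of the intersection with
  \<open>B\<close>, so some positive power has its inverse in \<open>B\<close>. The conclusion is
  phrased without inverses.\<close>

lemma commensurable_power:
  assumes \<Gamma>: "subgroup \<Gamma> Isom_H2C" and comm: "commensurable Isom_H2C \<Gamma> B" and B: "id \<in> B"
  obtains k where "k \<in> carrier Isom_H2C" "\<And>x. x \<in> \<Gamma> \<Longrightarrow> \<exists>n>0. \<exists>b\<in>B. b \<circ> (k \<circ> x ^^ n) = k"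
proof -
  interpret I: group Isom_H2C by (rule group_Isom_H2C)
  interpret S: subgroup \<Gamma> Isom_H2C by (rule \<Gamma>)
  obtain k where k: "k \<in> carrier Isom_H2C"
    and fin: "finite (rcosets\<^bsub>Isom_H2C\<lparr>carrier := k <#\<^bsub>Isom_H2C\<^esub> \<Gamma> #>\<^bsub>Isom_H2C\<^esub> inv\<^bsub>Isom_H2C\<^esub> k\<rparr>\<^esub>
        ((k <#\<^bsub>Isom_H2C\<^esub> \<Gamma> #>\<^bsub>Isom_H2C\<^esub> inv\<^bsub>Isom_H2C\<^esub> k) \<inter> B))"
    using comm unfolding commensurable_def Let_def by blast
  define k' where "k' = inv\<^bsub>Isom_H2C\<^esub> k"
  define A where "A = k <#\<^bsub>Isom_H2C\<^esub> \<Gamma> #>\<^bsub>Isom_H2C\<^esub> k'"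
  have kk: "k' \<circ> k = id" "k \<circ> k' = id" using I.l_inv[OF k] I.r_inv[OF k] by (simp_all add: k'_def)
  have A: "k \<circ> x \<circ> k' \<in> A" if "x \<in> \<Gamma>" for x
    unfolding A_def l_coset_def r_coset_def using that by auto
  have idA: "id \<in> A" using A[of id] S.one_closed kk(2) by simp
  show ?thesis
  proof (rule that[OF k])
    fix x assume x: "x \<in> \<Gamma>"
    define y where "y = k \<circ> x \<circ> k'"
    have pow: "y ^^ n = k \<circ> x ^^ n \<circ> k'" for n unfolding y_def by (rule funpow_conj[OF kk])
    have "x ^^ n \<in> \<Gamma>" for n
      using S.one_closed S.m_closed[OF x] by (induction n) (simp_all only: funpow.simps mult_Isom_H2C)
    then have yA: "y ^^ n \<in> A" for n unfolding pow by (rule A)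
    define C where "C n = (A \<inter> B) #>\<^bsub>Isom_H2C\<lparr>carrier := A\<rparr>\<^esub> (y ^^ n)" for n
    have "range C \<subseteq> rcosets\<^bsub>Isom_H2C\<lparr>carrier := A\<rparr>\<^esub> (A \<inter> B)"
      unfolding RCOSETS_def C_def using yA by auto
    then have "finite (range C)" using fin unfolding A_def[symmetric] k'_def[symmetric] by (rule finite_subset)
    then have "\<not> inj C" using finite_imageD[of C UNIV] infinite_UNIV_nat by blast
    then obtain i j where ij: "i < j" "C i = C j" using linorder_injI[of C] by blast
    define n where "n = j - i"
    have n: "n > 0" "j = n + i" using ij(1) by (simp_all add: n_def)
    have "y ^^ i \<in> C i" unfolding C_def r_coset_def using idA B by (auto intro!: bexI[of _ id])
    then have "y ^^ i \<in> C j" unfolding ij(2) .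
    then obtain b where b: "b \<in> B" "y ^^ i = b \<circ> y ^^ j" unfolding C_def r_coset_def by auto
    have xc: "x \<in> carrier Isom_H2C" by (rule S.mem_carrier[OF x])
    have xx: "x \<circ> inv\<^bsub>Isom_H2C\<^esub> x = id" using I.r_inv[OF xc] by simp
    have "y \<circ> (k \<circ> inv\<^bsub>Isom_H2C\<^esub> x \<circ> k') = k \<circ> (x \<circ> (k' \<circ> k) \<circ> inv\<^bsub>Isom_H2C\<^esub> x) \<circ> k'"
      unfolding y_def by (simp only: comp_assoc)
    then have yy: "y \<circ> (k \<circ> inv\<^bsub>Isom_H2C\<^esub> x \<circ> k') = id" unfolding kk comp_id xx .
    have "y ((k \<circ> inv\<^bsub>Isom_H2C\<^esub> x \<circ> k') p) = p" for p using fun_cong[OF yy, of p] by simp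
    \<comment> \<open>Surjectivity of y^i allows it to be cancelled on the right in y^i = b y^(n +
      i).\<close>
    then have "surj y" by (rule surjI)
    then have "surj (y ^^ i)" by (rule surj_fn)
    have "b \<circ> y ^^ n = id"
    proof
      fix p
      obtain p' where p: "p = (y ^^ i) p'" using \<open>surj (y ^^ i)\<close> by (metis surjD)
      have "(b \<circ> y ^^ n) p = (b \<circ> y ^^ j) p'" unfolding p n(2) funpow_add by simp
      then show "(b \<circ> y ^^ n) p = id p" unfolding b(2)[symmetric] p by simp
    qed
    then have "(b \<circ> y ^^ n) \<circ> k = k" by simp
    moreover have "(b \<circ> y ^^ n) \<circ> k = b \<circ> (k \<circ> x ^^ n) \<circ> (k' \<circ> k)" unfolding pow by (simp only: comp_assoc)
    ultimately have "b \<circ> (k \<circ> x ^^ n) = k" unfolding kk(1) comp_id by (simp only:)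
    then show "\<exists>n>0. \<exists>b\<in>B. b \<circ> (k \<circ> x ^^ n) = k" using b(1) n(1) by blast
  qed
qed

section \<open>Imaginary quadratic fields and ratios of translations\<close>

text \<open>The field Q(i sqrt d) in real coordinates: for d > 0, Im x * sqrt d is rational exactly
  when Im x is a rational multiple of sqrt d.\<close>

definition quad_field :: "nat \<Rightarrow> complex set" where
  "quad_field d = {x. Re x \<in> \<rat> \<and> Im x * sqrt d \<in> \<rat>}"

context
  fixes d :: nat
  assumes d: "d > 0"
begin

lemma quad_field_Im_mult:
  assumes "x \<in> quad_field d" "y \<in> quad_field d" shows "Im x * Im y \<in> \<rat>"
proof -
  have "Im x * Im y = (Im x * sqrt d) * (Im y * sqrt d) / real d"
    using d by (simp add: field_simps)
  moreover have "(Im x * sqrt d) * (Im y * sqrt d) / real d \<in> \<rat>"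
    using assms unfolding quad_field_def by (intro Rats_divide Rats_mult[of "Im x * sqrt d"]) simp_all
  ultimately show ?thesis by simp
qed

lemma quad_field_closed:
  "of_nat n \<in> quad_field d" "x \<in> quad_field d \<Longrightarrow> cnj x \<in> quad_field d"
  "x \<in> quad_field d \<Longrightarrow> y \<in> quad_field d \<Longrightarrow> x + y \<in> quad_field d"
  "x \<in> quad_field d \<Longrightarrow> y \<in> quad_field d \<Longrightarrow> x - y \<in> quad_field d"
  by (simp_all add: quad_field_def distrib_right left_diff_distrib)

lemma quad_field_mult:
  assumes "x \<in> quad_field d" "y \<in> quad_field d" shows "x * y \<in> quad_field d"
proof -
  have "Im (x * y) * sqrt d = Re x * (Im y * sqrt d) + (Im x * sqrt d) * Re y" by (simp add: algebra_simps)
  then show ?thesis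
    using assms quad_field_Im_mult[OF assms] by (simp add: quad_field_def)
qed

lemma quad_field_divide:
  assumes "x \<in> quad_field d" "y \<in> quad_field d" shows "x / y \<in> quad_field d"
proof -
  have N: "(Re y)\<^sup>2 + (Im y)\<^sup>2 \<in> \<rat>"
    using assms(2) quad_field_Im_mult[OF assms(2,2)] by (simp add: quad_field_def power2_eq_square)
  have "Im (inverse y) * sqrt d = - ((Im y * sqrt d) / ((Re y)\<^sup>2 + (Im y)\<^sup>2))" by simp
  moreover have "- ((Im y * sqrt d) / ((Re y)\<^sup>2 + (Im y)\<^sup>2)) \<in> \<rat>"
    using N assms(2) by (simp add: quad_field_def)
  ultimately have "inverse y \<in> quad_field d" using N assms(2) by (simp add: quad_field_def)
  then show ?thesis unfolding divide_inverse by (rule quad_field_mult[OF assms(1)])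
qed

lemma Rats_complex:
  assumes "a \<in> (\<rat> :: complex set)" obtains r where "r \<in> \<rat>" "a = complex_of_real r"
proof -
  obtain m n :: int where "a = of_int m / of_int n" using Rats_cases'[OF assms] by metis
  then show ?thesis using that[of "of_int m / of_int n"] by simp
qed

lemma ring_of_integers_quad_field: "ring_of_integers d \<subseteq> quad_field d"
proof
  fix x assume "x \<in> ring_of_integers d"
  then obtain a b where ab: "a \<in> \<rat>" "b \<in> \<rat>" "x = a + b * (\<i> * complex_of_real (sqrt (real d)))"
    unfolding ring_of_integers_def by blast
  obtain p q where "p \<in> \<rat>" "q \<in> \<rat>" "a = complex_of_real p" "b = complex_of_real q"
    using Rats_complex[OF ab(1)] Rats_complex[OF ab(2)] by metis
  then show "x \<in> quad_field d" by (simp add: ab(3) quad_field_def mult.assoc)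
qed

definition qmat :: "complex^3^3 \<Rightarrow> bool" where
  "qmat A \<longleftrightarrow> (\<forall>i j. A $ i $ j \<in> quad_field d)"

lemma qmat_closed:
  "qmat (mat 1)" "qmat A \<Longrightarrow> qmat B \<Longrightarrow> qmat (A - B)" "qmat A \<Longrightarrow> qmat B \<Longrightarrow> qmat (A ** B)" "qmat A \<Longrightarrow> qmat (adjH A)"
  using quad_field_closed(1)[of 0] quad_field_closed(1)[of 1]
  by (auto simp: qmat_def mat_def mmm3 adjH_def intro!: quad_field_closed(2-) quad_field_mult)

text \<open>A projective map determines its matrix only up to a scalar. A known trace recovers the
  scalar as trace B / 3, which lies in the field.\<close>

lemma qmat_normalised:
  assumes B: "qmat B" and eq: "B = smat l A" and tr: "trace A = 3" and l: "l \<noteq> 0"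
  shows "qmat A"
proof -
  have "trace B = l * trace A" unfolding eq by (simp add: trace_def sum_distrib_left)
  then have "l = trace B / of_nat 3" using tr by simp
  moreover have "trace B \<in> quad_field d"
    unfolding trace_def sum_3 using B by (intro quad_field_closed(3)) (simp_all add: qmat_def)
  ultimately have "l \<in> quad_field d" using quad_field_divide[OF _ quad_field_closed(1)] by blast
  moreover have "A $ i $ j = B $ i $ j / l" for i j using l by (simp add: eq)
  ultimately show ?thesis using B quad_field_divide by (simp add: qmat_def)
qed

end

definition E13 :: "complex^3^3" where
  "E13 = vector [vector [0, 0, 1], vector [0, 0, 0], vector [0, 0, 0]]"

lemma E13_nth:
  "E13 $ 1 $ 1 = 0" "E13 $ 1 $ 2 = 0" "E13 $ 1 $ 3 = 1" "E13 $ 2 $ 1 = 0" "E13 $ 2 $ 2 = 0" "E13 $ 2 $ 3 = 0"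
  "E13 $ 3 $ 1 = 0" "E13 $ 3 $ 2 = 0" "E13 $ 3 $ 3 = 0"
  by (simp_all add: E13_def vector_3)

text \<open>Heights drop out of the product of two such nilpotent matrices; only the planar parts
  remain, in one corner entry.\<close>

lemma heis_minus_1_mult: "(heis z t 1 - mat 1) ** (heis z' t' 1 - mat 1) = smat (- (cnj z * z')) E13"
  unfolding mat3_eq_iff mmm3 smat_nth E13_nth vector_minus_component heis_nth mat_1_3 by simp

lemma trace_conj_heis:
  assumes "V \<in> U21" shows "trace (V ** heis z t 1 ** adjH V) = 3"
proof -
  have "trace (V ** heis z t 1 ** adjH V) = trace (adjH V ** (V ** heis z t 1))" by (rule trace_mul_sym)
  also have "\<dots> = trace (heis z t 1)" by (simp add: matrix_mul_assoc adjH_mult[OF assms])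
  finally show ?thesis by (simp add: trace_def sum_3)
qed

lemma matrix_diff_distrib:
  fixes A B C :: "complex^3^3"
  shows "(A - B) ** C = A ** C - B ** C" "C ** (A - B) = C ** A - C ** B"
  by (simp_all add: mat3_eq_iff mmm3 algebra_simps)

lemma conj_minus_1:
  assumes "V \<in> U21" shows "V ** T ** adjH V - mat 1 = V ** (T - mat 1) ** adjH V"
  by (simp only: matrix_diff_distrib matrix_mul_rid adjH_mult2[OF assms])

text \<open>Both products are multiples of the one nonzero matrix V E13 V^-1, and one of its nonzero
  entries cancels in the quotient.\<close>

lemma translation_ratio:
  assumes d: "d > 0" and V: "V \<in> U21"
    and q: "qmat d (V ** heis z t 1 ** adjH V)" "qmat d (V ** heis z' t' 1 ** adjH V)" and z: "z \<noteq> 0"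
  shows "z' / z \<in> quad_field d"
proof -
  define Z where "Z = V ** E13 ** adjH V"
  define M where "M z t = V ** heis z t 1 ** adjH V - mat 1" for z t
  have prod: "M z t ** M z' t' = smat (- (cnj z * z')) Z" for z t z' t'
  proof -
    have "M z t ** M z' t' = V ** ((heis z t 1 - mat 1) ** (adjH V ** V) ** (heis z' t' 1 - mat 1)) ** adjH V"
      unfolding M_def conj_minus_1[OF V] by (simp only: matrix_mul_assoc)
    then show ?thesis
      unfolding adjH_mult[OF V] matrix_mul_rid heis_minus_1_mult smat_mmm Z_def .
  qed
  have "adjH V ** Z ** V = (adjH V ** V) ** E13 ** (adjH V ** V)" unfolding Z_def by (simp only: matrix_mul_assoc)
  then have E: "adjH V ** Z ** V = E13" unfolding adjH_mult[OF V] by simp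
  have "Z \<noteq> 0"
  proof
    assume "Z = 0"
    then have "E13 = 0" using E by (simp add: mat3_eq_iff mmm3)
    then show False by (simp add: mat3_eq_iff E13_nth)
  qed
  then obtain i j where ij: "Z $ i $ j \<noteq> 0" by (auto simp: vec_eq_iff)
  have "qmat d (M z t)" "qmat d (M z' t')" unfolding M_def using q qmat_closed[OF d] by blast+
  then have "qmat d (M z t ** M z' t')" "qmat d (M z t ** M z t)" using qmat_closed[OF d] by blast+
  then have "(- (cnj z * z')) * Z $ i $ j \<in> quad_field d" "(- (cnj z * z)) * Z $ i $ j \<in> quad_field d"
    unfolding prod qmat_def[OF d] smat_nth by blast+
  then have "((- (cnj z * z')) * Z $ i $ j) / ((- (cnj z * z)) * Z $ i $ j) \<in> quad_field d" by (rule quad_field_divide[OF d])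
  moreover have "((- (cnj z * z')) * Z $ i $ j) / ((- (cnj z * z)) * Z $ i $ j) = z' / z" using ij z by simp
  ultimately show ?thesis by (simp only:)
qed

lemma hyp_funpow_translation: "hyp z t 1 False ^^ n = hyp (n * z) (n * t) 1 False"
proof (induction n)
  case (Suc n)
  then show ?case by (simp only: funpow.simps hyp_comp norm_one) (simp add: algebra_simps)
qed (simp add: hyp_id)

text \<open>The conjugation is pushed to the right, so that everything to its left is given by one
  unitary matrix.\<close>

lemma proj_apply_conj:
  assumes "k \<in> carrier Isom_H2C" "W \<in> U21"
  obtains V e where "V \<in> U21" "k \<circ> proj W = proj V \<circ> (if e then conj_cp2 else id)"
proof -
  obtain A e where A: "A \<in> U21" "k = proj A \<circ> (if e then conj_cp2 else id)" by (rule Isom_H2CE[OF assms(1)])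
  show ?thesis
  proof (cases e)
    case True
    obtain W' where W': "W' \<in> U21" "conj_cp2 \<circ> proj W = proj W' \<circ> conj_cp2" using conj_proj[OF assms(2)] by blast
    have "k \<circ> proj W = proj A \<circ> (conj_cp2 \<circ> proj W)" using True A(2) by (simp add: comp_assoc)
    also have "\<dots> = proj A \<circ> proj W' \<circ> conj_cp2" by (simp only: W'(2) comp_assoc)
    finally show ?thesis using that[of "A ** W'" True] U21_mult[OF A(1) W'(1)] proj_mult[OF A(1) W'(1)] by simp
  next
    case False
    then show ?thesis using that[of "A ** W" False] U21_mult[OF A(1) assms(2)] proj_mult[OF A(1) assms(2)] A(2) by simp
  qed
qed

text \<open>The two translations may need different exponents to become integral; this changes the
  ratio by a rational factor, and an antiholomorphic conjugating isometry replaces it by its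
  conjugate. The field absorbs both.\<close>

lemma commensurable_translations:
  assumes d: "d > 0" and \<Gamma>: "subgroup \<Gamma> Isom_H2C" and comm: "commensurable Isom_H2C \<Gamma> (PU21_O d)"
    and W: "W \<in> U21" and z: "z \<noteq> 0"
    and mem: "proj W \<circ> hyp z t 1 False \<circ> proj (adjH W) \<in> \<Gamma>" "proj W \<circ> hyp z' t' 1 False \<circ> proj (adjH W) \<in> \<Gamma>"
  shows "z' / z \<in> quad_field d"
proof -
  have rat: "x \<in> ring_of_integers d" if "algebraic_int x" "x \<in> \<rat>" for x
    unfolding ring_of_integers_def using that by (intro CollectI conjI bexI[of _ x] bexI[of _ 0]) simp_all
  have "0 \<in> ring_of_integers d" "1 \<in> ring_of_integers d" by (rule rat; simp)+
  then have "mat 1 \<in> {A \<in> U21. \<forall>i j. A $ i $ j \<in> ring_of_integers d}"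
    using U21_one by (simp add: mat_def)
  then have idO: "id \<in> PU21_O d" unfolding PU21_O_def proj_one[symmetric] by (rule imageI)
  obtain k where k: "k \<in> carrier Isom_H2C" "\<And>x. x \<in> \<Gamma> \<Longrightarrow> \<exists>n>0. \<exists>b\<in>PU21_O d. b \<circ> (k \<circ> x ^^ n) = k"
    by (rule commensurable_power[OF \<Gamma> comm idO], rule that)
  obtain V e where V: "V \<in> U21" "k \<circ> proj W = proj V \<circ> (if e then conj_cp2 else id)"
    by (rule proj_apply_conj[OF k(1) W])
  have key: "\<exists>n>0. \<exists>s. qmat d (V ** heis (cj e (of_nat n * z)) s 1 ** adjH V)"
    if zt: "proj W \<circ> hyp z t 1 False \<circ> proj (adjH W) \<in> \<Gamma>" for z t
  proof -
    obtain n b where n: "n > 0" "b \<in> PU21_O d" "b \<circ> (k \<circ> (proj W \<circ> hyp z t 1 False \<circ> proj (adjH W)) ^^ n) = k"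
      using k(2)[OF zt] by (elim exE conjE bexE)
    obtain B where B: "B \<in> U21" "b = proj B" "\<forall>i j. B $ i $ j \<in> ring_of_integers d"
      using n(2) unfolding PU21_O_def by blast
    have qB: "qmat d B" using B(3) ring_of_integers_quad_field[OF d] unfolding qmat_def[OF d] by blast
    define T where "T = heis (cj e (of_nat n * z)) (sg e * (real n * t)) 1"
    define c where "c = (if e then conj_cp2 else id)"
    have TU: "T \<in> U21" unfolding T_def by (rule heis_U21) simp
    have cc: "c \<circ> c = id" unfolding c_def using conj_conj by simp
    have cT: "c \<circ> hyp (of_nat n * z) (real n * t) 1 False = proj T \<circ> c"
      unfolding c_def T_def hyp_def using conj_heis[of 1 "of_nat n * z" "real n * t"] by (cases e) (simp_all add: sg_def)
    have pow: "(proj W \<circ> hyp z t 1 False \<circ> proj (adjH W)) ^^ n = proj W \<circ> hyp (of_nat n * z) (real n * t) 1 False \<circ> proj (adjH W)"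
      unfolding funpow_conj[OF proj_adjH(2,1)[OF W]] hyp_funpow_translation ..
    have "proj V \<circ> c = k \<circ> proj W" unfolding V(2) c_def ..
    also have "\<dots> = b \<circ> (k \<circ> proj W) \<circ> hyp (of_nat n * z) (real n * t) 1 False \<circ> (proj (adjH W) \<circ> proj W)"
      by (subst n(3)[unfolded pow, symmetric]) (simp only: comp_assoc)
    also have "\<dots> = proj B \<circ> proj V \<circ> (c \<circ> hyp (of_nat n * z) (real n * t) 1 False)"
      unfolding proj_adjH(2)[OF W] V(2) c_def[symmetric] B(2) comp_id by (simp only: comp_assoc)
    also have "\<dots> = proj B \<circ> proj V \<circ> proj T \<circ> c" unfolding cT by (simp only: comp_assoc)
    finally have "(proj V \<circ> c) \<circ> c = (proj B \<circ> proj V \<circ> proj T \<circ> c) \<circ> c" by (simp only:)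
    then have "proj V = proj B \<circ> proj V \<circ> proj T" unfolding comp_assoc cc comp_id .
    then have "proj V = proj (B ** V ** T)"
      by (simp only: proj_mult U21_mult B(1) V(1) TU)
    then obtain l where l: "cmod l = 1" "V = smat l (B ** V ** T)"
      using proj_eqD[OF V(1) U21_mult[OF U21_mult[OF B(1) V(1)] TU]] by blast
    \<comment> \<open>\<open>b\<close> inverts the conjugated power, so it is the adjoint of
      \<open>B\<close> that is proportional to the conjugated unipotent matrix.\<close>
    have "adjH B = adjH B ** (V ** adjH V)" unfolding adjH_mult2[OF V(1)] by simp
    also have "\<dots> = adjH B ** (smat l (B ** V ** T) ** adjH V)" using l(2) by (simp only: l(2)[symmetric])
    also have "\<dots> = smat l ((adjH B ** B) ** V ** T ** adjH V)" by (simp only: smat_mmm matrix_mul_assoc)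
    also have "\<dots> = smat l (V ** T ** adjH V)" unfolding adjH_mult[OF B(1)] by simp
    finally have eq: "adjH B = smat l (V ** T ** adjH V)" .
    have "trace (V ** T ** adjH V) = 3" unfolding T_def by (rule trace_conj_heis[OF V(1)])
    moreover have "l \<noteq> 0" using l(1) by auto
    ultimately have "qmat d (V ** T ** adjH V)" by (rule qmat_normalised[OF d qmat_closed(4)[OF d qB] eq])
    then show ?thesis using n(1) unfolding T_def by blast
  qed
  obtain n s where n: "n > 0" "qmat d (V ** heis (cj e (of_nat n * z)) s 1 ** adjH V)" using key[OF mem(1)] by blast
  obtain n' s' where n': "n' > 0" "qmat d (V ** heis (cj e (of_nat n' * z')) s' 1 ** adjH V)" using key[OF mem(2)] by blast
  have "cj e (of_nat n * z) \<noteq> 0" using n(1) z by simp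
  then have "cj e (of_nat n' * z') / cj e (of_nat n * z) \<in> quad_field d" by (rule translation_ratio[OF d V(1) n(2) n'(2)])
  then have "of_nat n / of_nat n' * (cj e (of_nat n' * z') / cj e (of_nat n * z)) \<in> quad_field d"
    by (rule quad_field_mult[OF d quad_field_divide[OF d quad_field_closed(1)[OF d] quad_field_closed(1)[OF d]]])
  moreover have "of_nat n / of_nat n' * (cj e (of_nat n' * z') / cj e (of_nat n * z)) = cj e (z' / z)"
    using n(1) n'(1) z by (cases e) (simp_all add: cj_def field_simps)
  ultimately have "cj e (z' / z) \<in> quad_field d" by (simp only:)
  then show ?thesis using quad_field_closed(2)[OF d, of "cnj (z' / z)"] by (cases e) simp_all
qed

lemma nat_square_if_rat_square:
  assumes "q \<in> \<rat>" "q * q = real n" obtains m :: nat where "n = m\<^sup>2"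
proof -
  obtain a b :: nat where ab: "b \<noteq> 0" "\<bar>q\<bar> = real a / real b" "coprime a b"
    using Rats_abs_nat_div_natE[OF assms(1)] by metis
  have "real n = \<bar>q\<bar> * \<bar>q\<bar>" using assms(2) by (simp add: abs_mult_self_eq)
  then have "real (n * b\<^sup>2) = real (a\<^sup>2)" unfolding ab(2) using ab(1) by (simp add: field_simps power2_eq_square)
  then have eq: "n * b\<^sup>2 = a\<^sup>2" by (simp only: of_nat_eq_iff)
  then have "b\<^sup>2 dvd a\<^sup>2" by (metis dvd_triv_right)
  then have "b dvd a" by (simp add: pow_divides_pow_iff)
  then have "b = 1" using coprime_common_divisor[OF ab(3) \<open>b dvd a\<close> dvd_refl] by simp
  then show ?thesis using that[of a] eq by simp
qed

text \<open>Here v is i or -i, so sqrt d is rational and the squarefree number d is a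
  square.\<close>

lemma quad_field_fourth_root:
  assumes d: "d > 0" "squarefree d" and v: "v \<in> quad_field d" "v * v = - 1"
  shows "d = 1"
proof -
  have "Re v * Im v = 0" using v(2) by (auto simp: complex_eq_iff)
  have "Re v * Re v - Im v * Im v = -1" using v(2) by (simp add: complex_eq_iff)
  moreover have "Re v = 0"
  proof (rule ccontr)
    assume "Re v \<noteq> 0"
    then have "Im v = 0" using \<open>Re v * Im v = 0\<close> by simp
    then have "Re v * Re v = -1" using calculation by simp
    then show False using zero_le_square[of "Re v"] by linarith
  qed
  ultimately have "Im v * Im v = 1" by simp
  have "(Im v * sqrt d) * (Im v * sqrt d) = (Im v * Im v) * (sqrt d * sqrt d)" by algebra
  then have sq: "(Im v * sqrt d) * (Im v * sqrt d) = real d" unfolding \<open>Im v * Im v = 1\<close> by simp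
  have "Im v * sqrt d \<in> \<rat>" using v(1) by (simp add: quad_field_def)
  then obtain m where m: "d = m\<^sup>2" using nat_square_if_rat_square[OF _ sq] by blast
  have "m\<^sup>2 dvd d" unfolding m by (rule dvd_refl)
  then have "m dvd 1" by (rule squarefreeD[OF d(2)])
  then show ?thesis using m by simp
qed

text \<open>Here 2 Im v is sqrt 3 up to sign, so 3 d is a square m^2. Then 3 divides m, and d is
  three times a square.\<close>

lemma quad_field_third_root:
  assumes d: "d > 0" "squarefree d" and v: "v \<in> quad_field d" "1 + v + v * v = 0"
  shows "d = 3"
proof -
  have e: "1 + Re v + (Re v * Re v - Im v * Im v) = 0" "Im v + 2 * Re v * Im v = 0"
    using v(2) by (simp_all add: complex_eq_iff algebra_simps)
  have "Im v \<noteq> 0"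
  proof
    assume "Im v = 0"
    then have "(Re v + 1/2) * (Re v + 1/2) + 3/4 = 0" using e(1) by (simp add: algebra_simps)
    then show False using zero_le_square[of "Re v + 1/2"] by linarith
  qed
  moreover have "Im v * (1 + 2 * Re v) = 0" using e(2) by (simp add: algebra_simps)
  ultimately have "1 + 2 * Re v = 0" by (metis mult_eq_0_iff)
  then have "Re v = - 1 / 2" by simp
  then have "4 * (Im v * Im v) = 3" using e(1) by simp
  have "(2 * (Im v * sqrt d)) * (2 * (Im v * sqrt d)) = 4 * (Im v * Im v) * (sqrt d * sqrt d)" by algebra
  then have sq: "(2 * (Im v * sqrt d)) * (2 * (Im v * sqrt d)) = real (3 * d)"
    unfolding \<open>4 * (Im v * Im v) = 3\<close> by simp
  have "2 * (Im v * sqrt d) \<in> \<rat>" using v(1) by (simp add: quad_field_def)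
  then obtain m where m: "3 * d = m\<^sup>2" using nat_square_if_rat_square[OF _ sq] by blast
  \<comment> \<open>Squares are 0 or 1 modulo 3, and residue 0 occurs only for multiples of
    3.\<close>
  have "\<exists>j. m = 3 * j \<or> m = 3 * j + 1 \<or> m = 3 * j + 2" by presburger
  then obtain j where "m = 3 * j \<or> m = 3 * j + 1 \<or> m = 3 * j + 2" by (rule exE)
  then consider "m = 3 * j" | "3 * d = 3 * (3 * j * j + 2 * j) + 1" | "3 * d = 3 * (3 * j * j + 4 * j + 1) + 1"
    using m by (auto simp: power2_eq_square algebra_simps)
  then have "m = 3 * j" by cases presburger+
  then have j: "d = 3 * j\<^sup>2" using m by (simp add: power2_eq_square)
  have "j\<^sup>2 dvd d" unfolding j by (rule dvd_triv_right)
  then have "j dvd 1" by (rule squarefreeD[OF d(2)])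
  then show ?thesis using j by simp
qed

section \<open>Cusp cross-sections\<close>

text \<open>The columns of \<open>W\<close> have Gram matrix \<open>H\<close>: the first is
  \<open>Q\<close>, the third a null vector with product 1 with \<open>Q\<close>, and the second a
  unit vector orthogonal to both. If \<open>Q\<close> lies over infinity the third column lies over
  the origin, otherwise over infinity.\<close>

lemma null_frame:
  assumes "Q \<noteq> 0" "herm Q Q = 0"
  obtains W where "W \<in> U21" "W *v infinity = Q"
proof (cases "Q$3 = 0")
  case True
  then have Q: "Q$2 = 0" "Q$1 \<noteq> 0" using assms by (auto simp: herm_eq vec3_eq_iff)
  define W :: "complex^3^3" where "W = vector [vector [Q$1, 0, 0], vector [0, 1, 0], vector [0, 0, inverse (cnj (Q$1))]]"
  have nth: "W$1$1 = Q$1" "W$1$2 = 0" "W$1$3 = 0" "W$2$1 = 0" "W$2$2 = 1" "W$2$3 = 0"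
    "W$3$1 = 0" "W$3$2 = 0" "W$3$3 = inverse (cnj (Q$1))" by (simp_all add: W_def vector_3)
  have "W \<in> U21" by (rule U21I) (use Q in \<open>simp add: mat3_eq_iff mmm3 mat_1_3 nth\<close>)
  moreover have "W *v infinity = Q" using Q True by (simp add: vec3_eq_iff mvm3 nth)
  ultimately show ?thesis by (rule that)
next
  case False
  then have c: "cnj (Q$3) \<noteq> 0" by simp
  define W :: "complex^3^3" where
    "W = vector [vector [Q$1, - (cnj (Q$2) / cnj (Q$3)), 1 / cnj (Q$3)], vector [Q$2, 1, 0], vector [Q$3, 0, 0]]"
  have nth: "W$1$1 = Q$1" "W$1$2 = - (cnj (Q$2) / cnj (Q$3))" "W$1$3 = 1 / cnj (Q$3)" "W$2$1 = Q$2" "W$2$2 = 1" "W$2$3 = 0"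
    "W$3$1 = Q$3" "W$3$2 = 0" "W$3$3 = 0" by (simp_all add: W_def vector_3)
  have "cnj (Q$3) * Q$1 + cnj (Q$2) * Q$2 + cnj (Q$1) * Q$3 = 0" using assms(2) by (simp add: herm_eq algebra_simps)
  then have "W \<in> U21"
    by (intro U21I) (use False c in \<open>simp add: mat3_eq_iff mmm3 mat_1_3 nth\<close>)
  moreover have "W *v infinity = Q" by (simp add: vec3_eq_iff mvm3 nth)
  ultimately show ?thesis by (rule that)
qed

text \<open>The level r is absorbed by dividing the null vector by sqrt r; a frame sending
  \<open>infinity\<close> to the rescaled vector carries the standard horosphere to
  \<open>S\<close>.\<close>

lemma horosphere_frame:
  assumes "is_horosphere q S"
  obtains W where "W \<in> U21" "q = proj W (line infinity)" "S = range (\<lambda>p. proj W (line (horo p)))"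
proof -
  obtain Q r where Q: "Q \<noteq> 0" "herm Q Q = 0" "line Q = q" "r > 0"
    and S: "S = line ` {X. Re (herm X X) < 0 \<and> (cmod (herm X Q))\<^sup>2 = r * - Re (herm X X)}"
    using assms unfolding is_horosphere_def by blast
  define c where "c = complex_of_real (inverse (sqrt r))"
  have c: "c \<noteq> 0" "(cmod c)\<^sup>2 = inverse r"
    using Q(4) by (simp_all add: c_def power_inverse norm_inverse)
  have "herm (c *s Q) (c *s Q) = c * cnj c * herm Q Q" by (simp add: herm_eq algebra_simps)
  then have "c *s Q \<noteq> 0" "herm (c *s Q) (c *s Q) = 0" using c(1) Q by (simp_all add: vec_eq_iff)
  then obtain W where W: "W \<in> U21" "W *v infinity = c *s Q" by (rule null_frame)
  have inv: "invertible W" by (rule U21_invertible[OF W(1)])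
  have hQ: "(cmod (herm X (c *s Q)))\<^sup>2 = (cmod (herm X Q))\<^sup>2 / r" for X
  proof -
    have "herm X (c *s Q) = cnj c * herm X Q" by (simp add: herm_eq algebra_simps)
    then show ?thesis using c(2) by (simp add: norm_mult power_mult_distrib divide_inverse mult.commute)
  qed
  have "line (c *s Q) = line Q"
    unfolding eq_commute[of "line (c *s Q)"] line_eq_iff[OF Q(1) \<open>c *s Q \<noteq> 0\<close>]
    by (intro exI[of _ c] conjI c(1) HOL.refl)
  then have "q = proj W (line infinity)" by (simp add: proj_line[OF inv] W(2) Q(3))
  moreover have "S = proj W ` horosphere0"
  proof (intro equalityI subsetI)
    fix x assume "x \<in> S"
    then obtain X where X: "x = line X" "Re (herm X X) < 0" "(cmod (herm X Q))\<^sup>2 = r * - Re (herm X X)" using S by blast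
    define Y where "Y = adjH W *v X"
    have WY: "W *v Y = X" unfolding Y_def by (simp add: matrix_vector_mul_assoc adjH_mult2[OF W(1)])
    have "herm Y Y = herm X X" "herm Y infinity = herm X (c *s Q)"
      using U21_herm[OF W(1), of Y Y] U21_herm[OF W(1), of Y infinity] unfolding WY W(2) by simp_all
    then have "Re (herm Y Y) < 0" "(cmod (herm Y infinity))\<^sup>2 = 1 * - Re (herm Y Y)"
      using X hQ[of X] Q(4) by simp_all
    moreover then have "Y \<noteq> 0" by (auto simp: herm_eq)
    ultimately have "line Y \<in> horosphere0" "x = proj W (line Y)"
      unfolding horosphere0_def by (auto simp: proj_line[OF inv] WY X(1))
    then show "x \<in> proj W ` horosphere0" by blast
  next
    fix x assume "x \<in> proj W ` horosphere0"
    then obtain Y where Y: "x = proj W (line Y)" "Re (herm Y Y) < 0" "(cmod (herm Y infinity))\<^sup>2 = 1 * - Re (herm Y Y)"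
      unfolding horosphere0_def by blast
    have "Y \<noteq> 0" using Y(2) by (auto simp: herm_eq)
    then have x: "x = line (W *v Y)" unfolding Y(1) by (rule proj_line[OF inv])
    have "(cmod (herm (W *v Y) Q))\<^sup>2 = r * - Re (herm (W *v Y) (W *v Y))"
      using hQ[of "W *v Y"] Y(3) Q(4) unfolding W(2)[symmetric] U21_herm[OF W(1)] by (simp add: field_simps)
    moreover have "Re (herm (W *v Y) (W *v Y)) < 0" unfolding U21_herm[OF W(1)] by (rule Y(2))
    ultimately show "x \<in> S" unfolding S x by blast
  qed
  ultimately show ?thesis using that[OF W(1)] unfolding horosphere0_eq image_image by blast
qed

text \<open>Fixing infinity still leaves a dilation factor. Mapping one vector \<open>horo\<close>
  to a multiple of another, both of norm -1 and third coordinate 1, forces this factor to have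
  modulus 1, and a unit scalar then makes the matrix Heisenberg.\<close>

lemma fixes_cusp_and_horosphere:
  assumes g: "g \<in> carrier Isom_H2C" "g (line infinity) = line infinity" and p: "g (line (horo p)) = line (horo p')"
  obtains z t u e where "cmod u = 1" "g = hyp z t u e"
proof -
  obtain A e where A: "A \<in> U21" "g = proj A \<circ> (if e then conj_cp2 else id)" by (rule Isom_H2CE[OF g(1)])
  have e: "(if e then conj_cp2 else id) = hyp 0 0 1 e" by (simp add: hyp_def heis_1 proj_one)
  define p1 where "p1 = nil_iso 0 0 1 e p"
  have inv: "invertible A" by (rule U21_invertible[OF A(1)])
  have fixA: "proj A (line infinity) = line infinity"
    using g(2) unfolding A(2) e comp_apply by (simp add: hyp_infinity)
  have "proj A (line (horo p1)) = line (horo p')"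
    using p unfolding A(2) e comp_apply p1_def by (simp add: hyp_horo)
  then have "line (horo p') = line (A *v horo p1)" by (simp add: proj_line[OF inv])
  then obtain c where c: "c \<noteq> 0" "A *v horo p1 = c *s horo p'"
    using line_eq_iff[OF horo_nonzero invertible_nonzero[OF inv horo_nonzero]] by blast
  have "herm (A *v horo p1) (A *v horo p1) = c * cnj c * herm (horo p') (horo p')"
    unfolding c(2) by (simp add: herm_eq algebra_simps)
  then have "c * cnj c = 1" unfolding U21_herm[OF A(1)] herm_horo by simp
  then have "(cmod c)\<^sup>2 = 1" by (metis complex_norm_square of_real_eq_1_iff)
  then have cn: "cmod c = 1" using norm_ge_zero[of c] unfolding power2_eq_1_iff by linarith
  obtain l m u where E: "A$1$1 = l" "A$2$1 = 0" "A$3$1 = 0" "A$3$2 = 0" "A$3$3 = m" "l * cnj m = 1"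
    "A$2$2 = u" "cmod u = 1" by (rule U21_fixing_infinity[OF A(1) fixA], rule that)
  have "(A *v horo p1) $ 3 = c" unfolding c(2) by simp
  then have "m = c" by (simp add: mvm3 E)
  then have mc: "cmod m = 1" using cn by simp
  have "l = l * cnj m * m" using unit_cnj(2)[OF mc] by (simp add: mult.assoc)
  then have lm: "l = m" unfolding E(6) by simp
  define B where "B = smat (cnj m) A"
  have B: "B \<in> U21" unfolding B_def by (rule smat_U21[OF A(1)]) (simp add: mc)
  have "B = heis (B$2$3) (2 * Im (B$1$3)) (B$2$2)"
    by (rule unipotent_to_heis[OF B]) (simp_all add: B_def E lm unit_cnj(2)[OF mc])
  moreover have "proj A = proj B" unfolding B_def by (rule proj_smat[OF A(1), symmetric]) (simp add: mc)
  moreover have "cmod (B$2$2) = 1" by (simp add: B_def E norm_mult mc)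
  ultimately show ?thesis using that[of "B$2$2" "B$2$3" "2 * Im (B$1$3)" e] A(2) by (simp add: hyp_def)
qed

lemma orbit_eq_iff:
  assumes K: "id \<in> K" "\<And>g h. g \<in> K \<Longrightarrow> h \<in> K \<Longrightarrow> g \<circ> h \<in> K" "\<And>g. g \<in> K \<Longrightarrow> \<exists>h\<in>K. h \<circ> g = id"
  shows "orbit (M\<lparr>carrier := K\<rparr>) (\<lambda>g. g) x = orbit (M\<lparr>carrier := K\<rparr>) (\<lambda>g. g) y \<longleftrightarrow> (\<exists>g\<in>K. y = g x)"
proof -
  have orb: "orbit (M\<lparr>carrier := K\<rparr>) (\<lambda>g. g) x = {g x | g. g \<in> K}" for x by (simp add: orbit_def)
  show ?thesis
  proof
    assume eq: "orbit (M\<lparr>carrier := K\<rparr>) (\<lambda>g. g) x = orbit (M\<lparr>carrier := K\<rparr>) (\<lambda>g. g) y"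
    have "id y \<in> {g y | g. g \<in> K}" using K(1) by blast
    then have "y \<in> {g x | g. g \<in> K}" using eq unfolding orb by simp
    then show "\<exists>g\<in>K. y = g x" by blast
  next
    assume "\<exists>g\<in>K. y = g x"
    then obtain g where g: "g \<in> K" "y = g x" by blast
    obtain h where h: "h \<in> K" "h \<circ> g = id" using K(3)[OF g(1)] by blast
    have x: "x = h y" using fun_cong[OF h(2), of x] g(2) by simp
    have "k y \<in> {g x | g. g \<in> K}" if "k \<in> K" for k
    proof -
      have "k y = (k \<circ> g) x" unfolding g(2) comp_apply ..
      then show ?thesis using K(2)[OF that g(1)] by blast
    qed
    moreover have "k x \<in> {g y | g. g \<in> K}" if "k \<in> K" for k
    proof -
      have "k x = (k \<circ> h) y" unfolding comp_apply x[symmetric] ..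
      then show ?thesis using K(2)[OF that h(1)] by blast
    qed
    ultimately show "orbit (M\<lparr>carrier := K\<rparr>) (\<lambda>g. g) x = orbit (M\<lparr>carrier := K\<rparr>) (\<lambda>g. g) y"
      unfolding orb by blast
  qed
qed

text \<open>The frame \<open>W\<close> identifies Nil with the horosphere and the stabiliser of the
  cusp with a group of Nil isometries. The diffeomorphism then relates two free, properly
  discontinuous actions on Nil, and lifting it gives the homomorphism.\<close>

lemma cusp_cross_section_hom:
  assumes \<Delta>: "Nil_manifold_group \<Delta>" and M: "H2C_manifold_group \<Gamma>" and S: "is_horosphere q S"
    and diff: "diffeomorphic_quotients id UNIV (Isom_Nil\<lparr>carrier := \<Delta>\<rparr>) siegel S
      (Isom_H2C\<lparr>carrier := stabilizer (Isom_H2C\<lparr>carrier := \<Gamma>\<rparr>) (\<lambda>g. g) q\<rparr>)"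
  obtains W \<theta> where "W \<in> U21"
    "\<And>g. g \<in> \<Delta> \<Longrightarrow> \<exists>z t u e. cmod u = 1 \<and> \<theta> g = nil_iso z t u e \<and> proj W \<circ> hyp z t u e \<circ> proj (adjH W) \<in> \<Gamma>"
    "\<And>g h. g \<in> \<Delta> \<Longrightarrow> h \<in> \<Delta> \<Longrightarrow> \<theta> (g \<circ> h) = \<theta> g \<circ> \<theta> h" "\<And>g. g \<in> \<Delta> \<Longrightarrow> \<theta> g = id \<Longrightarrow> g = id"
proof -
  obtain W where W: "W \<in> U21" "q = proj W (line infinity)" "S = range (\<lambda>p. proj W (line (horo p)))"
    by (rule horosphere_frame[OF S], rule that)
  interpret r: discrete_rep "\<lambda>z t u e. proj W \<circ> hyp z t u e \<circ> proj (adjH W)" \<Gamma>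
    by (rule discrete_rep_conj[OF W(1) M])
  interpret A: nil_action \<Delta> by (rule nil_action_Nil_manifold[OF \<Delta>])
  interpret I: group Isom_H2C by (rule group_Isom_H2C)
  have \<Gamma>: "subgroup \<Gamma> Isom_H2C" using M by (simp add: H2C_manifold_group_def)
  interpret \<Gamma>: subgroup \<Gamma> Isom_H2C by (rule \<Gamma>)
  define K where "K = stabilizer (Isom_H2C\<lparr>carrier := \<Gamma>\<rparr>) (\<lambda>g. g) q"
  have K: "g \<in> K \<longleftrightarrow> g \<in> \<Gamma> \<and> g q = q" for g by (simp add: K_def stabilizer_def)
  define \<psi> where "\<psi> p = proj W (line (horo p))" for p
  have adj: "proj (adjH W) (proj W x) = x" "proj W (proj (adjH W) x) = x" for x
    using fun_cong[OF proj_adjH(2)[OF W(1)], of x] fun_cong[OF proj_adjH(1)[OF W(1)], of x] by simp_all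
  let ?oD = "orbit (Isom_Nil\<lparr>carrier := \<Delta>\<rparr>) (\<lambda>g. g)" and ?oK = "orbit (Isom_H2C\<lparr>carrier := K\<rparr>) (\<lambda>g. g)"
  have oD: "?oD x = ?oD y \<longleftrightarrow> (\<exists>g\<in>\<Delta>. y = g x)" for x y
    by (rule orbit_eq_iff[OF A.one_mem A.mult_mem]) (use A.inverse_mem in blast)+
  have oK: "?oK (\<psi> y) = ?oK (\<psi> y') \<longleftrightarrow> (\<exists>g\<in>r.G. y' = g y)" for y y'
  proof -
    have "?oK (\<psi> y) = ?oK (\<psi> y') \<longleftrightarrow> (\<exists>g\<in>K. \<psi> y' = g (\<psi> y))"
    proof (rule orbit_eq_iff)
      show "id \<in> K" unfolding K using r.id_mem by simp
      show "g \<circ> h \<in> K" if "g \<in> K" "h \<in> K" for g h using that r.mult[of g h] unfolding K by simp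
      fix g assume g: "g \<in> K"
      define h where "h = inv\<^bsub>Isom_H2C\<^esub> g"
      have h: "h \<in> \<Gamma>" "h \<circ> g = id" using g \<Gamma>.m_inv_closed[of g] I.l_inv[OF \<Gamma>.mem_carrier, of g] by (simp_all add: K h_def)
      have "h q = q" using fun_cong[OF h(2), of q] g unfolding K by simp
      then have "h \<in> K" unfolding K by (rule conjI[OF h(1)])
      then show "\<exists>h\<in>K. h \<circ> g = id" by (rule bexI[where P = "\<lambda>h. h \<circ> g = id", OF h(2)])
    qed
    also have "\<dots> \<longleftrightarrow> (\<exists>g\<in>r.G. y' = g y)"
    proof
      assume "\<exists>g\<in>K. \<psi> y' = g (\<psi> y)"
      then obtain g where "g \<in> K" and g3: "\<psi> y' = g (\<psi> y)" by (rule bexE)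
      have g: "g \<in> \<Gamma>" "g q = q" "\<psi> y' = g (\<psi> y)" using \<open>g \<in> K\<close> g3 unfolding K by simp_all
      define h where "h = proj (adjH W) \<circ> g \<circ> proj W"
      have hc: "h \<in> carrier Isom_H2C"
        using I.m_closed[OF I.m_closed[OF proj_in_Isom[OF adjH_U21[OF W(1)]] \<Gamma>.mem_carrier[OF g(1)]] proj_in_Isom[OF W(1)]]
        by (simp add: h_def)
      have hi: "h (line infinity) = line infinity" using g(2) unfolding W(2) h_def by (simp add: adj)
      have hy: "h (line (horo y)) = line (horo y')" 
      proof -
        have "h (line (horo y)) = proj (adjH W) (g (\<psi> y))" by (simp add: h_def \<psi>_def)
        also have "\<dots> = proj (adjH W) (\<psi> y')" unfolding g(3) ..
        also have "\<dots> = line (horo y')" unfolding \<psi>_def by (rule adj(1))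
        finally show ?thesis .
      qed
      obtain z t u e where e: "cmod u = 1" "h = hyp z t u e" by (rule fixes_cusp_and_horosphere[OF hc hi hy], rule that)
      have "proj W \<circ> h \<circ> proj (adjH W) = g" by (rule ext) (simp add: h_def adj)
      then have "nil_iso z t u e \<in> r.G" using g(1) unfolding e(2) by (intro r.GI[OF e(1)]) simp
      moreover have "y' = nil_iso z t u e y" using hy unfolding e(2) hyp_horo[OF e(1)] horo_inj by simp
      ultimately show "\<exists>g\<in>r.G. y' = g y" by (intro bexI[where P = "\<lambda>g. y' = g y"])
    next
      assume "\<exists>g\<in>r.G. y' = g y"
      then obtain g where g: "g \<in> r.G" "y' = g y" by (rule bexE)
      obtain z t u e where e: "g = nil_iso z t u e" "cmod u = 1" "proj W \<circ> hyp z t u e \<circ> proj (adjH W) \<in> \<Gamma>"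
        by (rule r.GE[OF g(1)], rule that)
      have "(proj W \<circ> hyp z t u e \<circ> proj (adjH W)) q = q" unfolding W(2) by (simp add: adj hyp_infinity[OF e(2)])
      then have "proj W \<circ> hyp z t u e \<circ> proj (adjH W) \<in> K" unfolding K by (rule conjI[OF e(3)])
      moreover have "\<psi> y' = (proj W \<circ> hyp z t u e \<circ> proj (adjH W)) (\<psi> y)"
        unfolding \<psi>_def g(2) e(1) by (simp add: adj hyp_horo[OF e(2)])
      ultimately show "\<exists>g\<in>K. \<psi> y' = g (\<psi> y)" by (intro bexI[where P = "\<lambda>g. \<psi> y' = g (\<psi> y)"])
    qed
    finally show ?thesis .
  qed
  define V where "V p = W *v horo p" for p
  have inv: "invertible W" by (rule U21_invertible[OF W(1)])
  have V0: "V p \<noteq> 0" for p unfolding V_def by (rule invertible_nonzero[OF inv horo_nonzero])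
  have \<psi>V: "\<psi> p = line (V p)" for p unfolding \<psi>_def V_def by (rule proj_line[OF inv horo_nonzero])
  \<comment> \<open>A vector with third coordinate 0 has norm |X$2|^2, which is never
    negative.\<close>
  have V3: "V p $ 3 \<noteq> 0" for p
  proof
    assume "V p $ 3 = 0"
    then have "herm (V p) (V p) = V p $ 2 * cnj (V p $ 2)" by (simp add: herm_eq)
    moreover have "herm (V p) (V p) = - 1" unfolding V_def U21_herm[OF W(1)] by (rule herm_horo)
    ultimately have "Re (V p $ 2 * cnj (V p $ 2)) = Re (- 1)" by metis
    then have "Re (V p $ 2 * cnj (V p $ 2)) = - 1" by (simp only: uminus_complex.sel one_complex.sel)
    moreover have "0 \<le> Re (V p $ 2 * cnj (V p $ 2))" by simp
    ultimately show False by linarith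
  qed
  have sieg: "siegel (\<psi> p) = (V p $ 1 / V p $ 3, V p $ 2 / V p $ 3)" for p unfolding \<psi>V by (rule siegel_line[OF V0])
  have contV: "continuous_on UNIV (\<lambda>p. V p $ i)" for i
    unfolding V_def mvm3 horo_nth hgt_def by (intro continuous_intros) simp_all
  have contS: "continuous_on UNIV (\<lambda>p. siegel (\<psi> p))"
    unfolding sieg by (intro continuous_intros contV) (use V3 in simp_all)
  \<comment> \<open>Undoes the frame: the adjoint of \<open>W\<close> is applied to the affine point
    (a, b, 1), and planar part and height are then read off as on the standard horosphere.\<close>
  define xc where "xc i ab = adjH W $ i $ 1 * fst ab + adjH W $ i $ 2 * snd ab + adjH W $ i $ 3" for i and ab :: "complex \<times> complex"
  define chart where "chart ab = (xc 2 ab / xc 3 ab, 2 * Im (xc 1 ab / xc 3 ab))" for ab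
  have contb: "continuous_on {ab. xc 3 ab \<noteq> 0} chart"
    unfolding chart_def[abs_def] xc_def by (intro continuous_intros) auto
  have xs: "xc i (siegel (\<psi> p)) = horo p $ i / V p $ 3" for i p
  proof -
    have "adjH W *v V p = horo p" unfolding V_def by (simp add: matrix_vector_mul_assoc adjH_mult[OF W(1)])
    then have "horo p $ i = adjH W $ i $ 1 * V p $ 1 + adjH W $ i $ 2 * V p $ 2 + adjH W $ i $ 3 * V p $ 3"
      using mvm3[of "adjH W" "V p" i] by simp
    then show ?thesis unfolding xc_def sieg fst_conv snd_conv using V3[of p] by (simp add: add_divide_distrib)
  qed
  have chart: "chart (siegel (\<psi> p)) = p" "xc 3 (siegel (\<psi> p)) \<noteq> 0" for p
    using V3[of p] by (simp_all add: chart_def xs hgt_def prod_eq_iff)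
  obtain f where f: "bij_betw f (orbits (Isom_Nil\<lparr>carrier := \<Delta>\<rparr>) UNIV (\<lambda>g. g)) (orbits (Isom_H2C\<lparr>carrier := K\<rparr>) S (\<lambda>g. g))"
    and f1: "smooth_quotient_map id UNIV (Isom_Nil\<lparr>carrier := \<Delta>\<rparr>) siegel S (Isom_H2C\<lparr>carrier := K\<rparr>) f"
    and f2: "smooth_quotient_map siegel S (Isom_H2C\<lparr>carrier := K\<rparr>) id UNIV (Isom_Nil\<lparr>carrier := \<Delta>\<rparr>)
        (inv_into (orbits (Isom_Nil\<lparr>carrier := \<Delta>\<rparr>) UNIV (\<lambda>g. g)) f)"
    using diff unfolding diffeomorphic_quotients_def K_def[symmetric] by (elim exE conjE)
  \<comment> \<open>Points are related when the diffeomorphism matches their orbits; the local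
    smooth representatives provide the local lifts on both sides.\<close>
  define R where "R x y \<longleftrightarrow> f (?oD x) = ?oK (\<psi> y)" for x y
  have locG: "\<exists>T \<eta>. open T \<and> x \<in> T \<and> continuous_on T \<eta> \<and> (\<forall>x'\<in>T. \<forall>y. R x' y \<longleftrightarrow> (\<exists>g\<in>r.G. y = g (\<eta> x')))" for x
  proof -
    obtain T h where T: "open T" "id x \<in> T" "C_infinity_on T h"
      "\<forall>y\<in>UNIV. id y \<in> T \<longrightarrow> (\<exists>z\<in>S. siegel z = h (id y) \<and> f (?oD y) = ?oK z)"
      using f1[unfolded smooth_quotient_map_def, THEN bspec, OF UNIV_I, of x] by (elim exE conjE)
    have h: "\<exists>p. siegel (\<psi> p) = h y \<and> f (?oD y) = ?oK (\<psi> p)" if "y \<in> T" for y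
      using T(4)[THEN bspec, OF UNIV_I, of y] that unfolding id_apply W(3) \<psi>_def by blast
    have "C_k_on 0 T h" using T(3) unfolding C_infinity_on_def by (rule spec)
    then have "continuous_on T h" by simp
    then have "continuous_on T (\<lambda>y. chart (h y))"
    proof (rule continuous_on_compose2[OF contb], intro image_subsetI CollectI)
      fix y assume "y \<in> T"
      then obtain p where "siegel (\<psi> p) = h y" using h by blast
      then show "xc 3 (h y) \<noteq> 0" using chart(2)[of p] by simp
    qed
    moreover have "\<forall>x'\<in>T. \<forall>y. R x' y \<longleftrightarrow> (\<exists>g\<in>r.G. y = g (chart (h x')))"
    proof (intro ballI allI)
      fix x' y assume "x' \<in> T"
      then obtain p where p: "siegel (\<psi> p) = h x'" "f (?oD x') = ?oK (\<psi> p)" using h by blast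
      have "chart (h x') = p" unfolding p(1)[symmetric] by (rule chart)
      then show "R x' y \<longleftrightarrow> (\<exists>g\<in>r.G. y = g (chart (h x')))" unfolding R_def p(2) oK by (simp only:)
    qed
    ultimately show ?thesis using T(1,2) unfolding id_apply by blast
  qed
  have locD: "\<exists>T \<eta>. open T \<and> y \<in> T \<and> continuous_on T \<eta> \<and> (\<forall>y'\<in>T. \<forall>x. R x y' \<longleftrightarrow> (\<exists>g\<in>\<Delta>. x = g (\<eta> y')))" for y
  proof -
    have \<psi>S: "\<psi> y \<in> S" for y unfolding W(3) \<psi>_def by blast
    obtain T h where T: "open T" "siegel (\<psi> y) \<in> T" "C_infinity_on T h"
      "\<forall>z\<in>S. siegel z \<in> T \<longrightarrow> (\<exists>x\<in>UNIV. id x = h (siegel z) \<and>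
         inv_into (orbits (Isom_Nil\<lparr>carrier := \<Delta>\<rparr>) UNIV (\<lambda>g. g)) f (?oK z) = ?oD x)"
      using f2[unfolded smooth_quotient_map_def, THEN bspec, OF \<psi>S, of y] by (elim exE conjE)
    define T' where "T' = (\<lambda>p. siegel (\<psi> p)) -` T"
    have T': "open T'" "y \<in> T'" unfolding T'_def using open_vimage[OF T(1) contS] T(2) by simp_all
    have "C_k_on 0 T h" using T(3) unfolding C_infinity_on_def by (rule spec)
    then have "continuous_on T h" by simp
    then have "continuous_on T' (\<lambda>y. h (siegel (\<psi> y)))"
      by (rule continuous_on_compose2[OF _ continuous_on_subset[OF contS subset_UNIV]]) (auto simp: T'_def)
    moreover have "\<forall>y'\<in>T'. \<forall>x. R x y' \<longleftrightarrow> (\<exists>g\<in>\<Delta>. x = g (h (siegel (\<psi> y'))))"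
    proof (intro ballI allI)
      fix y' x assume "y' \<in> T'"
      then have "siegel (\<psi> y') \<in> T" by (simp add: T'_def)
      then have inv: "inv_into (orbits (Isom_Nil\<lparr>carrier := \<Delta>\<rparr>) UNIV (\<lambda>g. g)) f (?oK (\<psi> y')) = ?oD (h (siegel (\<psi> y')))"
        using T(4)[THEN bspec, OF \<psi>S, of y', THEN mp] unfolding id_apply by auto
      have m: "?oD z \<in> orbits (Isom_Nil\<lparr>carrier := \<Delta>\<rparr>) UNIV (\<lambda>g. g)" for z unfolding orbits_def by blast
      have "?oK (\<psi> y') \<in> orbits (Isom_H2C\<lparr>carrier := K\<rparr>) S (\<lambda>g. g)" unfolding orbits_def using \<psi>S by blast
      then have fh: "f (?oD (h (siegel (\<psi> y')))) = ?oK (\<psi> y')"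
        unfolding inv[symmetric] by (rule bij_betw_inv_into_right[OF f])
      have "R x y' \<longleftrightarrow> f (?oD (h (siegel (\<psi> y')))) = f (?oD x)" unfolding R_def fh by (rule eq_commute)
      also have "\<dots> \<longleftrightarrow> ?oD (h (siegel (\<psi> y'))) = ?oD x"
        by (rule inj_on_eq_iff[OF bij_betw_imp_inj_on[OF f] m m])
      finally show "R x y' \<longleftrightarrow> (\<exists>g\<in>\<Delta>. x = g (h (siegel (\<psi> y'))))" unfolding oD .
    qed
    ultimately show ?thesis using T' by blast
  qed
  obtain \<theta> where \<theta>: "\<And>g. g \<in> \<Delta> \<Longrightarrow> \<theta> g \<in> r.G" "\<And>g h. g \<in> \<Delta> \<Longrightarrow> h \<in> \<Delta> \<Longrightarrow> \<theta> (g \<circ> h) = \<theta> g \<circ> \<theta> h"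
    "\<And>g. g \<in> \<Delta> \<Longrightarrow> \<theta> g = id \<Longrightarrow> g = id"
    by (rule deck_group_hom[OF A.nil_action_axioms r.nil_action_G locD locG], rule that)
  show ?thesis
  proof (rule that[OF W(1)])
    show "\<exists>z t u e. cmod u = 1 \<and> \<theta> g = nil_iso z t u e \<and> proj W \<circ> hyp z t u e \<circ> proj (adjH W) \<in> \<Gamma>" if "g \<in> \<Delta>" for g
      using \<theta>(1)[OF that] unfolding r.G_def by blast
  qed (rule \<theta>(2,3), assumption+)+
qed

lemma cusp_cross_section_quad_field:
  assumes \<Delta>: "Nil_manifold_group \<Delta>" and occ: "occurs_as_cusp_cross_section \<Delta> d" and d: "d > 0"
  obtains \<theta> where "\<And>g. g \<in> \<Delta> \<Longrightarrow> \<theta> g \<in> carrier Isom_Nil" "\<And>g h. g \<in> \<Delta> \<Longrightarrow> h \<in> \<Delta> \<Longrightarrow> \<theta> (g \<circ> h) = \<theta> g \<circ> \<theta> h"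
    "\<And>g. g \<in> \<Delta> \<Longrightarrow> \<theta> g = id \<Longrightarrow> g = id"
    "\<And>a b za ta zb tb. a \<in> \<Delta> \<Longrightarrow> b \<in> \<Delta> \<Longrightarrow> \<theta> a = nil_iso za ta 1 False \<Longrightarrow> \<theta> b = nil_iso zb tb 1 False \<Longrightarrow>
       za \<noteq> 0 \<Longrightarrow> zb / za \<in> quad_field d"
proof -
  obtain \<Gamma> q S where M: "H2C_manifold_group \<Gamma>" and comm: "commensurable Isom_H2C \<Gamma> (PU21_O d)" and S: "is_horosphere q S"
    and diff: "diffeomorphic_quotients id UNIV (Isom_Nil\<lparr>carrier := \<Delta>\<rparr>) siegel S
            (Isom_H2C\<lparr>carrier := stabilizer (Isom_H2C\<lparr>carrier := \<Gamma>\<rparr>) (\<lambda>g. g) q\<rparr>)"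
    using occ unfolding occurs_as_cusp_cross_section_def by (elim exE conjE)
  obtain W \<theta> where W: "W \<in> U21"
    and \<theta>: "\<And>g. g \<in> \<Delta> \<Longrightarrow> \<exists>z t u e. cmod u = 1 \<and> \<theta> g = nil_iso z t u e \<and> proj W \<circ> hyp z t u e \<circ> proj (adjH W) \<in> \<Gamma>"
    and hom: "\<And>g h. g \<in> \<Delta> \<Longrightarrow> h \<in> \<Delta> \<Longrightarrow> \<theta> (g \<circ> h) = \<theta> g \<circ> \<theta> h" and inj: "\<And>g. g \<in> \<Delta> \<Longrightarrow> \<theta> g = id \<Longrightarrow> g = id"
    by (rule cusp_cross_section_hom[OF \<Delta> M S diff], rule that)
  have \<Gamma>: "subgroup \<Gamma> Isom_H2C" using M by (simp add: H2C_manifold_group_def)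
  have mem: "proj W \<circ> hyp z t 1 False \<circ> proj (adjH W) \<in> \<Gamma>" if a: "a \<in> \<Delta>" "\<theta> a = nil_iso z t 1 False" for a z t
  proof -
    obtain z' t' u' e' where p: "cmod u' = 1" "\<theta> a = nil_iso z' t' u' e'" "proj W \<circ> hyp z' t' u' e' \<circ> proj (adjH W) \<in> \<Gamma>"
      using \<theta>[OF a(1)] by (elim exE conjE)
    have "z = z' \<and> t = t' \<and> 1 = u' \<and> False = e'"
      using p(2) a(2) nil_iso_inject[of 1 z t False z' t' u' e'] by simp
    then show ?thesis using p(3) by (elim conjE) (simp only:)
  qed
  show ?thesis
  proof (rule that[of \<theta>, OF _ hom inj])
    show "\<theta> g \<in> carrier Isom_Nil" if g: "g \<in> \<Delta>" for g
      using \<theta>[OF g] by (elim exE conjE) (simp only: nil_isoI)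
    show "zb / za \<in> quad_field d" if a: "a \<in> \<Delta>" "b \<in> \<Delta>" "\<theta> a = nil_iso za ta 1 False" "\<theta> b = nil_iso zb tb 1 False" "za \<noteq> 0"
      for a b za ta zb tb
      by (rule commensurable_translations[OF d \<Gamma> comm W a(5) mem[OF a(1,3)] mem[OF a(2,4)]])
  qed
qed

section \<open>Determination of d from the relations\<close>

text \<open>The images of the generators satisfy the same relations and \<open>c\<close> keeps
  infinite order by injectivity. So \<open>a\<close> and \<open>b\<close> again become translations,
  to which the field condition applies.\<close>

lemma twist_ratio:
  assumes \<Delta>: "Nil_manifold_group \<Delta>" and occ: "occurs_as_cusp_cross_section \<Delta> d" and d: "d > 0"
    and k: "k > 0" and sub: "{a, b, c, s} \<subseteq> \<Delta>" and inf: "\<And>j. j > 0 \<Longrightarrow> c ^^ j \<noteq> id"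
    and P: "P a b c s"
    and hom_P: "\<And>K. id \<in> \<Delta> \<Longrightarrow> K id = id \<Longrightarrow> \<forall>f\<in>\<Delta>. \<forall>g\<in>\<Delta>. f \<circ> g \<in> \<Delta> \<and> K (f \<circ> g) = K f \<circ> K g \<Longrightarrow>
       P (K a) (K b) (K c) (K s)"
    and heis: "\<And>a b c s. P a b c s \<Longrightarrow> heis_rels k a b c s"
    and rel: "\<And>a b c s. P a b c s \<Longrightarrow> s \<circ> a = b \<circ> s \<or> (\<exists>j. s \<circ> a = b \<circ> (s \<circ> c ^^ j)) \<or> (s \<circ> a = a \<circ> (b \<circ> s) \<and> a \<circ> (s \<circ> b) = s)"
  obtains h za ta zb tb z t u where "za \<noteq> 0" "zb / za \<in> quad_field d"
    "P (nil_iso za ta 1 False) (nil_iso zb tb 1 False) (nil_iso 0 h 1 False) (nil_iso z t u False)"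
proof -
  interpret I: group Isom_Nil by (rule group_Isom_Nil)
  have D: "subgroup \<Delta> Isom_Nil" using \<Delta> by (simp add: Nil_manifold_group_def)
  interpret D: subgroup \<Delta> Isom_Nil by (rule D)
  have mem: "a \<in> \<Delta>" "b \<in> \<Delta>" "c \<in> \<Delta>" "s \<in> \<Delta>" using sub by blast+
  obtain \<theta> where \<theta>: "\<And>g. g \<in> \<Delta> \<Longrightarrow> \<theta> g \<in> carrier Isom_Nil"
    and hom: "\<And>g h. g \<in> \<Delta> \<Longrightarrow> h \<in> \<Delta> \<Longrightarrow> \<theta> (g \<circ> h) = \<theta> g \<circ> \<theta> h"
    and inj: "\<And>g. g \<in> \<Delta> \<Longrightarrow> \<theta> g = id \<Longrightarrow> g = id"
    and ratio: "\<And>a b za ta zb tb. a \<in> \<Delta> \<Longrightarrow> b \<in> \<Delta> \<Longrightarrow> \<theta> a = nil_iso za ta 1 False \<Longrightarrow> \<theta> b = nil_iso zb tb 1 False \<Longrightarrow>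
       za \<noteq> 0 \<Longrightarrow> zb / za \<in> quad_field d"
    by (rule cusp_cross_section_quad_field[OF \<Delta> occ d], rule that)
  have idD: "id \<in> \<Delta>" using D.one_closed by simp
  have "\<theta> id \<otimes>\<^bsub>Isom_Nil\<^esub> \<theta> id = \<theta> id" using hom[OF idD idD] by simp
  then have "\<theta> id = \<one>\<^bsub>Isom_Nil\<^esub>" using I.l_cancel_one[OF \<theta>[OF idD] \<theta>[OF idD]] by blast
  then have id: "\<theta> id = id" by simp
  have comp: "\<forall>f\<in>\<Delta>. \<forall>g\<in>\<Delta>. f \<circ> g \<in> \<Delta> \<and> \<theta> (f \<circ> g) = \<theta> f \<circ> \<theta> g"
    using D.m_closed hom by (simp only: mult_Isom_Nil) blast
  have R: "P (\<theta> a) (\<theta> b) (\<theta> c) (\<theta> s)" by (rule hom_P[OF idD id comp])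
  have inf': "\<theta> c ^^ j \<noteq> id" if j: "j > 0" for j
  proof
    assume "\<theta> c ^^ j = id"
    then have "c ^^ j = id" using hom_funpow[OF idD id comp mem(3), of j] inj[of "c ^^ j"] by simp
    then show False using inf[OF j] by contradiction
  qed
  note H = heis[OF R, unfolded heis_rels_def]
  obtain h za ta zb tb z t u where p: "\<theta> c = nil_iso 0 h 1 False" "\<theta> a = nil_iso za ta 1 False"
    "\<theta> b = nil_iso zb tb 1 False" "\<theta> s = nil_iso z t u False" "za \<noteq> 0"
    by (rule twist_coordinates[OF \<theta>[OF mem(1)] \<theta>[OF mem(2)] \<theta>[OF mem(3)] \<theta>[OF mem(4)] k conjunct1[OF H]
        conjunct1[OF conjunct2[OF H]] conjunct1[OF conjunct2[OF conjunct2[OF H]]] conjunct2[OF conjunct2[OF conjunct2[OF H]]]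
        inf' rel[OF R]], assumption, rule that)
  show ?thesis
    by (rule that[OF p(5) ratio[OF mem(1,2) p(2,3,5)]]) (use R in \<open>simp only: p\<close>)
qed

lemma planar_part:
  assumes "f = g" shows "fst (f (0 :: nil)) = fst (g (0 :: nil))"
  unfolding assms ..

lemma quarter_twist_only:
  assumes \<Delta>: "Nil_manifold_group \<Delta>" and occ: "occurs_as_cusp_cross_section \<Delta> d" and d: "d > 0" "squarefree d"
    and q: "quarter_twist (Isom_Nil\<lparr>carrier := \<Delta>\<rparr>)"
  shows "d = 1"
proof -
  have D: "subgroup \<Delta> Isom_Nil" using \<Delta> by (simp add: Nil_manifold_group_def)
  obtain k p a b c s where k: "k > 0" and rel: "quarter_rels k p a b c s" and sub: "{a, b, c, s} \<subseteq> \<Delta>"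
    and inf: "\<And>j. j > 0 \<Longrightarrow> c ^^ j \<noteq> id" by (rule quarter_twist_generators[OF D q], rule that)
  obtain h za ta zb tb z t u where za: "za \<noteq> 0" and v: "zb / za \<in> quad_field d"
    and R: "quarter_rels k p (nil_iso za ta 1 False) (nil_iso zb tb 1 False) (nil_iso 0 h 1 False) (nil_iso z t u False)"
  proof (rule twist_ratio[OF \<Delta> occ d(1) k sub inf, of "quarter_rels k p"], assumption)
    show "quarter_rels k p (K a) (K b) (K c) (K s)"
      if "id \<in> \<Delta>" "K id = id" "\<forall>f\<in>\<Delta>. \<forall>g\<in>\<Delta>. f \<circ> g \<in> \<Delta> \<and> K (f \<circ> g) = K f \<circ> K g" for K
      by (rule hom_quarter_rels[OF that _ _ _ _ rel]) (use sub in blast)+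
    show "heis_rels k a b c s" if "quarter_rels k p a b c s" for a b c s :: "nil \<Rightarrow> nil"
      using that unfolding quarter_rels_def by blast
    show "s \<circ> a = b \<circ> s \<or> (\<exists>j. s \<circ> a = b \<circ> (s \<circ> c ^^ j)) \<or> (s \<circ> a = a \<circ> (b \<circ> s) \<and> a \<circ> (s \<circ> b) = s)"
      if "quarter_rels k p a b c s" for a b c s :: "nil \<Rightarrow> nil"
      using that unfolding quarter_rels_def by blast
  qed (rule rel | rule that, assumption+)+
  \<comment> \<open>On planar parts \<open>s\<close> takes za to zb and zb to -za, so the two
    squares sum to zero.\<close>
  have "u * za = zb" "za + u * zb = 0"
    using planar_part[OF conjunct1[OF conjunct2[OF R[unfolded quarter_rels_def]]]]
      planar_part[OF conjunct1[OF conjunct2[OF conjunct2[OF R[unfolded quarter_rels_def]]]]]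
    by (simp_all add: nil_iso_funpow_vertical nil_iso_def algebra_simps)
  moreover have "zb * zb + za * za = za * (za + u * zb) + (zb - u * za) * zb" by (simp add: algebra_simps)
  ultimately have "zb * zb + za * za = 0" by simp
  then have "zb / za * (zb / za) = - 1" using za by (simp add: field_simps add_eq_0_iff)
  then show ?thesis by (rule quad_field_fourth_root[OF d v])
qed

lemma third_ratio:
  assumes "zb * zb + zb * za + za * za = 0" "za \<noteq> 0" shows "1 + zb / za + zb / za * (zb / za) = (0 :: complex)"
proof -
  have "1 + zb / za + zb / za * (zb / za) = (zb * zb + zb * za + za * za) / (za * za)"
    using assms(2) by (simp add: field_simps)
  then show ?thesis using assms(1) by simp
qed

lemma third_twist_only:
  assumes \<Delta>: "Nil_manifold_group \<Delta>" and occ: "occurs_as_cusp_cross_section \<Delta> d" and d: "d > 0" "squarefree d"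
    and q: "third_twist (Isom_Nil\<lparr>carrier := \<Delta>\<rparr>)"
  shows "d = 3"
proof -
  have D: "subgroup \<Delta> Isom_Nil" using \<Delta> by (simp add: Nil_manifold_group_def)
  obtain k k1 k2 a b c s where k: "k > 0" and rel: "third_rels k k1 k2 a b c s" and sub: "{a, b, c, s} \<subseteq> \<Delta>"
    and inf: "\<And>j. j > 0 \<Longrightarrow> c ^^ j \<noteq> id" by (rule third_twist_generators[OF D q], rule that)
  obtain h za ta zb tb z t u where za: "za \<noteq> 0" and v: "zb / za \<in> quad_field d"
    and R: "third_rels k k1 k2 (nil_iso za ta 1 False) (nil_iso zb tb 1 False) (nil_iso 0 h 1 False) (nil_iso z t u False)"
  proof (rule twist_ratio[OF \<Delta> occ d(1) k sub inf, of "third_rels k k1 k2"], assumption)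
    show "third_rels k k1 k2 (K a) (K b) (K c) (K s)"
      if "id \<in> \<Delta>" "K id = id" "\<forall>f\<in>\<Delta>. \<forall>g\<in>\<Delta>. f \<circ> g \<in> \<Delta> \<and> K (f \<circ> g) = K f \<circ> K g" for K
      by (rule hom_third_rels[OF that _ _ _ _ rel]) (use sub in blast)+
    show "s \<circ> a = b \<circ> s \<or> (\<exists>j. s \<circ> a = b \<circ> (s \<circ> c ^^ j)) \<or> (s \<circ> a = a \<circ> (b \<circ> s) \<and> a \<circ> (s \<circ> b) = s)"
      if "third_rels k k1 k2 a b c s" for a b c s :: "nil \<Rightarrow> nil"
      using that unfolding third_rels_def by blast
    show "heis_rels k a b c s" if "third_rels k k1 k2 a b c s" for a b c s :: "nil \<Rightarrow> nil"
      using that unfolding third_rels_def by blast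
  qed (rule rel | rule that, assumption+)+
  \<comment> \<open>Now \<open>s\<close> takes za to zb and zb to -(za + zb). The combination below
    is 1 + v + v^2 for v = zb / za, cleared of denominators.\<close>
  have "u * za = zb" "zb + za + u * zb = 0"
    using planar_part[OF conjunct1[OF conjunct2[OF R[unfolded third_rels_def]]]]
      planar_part[OF conjunct1[OF conjunct2[OF conjunct2[OF R[unfolded third_rels_def]]]]]
    by (simp_all add: nil_iso_funpow_vertical nil_iso_def algebra_simps)
  moreover have "zb * zb + zb * za + za * za = za * (zb + za + u * zb) + (zb - u * za) * zb" by (simp add: algebra_simps)
  ultimately have "zb * zb + zb * za + za * za = 0" by simp
  then show ?thesis by (intro quad_field_third_root[OF d v] third_ratio za)
qed

lemma sixth_twist_only:
  assumes \<Delta>: "Nil_manifold_group \<Delta>" and occ: "occurs_as_cusp_cross_section \<Delta> d" and d: "d > 0" "squarefree d"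
    and q: "sixth_twist (Isom_Nil\<lparr>carrier := \<Delta>\<rparr>)"
  shows "d = 3"
proof -
  have D: "subgroup \<Delta> Isom_Nil" using \<Delta> by (simp add: Nil_manifold_group_def)
  obtain k k1 a b c s where k: "k > 0" and rel: "sixth_rels k k1 a b c s" and sub: "{a, b, c, s} \<subseteq> \<Delta>"
    and inf: "\<And>j. j > 0 \<Longrightarrow> c ^^ j \<noteq> id" by (rule sixth_twist_generators[OF D q], rule that)
  obtain h za ta zb tb z t u where za: "za \<noteq> 0" and v: "zb / za \<in> quad_field d"
    and R: "sixth_rels k k1 (nil_iso za ta 1 False) (nil_iso zb tb 1 False) (nil_iso 0 h 1 False) (nil_iso z t u False)"
  proof (rule twist_ratio[OF \<Delta> occ d(1) k sub inf, of "sixth_rels k k1"], assumption)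
    show "sixth_rels k k1 (K a) (K b) (K c) (K s)"
      if "id \<in> \<Delta>" "K id = id" "\<forall>f\<in>\<Delta>. \<forall>g\<in>\<Delta>. f \<circ> g \<in> \<Delta> \<and> K (f \<circ> g) = K f \<circ> K g" for K
      by (rule hom_sixth_rels[OF that _ _ _ _ rel]) (use sub in blast)+
    show "heis_rels k a b c s" if "sixth_rels k k1 a b c s" for a b c s :: "nil \<Rightarrow> nil"
      using that unfolding sixth_rels_def by blast
    show "s \<circ> a = b \<circ> s \<or> (\<exists>j. s \<circ> a = b \<circ> (s \<circ> c ^^ j)) \<or> (s \<circ> a = a \<circ> (b \<circ> s) \<and> a \<circ> (s \<circ> b) = s)"
      if "sixth_rels k k1 a b c s" for a b c s :: "nil \<Rightarrow> nil"
      using that unfolding sixth_rels_def by blast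
  qed (rule rel | rule that, assumption+)+
  \<comment> \<open>The rotation now has order 6, but the ratio zb / za = u - 1 is again a primitive
    cube root of unity.\<close>
  have "u * za = za + zb" "za + u * zb = 0"
    using planar_part[OF conjunct1[OF conjunct2[OF R[unfolded sixth_rels_def]]]]
      planar_part[OF conjunct1[OF conjunct2[OF conjunct2[OF R[unfolded sixth_rels_def]]]]]
    by (simp_all add: nil_iso_funpow_vertical nil_iso_def algebra_simps)
  moreover have "zb * zb + zb * za + za * za = za * (za + u * zb) + (za + zb - u * za) * zb" by (simp add: algebra_simps)
  ultimately have "zb * zb + zb * za + za * za = 0" by simp
  then show ?thesis by (intro quad_field_third_root[OF d v] third_ratio za)
qed

theorem theorem2:
  fixes \<Delta> :: "(nil \<Rightarrow> nil) set" and d :: nat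
  assumes "Nil_manifold_group \<Delta>" and "d \<ge> 1" and "squarefree d"
  shows "(quarter_twist (Isom_Nil\<lparr>carrier := \<Delta>\<rparr>) \<longrightarrow>
            (occurs_as_cusp_cross_section \<Delta> d \<longleftrightarrow> d = 1)) \<and>
         (third_twist (Isom_Nil\<lparr>carrier := \<Delta>\<rparr>) \<or> sixth_twist (Isom_Nil\<lparr>carrier := \<Delta>\<rparr>) \<longrightarrow>
            (occurs_as_cusp_cross_section \<Delta> d \<longleftrightarrow> d = 3))"
proof -
  have D: "subgroup \<Delta> Isom_Nil" "torsion_free (Isom_Nil\<lparr>carrier := \<Delta>\<rparr>)"
    using assms(1) by (simp_all add: Nil_manifold_group_def)
  have d: "d > 0" using assms(2) by simp
  have "d = 1" if "quarter_twist (Isom_Nil\<lparr>carrier := \<Delta>\<rparr>)" "occurs_as_cusp_cross_section \<Delta> d"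
    by (rule quarter_twist_only[OF assms(1) that(2) d assms(3) that(1)])
  moreover have "d = 3" if "third_twist (Isom_Nil\<lparr>carrier := \<Delta>\<rparr>)" "occurs_as_cusp_cross_section \<Delta> d"
    by (rule third_twist_only[OF assms(1) that(2) d assms(3) that(1)])
  moreover have "d = 3" if "sixth_twist (Isom_Nil\<lparr>carrier := \<Delta>\<rparr>)" "occurs_as_cusp_cross_section \<Delta> d"
    by (rule sixth_twist_only[OF assms(1) that(2) d assms(3) that(1)])
  ultimately show ?thesis
    using quarter_twist_occurs[OF D] third_twist_occurs[OF D] sixth_twist_occurs[OF D] by blast
qed

end
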